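(* Let $f$ be a piecewise polynomial with respect to $\mathcal T_h$. Let $(\psi,u)\in H_0^1(\Omega)\times H_0^1(\Omega)$ be the solution of $$\varepsilon^2(\nabla\psi,\nabla\varphi)+(\psi,\varphi)=(f,\varphi)\quad\forall\,\varphi\in H_0^1(\Omega),\qquad (\nabla u,\nabla v)=(\psi,v)\quad\forall\, v\in H_0^1(\Omega),$$ and let $(\psi_h,u_h)\in V_h^0\times V_h^0$ be the solution of $$\varepsilon^2(\nabla\psi_h,\nabla\varphi_h)+(\psi_h,\varphi_h)=(f,\varphi_h)\quad\forall\,\varphi_h\in V_h^0,\qquad (\nabla u_h,\nabla v_h)=(\psi_h,v_h)\quad\forall\, v_h\in V_h^0.$$ Then there exist positive constants $C_7$ and $C_8$, independent of the mesh-size function $h$ and of $\varepsilon$, such that $$C_7\Big\{\sum_{T\in\mathcal T_h}\eta_{\psi,T}^2\Big\}^{1/2}\le\|\psi-\psi_h\|_{\mathcal E}$$ and $$C_8\Big\{\sum_{T\in\mathcal T_h}\big(\eta_{\psi,T}^2+\eta_{u,T}^2\big)\Big\}^{1/2}\le\|(\psi-\psi_h,u-u_h)\|.$$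
   Context: $\Omega\subset\mathbb{R}^d$, $d\in\{2,3\}$, is a bounded polygonal/polyhedral domain with Lipschitz boundary $\Gamma$; $\varepsilon>0$ is a small parameter ($\varepsilon\ll1$; one may read $0<\varepsilon<1$). $(\cdot,\cdot)$ and $\|\cdot\|$ are the $L^2(\Omega)$ inner product and norm, $|\cdot|_1=\|\nabla\cdot\|$; a subscript $T$ or $E$ means the $L^2$ norm on that set. Mesh and spaces: $\mathcal T_h$ is a shape regular partition of $\Omega$ into triangles (tetrahedra if $d=3$) or parallelograms (parallelepipeds if $d=3$) such that $C_0^{-1}h_T^d\le|T|\le C_0h_T^d$ for all $T\in\mathcal T_h$, where $h_T=\mathrm{diam}(T)$. For a fixed integer $k\ge1$, $P_k(T)$ is the space of polynomials of total degree at most $k$ if $T$ is a simplex, or of degree at most $k$ in each variable if $T$ is a parallelogram/parallelepiped. $V_h=\{v_h\in C(\overline\Omega): v_h|_T\in P_k(T)\ \forall T\in\mathcal T_h\}$ and $V_h^0=\{v_h\in V_h: v_h|_\Gamma=0\}$. Piecewise polynomial means that $f|_T$ is a polynomial, of some fixed maximal degree, for every $T\in\mathcal T_h$. $\mathcal E_h^0$ is the set of interior sides ($d=2$) or faces ($d=3$), $\mathcal E_T$ the set of sides/faces of $T$, $h_E=\mathrm{diam}(E)$. For $E=T_+\cap T_-\in\mathcal E_h^0$, $[v]|_E=(v|_{T_+})|_E-(v|_{T_-})|_E$ is the jump, and $\partial/\partial\mathbf n$ on $E$ is the derivative in a fixed unit normal direction to $E$. Error measures: $\|\varphi\|_{\mathcal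 E}=(\varepsilon^2|\varphi|_1^2+\|\varphi\|^2)^{1/2}$ and $\|(\psi-\psi_h,u-u_h)\|^2=\|\psi-\psi_h\|_{\mathcal E}^2+|u-u_h|_1^2$. Indicators: for $T\in\mathcal T_h$ and $E\subset\partial T$, $\alpha_T=\min\{h_T\varepsilon^{-1},1\}$ and $\alpha_E=\varepsilon^{-1/2}\min\{h_T\varepsilon^{-1},1\}^{1/2}$, $$\eta_{\psi,T}=\Big\{\alpha_T^2\|f+\varepsilon^2\triangle\psi_h-\psi_h\|_T^2+\tfrac12\sum_{E\in\mathcal E_T\cap\mathcal E_h^0}\alpha_E^2\Big\|\Big[\varepsilon^2\tfrac{\partial\psi_h}{\partial\mathbf n}\Big]\Big\|_E^2\Big\}^{1/2},$$ $$\eta_{u,T}=\Big\{h_T^2\|\triangle u_h+\psi_h\|_T^2+\tfrac12\sum_{E\in\mathcal E_T\cap\mathcal E_h^0}h_E\Big\|\Big[\tfrac{\partial u_h}{\partial\mathbf n}\Big]\Big\|_E^2\Big\}^{1/2}.$$ The constants $C_i$ depend only on the mesh shape regularity and $d$ (with $\Omega$, $k$ and the maximal polynomial degree of $f$ fixed). *)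

theory Defs
  imports "HOL-Analysis.Analysis"
begin

section \<open>Lebesgue and Sobolev spaces\<close>

text \<open>Elements of function spaces are represented by functions on the whole type; only their
  values on the set in question matter.  The inner product and norm are polymorphic in the
  range, so that they apply to scalar functions and to gradients alike.\<close>

definition sq_integrable_on :: "(real^'n) set \<Rightarrow> (real^'n \<Rightarrow> 'b::euclidean_space) \<Rightarrow> bool" where
  "sq_integrable_on S f \<longleftrightarrow> f \<in> borel_measurable (lebesgue_on S) \<and>
     integrable (lebesgue_on S) (\<lambda>x. (norm (f x))\<^sup>2)"

definition L2_inner ::
  "(real^'n) set \<Rightarrow> (real^'n \<Rightarrow> 'b::euclidean_space) \<Rightarrow> (real^'n \<Rightarrow> 'b) \<Rightarrow> real" where
  "L2_inner S f g = (LINT x|lebesgue_on S. f x \<bullet> g x)"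

definition L2_norm :: "(real^'n) set \<Rightarrow> (real^'n \<Rightarrow> 'b::euclidean_space) \<Rightarrow> real" where
  "L2_norm S f = sqrt (L2_inner S f f)"

definition partial :: "'n::finite \<Rightarrow> (real^'n \<Rightarrow> real) \<Rightarrow> real^'n \<Rightarrow> real" where
  "partial i f x = frechet_derivative f (at x) (axis i 1)"

definition laplacian :: "(real^'n \<Rightarrow> real) \<Rightarrow> real^'n \<Rightarrow> real" where
  "laplacian f x = (\<Sum>i\<in>UNIV. partial i (partial i f) x)"

primrec C_k :: "nat \<Rightarrow> (real^'n \<Rightarrow> real) \<Rightarrow> bool" where
  "C_k 0 f \<longleftrightarrow> continuous_on UNIV f"
| "C_k (Suc n) f \<longleftrightarrow> (\<forall>x. f differentiable (at x)) \<and> (\<forall>i. C_k n (partial i f))"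

definition test_functions :: "(real^'n) set \<Rightarrow> (real^'n \<Rightarrow> real) set" where
  "test_functions \<Omega> =
     {\<phi>. (\<forall>n. C_k n \<phi>) \<and> (\<exists>K. compact K \<and> K \<subseteq> \<Omega> \<and> (\<forall>x. x \<notin> K \<longrightarrow> \<phi> x = 0))}"

definition has_weak_gradient ::
  "(real^'n) set \<Rightarrow> (real^'n \<Rightarrow> real) \<Rightarrow> (real^'n \<Rightarrow> real^'n) \<Rightarrow> bool" where
  "has_weak_gradient \<Omega> u G \<longleftrightarrow>
     (\<forall>\<phi>\<in>test_functions \<Omega>. \<forall>i. L2_inner \<Omega> u (partial i \<phi>) = - L2_inner \<Omega> (\<lambda>x. G x $ i) \<phi>)"

definition H1 :: "(real^'n) set \<Rightarrow> (real^'n \<Rightarrow> real) set" where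
  "H1 \<Omega> = {u. sq_integrable_on \<Omega> u \<and> (\<exists>G. sq_integrable_on \<Omega> G \<and> has_weak_gradient \<Omega> u G)}"

text \<open>The weak gradient is determined only almost everywhere; this picks a representative.\<close>

definition weak_grad :: "(real^'n) set \<Rightarrow> (real^'n \<Rightarrow> real) \<Rightarrow> real^'n \<Rightarrow> real^'n" where
  "weak_grad \<Omega> u = (SOME G. sq_integrable_on \<Omega> G \<and> has_weak_gradient \<Omega> u G)"

definition H1_seminorm :: "(real^'n) set \<Rightarrow> (real^'n \<Rightarrow> real) \<Rightarrow> real" where
  "H1_seminorm \<Omega> u = L2_norm \<Omega> (weak_grad \<Omega> u)"

text \<open>The closure of the test functions in the \<open>H1\<close> norm.\<close>

definition H1_0 :: "(real^'n) set \<Rightarrow> (real^'n \<Rightarrow> real) set" where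
  "H1_0 \<Omega> = {u \<in> H1 \<Omega>. \<forall>\<delta>>0. \<exists>\<phi>\<in>test_functions \<Omega>.
     L2_norm \<Omega> (\<lambda>x. u x - \<phi> x) < \<delta> \<and> H1_seminorm \<Omega> (\<lambda>x. u x - \<phi> x) < \<delta>}"

section \<open>Polyhedral Lipschitz domains\<close>

definition polyhedral_domain :: "(real^'n) set \<Rightarrow> bool" where
  "polyhedral_domain \<Omega> \<longleftrightarrow> open \<Omega> \<and> connected \<Omega> \<and> bounded \<Omega> \<and> \<Omega> \<noteq> {} \<and>
     (\<exists>F. finite F \<and> (\<forall>P\<in>F. polytope P \<and> aff_dim P = int CARD('n) - 1) \<and> frontier \<Omega> = \<Union>F)"

text \<open>Near each boundary point, in coordinates split into the direction \<open>\<nu>\<close> and its orthogonal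
  complement, the domain is the region above the graph of a Lipschitz function \<open>\<gamma>\<close>.\<close>

definition lipschitz_boundary :: "(real^'n) set \<Rightarrow> bool" where
  "lipschitz_boundary \<Omega> \<longleftrightarrow>
     (\<forall>x\<in>frontier \<Omega>. \<exists>r>0. \<exists>\<nu> \<gamma> L. norm \<nu> = 1 \<and> L-lipschitz_on {z. \<nu> \<bullet> z = 0} \<gamma> \<and>
        \<Omega> \<inter> ball x r = {y \<in> ball x r. \<gamma> (y - (\<nu> \<bullet> y) *\<^sub>R \<nu>) < \<nu> \<bullet> y})"

section \<open>Meshes\<close>

definition is_simplex :: "(real^'n) set \<Rightarrow> bool" where
  "is_simplex T \<longleftrightarrow> int CARD('n) simplex T"

definition is_parallelotope :: "(real^'n) set \<Rightarrow> bool" where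
  "is_parallelotope T \<longleftrightarrow> (\<exists>a (v :: 'n \<Rightarrow> real^'n). inj v \<and> independent (range v) \<and>
     T = {a + (\<Sum>i\<in>UNIV. t i *\<^sub>R v i) | t. \<forall>i. 0 \<le> t i \<and> t i \<le> 1})"

text \<open>Elements are closed sets and meshes are conforming (no hanging nodes).  Shape
  regularity is quantified by the constant \<open>C0\<close>.\<close>

definition shape_regular_mesh ::
  "real \<Rightarrow> (real^'n) set \<Rightarrow> (real^'n) set set \<Rightarrow> bool" where
  "shape_regular_mesh C0 \<Omega> \<T> \<longleftrightarrow>
     finite \<T> \<and> \<Union>\<T> = closure \<Omega> \<and>
     (\<forall>T\<in>\<T>. is_simplex T \<or> is_parallelotope T) \<and>
     (\<forall>S\<in>\<T>. \<forall>T\<in>\<T>. S \<noteq> T \<longrightarrow>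
        interior S \<inter> interior T = {} \<and> (S \<inter> T) face_of S \<and> (S \<inter> T) face_of T) \<and>
     (\<forall>T\<in>\<T>. diameter T ^ CARD('n) / C0 \<le> measure lebesgue T \<and>
            measure lebesgue T \<le> C0 * diameter T ^ CARD('n))"

definition sides :: "(real^'n) set \<Rightarrow> (real^'n) set set" where
  "sides T = {E. E facet_of T}"

definition interior_sides :: "(real^'n) set set \<Rightarrow> (real^'n) set set" where
  "interior_sides \<T> = {E. \<exists>Tp\<in>\<T>. \<exists>Tm\<in>\<T>. Tp \<noteq> Tm \<and> E = Tp \<inter> Tm \<and> E \<in> sides Tp \<and> E \<in> sides Tm}"

section \<open>Piecewise polynomials\<close>

text \<open>Polynomial functions with exponents in the (finite) set \<open>A\<close> of multi-indices.\<close>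

definition polys_with_exponents :: "('n::finite \<Rightarrow> nat) set \<Rightarrow> (real^'n \<Rightarrow> real) set" where
  "polys_with_exponents A = {p. \<exists>c. p = (\<lambda>x. \<Sum>\<alpha>\<in>A. c \<alpha> * (\<Prod>i\<in>UNIV. (x $ i) ^ \<alpha> i))}"

definition polys_total :: "nat \<Rightarrow> (real^'n \<Rightarrow> real) set" where
  "polys_total k = polys_with_exponents {\<alpha>. (\<Sum>i\<in>UNIV. \<alpha> i) \<le> k}"

definition polys_each_var :: "nat \<Rightarrow> (real^'n \<Rightarrow> real) set" where
  "polys_each_var k = polys_with_exponents {\<alpha>. \<forall>i. \<alpha> i \<le> k}"

definition P_k :: "nat \<Rightarrow> (real^'n) set \<Rightarrow> (real^'n \<Rightarrow> real) set" where
  "P_k k T = (if is_simplex T then polys_total k else polys_each_var k)"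

definition V_h :: "nat \<Rightarrow> (real^'n) set \<Rightarrow> (real^'n) set set \<Rightarrow> (real^'n \<Rightarrow> real) set" where
  "V_h k \<Omega> \<T> = {v. continuous_on (closure \<Omega>) v \<and> (\<forall>T\<in>\<T>. \<exists>p\<in>P_k k T. \<forall>x\<in>T. v x = p x)}"

definition V_h_0 :: "nat \<Rightarrow> (real^'n) set \<Rightarrow> (real^'n) set set \<Rightarrow> (real^'n \<Rightarrow> real) set" where
  "V_h_0 k \<Omega> \<T> = {v \<in> V_h k \<Omega> \<T>. \<forall>x\<in>frontier \<Omega>. v x = 0}"

text \<open>Asking for agreement on the closed elements would force continuity across sides;
  hence the interiors.\<close>

definition piecewise_polys :: "nat \<Rightarrow> (real^'n) set set \<Rightarrow> (real^'n \<Rightarrow> real) set" where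
  "piecewise_polys m \<T> = {f. \<forall>T\<in>\<T>. \<exists>p\<in>polys_total m. \<forall>x\<in>interior T. f x = p x}"

section \<open>Norms and jumps on sides\<close>

text \<open>The surface measure on a flat side is \<open>(d - 1)\<close>-dimensional Lebesgue measure,
  transported to the hyperplane spanned by the side through an isometric affine chart.  It
  does not depend on the chart.\<close>

definition side_chart :: "(real^'n) set \<Rightarrow> ((nat \<Rightarrow> real) \<Rightarrow> real^'n) \<Rightarrow> bool" where
  "side_chart E \<Phi> \<longleftrightarrow> (\<exists>a e.
     (\<forall>i<CARD('n) - 1. \<forall>j<CARD('n) - 1. e i \<bullet> e j = (if i = j then 1 else 0)) \<and>
     \<Phi> = (\<lambda>y. a + (\<Sum>i<CARD('n) - 1. y i *\<^sub>R e i)) \<and> range \<Phi> = affine hull E)"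

definition surface_measure :: "(real^'n) set \<Rightarrow> (real^'n) measure" where
  "surface_measure E =
     distr (Pi\<^sub>M {..<CARD('n) - 1} (\<lambda>_. lborel)) borel (SOME \<Phi>. side_chart E \<Phi>)"

definition side_norm :: "(real^'n) set \<Rightarrow> (real^'n \<Rightarrow> real) \<Rightarrow> real" where
  "side_norm E g = sqrt (LINT x:E|surface_measure E. (g x)\<^sup>2)"

definition unit_normal :: "(real^'n) set \<Rightarrow> real^'n" where
  "unit_normal E = (SOME n. norm n = 1 \<and> (\<forall>x\<in>E. \<forall>y\<in>E. n \<bullet> (x - y) = 0))"

text \<open>The restriction to \<open>T\<close> of the derivative of \<open>v\<close> normal to \<open>E\<close>; at points of the boundary
  of \<open>T\<close> the derivative is that of the restriction of \<open>v\<close> to \<open>T\<close>.\<close>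

definition normal_deriv ::
  "(real^'n \<Rightarrow> real) \<Rightarrow> (real^'n) set \<Rightarrow> (real^'n) set \<Rightarrow> real^'n \<Rightarrow> real" where
  "normal_deriv v E T x = frechet_derivative v (at x within T) (unit_normal E)"

text \<open>The argument \<open>w T\<close> is the restriction to \<open>T\<close> of a piecewise defined function.  Which of
  the two elements sharing \<open>E\<close> is \<open>Tp\<close> affects only the sign of the jump.\<close>

definition jump ::
  "(real^'n) set set \<Rightarrow> (real^'n) set \<Rightarrow> ((real^'n) set \<Rightarrow> real^'n \<Rightarrow> real) \<Rightarrow> real^'n \<Rightarrow> real" where
  "jump \<T> E w x =
     (let (Tp, Tm) = (SOME (Tp, Tm). Tp \<in> \<T> \<and> Tm \<in> \<T> \<and> Tp \<noteq> Tm \<and> E = Tp \<inter> Tm)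
      in w Tp x - w Tm x)"

section \<open>Error measures and indicators\<close>

definition energy_norm :: "real \<Rightarrow> (real^'n) set \<Rightarrow> (real^'n \<Rightarrow> real) \<Rightarrow> real" where
  "energy_norm \<epsilon> \<Omega> \<phi> = sqrt (\<epsilon>\<^sup>2 * (H1_seminorm \<Omega> \<phi>)\<^sup>2 + (L2_norm \<Omega> \<phi>)\<^sup>2)"

definition pair_norm ::
  "real \<Rightarrow> (real^'n) set \<Rightarrow> (real^'n \<Rightarrow> real) \<Rightarrow> (real^'n \<Rightarrow> real) \<Rightarrow> real" where
  "pair_norm \<epsilon> \<Omega> \<phi> v = sqrt ((energy_norm \<epsilon> \<Omega> \<phi>)\<^sup>2 + (H1_seminorm \<Omega> v)\<^sup>2)"

definition alpha_T :: "real \<Rightarrow> (real^'n) set \<Rightarrow> real" where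
  "alpha_T \<epsilon> T = min (diameter T / \<epsilon>) 1"

text \<open>The weight of a side of \<open>T\<close>; it depends on the side only through \<open>T\<close>.\<close>

definition alpha_E :: "real \<Rightarrow> (real^'n) set \<Rightarrow> real" where
  "alpha_E \<epsilon> T = \<epsilon> powr (- 1 / 2) * sqrt (min (diameter T / \<epsilon>) 1)"

definition eta_psi :: "real \<Rightarrow> (real^'n) set set \<Rightarrow> (real^'n \<Rightarrow> real) \<Rightarrow> (real^'n \<Rightarrow> real) \<Rightarrow>
    (real^'n) set \<Rightarrow> real" where
  "eta_psi \<epsilon> \<T> f \<psi>h T = sqrt (
     (alpha_T \<epsilon> T)\<^sup>2 * (L2_norm T (\<lambda>x. f x + \<epsilon>\<^sup>2 * laplacian \<psi>h x - \<psi>h x))\<^sup>2 +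
     1/2 * (\<Sum>E\<in>sides T \<inter> interior_sides \<T>.
       (alpha_E \<epsilon> T)\<^sup>2 * (side_norm E (jump \<T> E (\<lambda>S x. \<epsilon>\<^sup>2 * normal_deriv \<psi>h E S x)))\<^sup>2))"

definition eta_u :: "(real^'n) set set \<Rightarrow> (real^'n \<Rightarrow> real) \<Rightarrow> (real^'n \<Rightarrow> real) \<Rightarrow>
    (real^'n) set \<Rightarrow> real" where
  "eta_u \<T> \<psi>h uh T = sqrt (
     (diameter T)\<^sup>2 * (L2_norm T (\<lambda>x. laplacian uh x + \<psi>h x))\<^sup>2 +
     1/2 * (\<Sum>E\<in>sides T \<inter> interior_sides \<T>.
       diameter E * (side_norm E (jump \<T> E (normal_deriv uh E)))\<^sup>2))"

section \<open>The continuous and the discrete problem\<close>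

definition solves :: "real \<Rightarrow> (real^'n) set \<Rightarrow> (real^'n \<Rightarrow> real) \<Rightarrow> (real^'n \<Rightarrow> real) set \<Rightarrow>
    (real^'n \<Rightarrow> real) \<Rightarrow> (real^'n \<Rightarrow> real) \<Rightarrow> bool" where
  "solves \<epsilon> \<Omega> f V \<psi> u \<longleftrightarrow> \<psi> \<in> V \<and> u \<in> V \<and>
     (\<forall>\<phi>\<in>V. \<epsilon>\<^sup>2 * L2_inner \<Omega> (weak_grad \<Omega> \<psi>) (weak_grad \<Omega> \<phi>) + L2_inner \<Omega> \<psi> \<phi>
              = L2_inner \<Omega> f \<phi>) \<and>
     (\<forall>v\<in>V. L2_inner \<Omega> (weak_grad \<Omega> u) (weak_grad \<Omega> v) = L2_inner \<Omega> \<psi> v)"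

end

(* Efficiency needs only the residual of the discrete solution tested with smooth functions:
   Galerkin orthogonality is irrelevant, and both equations have the form
   kappa^2 (grad w, grad phi) + (e, phi) = (g, phi) with g piecewise polynomial.  Testing with a
   bump times the element residual bounds the latter by the local error.  For a side E, the
   bump is squeezed in the normal direction to the thickness min(h, kappa), which produces the
   weights alpha_E, and is multiplied by the jump extended constantly along the normal; as bumps are
   smooth and supported in a ball around a point of E, only integration by parts on half spaces
   is needed.  Norms of polynomials of bounded degree on a ball and on a comparable smaller ball
   are equivalent, which replaces inverse estimates on reference elements. *)
theory Submission
  imports Defs "HOL-Computational_Algebra.Polynomial"
begin

text \<open>Smooth test functions suffice because they lie in \<open>H1_0\<close> and weak gradients
  are defined by them; the continuous, piecewise polynomial bubbles of finite element theory would
  need a Sobolev calculus of their own. The price is that \<open>weak_grad\<close>, the chart of a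
  side and the pair of elements in \<open>jump\<close> are arbitrary choices. Weak gradients must
  first be shown unique almost everywhere before the gradient of the error can be compared with that
  of a polynomial, and the pair in \<open>jump\<close> has to be tied to the element whose indicator
  is estimated.

  The support of a side bubble has to lie in the open domain, whereas two adjacent elements only
  fill a ball of its closure: here the Lipschitz boundary comes in, through
  \<open>interior_closure_lipschitz\<close>.

  In the second equation \<kappa> is 1. Its residual is controlled by the gradient error of u and by
  the L2 error of \<psi>, which the energy norm dominates. The resulting weight is min(h, 1) in
  place of h, and the bounded diameter of the domain makes up for the difference. All constants are
  fixed before mesh, \<epsilon> and solutions.\<close>

definition smooth :: "(real^'n \<Rightarrow> real) \<Rightarrow> bool" where
  "smooth f \<longleftrightarrow> (\<forall>n. C_k n f)"

section \<open>Partial derivatives and smooth functions\<close>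

lemma partial_eqI: "(f has_derivative f') (at x) \<Longrightarrow> partial i f x = f' (axis i 1)"
  unfolding partial_def by (metis frechet_derivative_at)

lemma frechet_derivative_partial:
  fixes f :: "real^'n \<Rightarrow> real"
  assumes "f differentiable (at x)"
  shows "frechet_derivative f (at x) v = (\<Sum>i\<in>UNIV. partial i f x * v $ i)"
proof -
  have l: "linear (frechet_derivative f (at x))"
    using assms frechet_derivative_works has_derivative_linear by blast
  have "v = (\<Sum>i\<in>UNIV. v $ i *\<^sub>R axis i 1)"
    by (metis basis_expansion scalar_mult_eq_scaleR)
  then have "frechet_derivative f (at x) v = frechet_derivative f (at x) (\<Sum>i\<in>UNIV. v $ i *\<^sub>R axis i 1)"
    by simp
  also have "\<dots> = (\<Sum>i\<in>UNIV. partial i f x * v $ i)"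
    unfolding partial_def using l by (simp add: linear_sum linear_scale mult.commute)
  finally show ?thesis .
qed

lemma has_derivative_partial:
  fixes f :: "real^'n \<Rightarrow> real"
  assumes "f differentiable (at x)"
  shows "(f has_derivative (\<lambda>v. \<Sum>i\<in>UNIV. partial i f x * v $ i)) (at x)"
  using frechet_derivative_works[of f "at x"] assms frechet_derivative_partial[OF assms]
  by (metis (no_types, lifting) ext)

lemma partial_const [simp]: "partial i (\<lambda>x. c) = (\<lambda>x. 0)"
  by (rule ext, rule partial_eqI[of _ "\<lambda>_. 0"]) simp

lemma partial_coord: "partial i (\<lambda>x :: real^'n. x $ j) = (\<lambda>x. if i = j then 1 else 0)"
proof
  fix x :: "real^'n"
  have "((\<lambda>x. x $ j) has_derivative (\<lambda>v. v $ j)) (at x)"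
    by (intro bounded_linear_imp_has_derivative bounded_linear_vec_nth)
  from partial_eqI[OF this, of i] show "partial i (\<lambda>x :: real^'n. x $ j) x = (if i = j then 1 else 0)"
    by (simp add: axis_def)
qed

lemma partial_add:
  assumes "f differentiable (at x)" "g differentiable (at x)"
  shows "partial i (\<lambda>x. f x + g x) x = partial i f x + partial i g x"
  by (rule partial_eqI[THEN trans], rule has_derivative_add)
    (use assms in \<open>auto simp: partial_def frechet_derivative_works\<close>)

lemma partial_cmul:
  assumes "f differentiable (at x)"
  shows "partial i (\<lambda>x. c * f x) x = c * partial i f x"
  by (rule partial_eqI[THEN trans], rule has_derivative_mult_right)
    (use assms in \<open>auto simp: partial_def frechet_derivative_works\<close>)

lemma partial_sum:
  assumes "\<And>j. j \<in> J \<Longrightarrow> f j differentiable (at x)"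
  shows "partial i (\<lambda>x. \<Sum>j\<in>J. f j x) x = (\<Sum>j\<in>J. partial i (f j) x)"
  by (rule partial_eqI[THEN trans], rule has_derivative_sum)
    (use assms in \<open>auto simp: partial_def frechet_derivative_works\<close>)

lemma partial_mult:
  assumes "f differentiable (at x)" "g differentiable (at x)"
  shows "partial i (\<lambda>x. f x * g x) x = partial i f x * g x + f x * partial i g x"
  by (rule partial_eqI[THEN trans], rule has_derivative_mult)
    (use assms in \<open>auto simp: partial_def frechet_derivative_works\<close>)

lemma partial_affine:
  fixes f :: "real^'n \<Rightarrow> real" and A :: "real^'m \<Rightarrow> real^'n"
  assumes "linear A" "f differentiable (at (A x + b))"
  shows "partial i (\<lambda>x. f (A x + b)) x = (\<Sum>j\<in>UNIV. partial j f (A x + b) * A (axis i 1) $ j)"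
proof -
  have A: "((\<lambda>x. A x + b) has_derivative A) (at x)"
    using assms(1) by (auto intro!: derivative_eq_intros linear_imp_has_derivative)
  from has_derivative_compose[OF A has_derivative_partial[OF assms(2)]]
  show ?thesis by (rule partial_eqI)
qed

lemma partial_comp_real:
  fixes g :: "real^'n \<Rightarrow> real" and H :: "real \<Rightarrow> real"
  assumes "(H has_real_derivative D) (at (g x))" "g differentiable (at x)"
  shows "partial i (\<lambda>x. H (g x)) x = D * partial i g x"
proof -
  have "((\<lambda>x. H (g x)) has_derivative (\<lambda>v. D * (\<Sum>i\<in>UNIV. partial i g x * v $ i))) (at x)"
    using has_derivative_compose[OF has_derivative_partial[OF assms(2)]] assms(1)
    by (auto simp: has_field_derivative_def)
  moreover have "(\<Sum>j\<in>UNIV. partial j g x * axis i 1 $ j) = partial i g x"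
    by (simp add: axis_def if_distrib cong: if_cong)
  ultimately show ?thesis using partial_eqI by metis
qed

lemma C_k_Suc_imp: "C_k (Suc n) f \<Longrightarrow> C_k n f"
proof (induction n arbitrary: f)
  case 0
  then show ?case
    by (auto intro!: continuous_at_imp_continuous_on differentiable_imp_continuous_within)
next
  case (Suc n)
  then show ?case by (metis C_k.simps(2))
qed

lemma C_k_const [simp]: "C_k n (\<lambda>x. c)"
  by (induction n arbitrary: c) auto

lemma C_k_coord: "C_k n (\<lambda>x :: real^'n. x $ j)"
proof (cases n)
  case (Suc m)
  have "\<And>x. (\<lambda>x. x $ j) differentiable (at (x :: real^'n))"
    by (intro bounded_linear_imp_differentiable bounded_linear_vec_nth)
  then show ?thesis using Suc by (auto simp: partial_coord)
qed (auto intro!: continuous_intros)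

lemma C_k_add: "C_k n f \<Longrightarrow> C_k n g \<Longrightarrow> C_k n (\<lambda>x. f x + g x)"
proof (induction n arbitrary: f g)
  case (Suc n)
  then have "partial i (\<lambda>x. f x + g x) = (\<lambda>x. partial i f x + partial i g x)" for i
    by (intro ext partial_add) auto
  with Suc show ?case by auto
qed (auto intro: continuous_intros)

lemma C_k_sum: "(\<And>j. j \<in> J \<Longrightarrow> C_k n (f j)) \<Longrightarrow> C_k n (\<lambda>x. \<Sum>j\<in>J. f j x)"
  by (induction J rule: infinite_finite_induct) (auto intro: C_k_add)

lemma C_k_mult: "C_k n f \<Longrightarrow> C_k n g \<Longrightarrow> C_k n (\<lambda>x. f x * g x)"
proof (induction n arbitrary: f g)
  case (Suc n)
  then have e: "partial i (\<lambda>x. f x * g x) = (\<lambda>x. partial i f x * g x + f x * partial i g x)" for i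
    by (intro ext partial_mult) auto
  have "C_k n f" "C_k n g" using Suc.prems C_k_Suc_imp by blast+
  with Suc show ?case by (auto simp: e intro!: C_k_add)
qed (auto intro: continuous_intros)

lemma C_k_affine:
  fixes f :: "real^'n \<Rightarrow> real" and A :: "real^'m \<Rightarrow> real^'n"
  assumes A: "linear A"
  shows "C_k n f \<Longrightarrow> C_k n (\<lambda>x. f (A x + b))"
proof (induction n arbitrary: f)
  case 0
  have "continuous_on UNIV (\<lambda>x. A x + b)"
    using A by (intro continuous_intros linear_continuous_on) (auto simp: linear_conv_bounded_linear)
  with 0 show ?case by (auto intro: continuous_on_compose2)
next
  case (Suc n)
  have e: "partial i (\<lambda>x. f (A x + b)) = (\<lambda>x. \<Sum>j\<in>UNIV. partial j f (A x + b) * A (axis i 1) $ j)" for i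
    using Suc.prems by (intro ext partial_affine A) auto
  have d: "(\<lambda>x. f (A x + b)) differentiable (at x)" for x
  proof -
    have "((\<lambda>x. A x + b) has_derivative A) (at x)"
      using A by (auto intro!: derivative_eq_intros linear_imp_has_derivative)
    then have "(\<lambda>x. A x + b) differentiable (at x)" by (rule differentiableI)
    then show ?thesis using Suc.prems by (metis C_k.simps(2) differentiable_compose)
  qed
  show ?case using Suc.prems d by (auto simp: e intro!: C_k_sum C_k_mult Suc.IH)
qed

text \<open>The whole sequence of derivatives of the outer function is given at once:
  differentiating replaces \<open>D k\<close> by \<open>D (Suc k)\<close>, so the induction on
  \<open>n\<close> leaves \<open>k\<close> free. For the flat function below these derivatives are
  known in closed form.\<close>

lemma C_k_comp_real:
  fixes g :: "real^'n \<Rightarrow> real" and D :: "nat \<Rightarrow> real \<Rightarrow> real"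
  assumes D: "\<And>k x. (D k has_real_derivative D (Suc k) x) (at x)"
  shows "C_k n g \<Longrightarrow> C_k n (\<lambda>x. D k (g x))"
proof (induction n arbitrary: k)
  case 0
  have "continuous_on UNIV (D k)"
    using D by (auto intro!: continuous_at_imp_continuous_on DERIV_isCont)
  with 0 show ?case by (auto intro: continuous_on_compose2)
next
  case (Suc n)
  have e: "partial i (\<lambda>x. D k (g x)) = (\<lambda>x. D (Suc k) (g x) * partial i g x)" for i
    using Suc.prems D by (intro ext partial_comp_real) auto
  have d: "(\<lambda>x. D k (g x)) differentiable (at x)" for x
  proof (rule differentiable_compose[of "D k"])
    show "D k differentiable (at (g x))"
      using D by (auto simp: differentiable_def has_field_derivative_def)
    show "g differentiable (at x)" using Suc.prems by auto
  qed
  have "C_k n g" using Suc.prems C_k_Suc_imp by blast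
  then show ?case using Suc d by (auto simp: e intro!: C_k_mult)
qed

lemma smooth_differentiable: "smooth f \<Longrightarrow> f differentiable (at x)"
  unfolding smooth_def by (metis C_k.simps(2))

lemma smooth_partial: "smooth f \<Longrightarrow> smooth (partial i f)"
  unfolding smooth_def by (metis C_k.simps(2))

lemma smooth_continuous_on: "smooth f \<Longrightarrow> continuous_on S f"
  unfolding smooth_def by (metis C_k.simps(1) continuous_on_subset top_greatest)

lemma smooth_const [simp]: "smooth (\<lambda>x. c)"
  and smooth_coord: "smooth (\<lambda>x. x $ j)"
  and smooth_add: "smooth f \<Longrightarrow> smooth g \<Longrightarrow> smooth (\<lambda>x. f x + g x)"
  and smooth_mult: "smooth f \<Longrightarrow> smooth g \<Longrightarrow> smooth (\<lambda>x. f x * g x)"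
  and smooth_affine: "linear A \<Longrightarrow> smooth f \<Longrightarrow> smooth (\<lambda>x. f (A x + b))"
  and smooth_sum: "(\<And>j. j \<in> J \<Longrightarrow> smooth (f' j)) \<Longrightarrow> smooth (\<lambda>x. \<Sum>j\<in>J. f' j x)"
  unfolding smooth_def by (auto intro: C_k_coord C_k_add C_k_mult C_k_affine C_k_sum)

section \<open>A smooth bump function\<close>

text \<open>The k-th derivative of exp(-1/s) is p(1/s) exp(-1/s) for a polynomial p. Differentiating
  once more gives (p - p')(1/s) times 1/s^2, whence the recursion with
  \<open>monom 1 2\<close>.\<close>

fun flat_poly :: "nat \<Rightarrow> real poly" where
  "flat_poly 0 = 1"
| "flat_poly (Suc k) = monom 1 2 * (flat_poly k - pderiv (flat_poly k))"

definition flat_deriv :: "nat \<Rightarrow> real \<Rightarrow> real" where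
  "flat_deriv k s = (if s > 0 then poly (flat_poly k) (1 / s) * exp (- (1 / s)) else 0)"

abbreviation flat :: "real \<Rightarrow> real" where
  "flat \<equiv> flat_deriv 0"

lemma flat_eq: "flat s = (if s > 0 then exp (- (1 / s)) else 0)"
  by (simp add: flat_deriv_def)

text \<open>With y = 1/s this says that no negative power of s outweighs exp(-1/s) as s tends to 0
  from the right, which is the source of flatness at 0.\<close>

lemma poly_exp_tendsto_0: "((\<lambda>y. poly p y * exp (- y)) \<longlongrightarrow> 0) (at_top :: real filter)"
proof (induction p rule: pCons_induct)
  case (pCons a p)
  have "((\<lambda>y::real. y ^ i / exp y) \<longlongrightarrow> 0) at_top" for i
    by (rule tendsto_power_div_exp_0)
  then have c: "((\<lambda>y. coeff (pCons a p) i * (y ^ i / exp y)) \<longlongrightarrow> 0) at_top" for i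
    by (rule tendsto_mult_right_zero)
  have "poly (pCons a p) y * exp (- y) = (\<Sum>i\<le>degree (pCons a p). coeff (pCons a p) i * (y ^ i / exp y))" for y
    unfolding poly_altdef by (simp only: sum_distrib_right exp_minus divide_inverse mult.assoc)
  moreover have "((\<lambda>y. \<Sum>i\<le>degree (pCons a p). coeff (pCons a p) i * (y ^ i / exp y)) \<longlongrightarrow> (\<Sum>i\<le>degree (pCons a p). 0)) at_top"
    by (intro tendsto_sum c)
  ultimately show ?case by simp
qed simp

lemma flat_deriv_has_derivative: "(flat_deriv k has_real_derivative flat_deriv (Suc k) x) (at x)"
proof -
  consider "x > 0" | "x < 0" | "x = 0" by linarith
  then show ?thesis
  proof cases
    case 1
    have "((\<lambda>s. poly (flat_poly k) (1 / s) * exp (- (1 / s))) has_real_derivative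
        flat_deriv (Suc k) x) (at x)"
    proof -
      have i: "((\<lambda>s. 1 / s) has_real_derivative - (1 / (x * x))) (at x)"
        using 1 by (auto intro!: derivative_eq_intros)
      have "((\<lambda>s. poly (flat_poly k) (1 / s)) has_real_derivative poly (pderiv (flat_poly k)) (1 / x) * - (1 / (x * x))) (at x)"
        using DERIV_chain2[OF poly_DERIV i] .
      moreover have "((\<lambda>s. exp (- (1 / s))) has_real_derivative exp (- (1 / x)) * (1 / (x * x))) (at x)"
        using DERIV_chain2[OF DERIV_exp DERIV_minus[OF i]] by simp
      ultimately show ?thesis
        by (rule DERIV_mult[THEN DERIV_cong])
          (use 1 in \<open>simp add: flat_deriv_def poly_monom power2_eq_square field_simps\<close>)
    qed
    moreover have "\<forall>\<^sub>F s in nhds x. flat_deriv k s = poly (flat_poly k) (1 / s) * exp (- (1 / s))"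
      using eventually_nhds_in_open[of "{0<..}" x] 1
      by (auto simp: flat_deriv_def elim!: eventually_mono)
    ultimately show ?thesis by (simp only: DERIV_cong_ev[OF refl _ refl])
  next
    case 2
    have "\<forall>\<^sub>F s in nhds x. flat_deriv k s = 0"
      using eventually_nhds_in_open[of "{..<0}" x] 2
      by (auto simp: flat_deriv_def elim!: eventually_mono)
    moreover have "flat_deriv (Suc k) x = 0" using 2 by (simp add: flat_deriv_def)
    ultimately show ?thesis by (simp only: DERIV_cong_ev[OF refl _ refl] DERIV_const)
  next
    case 3
    have "((\<lambda>s. flat_deriv k s / s) \<longlongrightarrow> 0) (at_right 0)"
    proof -
      \<comment> \<open>Dividing by s multiplies the polynomial by its variable 1/s, which is what
        \<open>pCons 0\<close> does; so the difference quotient at 0 is again of the form covered by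
        \<open>poly_exp_tendsto_0\<close>.\<close>
      have "((\<lambda>s. poly (pCons 0 (flat_poly k)) (inverse s) * exp (- inverse s)) \<longlongrightarrow> 0) (at_right (0::real))"
        by (rule filterlim_compose[OF poly_exp_tendsto_0 filterlim_inverse_at_top_right])
      moreover have "\<forall>\<^sub>F s in at_right (0::real). poly (pCons 0 (flat_poly k)) (inverse s) * exp (- inverse s) = flat_deriv k s / s"
        by (auto simp: eventually_at_filter flat_deriv_def field_simps)
      ultimately show ?thesis by (simp only: tendsto_cong)
    qed
    moreover have "((\<lambda>s. flat_deriv k s / s) \<longlongrightarrow> 0) (at_left 0)"
    proof -
      have "\<forall>\<^sub>F s in at_left (0::real). 0 = flat_deriv k s / s"
        by (auto simp: eventually_at_filter flat_deriv_def)
      from tendsto_cong[OF this, THEN iffD1, OF tendsto_const] show ?thesis .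
    qed
    ultimately have "((\<lambda>s. flat_deriv k s / s) \<longlongrightarrow> 0) (at 0)"
      by (blast intro: filterlim_split_at)
    then show ?thesis using 3 by (simp add: has_field_derivative_iff flat_deriv_def)
  qed
qed

lemma smooth_flat: "smooth g \<Longrightarrow> smooth (\<lambda>x. flat (g x))"
  unfolding smooth_def using C_k_comp_real[of flat_deriv] flat_deriv_has_derivative by blast

lemma flat_nonneg: "0 \<le> flat s" and flat_le_1: "flat s \<le> 1" and flat_pos_iff: "0 < flat s \<longleftrightarrow> 0 < s"
  by (auto simp: flat_eq)

lemma flat_mono: "s \<le> t \<Longrightarrow> flat s \<le> flat t"
  by (auto simp: flat_eq field_simps)

text \<open>The classical mollifier kernel exp(-1/(1 - |x|^2)), left unnormalised since no averages
  are taken with it.\<close>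

definition bump :: "real^'n \<Rightarrow> real" where
  "bump x = flat (1 - x \<bullet> x)"

lemma smooth_bump: "smooth (bump :: real^'n \<Rightarrow> real)"
proof -
  have "smooth (\<lambda>x :: real^'n. 1 + (\<Sum>i\<in>UNIV. (-1) * (x $ i * x $ i)))"
    by (intro smooth_add smooth_sum smooth_mult smooth_coord smooth_const)
  moreover have "(\<lambda>x :: real^'n. 1 + (\<Sum>i\<in>UNIV. (-1) * (x $ i * x $ i))) = (\<lambda>x. 1 - x \<bullet> x)"
    by (simp add: inner_vec_def sum_negf)
  ultimately show ?thesis unfolding bump_def[abs_def] by (metis smooth_flat)
qed

lemma bump_nonneg: "0 \<le> bump x" and bump_le_1: "bump x \<le> 1"
  by (simp_all add: bump_def flat_nonneg flat_le_1)

lemma bump_pos_iff: "0 < bump x \<longleftrightarrow> norm x < 1"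
  by (simp add: bump_def flat_pos_iff power2_norm_eq_inner[symmetric] abs_square_less_1)

lemma bump_eq_0: "1 \<le> norm x \<Longrightarrow> bump x = 0"
  using bump_pos_iff[of x] bump_nonneg[of x] by linarith

text \<open>\<open>flat (3 / 4)\<close> is the value of the bump at distance 1/2 from its centre.
  This lower bound ends up in the denominators of the efficiency constants.\<close>

lemma bump_ge: "norm x \<le> 1 / 2 \<Longrightarrow> flat (3 / 4) \<le> bump x"
proof -
  assume "norm x \<le> 1 / 2"
  then have "(norm x)\<^sup>2 \<le> (1/2)\<^sup>2" by (intro power_mono) auto
  then show ?thesis unfolding bump_def
    by (intro flat_mono) (simp add: power2_norm_eq_inner[symmetric] power2_eq_square)
qed

lemma partial_eq_0_outside:
  assumes "closed K" "\<And>x. x \<notin> K \<Longrightarrow> f x = 0" "x \<notin> K"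
  shows "partial i f x = 0"
proof -
  have "(f has_derivative (\<lambda>_. 0)) (at x)"
    by (rule has_derivative_transform_within_open[of "\<lambda>_. 0" _ _ UNIV "- K"]) (use assms in auto)
  from partial_eqI[OF this] show ?thesis .
qed

lemma smooth_compact_support_bounded:
  fixes f :: "real^'n \<Rightarrow> real"
  assumes "smooth f" "compact K" "\<And>x. x \<notin> K \<Longrightarrow> f x = 0"
  obtains B where "B \<ge> 0" "\<And>x. \<bar>f x\<bar> \<le> B" "\<And>x i. \<bar>partial i f x\<bar> \<le> B"
proof -
  have "\<exists>B. \<forall>x. \<bar>g x\<bar> \<le> B" if "continuous_on K g" "\<And>x. x \<notin> K \<Longrightarrow> g x = 0" for g :: "real^'n \<Rightarrow> real"
  proof -
    have "bounded (g ` K)"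
      using compact_continuous_image compact_imp_bounded that(1) assms(2) by blast
    then obtain B where "\<And>x. x \<in> K \<Longrightarrow> \<bar>g x\<bar> \<le> B" unfolding bounded_iff by auto
    then have "\<bar>g x\<bar> \<le> max B 0" for x using that(2)[of x] by (cases "x \<in> K") (auto simp: le_max_iff_disj)
    then show ?thesis by blast
  qed
  note * = this
  obtain B0 where B0: "\<forall>x. \<bar>f x\<bar> \<le> B0" using *[of f] smooth_continuous_on assms by blast
  have "\<exists>B. \<forall>x. \<bar>partial i f x\<bar> \<le> B" for i
    using assms partial_eq_0_outside[of K f] compact_imp_closed
    by (intro *) (auto intro!: smooth_continuous_on smooth_partial)
  then obtain B where B: "\<And>i x. \<bar>partial i f x\<bar> \<le> B i" by metis
  have "B i \<ge> 0" for i using B[of i 0] by linarith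
  then have Bs: "B i \<le> (\<Sum>i\<in>UNIV. B i)" for i by (intro member_le_sum) auto
  have "\<bar>partial i f x\<bar> \<le> max B0 (\<Sum>i\<in>UNIV. B i)" for i x
    using B[of i x] Bs[of i] by linarith
  moreover have "0 \<le> max B0 (\<Sum>i\<in>UNIV. B i)" using calculation by (meson abs_ge_zero order_trans)
  ultimately show ?thesis using B0 that by (meson max.coboundedI1)
qed

section \<open>Polynomial functions\<close>

lemma finite_exponents: "finite {\<alpha> :: 'n::finite \<Rightarrow> nat. (\<Sum>i\<in>UNIV. \<alpha> i) \<le> N}"
proof (rule finite_subset)
  show "finite (PiE (UNIV :: 'n set) (\<lambda>_. {..N}))"
    by (intro finite_PiE) auto
  have "\<alpha> i \<le> N" if "(\<Sum>i\<in>UNIV. \<alpha> i) \<le> N" for \<alpha> :: "'n \<Rightarrow> nat" and i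
    using member_le_sum[of i UNIV \<alpha>] that by auto
  then show "{\<alpha> :: 'n::finite \<Rightarrow> nat. (\<Sum>i\<in>UNIV. \<alpha> i) \<le> N} \<subseteq> PiE UNIV (\<lambda>_. {..N})"
    by (auto simp: PiE_UNIV_domain)
qed

lemma polys_total_monomial:
  assumes "(\<Sum>i\<in>UNIV. \<alpha> i) \<le> N"
  shows "(\<lambda>x. \<Prod>i\<in>UNIV. (x $ i) ^ \<alpha> i) \<in> polys_total N"
  unfolding polys_total_def polys_with_exponents_def mem_Collect_eq
proof (intro exI[of _ "\<lambda>\<beta>. if \<beta> = \<alpha> then 1 else 0"] ext)
  fix x :: "real^'a"
  show "(\<Prod>i\<in>UNIV. x $ i ^ \<alpha> i) = (\<Sum>\<beta> | sum \<beta> UNIV \<le> N. (if \<beta> = \<alpha> then 1 else 0) * (\<Prod>i\<in>UNIV. x $ i ^ \<beta> i))"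
    using assms by (simp add: if_distrib[of "\<lambda>c. c * _"] finite_exponents cong: if_cong)
qed

lemma polys_total_add:
  assumes "p \<in> polys_total N" "q \<in> polys_total N"
  shows "(\<lambda>x. p x + q x) \<in> polys_total N"
proof -
  from assms obtain c d where "p = (\<lambda>x. \<Sum>\<alpha> | sum \<alpha> UNIV \<le> N. c \<alpha> * (\<Prod>i\<in>UNIV. x $ i ^ \<alpha> i))"
    "q = (\<lambda>x. \<Sum>\<alpha> | sum \<alpha> UNIV \<le> N. d \<alpha> * (\<Prod>i\<in>UNIV. x $ i ^ \<alpha> i))"
    unfolding polys_total_def polys_with_exponents_def by auto
  then have "(\<lambda>x. p x + q x) = (\<lambda>x. \<Sum>\<alpha> | sum \<alpha> UNIV \<le> N. (c \<alpha> + d \<alpha>) * (\<Prod>i\<in>UNIV. x $ i ^ \<alpha> i))"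
    by (simp add: sum.distrib distrib_right)
  then show ?thesis unfolding polys_total_def polys_with_exponents_def by (auto intro!: exI[of _ "\<lambda>\<alpha>. c \<alpha> + d \<alpha>"])
qed

lemma polys_total_cmul:
  assumes "p \<in> polys_total N"
  shows "(\<lambda>x. a * p x) \<in> polys_total N"
proof -
  from assms obtain c where "p = (\<lambda>x. \<Sum>\<alpha> | sum \<alpha> UNIV \<le> N. c \<alpha> * (\<Prod>i\<in>UNIV. x $ i ^ \<alpha> i))"
    unfolding polys_total_def polys_with_exponents_def by auto
  then have "(\<lambda>x. a * p x) = (\<lambda>x. \<Sum>\<alpha> | sum \<alpha> UNIV \<le> N. (a * c \<alpha>) * (\<Prod>i\<in>UNIV. x $ i ^ \<alpha> i))"
    by (simp add: sum_distrib_left mult.assoc)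
  then show ?thesis unfolding polys_total_def polys_with_exponents_def by (auto intro!: exI[of _ "\<lambda>\<alpha>. a * c \<alpha>"])
qed

lemma polys_total_const [simp]: "(\<lambda>x. c) \<in> polys_total N"
  using polys_total_cmul[OF polys_total_monomial[of "\<lambda>_. 0"], of N c] by simp

lemma polys_total_diff:
  assumes "p \<in> polys_total N" "q \<in> polys_total N"
  shows "(\<lambda>x. p x - q x) \<in> polys_total N"
  using polys_total_add[OF assms(1) polys_total_cmul[OF assms(2), of "-1"]] by simp

lemma polys_total_sum:
  "(\<And>j. j \<in> J \<Longrightarrow> p j \<in> polys_total N) \<Longrightarrow> (\<lambda>x. \<Sum>j\<in>J. p j x) \<in> polys_total N"
  by (induction J rule: infinite_finite_induct) (auto intro: polys_total_add)

lemma monomial_Suc: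
  fixes x :: "real^'n"
  shows "x $ j * (\<Prod>i\<in>UNIV. (x $ i) ^ \<alpha> i) = (\<Prod>i\<in>UNIV. (x $ i) ^ (\<alpha>(j := Suc (\<alpha> j))) i)"
proof -
  have "(\<Prod>i\<in>UNIV. (x $ i) ^ (\<alpha>(j := Suc (\<alpha> j))) i) = (\<Prod>i\<in>UNIV. (if i = j then x $ j else 1) * (x $ i) ^ \<alpha> i)"
    by (intro prod.cong) auto
  then show ?thesis by (simp add: prod.distrib)
qed

lemma sum_exponent_Suc:
  fixes \<alpha> :: "'n::finite \<Rightarrow> nat"
  shows "(\<Sum>i\<in>UNIV. (\<alpha>(j := Suc (\<alpha> j))) i) = Suc (\<Sum>i\<in>UNIV. \<alpha> i)"
proof -
  have "(\<Sum>i\<in>UNIV. (\<alpha>(j := Suc (\<alpha> j))) i) = (\<Sum>i\<in>UNIV. (if i = j then 1 else 0) + \<alpha> i)"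
    by (intro sum.cong) auto
  then show ?thesis by (simp add: sum.distrib)
qed

lemma polys_total_coord_mult:
  assumes "p \<in> polys_total N"
  shows "(\<lambda>x. x $ j * p x) \<in> polys_total (Suc N)"
proof -
  from assms obtain c where "p = (\<lambda>x. \<Sum>\<alpha> | sum \<alpha> UNIV \<le> N. c \<alpha> * (\<Prod>i\<in>UNIV. x $ i ^ \<alpha> i))"
    unfolding polys_total_def polys_with_exponents_def by auto
  then have e: "(\<lambda>x. x $ j * p x) = (\<lambda>x. \<Sum>\<alpha> | sum \<alpha> UNIV \<le> N. c \<alpha> * (x $ j * (\<Prod>i\<in>UNIV. x $ i ^ \<alpha> i)))"
    by (simp add: sum_distrib_left mult.left_commute)
  show ?thesis unfolding e monomial_Suc
  proof (intro polys_total_sum polys_total_cmul polys_total_monomial)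
    fix \<alpha> :: "'a \<Rightarrow> nat" assume "\<alpha> \<in> {\<alpha>. sum \<alpha> UNIV \<le> N}"
    then show "sum (\<alpha>(j := Suc (\<alpha> j))) UNIV \<le> Suc N" by (simp only: sum_exponent_Suc) simp
  qed
qed

text \<open>Closure properties of polynomials follow from this rule without reference to
  multi-indices. The degree bound is an argument of \<open>P\<close>, so that it can grow by one
  when a coordinate is multiplied on.\<close>

lemma polys_total_induct [consumes 1, case_names const add cmul coord]:
  fixes p :: "real^'n \<Rightarrow> real"
  assumes "p \<in> polys_total N"
    and const: "\<And>N c. P N (\<lambda>x. c)"
    and add: "\<And>N p q. p \<in> polys_total N \<Longrightarrow> q \<in> polys_total N \<Longrightarrow> P N p \<Longrightarrow> P N q \<Longrightarrow> P N (\<lambda>x. p x + q x)"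
    and cmul: "\<And>N p c. p \<in> polys_total N \<Longrightarrow> P N p \<Longrightarrow> P N (\<lambda>x. c * p x)"
    and coord: "\<And>N p j. p \<in> polys_total N \<Longrightarrow> P N p \<Longrightarrow> P (Suc N) (\<lambda>x. x $ j * p x)"
  shows "P N p"
proof -
  have mono: "P N (\<lambda>x. \<Prod>i\<in>UNIV. (x $ i) ^ \<alpha> i)" if "sum \<alpha> UNIV \<le> N" for \<alpha> N
    using that
  proof (induction N arbitrary: \<alpha>)
    case 0
    then show ?case using const[of 0 1] by simp
  next
    case (Suc N)
    show ?case
    proof (cases "\<forall>i. \<alpha> i = 0")
      case True
      then show ?thesis using const[of "Suc N" 1] by simp
    next
      case False
      \<comment> \<open>One factor of a coordinate with positive exponent is split off, which lowers
        the total degree by one.\<close>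
      then obtain j k where j: "\<alpha> j = Suc k" using not0_implies_Suc by metis
      define \<beta> where "\<beta> = \<alpha>(j := k)"
      have a: "\<alpha> = \<beta>(j := Suc (\<beta> j))" by (auto simp: \<beta>_def j)
      then have "sum \<beta> UNIV \<le> N" using Suc.prems sum_exponent_Suc[of \<beta> j] by simp
      then show ?thesis
        unfolding a monomial_Suc[symmetric] by (intro coord Suc.IH polys_total_monomial)
    qed
  qed
  have sum: "finite A \<Longrightarrow> A \<subseteq> {\<alpha>. sum \<alpha> UNIV \<le> N} \<Longrightarrow>
      P N (\<lambda>x. \<Sum>\<alpha>\<in>A. c \<alpha> * (\<Prod>i\<in>UNIV. x $ i ^ \<alpha> i))" for A c
  proof (induction A rule: finite_induct)
    case empty
    then show ?case using const[of N 0] by simp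
  next
    case (insert \<alpha> A)
    have "P N (\<lambda>x. c \<alpha> * (\<Prod>i\<in>UNIV. x $ i ^ \<alpha> i) + (\<Sum>\<alpha>\<in>A. c \<alpha> * (\<Prod>i\<in>UNIV. x $ i ^ \<alpha> i)))"
      using insert
      by (intro add cmul mono polys_total_sum polys_total_cmul polys_total_monomial) auto
    then show ?case using insert by simp
  qed
  from assms(1) obtain c where "p = (\<lambda>x. \<Sum>\<alpha> | sum \<alpha> UNIV \<le> N. c \<alpha> * (\<Prod>i\<in>UNIV. x $ i ^ \<alpha> i))"
    unfolding polys_total_def polys_with_exponents_def by auto
  then show ?thesis using sum[OF finite_exponents subset_refl] by simp
qed

lemma polys_total_mono: "p \<in> polys_total N \<Longrightarrow> N \<le> M \<Longrightarrow> p \<in> polys_total M"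
proof (induction arbitrary: M rule: polys_total_induct)
  case (coord N p j)
  then obtain M' where "M = Suc M'" "N \<le> M'" by (metis Suc_le_D Suc_le_mono)
  with coord show ?case by (auto intro: polys_total_coord_mult)
qed (auto intro: polys_total_add polys_total_cmul)

text \<open>Exponents of at most k in each of d variables add up to at most d k, so a bound on the
  total degree serves simplices and parallelotopes alike.\<close>

lemma polys_each_var_subset: "polys_each_var k \<subseteq> (polys_total (CARD('n::finite) * k) :: (real^'n \<Rightarrow> real) set)"
proof
  fix p :: "real^'n \<Rightarrow> real" assume "p \<in> polys_each_var k"
  then obtain c where p: "p = (\<lambda>x. \<Sum>\<alpha> | \<forall>i. \<alpha> i \<le> k. c \<alpha> * (\<Prod>i\<in>UNIV. x $ i ^ \<alpha> i))"
    unfolding polys_each_var_def polys_with_exponents_def by auto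
  show "p \<in> polys_total (CARD('n) * k)" unfolding p
    by (intro polys_total_sum polys_total_cmul polys_total_monomial sum_bounded_above[THEN order_trans]) auto
qed

lemma P_k_subset: "k \<le> N \<Longrightarrow> CARD('n) * k \<le> N \<Longrightarrow> p \<in> P_k k (T :: (real^'n) set) \<Longrightarrow> p \<in> polys_total N"
  unfolding P_k_def using polys_each_var_subset[of k] polys_total_mono by (auto split: if_splits)

lemma polys_total_smooth: "p \<in> polys_total N \<Longrightarrow> smooth p"
  by (induction rule: polys_total_induct) (auto intro: smooth_add smooth_mult smooth_coord)

lemma polys_total_differentiable: "p \<in> polys_total N \<Longrightarrow> p differentiable (at x)"
  using polys_total_smooth smooth_differentiable by blast

text \<open>The bound \<open>N\<close> is kept instead of being lowered, so that functions, their
  derivatives and the residuals built from them all live in one space.\<close>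

lemma polys_total_partial:
  fixes p :: "real^'n \<Rightarrow> real"
  shows "p \<in> polys_total N \<Longrightarrow> partial i p \<in> polys_total N"
proof (induction rule: polys_total_induct)
  case (add N p q)
  then have "partial i (\<lambda>x. p x + q x) = (\<lambda>x. partial i p x + partial i q x)"
    by (intro ext partial_add) (auto intro: polys_total_differentiable)
  then show ?case using add by (auto intro: polys_total_add)
next
  case (cmul N p c)
  then have "partial i (\<lambda>x. c * p x) = (\<lambda>x. c * partial i p x)"
    by (intro ext partial_cmul) (auto intro: polys_total_differentiable)
  then show ?case using cmul by (auto intro: polys_total_cmul)
next
  case (coord N p j)
  have "partial i (\<lambda>x. x $ j * p x) = (\<lambda>x. (if i = j then 1 else 0) * p x + x $ j * partial i p x)"
  proof
    fix x :: "real^'n"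
    show "partial i (\<lambda>x. x $ j * p x) x = (if i = j then 1 else 0) * p x + x $ j * partial i p x"
      by (subst partial_mult[OF smooth_differentiable[OF smooth_coord] polys_total_differentiable[OF coord.hyps]])
        (simp only: partial_coord)
  qed
  moreover have "p \<in> polys_total (Suc N)" by (rule polys_total_mono[OF coord.hyps]) simp
  ultimately show ?case using coord.IH
    by (simp only:) (intro polys_total_add polys_total_cmul polys_total_coord_mult)
qed auto

text \<open>\<open>A\<close> may be singular. Besides the scaling to the unit ball this covers the
  extension of a jump along the normal, which is composition with a projection.\<close>

lemma polys_total_affine:
  fixes A :: "real^'m \<Rightarrow> real^'n"
  assumes A: "linear A"
  shows "p \<in> polys_total N \<Longrightarrow> (\<lambda>x. p (A x + b)) \<in> polys_total N"
proof (induction rule: polys_total_induct)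
  case (coord N p j)
  have Aj: "A x $ j = (\<Sum>i\<in>UNIV. A (axis i 1) $ j * x $ i)" for x
  proof -
    have "x = (\<Sum>i\<in>UNIV. x $ i *\<^sub>R axis i 1)"
      by (metis basis_expansion scalar_mult_eq_scaleR)
    then have "A x = A (\<Sum>i\<in>UNIV. x $ i *\<^sub>R axis i 1)" by simp
    also have "\<dots> = (\<Sum>i\<in>UNIV. x $ i *\<^sub>R A (axis i 1))" by (simp add: A linear_sum linear_scale)
    finally show ?thesis by (simp add: sum_component mult.commute)
  qed
  have "(\<lambda>x. (A x + b) $ j * p (A x + b)) =
      (\<lambda>x. (\<Sum>i\<in>UNIV. A (axis i 1) $ j * (x $ i * p (A x + b))) + b $ j * p (A x + b))"
    by (intro ext, subst vector_add_component, subst Aj)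
      (simp add: distrib_right sum_distrib_right mult.assoc)
  moreover have "(\<lambda>x. p (A x + b)) \<in> polys_total (Suc N)"
    by (rule polys_total_mono[OF coord.IH]) simp
  ultimately show ?case using coord.IH
    by (simp only:) (intro polys_total_add polys_total_sum polys_total_cmul polys_total_coord_mult)
qed (auto intro: polys_total_add polys_total_cmul)

lemma polys_total_on_line:
  fixes p :: "real^'n \<Rightarrow> real"
  assumes "p \<in> polys_total N"
  shows "\<exists>P. \<forall>t. poly P t = p (a + t *\<^sub>R v)"
  using assms
proof (induction rule: polys_total_induct)
  case (const N c)
  show ?case by (rule exI[of _ "[:c:]"]) simp
next
  case (add N p q)
  then show ?case by (metis poly_add)
next
  case (cmul N p c)
  then show ?case by (metis poly_smult)
next
  case (coord N p j)
  then obtain P where P: "\<forall>t. poly P t = p (a + t *\<^sub>R v)" by blast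
  then show ?case by (intro exI[of _ "[:a $ j, v $ j:] * P"]) (simp add: algebra_simps)
qed

text \<open>On the line through \<open>c\<close> and \<open>x\<close> the function is a polynomial
  in one variable with infinitely many zeros.\<close>

lemma polys_total_identity:
  fixes p :: "real^'n \<Rightarrow> real"
  assumes "p \<in> polys_total N" "r > 0" "\<And>x. x \<in> ball c r \<Longrightarrow> p x = 0"
  shows "p x = 0"
proof (cases "x = c")
  case False
  obtain P where P: "\<And>t. poly P t = p (c + t *\<^sub>R (x - c))"
    using polys_total_on_line[OF assms(1)] by metis
  define \<delta> where "\<delta> = r / norm (x - c)"
  have "\<delta> > 0" using False assms(2) by (simp add: \<delta>_def)
  have "poly P t = 0" if "t \<in> {0<..<\<delta>}" for t
  proof -
    have "dist c (c + t *\<^sub>R (x - c)) < r" using that False by (simp add: dist_norm \<delta>_def pos_less_divide_eq)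
    then show ?thesis unfolding P by (intro assms(3)) simp
  qed
  then have "{0<..<\<delta>} \<subseteq> {t. poly P t = 0}" by blast
  then have "infinite {t. poly P t = 0}"
    using \<open>\<delta> > 0\<close> infinite_Ioo infinite_super by blast
  then have "P = 0" using poly_roots_finite by blast
  then show ?thesis using P[of 1] by simp
qed (use assms in auto)

section \<open>Equivalence of norms on polynomials\<close>

abbreviation ball_ip :: "real^'n \<Rightarrow> real \<Rightarrow> (real^'n \<Rightarrow> real) \<Rightarrow> (real^'n \<Rightarrow> real) \<Rightarrow> real" where
  "ball_ip c r p q \<equiv> (LINT x:cball c r|lborel. p x * q x)"

lemma set_integrable_cball:
  fixes f :: "real^'n \<Rightarrow> real"
  shows "continuous_on UNIV f \<Longrightarrow> set_integrable lborel (cball c r) f"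
  unfolding set_integrable_def
  by (intro borel_integrable_compact compact_cball) (auto intro: continuous_on_subset)

lemma polys_total_continuous: "p \<in> polys_total N \<Longrightarrow> continuous_on S p"
  using polys_total_smooth smooth_continuous_on by blast

lemma ball_ip_add:
  assumes "p \<in> polys_total N" "p' \<in> polys_total N" "q \<in> polys_total N"
  shows "ball_ip c r (\<lambda>x. p x + p' x) q = ball_ip c r p q + ball_ip c r p' q"
  unfolding distrib_right
  by (intro set_integral_add set_integrable_cball continuous_intros assms[THEN polys_total_continuous])

lemma ball_ip_sum:
  assumes "\<And>j. j \<in> J \<Longrightarrow> p j \<in> polys_total N" "q \<in> polys_total N"
  shows "ball_ip c r (\<lambda>x. \<Sum>j\<in>J. a j * p j x) q = (\<Sum>j\<in>J. a j * ball_ip c r (p j) q)"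
  using assms(1)
proof (induction J rule: infinite_finite_induct)
  case (insert j J)
  have "ball_ip c r (\<lambda>x. a j * p j x + (\<Sum>j\<in>J. a j * p j x)) q =
      ball_ip c r (\<lambda>x. a j * p j x) q + ball_ip c r (\<lambda>x. \<Sum>j\<in>J. a j * p j x) q"
    using insert by (intro ball_ip_add[of _ N] polys_total_sum polys_total_cmul assms(2)) auto
  then show ?case using insert by (simp add: mult.assoc)
qed (auto simp: set_lebesgue_integral_def)

lemma ball_ip_commute: "ball_ip c r p q = ball_ip c r q p"
  by (simp add: mult.commute)

lemma ball_ip_nonneg: "0 \<le> ball_ip c r p p"
  unfolding set_lebesgue_integral_def by (intro integral_nonneg_AE) auto

text \<open>The points of the open ball where p does not vanish form an open null set, so there are
  none, and the identity theorem extends the zero to the whole space.\<close>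

lemma ball_ip_definite:
  fixes p :: "real^'n \<Rightarrow> real"
  assumes p: "p \<in> polys_total N" and r: "r > 0" and z: "ball_ip c r p p = 0"
  shows "p x = 0"
proof (rule polys_total_identity[OF p r])
  have ct: "continuous_on UNIV p" using p polys_total_continuous by blast
  have i: "set_integrable lborel (cball c r) (\<lambda>x. p x * p x)"
    by (intro set_integrable_cball continuous_intros ct)
  have "AE x in lborel. indicat_real (cball c r) x *\<^sub>R (p x * p x) = 0"
    using z i unfolding set_lebesgue_integral_def set_integrable_def
    by (subst (asm) integral_nonneg_eq_0_iff_AE) auto
  then obtain Z where Z: "Z \<in> null_sets lborel" "{x. \<not> indicat_real (cball c r) x *\<^sub>R (p x * p x) = 0} \<subseteq> Z"
    by (auto elim: AE_E simp: null_sets_def)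
  let ?U = "ball c r \<inter> p -` (- {0})"
  have "open ?U" using ct by (intro open_Int open_ball open_vimage) auto
  moreover have "?U \<subseteq> Z" using Z(2) by (force simp: indicator_def)
  then have "negligible ?U"
    using Z(1) by (meson negligible_iff_null_sets negligible_subset null_sets_completionI)
  ultimately have "?U = {}" using open_not_negligible by blast
  then show "p y = 0" if "y \<in> ball c r" for y using that by blast
qed

text \<open>Gram-Schmidt. The members of \<open>F\<close> may be dependent: one that adds nothing to
  the span leaves a remainder of norm zero, which is the zero function by
  \<open>ball_ip_definite\<close>, and is skipped. So the dimension of the polynomial space never
  has to be known.\<close>

lemma orthonormal_polys:
  fixes F :: "(real^'n \<Rightarrow> real) set"
  assumes "finite F" "F \<subseteq> polys_total N" "r > 0"
  shows "\<exists>m e. (\<forall>i<m. e i \<in> polys_total N) \<and>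
    (\<forall>i<m. \<forall>j<m. ball_ip c r (e i) (e j) = (if i = j then 1 else 0)) \<and>
    (\<forall>f\<in>F. \<exists>a. f = (\<lambda>x. \<Sum>i<m::nat. a i * e i x))"
  using assms(1,2)
proof (induction F rule: finite_induct)
  case empty
  then show ?case by (intro exI[of _ 0]) auto
next
  case (insert f F)
  then have "F \<subseteq> polys_total N" by auto
  with insert.IH obtain m e where *: "(\<forall>i<m. e i \<in> polys_total N) \<and>
    (\<forall>i<m. \<forall>j<m. ball_ip c r (e i) (e j) = (if i = j then 1 else 0)) \<and>
    (\<forall>f\<in>F. \<exists>a. f = (\<lambda>x. \<Sum>i<m::nat. a i * e i x))" by blast
  then have e: "\<And>i. i < m \<Longrightarrow> e i \<in> polys_total N"
    and orth: "\<And>i j. i < m \<Longrightarrow> j < m \<Longrightarrow> ball_ip c r (e i) (e j) = (if i = j then 1 else 0)"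
    and sp: "\<And>f. f \<in> F \<Longrightarrow> \<exists>a. f = (\<lambda>x. \<Sum>i<m. a i * e i x)"
    by blast+
  have f: "f \<in> polys_total N" using insert by auto
  define b where "b i = ball_ip c r f (e i)" for i
  \<comment> \<open>\<open>g\<close> is \<open>f\<close> minus its orthogonal projection onto the
    span found so far.\<close>
  define g where "g x = f x + (-1) * (\<Sum>i<m. b i * e i x)" for x
  have s: "(\<lambda>x. \<Sum>i<m. b i * e i x) \<in> polys_total N"
    using e by (intro polys_total_sum polys_total_cmul) auto
  have g: "g \<in> polys_total N" unfolding g_def[abs_def]
    by (intro polys_total_add polys_total_cmul f s)
  have ge: "ball_ip c r g (e j) = 0" if "j < m" for j
  proof -
    have "ball_ip c r g (e j) = ball_ip c r f (e j) + ball_ip c r (\<lambda>x. (-1) * (\<Sum>i<m. b i * e i x)) (e j)"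
      unfolding g_def by (intro ball_ip_add[of _ N] f polys_total_cmul s e that)
    also have "(\<lambda>x. (-1) * (\<Sum>i<m. b i * e i x)) = (\<lambda>x. \<Sum>i<m. (- b i) * e i x)"
      by (simp add: sum_negf)
    also have "ball_ip c r (\<lambda>x. \<Sum>i<m. (- b i) * e i x) (e j) = (\<Sum>i<m. (- b i) * ball_ip c r (e i) (e j))"
      using e that by (intro ball_ip_sum[of _ _ N]) auto
    also have "\<dots> = (\<Sum>i<m. if i = j then - b i else 0)"
      using that orth by (intro sum.cong) auto
    finally show ?thesis using that by (simp add: b_def)
  qed
  have fg: "f x = (\<Sum>i<m. b i * e i x) + g x" for x by (simp add: g_def)
  show ?case
  proof (cases "ball_ip c r g g = 0")
    case True
    have "g x = 0" for x by (rule ball_ip_definite[OF g assms(3) True])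
    then have "f = (\<lambda>x. \<Sum>i<m. b i * e i x)" using fg by (intro ext) simp
    then have "\<forall>h\<in>insert f F. \<exists>a. h = (\<lambda>x. \<Sum>i<m. a i * e i x)" using sp by blast
    then show ?thesis using e orth by blast
  next
    case False
    define \<nu> where "\<nu> = sqrt (ball_ip c r g g)"
    have \<nu>: "\<nu> > 0" "\<nu> * \<nu> = ball_ip c r g g" 
      using False ball_ip_nonneg[of c r g] unfolding \<nu>_def by (metis order_le_less real_sqrt_gt_zero, metis real_sqrt_mult_self abs_of_nonneg)
    define e' where "e' = e(m := (\<lambda>x. (1 / \<nu>) * g x))"
    have e': "e' i \<in> polys_total N" if "i < Suc m" for i
    proof (cases "i = m")
      case True
      then show ?thesis using polys_total_cmul[OF g, of "1 / \<nu>"] by (simp add: e'_def)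
    next
      case False
      then show ?thesis using that e by (simp add: e'_def)
    qed
    have sc: "ball_ip c r (\<lambda>x. a * p x) q = a * ball_ip c r p q" for a and p q :: "real^'n \<Rightarrow> real"
      by (simp add: mult.assoc)
    have e'm: "e' m = (\<lambda>x. (1 / \<nu>) * g x)" and e'l: "\<And>i. i < m \<Longrightarrow> e' i = e i" by (auto simp: e'_def)
    have "ball_ip c r (e' m) (e' m) = (1 / \<nu>) * ((1 / \<nu>) * ball_ip c r g g)"
      unfolding e'm sc by (subst ball_ip_commute, unfold sc) (rule refl)
    then have mm: "ball_ip c r (e' m) (e' m) = 1" unfolding \<nu>(2)[symmetric] using \<nu>(1) by simp
    have mj: "ball_ip c r (e' m) (e' j) = 0" if "j < m" for j
    proof -
      have "ball_ip c r (e' m) (e' j) = (1 / \<nu>) * ball_ip c r g (e j)"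
        unfolding e'm e'l[OF that] by (rule sc)
      then show ?thesis by (simp only: ge[OF that] mult_zero_right)
    qed
    have o': "ball_ip c r (e' i) (e' j) = (if i = j then 1 else 0)" if ij: "i < Suc m" "j < Suc m" for i j
    proof -
      consider "i = m" "j = m" | "i = m" "j < m" | "i < m" "j = m" | "i < m" "j < m"
        using ij by linarith
      then show ?thesis
      proof cases
        case 3
        then show ?thesis using trans[OF ball_ip_commute mj] by simp
      next
        case 1
        then show ?thesis using mm by simp
      next
        case 2
        then show ?thesis using mj by simp
      next
        case 4
        then show ?thesis using orth by (simp add: e'l)
      qed
    qed
    have sp': "\<exists>a. h = (\<lambda>x. \<Sum>i<Suc m. a i * e' i x)" if "h \<in> insert f F" for h
    proof (cases "h = f")
      case True
      have "f = (\<lambda>x. \<Sum>i<Suc m. (b(m := \<nu>)) i * e' i x)"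
        using fg \<nu> by (intro ext) (simp add: e'_def)
      then show ?thesis unfolding True by (intro exI[of _ "b(m := \<nu>)"])
    next
      case False
      then have "h \<in> F" using that by blast
      from sp[OF this] obtain a where "h = (\<lambda>x. \<Sum>i<m. a i * e i x)" ..
      then have "h = (\<lambda>x. \<Sum>i<Suc m. (a(m := 0)) i * e' i x)" by (simp add: e'_def)
      then show ?thesis by (intro exI[of _ "a(m := 0)"])
    qed
    show ?thesis
    proof (intro exI[of _ "Suc m"] exI[of _ e'] conjI allI impI ballI)
    qed (use e' o' sp' in simp_all)
  qed
qed

text \<open>In a system that is orthonormal on the ball of radius \<open>r\<close>,
  \<open>ball_ip\<close> is the sum of the squared coefficients, so no coefficient exceeds the norm.
  Bounds for the finitely many members and their partial derivatives on the unit ball then carry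
  over to every polynomial, even when \<open>r\<close> is much smaller than 1.\<close>

lemma polys_norm_equiv_unit:
  assumes "r > 0"
  shows "\<exists>C>0. \<forall>p \<in> (polys_total N :: (real^'n \<Rightarrow> real) set). \<forall>x\<in>cball 0 1.
    (p x)\<^sup>2 \<le> C * ball_ip 0 r p p \<and> (\<forall>j. (partial j p x)\<^sup>2 \<le> C * ball_ip 0 r p p)"
proof -
  let ?A = "{\<alpha> :: 'n \<Rightarrow> nat. sum \<alpha> UNIV \<le> N}"
  let ?mon = "\<lambda>\<alpha> (x :: real^'n). \<Prod>i\<in>UNIV. x $ i ^ \<alpha> i"
  have "?mon ` ?A \<subseteq> polys_total N" by (auto intro: polys_total_monomial)
  from orthonormal_polys[OF finite_imageI[OF finite_exponents] this assms, of 0]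
  obtain m :: nat and e where *: "(\<forall>i<m. e i \<in> polys_total N) \<and>
    (\<forall>i<m. \<forall>j<m. ball_ip 0 r (e i) (e j) = (if i = j then 1 else 0)) \<and>
    (\<forall>f\<in>?mon ` ?A. \<exists>a. f = (\<lambda>x. \<Sum>i<m::nat. a i * e i x))" by blast
  then have e: "\<And>i. i < m \<Longrightarrow> e i \<in> polys_total N"
    and orth: "\<And>i j. i < m \<Longrightarrow> j < m \<Longrightarrow> ball_ip 0 r (e i) (e j) = (if i = j then 1 else 0)"
    and sp: "\<And>\<alpha>. \<alpha> \<in> ?A \<Longrightarrow> \<exists>a. ?mon \<alpha> = (\<lambda>x. \<Sum>i<m. a i * e i x)"
    by blast+
  have "\<forall>\<alpha>\<in>?A. \<exists>a. ?mon \<alpha> = (\<lambda>x. \<Sum>i<m. a i * e i x)" using sp by (rule ballI)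
  from bchoice[OF this] obtain a where
    a: "\<And>\<alpha>. \<alpha> \<in> ?A \<Longrightarrow> ?mon \<alpha> = (\<lambda>x. \<Sum>i<m. a \<alpha> i * e i x)" by blast
  have "\<exists>M. \<forall>x\<in>cball 0 1. \<bar>q x\<bar> \<le> M" if "q \<in> polys_total N" for q :: "real^'n \<Rightarrow> real"
  proof -
    have "bounded (q ` cball 0 1)"
      by (intro compact_imp_bounded compact_continuous_image compact_cball polys_total_continuous[OF that])
    then show ?thesis unfolding bounded_iff by auto
  qed
  then have "\<forall>q\<in>polys_total N. \<exists>M. \<forall>x\<in>cball 0 1. \<bar>q (x::real^'n)\<bar> \<le> M" by (rule ballI)
  from bchoice[OF this] obtain B where
    B: "\<And>q x. q \<in> polys_total N \<Longrightarrow> x \<in> cball 0 1 \<Longrightarrow> \<bar>q (x::real^'n)\<bar> \<le> B q" by blast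
  define M where "M i = B (e i) + (\<Sum>j\<in>UNIV. B (partial j (e i)))" for i
  have B0: "B q \<ge> 0" if "q \<in> polys_total N" for q :: "real^'n \<Rightarrow> real"
    using B[OF that, of 0] by (simp add: order_trans[OF abs_ge_zero])
  have M: "\<bar>e i x\<bar> \<le> M i" "\<bar>partial j (e i) x\<bar> \<le> M i" "0 \<le> M i" if "i < m" "x \<in> cball 0 1" for i j x
  proof -
    have s: "B (partial j (e i)) \<le> (\<Sum>j\<in>UNIV. B (partial j (e i)))" for j
      using e that by (intro member_le_sum) (auto intro!: B0 polys_total_partial)
    have "0 \<le> B (partial j (e i))" for j using e that by (auto intro!: B0 polys_total_partial)
    moreover have "0 \<le> B (e i)" using e that by (auto intro!: B0)
    moreover have "\<bar>e i x\<bar> \<le> B (e i)" using e that by (intro B) auto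
    moreover have "\<bar>partial j (e i) x\<bar> \<le> B (partial j (e i))" using e that by (intro B polys_total_partial) auto
    ultimately show "\<bar>e i x\<bar> \<le> M i" "\<bar>partial j (e i) x\<bar> \<le> M i" "0 \<le> M i"
      using s[of j] unfolding M_def by linarith+
  qed
  define K where "K = (\<Sum>i<m. M i)"
  have K0: "K \<ge> 0" unfolding K_def using M(3)[of _ 0] by (intro sum_nonneg) auto
  show ?thesis
  \<comment> \<open>The summand 1 makes the constant positive.\<close>
  proof (intro exI[of _ "K\<^sup>2 + 1"] conjI ballI allI)
    show "K\<^sup>2 + 1 > 0" by (simp add: add_nonneg_pos)
    fix p :: "real^'n \<Rightarrow> real" and x :: "real^'n"
    assume p: "p \<in> polys_total N" and x: "x \<in> cball 0 1"
    from p obtain c where "p = (\<lambda>x. \<Sum>\<alpha>\<in>?A. c \<alpha> * ?mon \<alpha> x)"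
      unfolding polys_total_def polys_with_exponents_def by auto
    also have "\<dots> = (\<lambda>x. \<Sum>\<alpha>\<in>?A. c \<alpha> * (\<Sum>i<m. a \<alpha> i * e i x))"
    proof (intro ext sum.cong refl)
      fix x :: "real^'n" and \<alpha> assume "\<alpha> \<in> ?A"
      from fun_cong[OF a[OF this], of x] show "c \<alpha> * ?mon \<alpha> x = c \<alpha> * (\<Sum>i<m. a \<alpha> i * e i x)" by simp
    qed
    also have "\<dots> = (\<lambda>x. \<Sum>i<m. (\<Sum>\<alpha>\<in>?A. c \<alpha> * a \<alpha> i) * e i x)"
      by (simp only: sum_distrib_left sum_distrib_right mult.assoc sum.swap[of _ ?A])
    finally have pb': "p = (\<lambda>x. \<Sum>i<m. (\<Sum>\<alpha>\<in>?A. c \<alpha> * a \<alpha> i) * e i x)" .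
    define b where "b i = (\<Sum>\<alpha>\<in>?A. c \<alpha> * a \<alpha> i)" for i
    have pb: "p = (\<lambda>x. \<Sum>i<m. b i * e i x)" unfolding b_def by (rule pb')
    have ipb: "ball_ip 0 r p q = (\<Sum>i<m. b i * ball_ip 0 r (e i) q)" if q: "q \<in> polys_total N" for q
    proof -
      have "ball_ip 0 r p q = ball_ip 0 r (\<lambda>x. \<Sum>i<m. b i * e i x) q"
        by (rule arg_cong[OF pb, of "\<lambda>s. ball_ip 0 r s q"])
      also have "\<dots> = (\<Sum>i<m. b i * ball_ip 0 r (e i) q)"
        by (rule ball_ip_sum[OF _ q]) (use e in auto)
      finally show ?thesis .
    qed
    have "ball_ip 0 r p p = (\<Sum>i<m. b i * ball_ip 0 r (e i) p)" by (rule ipb[OF p])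
    also have "\<dots> = (\<Sum>i<m. b i * b i)"
    proof (intro sum.cong refl)
      fix i assume i: "i \<in> {..<m}"
      have "ball_ip 0 r (e i) p = ball_ip 0 r p (e i)" by (rule ball_ip_commute)
      also have "\<dots> = (\<Sum>j<m. b j * ball_ip 0 r (e j) (e i))"
        using e i by (intro ipb) auto
      also have "\<dots> = (\<Sum>j<m. if j = i then b j else 0)" using i orth by (intro sum.cong) auto
      also have "\<dots> = b i" using i by simp
      finally show "b i * ball_ip 0 r (e i) p = b i * b i" by simp
    qed
    finally have ip: "ball_ip 0 r p p = (\<Sum>i<m. (b i)\<^sup>2)" by (simp add: power2_eq_square)
    have bi: "\<bar>b i\<bar> \<le> sqrt (ball_ip 0 r p p)" if "i < m" for i
      using that unfolding ip by (intro real_le_rsqrt) (auto intro: member_le_sum)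
    \<comment> \<open>Stated for arbitrary numbers \<open>y i\<close>, so as to serve the values of
      the basis functions at x as well as their partial derivatives there.\<close>
    have key: "(\<Sum>i<m. b i * y i)\<^sup>2 \<le> (K\<^sup>2 + 1) * ball_ip 0 r p p" if y: "\<And>i. i < m \<Longrightarrow> \<bar>y i\<bar> \<le> M i" for y
    proof -
      have "\<bar>\<Sum>i<m. b i * y i\<bar> \<le> (\<Sum>i<m. \<bar>b i * y i\<bar>)" by (rule sum_abs)
      also have "\<dots> \<le> (\<Sum>i<m. sqrt (ball_ip 0 r p p) * M i)"
        unfolding abs_mult using bi y ball_ip_nonneg[of 0 r p] by (intro sum_mono mult_mono) auto
      also have "\<dots> = sqrt (ball_ip 0 r p p) * K" by (simp add: K_def sum_distrib_left)
      finally have "\<bar>\<Sum>i<m. b i * y i\<bar>\<^sup>2 \<le> (sqrt (ball_ip 0 r p p) * K)\<^sup>2"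
        by (intro power_mono) auto
      also have "\<dots> = ball_ip 0 r p p * K\<^sup>2"
        using ball_ip_nonneg[of 0 r p] by (simp add: power_mult_distrib)
      finally show ?thesis using ball_ip_nonneg[of 0 r p] by (simp add: algebra_simps)
    qed
    show "(p x)\<^sup>2 \<le> (K\<^sup>2 + 1) * ball_ip 0 r p p"
    proof -
      have "p x = (\<Sum>i<m. b i * e i x)" by (rule fun_cong[OF pb])
      then show ?thesis using key[of "\<lambda>i. e i x"] M(1)[OF _ x] by simp
    qed
    fix j
    have "partial j p x = (\<Sum>i<m. b i * partial j (e i) x)"
    proof -
      have "partial j p x = partial j (\<lambda>x. \<Sum>i<m. b i * e i x) x"
        by (rule arg_cong[OF pb, of "\<lambda>s. partial j s x"])
      also have "\<dots> = (\<Sum>i<m. partial j (\<lambda>x. b i * e i x) x)"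
        by (rule partial_sum) (use e polys_total_differentiable polys_total_cmul in blast)
      also have "\<dots> = (\<Sum>i<m. b i * partial j (e i) x)"
        by (intro sum.cong refl partial_cmul) (use e polys_total_differentiable in blast)
      finally show ?thesis .
    qed
    then show "(partial j p x)\<^sup>2 \<le> (K\<^sup>2 + 1) * ball_ip 0 r p p"
      using key[of "\<lambda>i. partial j (e i) x"] M(2) x by simp
  qed
qed

lemma integral_lborel_affine:
  fixes f :: "real^'n \<Rightarrow> real"
  assumes "h > 0" "f \<in> borel_measurable borel"
  shows "(LINT x|lborel. f x) = h ^ CARD('n) * (LINT y|lborel. f (c + h *\<^sub>R y))"
proof -
  have "(LINT x|lborel. f x) = (LINT x|density (distr lborel borel (\<lambda>y. c + h *\<^sub>R y)) (\<lambda>_. ennreal (h ^ CARD('n))). f x)"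
    using lborel_affine[of h c] assms(1) by (simp add: abs_of_pos)
  also have "\<dots> = (LINT x|distr lborel borel (\<lambda>y. c + h *\<^sub>R y). h ^ CARD('n) * f x)"
    using assms by (subst integral_density) auto
  also have "\<dots> = (LINT y|lborel. h ^ CARD('n) * f (c + h *\<^sub>R y))"
    using assms by (subst integral_distr) auto
  finally show ?thesis by simp
qed

text \<open>Scaling by x = c + h y: the integral picks up a factor h^d and each derivative a factor
  h, so one constant works for all centres and sizes.\<close>

lemma polys_norm_equiv:
  assumes "r > 0"
  shows "\<exists>C>0. \<forall>p \<in> (polys_total N :: (real^'n \<Rightarrow> real) set). \<forall>c h. h > 0 \<longrightarrow> (\<forall>x\<in>cball c h.
    (p x)\<^sup>2 \<le> C / h ^ CARD('n) * ball_ip c (r * h) p p \<and>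
    (\<forall>j. h\<^sup>2 * (partial j p x)\<^sup>2 \<le> C / h ^ CARD('n) * ball_ip c (r * h) p p))"
proof -
  from polys_norm_equiv_unit[OF assms, of N] obtain C where C0: "C > 0" and
    *: "\<forall>p \<in> (polys_total N :: (real^'n \<Rightarrow> real) set). \<forall>x\<in>cball 0 1.
    (p x)\<^sup>2 \<le> C * ball_ip 0 r p p \<and> (\<forall>j. (partial j p x)\<^sup>2 \<le> C * ball_ip 0 r p p)" by (elim exE conjE)
  have C: "(p x)\<^sup>2 \<le> C * ball_ip 0 r p p" "(partial j p x)\<^sup>2 \<le> C * ball_ip 0 r p p"
    if "p \<in> polys_total N" "x \<in> cball 0 1" for p and x :: "real^'n" and j
    using * that by simp_all
show ?thesis
  proof (intro exI[of _ C] conjI ballI allI impI)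
    fix p :: "real^'n \<Rightarrow> real" and c x :: "real^'n" and h :: real and j
    assume p: "p \<in> polys_total N" and h: "h > 0" and x: "x \<in> cball c (h::real)"
    define q where "q y = p (h *\<^sub>R y + c)" for y
    have lin: "linear (\<lambda>y :: real^'n. h *\<^sub>R y)" by (rule linear_compose_scale_right[OF linear_ident])
    have q: "q \<in> polys_total N" unfolding q_def[abs_def]
      by (rule polys_total_affine[OF lin p])
    define y where "y = (x - c) /\<^sub>R h"
    have y: "y \<in> cball 0 1" using x h by (simp add: y_def dist_norm norm_minus_commute divide_simps)
    have xy: "h *\<^sub>R y + c = x" using h by (simp add: y_def)
    have ct: "continuous_on UNIV p" using p polys_total_continuous by blast
    have [measurable]: "p \<in> borel_measurable borel" by (rule borel_measurable_continuous_onI[OF ct])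
    have "ball_ip c (r * h) p p = h ^ CARD('n) * (LINT y|lborel. indicator (cball c (r * h)) (c + h *\<^sub>R y) *\<^sub>R (p (c + h *\<^sub>R y) * p (c + h *\<^sub>R y)))"
      unfolding set_lebesgue_integral_def by (rule integral_lborel_affine[OF h]) (auto intro!: borel_measurable_scaleR borel_measurable_times borel_measurable_indicator)
    also have "(\<lambda>y. indicat_real (cball c (r * h)) (c + h *\<^sub>R y) *\<^sub>R (p (c + h *\<^sub>R y) * p (c + h *\<^sub>R y))) =
       (\<lambda>y. indicator (cball 0 r) y *\<^sub>R (q y * q y))"
      using h by (intro ext) (auto simp: q_def indicator_def dist_norm add.commute mult.commute)
    finally have ip: "ball_ip c (r * h) p p = h ^ CARD('n) * ball_ip 0 r q q"
      by (simp add: set_lebesgue_integral_def)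
    have ip': "C / h ^ CARD('n) * ball_ip c (r * h) p p = C * ball_ip 0 r q q"
      unfolding ip using h by simp
    show "(p x)\<^sup>2 \<le> C / h ^ CARD('n) * ball_ip c (r * h) p p"
      unfolding ip' using C(1)[OF q y] by (simp add: q_def xy)
    have "partial j q y = (\<Sum>k\<in>UNIV. partial k p (h *\<^sub>R y + c) * (h *\<^sub>R axis j 1) $ k)"
      unfolding q_def using lin polys_total_differentiable[OF p] by (rule partial_affine)
    also have "\<dots> = h * partial j p x"
      by (simp add: axis_def if_distrib xy mult.commute cong: if_cong)
    finally show "h\<^sup>2 * (partial j p x)\<^sup>2 \<le> C / h ^ CARD('n) * ball_ip c (r * h) p p"
      unfolding ip' using C(2)[OF q y, of j] by (simp add: power_mult_distrib)
  qed (use C0 in auto)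
qed

section \<open>Square integrable functions\<close>

lemma sq_integrable_inner:
  fixes f g :: "real^'n \<Rightarrow> 'b::euclidean_space"
  assumes "sq_integrable_on S f" "sq_integrable_on S g"
  shows "integrable (lebesgue_on S) (\<lambda>x. f x \<bullet> g x)"
proof (rule Bochner_Integration.integrable_bound[of _ "\<lambda>x. (norm (f x))\<^sup>2 + (norm (g x))\<^sup>2"])
  show "integrable (lebesgue_on S) (\<lambda>x. (norm (f x))\<^sup>2 + (norm (g x))\<^sup>2)"
    using assms unfolding sq_integrable_on_def by (intro Bochner_Integration.integrable_add) auto
  show "(\<lambda>x. f x \<bullet> g x) \<in> borel_measurable (lebesgue_on S)"
    using assms unfolding sq_integrable_on_def by (intro borel_measurable_inner) auto
  have "\<bar>f x \<bullet> g x\<bar> \<le> (norm (f x))\<^sup>2 + (norm (g x))\<^sup>2" for x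
  proof -
    have "\<bar>f x \<bullet> g x\<bar> \<le> norm (f x) * norm (g x)" by (rule Cauchy_Schwarz_ineq2)
    also have "\<dots> \<le> 2 * norm (f x) * norm (g x)" by (simp add: mult_le_cancel_right1)
    also have "\<dots> \<le> (norm (f x))\<^sup>2 + (norm (g x))\<^sup>2" by (rule sum_squares_bound)
    finally show ?thesis .
  qed
  then show "AE x in lebesgue_on S. norm (f x \<bullet> g x) \<le> norm ((norm (f x))\<^sup>2 + (norm (g x))\<^sup>2)"
    by (intro always_eventually allI) simp
qed

lemma sq_integrable_lincomb:
  fixes f g :: "real^'n \<Rightarrow> 'b::euclidean_space"
  assumes "sq_integrable_on S f" "sq_integrable_on S g"
  shows "sq_integrable_on S (\<lambda>x. a *\<^sub>R f x + b *\<^sub>R g x)"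
  unfolding sq_integrable_on_def
proof
  show m: "(\<lambda>x. a *\<^sub>R f x + b *\<^sub>R g x) \<in> borel_measurable (lebesgue_on S)"
    using assms unfolding sq_integrable_on_def by (intro borel_measurable_add borel_measurable_scaleR) auto
  have "(norm (a *\<^sub>R f x + b *\<^sub>R g x))\<^sup>2 = a\<^sup>2 * (f x \<bullet> f x) + (2 * a * b) * (f x \<bullet> g x) + b\<^sup>2 * (g x \<bullet> g x)" for x
    unfolding power2_norm_eq_inner
    by (simp add: inner_add_left inner_add_right inner_commute power2_eq_square algebra_simps)
  then show "integrable (lebesgue_on S) (\<lambda>x. (norm (a *\<^sub>R f x + b *\<^sub>R g x))\<^sup>2)"
    using assms by (simp only:) (intro Bochner_Integration.integrable_add integrable_mult_right sq_integrable_inner)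
qed

lemma sq_integrable_diff:
  fixes f g :: "real^'n \<Rightarrow> 'b::euclidean_space"
  shows "sq_integrable_on S f \<Longrightarrow> sq_integrable_on S g \<Longrightarrow> sq_integrable_on S (\<lambda>x. f x - g x)"
  using sq_integrable_lincomb[of S f g 1 "-1"] by simp

lemma sq_integrable_component:
  fixes G :: "real^'n \<Rightarrow> real^'m"
  assumes "sq_integrable_on S G"
  shows "sq_integrable_on S (\<lambda>x. G x $ i)"
  unfolding sq_integrable_on_def
proof
  have [measurable]: "G \<in> borel_measurable (lebesgue_on S)" using assms by (simp add: sq_integrable_on_def)
  have e: "G x $ i = G x \<bullet> axis i 1" for x by (simp add: inner_axis)
  show m: "(\<lambda>x. G x $ i) \<in> borel_measurable (lebesgue_on S)" unfolding e by measurable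
  show "integrable (lebesgue_on S) (\<lambda>x. (norm (G x $ i))\<^sup>2)"
  proof (rule Bochner_Integration.integrable_bound)
    show "integrable (lebesgue_on S) (\<lambda>x. (norm (G x))\<^sup>2)" using assms by (simp add: sq_integrable_on_def)
    show "(\<lambda>x. (norm (G x $ i))\<^sup>2) \<in> borel_measurable (lebesgue_on S)" using m by measurable
    have "(norm (G x $ i))\<^sup>2 \<le> (norm (G x))\<^sup>2" for x
      using component_le_norm_cart[of "G x" i] by (intro power_mono) auto
    then show "AE x in lebesgue_on S. norm ((norm (G x $ i))\<^sup>2) \<le> norm ((norm (G x))\<^sup>2)"
      by (intro always_eventually allI) simp
  qed
qed

lemma L2_inner_self_nonneg: "0 \<le> L2_inner S f f"
  unfolding L2_inner_def by (intro integral_nonneg_AE) auto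

lemma L2_norm_nonneg: "0 \<le> L2_norm S f"
  by (simp add: L2_norm_def L2_inner_self_nonneg)

lemma L2_norm_power2: "(L2_norm S f)\<^sup>2 = L2_inner S f f"
  by (simp add: L2_norm_def L2_inner_self_nonneg)

lemma L2_inner_lincomb:
  fixes f g h :: "real^'n \<Rightarrow> 'b::euclidean_space"
  assumes "sq_integrable_on S f" "sq_integrable_on S g" "sq_integrable_on S h"
  shows "L2_inner S (\<lambda>x. a *\<^sub>R f x + b *\<^sub>R g x) h = a * L2_inner S f h + b * L2_inner S g h"
  unfolding L2_inner_def
  using sq_integrable_inner[OF assms(1,3)] sq_integrable_inner[OF assms(2,3)]
  by (simp add: inner_add_left)

lemma L2_inner_diff:
  fixes f g h :: "real^'n \<Rightarrow> 'b::euclidean_space"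
  assumes "sq_integrable_on S f" "sq_integrable_on S g" "sq_integrable_on S h"
  shows "L2_inner S (\<lambda>x. f x - g x) h = L2_inner S f h - L2_inner S g h"
  using L2_inner_lincomb[OF assms, of 1 "-1"] by simp

lemma L2_inner_commute: "L2_inner S f g = L2_inner S g f"
  by (simp add: L2_inner_def inner_commute)

lemma L2_Cauchy_Schwarz:
  fixes f g :: "real^'n \<Rightarrow> 'b::euclidean_space"
  assumes "sq_integrable_on S f" "sq_integrable_on S g"
  shows "\<bar>L2_inner S f g\<bar> \<le> L2_norm S f * L2_norm S g"
proof -
  define a b c where "a = L2_inner S f f" and "b = L2_inner S g g" and "c = L2_inner S f g"
  have a: "a \<ge> 0" and b: "b \<ge> 0" by (simp_all add: a_def b_def L2_inner_self_nonneg)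
  have q: "0 \<le> a + 2 * t * c + t\<^sup>2 * b" for t
  proof -
    let ?h = "\<lambda>x. 1 *\<^sub>R f x + t *\<^sub>R g x"
    have h: "sq_integrable_on S ?h" by (rule sq_integrable_lincomb[OF assms])
    have "0 \<le> L2_inner S ?h ?h" by (rule L2_inner_self_nonneg)
    also have "\<dots> = 1 * L2_inner S ?h f + t * L2_inner S ?h g"
      by (subst L2_inner_lincomb[OF assms h]) (simp only: L2_inner_commute)
    also have "L2_inner S ?h f = 1 * L2_inner S f f + t * L2_inner S g f"
      by (rule L2_inner_lincomb[OF assms assms(1)])
    also have "L2_inner S ?h g = 1 * L2_inner S f g + t * L2_inner S g g"
      by (rule L2_inner_lincomb[OF assms assms(2)])
    finally show ?thesis
      by (simp add: a_def b_def c_def L2_inner_commute[of S g f] power2_eq_square algebra_simps)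
  qed
  have "c\<^sup>2 \<le> a * b"
  proof (cases "b = 0")
    case True
    have "c = 0"
    proof (rule ccontr)
      assume "c \<noteq> 0"
      \<comment> \<open>For b = 0 the quadratic is affine in t, and this t gives it the value
        -1.\<close>
      then show False using q[of "- (a + 1) / (2 * c)"] True a by (simp add: field_simps)
    qed
    then show ?thesis using a b by simp
  next
    case False
    \<comment> \<open>The quadratic at its minimum -c/b, multiplied by b.\<close>
    then have "0 \<le> (a + 2 * (- c / b) * c + (- c / b)\<^sup>2 * b) * b"
      using q[of "- c / b"] b by (intro mult_nonneg_nonneg) auto
    also have "\<dots> = a * b - c\<^sup>2" using False by (simp add: power2_eq_square field_simps)
    finally show ?thesis by simp
  qed
  then have "\<bar>c\<bar> \<le> sqrt (a * b)" by (metis real_sqrt_abs real_sqrt_le_iff)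
  then show ?thesis by (simp add: L2_norm_def real_sqrt_mult a_def b_def c_def)
qed

text \<open>Inner products are integrals over a subset with respect to Lebesgue measure, while
  translations, Fubini and the fundamental theorem are applied to Borel functions on the whole
  space. \<open>F'\<close>, the extension of \<open>F\<close> by zero, connects the two.\<close>

lemma integral_lebesgue_on_lborel:
  fixes F F' :: "real^'n \<Rightarrow> real"
  assumes "S \<in> sets borel" "F' \<in> borel_measurable borel"
    "\<And>x. x \<in> S \<Longrightarrow> F x = F' x" "\<And>x. x \<notin> S \<Longrightarrow> F' x = 0"
  shows "(LINT x|lebesgue_on S. F x) = (LINT x|lborel. F' x)"
proof -
  have "(LINT x|lebesgue_on S. F x) = (LINT x|lebesgue_on S. F' x)"
    by (intro Bochner_Integration.integral_cong) (auto simp: assms(3))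
  also have "\<dots> = (LINT x|lebesgue. indicat_real S x *\<^sub>R F' x)"
    using assms(1) by (intro integral_restrict_space) auto
  also have "\<dots> = (LINT x|lebesgue. F' x)"
    by (intro Bochner_Integration.integral_cong) (auto simp: indicator_def assms(4))
  also have "\<dots> = (LINT x|lborel. F' x)"
    using assms(2) by (intro integral_completion) simp
  finally show ?thesis .
qed

lemma integrable_compact_bounded:
  fixes f :: "real^'n \<Rightarrow> real"
  assumes [measurable]: "f \<in> borel_measurable borel" and "compact K" and "\<And>x. \<bar>f x\<bar> \<le> C * indicator K x"
  shows "integrable lborel f"
proof (rule Bochner_Integration.integrable_bound)
  have "K \<in> fmeasurable lborel"
    using assms(2) by (intro fmeasurable_compact)
  then show "integrable lborel (\<lambda>x. C * indicat_real K x)"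
    by (intro integrable_mult_right) (auto simp: integrable_indicator_iff fmeasurable_def)
  show "AE x in lborel. norm (f x) \<le> norm (C * indicator K x)"
    using assms(3) by (intro always_eventually allI) (metis abs_ge_self order_trans real_norm_def)
qed simp

lemma sq_integrable_bounded:
  fixes f U :: "real^'n \<Rightarrow> 'b::euclidean_space"
  assumes S: "S \<in> sets borel" "bounded S" and U: "U \<in> borel_measurable borel"
    and "\<And>x. x \<in> S \<Longrightarrow> f x = U x" "\<And>x. x \<in> S \<Longrightarrow> norm (U x) \<le> B"
  shows "sq_integrable_on S f"
  unfolding sq_integrable_on_def
proof
  have "U \<in> borel_measurable (lebesgue_on S)"
    using U by (intro measurable_restrict_space1 measurable_completion) simp
  moreover have "f \<in> borel_measurable (lebesgue_on S) \<longleftrightarrow> U \<in> borel_measurable (lebesgue_on S)"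
    using assms(4) by (intro measurable_cong) simp
  ultimately show m: "f \<in> borel_measurable (lebesgue_on S)" by simp
  have fin: "emeasure (lebesgue_on S) (space (lebesgue_on S)) \<noteq> \<infinity>"
    using S bounded_set_imp_lmeasurable[of S]
    by (auto simp: emeasure_restrict_space fmeasurable_def)
  interpret finite_measure "lebesgue_on S" by (rule finite_measureI[OF fin])
  show "integrable (lebesgue_on S) (\<lambda>x. (norm (f x))\<^sup>2)"
  proof (rule integrable_const_bound[of _ "B\<^sup>2"])
    show "(\<lambda>x. (norm (f x))\<^sup>2) \<in> borel_measurable (lebesgue_on S)" using m by measurable
    show "AE x in lebesgue_on S. norm ((norm (f x))\<^sup>2) \<le> B\<^sup>2"
      using assms(4,5) by (intro AE_I2) (auto intro!: power_mono)
  qed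
qed

section \<open>Integration by parts via difference quotients\<close>

definition dderiv :: "(real^'n \<Rightarrow> real) \<Rightarrow> real^'n \<Rightarrow> real^'n \<Rightarrow> real" where
  "dderiv f v x = (\<Sum>i\<in>UNIV. partial i f x * v $ i)"

lemma dderiv_axis: "dderiv f (axis i 1) x = partial i f x"
  by (simp add: dderiv_def axis_def if_distrib cong: if_cong)

lemma smooth_dderiv: "smooth f \<Longrightarrow> smooth (dderiv f v)"
  unfolding dderiv_def[abs_def] by (intro smooth_sum smooth_mult smooth_partial smooth_const)

lemma has_real_derivative_line:
  assumes "smooth f"
  shows "((\<lambda>s. f (x + s *\<^sub>R v)) has_real_derivative dderiv f v (x + t *\<^sub>R v)) (at t)"
proof -
  have "((\<lambda>s. x + s *\<^sub>R v) has_derivative (\<lambda>s. s *\<^sub>R v)) (at t)"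
    by (auto intro!: derivative_eq_intros)
  from has_derivative_compose[OF this has_derivative_partial[OF smooth_differentiable[OF assms]]]
  have "((\<lambda>s. f (x + s *\<^sub>R v)) has_derivative (\<lambda>s. \<Sum>i\<in>UNIV. partial i f (x + t *\<^sub>R v) * (s *\<^sub>R v) $ i)) (at t)" .
  moreover have "(\<lambda>s. \<Sum>i\<in>UNIV. partial i f (x + t *\<^sub>R v) * (s *\<^sub>R v) $ i) = (*) (dderiv f v (x + t *\<^sub>R v))"
    by (simp add: fun_eq_iff dderiv_def sum_distrib_left mult_ac)
  ultimately show ?thesis by (simp add: has_field_derivative_def)
qed

lemma mvt_line:
  assumes "smooth f" "0 < t"
  obtains s where "0 < s" "s < t" "f (x + t *\<^sub>R v) - f x = t * dderiv f v (x + s *\<^sub>R v)"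
proof -
  have "\<exists>s. 0 < s \<and> s < t \<and> f (x + t *\<^sub>R v) - f (x + 0 *\<^sub>R v) = (t - 0) * dderiv f v (x + s *\<^sub>R v)"
    by (rule MVT2[OF assms(2)]) (rule has_real_derivative_line[OF assms(1)])
  then show ?thesis using that by auto
qed

lemma difference_quotient_tendsto:
  assumes "smooth f"
  shows "((\<lambda>t. (f (x + t *\<^sub>R v) - f x) / t) \<longlongrightarrow> dderiv f v x) (at_right 0)"
  using has_real_derivative_line[OF assms, of x v 0]
  unfolding has_field_derivative_iff by (auto intro: filterlim_mono simp: at_within_le_at)

lemma integral_lborel_translate:
  fixes F :: "real^'n \<Rightarrow> real"
  assumes "F \<in> borel_measurable borel"
  shows "(LINT x|lborel. F (c + x)) = (LINT x|lborel. F x)"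
proof -
  have "(LINT x|lborel. F x) = (LINT x|distr lborel borel ((+) c). F x)" by (simp add: lborel_distr_plus)
  also have "\<dots> = (LINT x|lborel. F (c + x))" using assms by (subst integral_distr) auto
  finally show ?thesis by simp
qed

lemma smooth_borel_measurable: "smooth f \<Longrightarrow> f \<in> borel_measurable borel"
  by (intro borel_measurable_continuous_onI smooth_continuous_on)

text \<open>Translation invariance moves a difference quotient from the test function to
  \<open>U\<close>, and dominated convergence takes the limit on both sides. All that is asked of
  \<open>U\<close> is a bound and a Lipschitz estimate along \<open>v\<close> near the support, and
  a directional derivative almost everywhere. A continuous piecewise smooth function qualifies, and
  no boundary terms between elements ever have to be cancelled.\<close>

lemma ibp_difference:
  fixes \<phi> U g :: "real^'n \<Rightarrow> real"
  assumes \<phi>: "smooth \<phi>" "compact K" "\<And>x. x \<notin> K \<Longrightarrow> \<phi> x = 0" and t0: "t0 > 0"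
    and U [measurable]: "U \<in> borel_measurable borel" and g [measurable]: "g \<in> borel_measurable borel"
    and B: "\<And>x t. x \<in> K \<Longrightarrow> 0 \<le> t \<Longrightarrow> t \<le> t0 \<Longrightarrow> \<bar>U (x - t *\<^sub>R v)\<bar> \<le> B"
    and L: "\<And>x t. x \<in> K \<Longrightarrow> 0 < t \<Longrightarrow> t \<le> t0 \<Longrightarrow> \<bar>U (x - t *\<^sub>R v) - U x\<bar> \<le> L * t"
    and lim: "AE x in lborel. x \<in> K \<longrightarrow> ((\<lambda>t. (U (x - t *\<^sub>R v) - U x) / t) \<longlongrightarrow> - g x) (at_right 0)"
  shows "(LINT x|lborel. U x * dderiv \<phi> v x) = - (LINT x|lborel. g x * \<phi> x)"
proof -
  \<comment> \<open>Dominated convergence is applied along this sequence of step sizes.\<close>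
  define \<tau> where "\<tau> j = t0 / real (Suc j)" for j
  have \<tau>: "\<tau> j > 0" "\<tau> j \<le> t0" for j using t0 by (auto simp: \<tau>_def divide_simps mult_le_cancel_left1)
  have "\<tau> \<longlonglongrightarrow> 0" unfolding \<tau>_def[abs_def] by (rule LIMSEQ_Suc[OF lim_const_over_n])
  then have \<tau>r: "filterlim \<tau> (at_right 0) sequentially"
    using \<tau>(1) by (auto simp: filterlim_at less_imp_neq[OF \<tau>(1), symmetric] intro!: always_eventually)
  obtain M where M: "M \<ge> 0" "\<And>x. \<bar>\<phi> x\<bar> \<le> M" "\<And>x i. \<bar>partial i \<phi> x\<bar> \<le> M"
    using smooth_compact_support_bounded[OF \<phi>] by metis
  define M' where "M' = (\<Sum>i\<in>UNIV. M * \<bar>v $ i\<bar>)"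
  have M': "\<bar>dderiv \<phi> v x\<bar> \<le> M'" for x
    unfolding dderiv_def M'_def
    by (intro order_trans[OF sum_abs] sum_mono) (auto simp: abs_mult intro!: mult_right_mono M)
  have M'0: "M' \<ge> 0" unfolding M'_def using M by (intro sum_nonneg) auto
  have [measurable]: "\<phi> \<in> borel_measurable borel" "dderiv \<phi> v \<in> borel_measurable borel"
    using \<phi>(1) smooth_dderiv smooth_borel_measurable by blast+
  \<comment> \<open>The points reached from \<open>K\<close> by stepping back along
    \<open>v\<close>. Outside this compact set all the difference quotients of \<phi>
    vanish.\<close>
  define K' where "K' = (\<lambda>(x, t). x - t *\<^sub>R v) ` (K \<times> {0..t0})"
  have K'c: "compact K'" unfolding K'_def
    by (intro compact_continuous_image compact_Times compact_Icc \<phi>(2))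
      (auto simp: case_prod_unfold intro!: continuous_intros)
  have K': "x - t *\<^sub>R v \<in> K'" if "x \<in> K" "0 \<le> t" "t \<le> t0" for x t
    unfolding K'_def using that by (intro image_eqI[of _ _ "(x, t)"]) auto
  have KK': "x \<in> K'" if "x \<in> K" for x using K'[OF that, of 0] t0 by simp
  have UB: "\<bar>U x\<bar> \<le> B" if "x \<in> K'" for x using that B by (auto simp: K'_def)
  define dq where "dq j x = (\<phi> (x + \<tau> j *\<^sub>R v) - \<phi> x) / \<tau> j" for j x
  have dqM: "\<bar>dq j x\<bar> \<le> M'" for j x
  proof -
    obtain s where "\<phi> (x + \<tau> j *\<^sub>R v) - \<phi> x = \<tau> j * dderiv \<phi> v (x + s *\<^sub>R v)"
      using mvt_line[OF \<phi>(1) \<tau>(1)] by metis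
    then have "dq j x = dderiv \<phi> v (x + s *\<^sub>R v)" using \<tau>(1)[of j] by (simp add: dq_def)
    then show ?thesis using M' by simp
  qed
  have dq0: "dq j x = 0" if "x \<notin> K'" for j x
  proof -
    have "x \<notin> K" using that KK' by blast
    moreover have "x + \<tau> j *\<^sub>R v \<notin> K"
      using that K'[of "x + \<tau> j *\<^sub>R v" "\<tau> j"] \<tau>[of j] by auto
    ultimately show ?thesis by (simp add: dq_def \<phi>(3))
  qed
  have [measurable]: "dq j \<in> borel_measurable borel" for j
    unfolding dq_def[abs_def] by measurable
  have lim1: "(\<lambda>j. LINT x|lborel. U x * dq j x) \<longlonglongrightarrow> (LINT x|lborel. U x * dderiv \<phi> v x)"
  proof (rule integral_dominated_convergence[where w = "\<lambda>x. B * M' * indicator K' x"])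
    show "integrable lborel (\<lambda>x. B * M' * indicat_real K' x)"
      using fmeasurable_compact[OF K'c]
      by (intro integrable_mult_right) (auto simp: integrable_indicator_iff fmeasurable_def)
    have "(\<lambda>j. dq j x) \<longlonglongrightarrow> dderiv \<phi> v x" for x
      unfolding dq_def using filterlim_compose[OF difference_quotient_tendsto[OF \<phi>(1)] \<tau>r] .
    then show "AE x in lborel. (\<lambda>j. U x * dq j x) \<longlonglongrightarrow> U x * dderiv \<phi> v x"
      by (intro always_eventually allI tendsto_mult tendsto_const)
    fix j
    have "\<bar>U x * dq j x\<bar> \<le> B * M' * indicator K' x" for x
    proof (cases "x \<in> K'")
      case True
      have "\<bar>U x\<bar> * \<bar>dq j x\<bar> \<le> B * M'"
        using UB[OF True] dqM[of j x] M'0 by (intro mult_mono) auto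
      then show ?thesis using True by (simp add: abs_mult)
    qed (simp add: dq0)
    then show "AE x in lborel. norm (U x * dq j x) \<le> B * M' * indicat_real K' x" by simp
  qed simp_all
  define B' where "B' = max B 0"
  \<comment> \<open>A translation by \<tau> v moves the shift from \<phi> to U. The integral of the
    difference is split beforehand and reassembled afterwards, which is why the three products are
    shown to be integrable one by one.\<close>
  have eq: "(LINT x|lborel. U x * dq j x) = (LINT x|lborel. (U (x - \<tau> j *\<^sub>R v) - U x) / \<tau> j * \<phi> x)" for j
  proof -
    have i1: "integrable lborel (\<lambda>x. U (x - \<tau> j *\<^sub>R v) * \<phi> x)"
    proof (rule integrable_compact_bounded[OF _ \<phi>(2)])
      show "\<bar>U (x - \<tau> j *\<^sub>R v) * \<phi> x\<bar> \<le> B * M * indicat_real K x" for x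
      proof (cases "x \<in> K")
        case True
        have "\<bar>U (x - \<tau> j *\<^sub>R v)\<bar> * \<bar>\<phi> x\<bar> \<le> B * M"
          using UB[OF K'[OF True, of "\<tau> j"]] \<tau>[of j] M(1,2) by (intro mult_mono) (auto intro: order_trans[OF abs_ge_zero])
        then show ?thesis using True by (simp add: abs_mult)
      qed (simp add: \<phi>(3))
    qed measurable
    have i2: "integrable lborel (\<lambda>x. U x * \<phi> x)"
    proof (rule integrable_compact_bounded[OF _ \<phi>(2)])
      show "\<bar>U x * \<phi> x\<bar> \<le> B * M * indicat_real K x" for x
      proof (cases "x \<in> K")
        case True
        have "\<bar>U x\<bar> * \<bar>\<phi> x\<bar> \<le> B * M"
          using UB[OF KK'[OF True]] M(1,2) by (intro mult_mono) (auto intro: order_trans[OF abs_ge_zero])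
        then show ?thesis using True by (simp add: abs_mult)
      qed (simp add: \<phi>(3))
    qed measurable
    have i3: "integrable lborel (\<lambda>x. U x * \<phi> (x + \<tau> j *\<^sub>R v))"
    proof (rule integrable_compact_bounded[OF _ K'c])
      show "\<bar>U x * \<phi> (x + \<tau> j *\<^sub>R v)\<bar> \<le> B * M * indicat_real K' x" for x
      proof (cases "x \<in> K'")
        case True
        have "\<bar>U x\<bar> * \<bar>\<phi> (x + \<tau> j *\<^sub>R v)\<bar> \<le> B * M"
          using UB[OF True] M(1,2) by (intro mult_mono) (auto intro: order_trans[OF abs_ge_zero])
        then show ?thesis using True by (simp add: abs_mult)
      next
        case False
        then have "x + \<tau> j *\<^sub>R v \<notin> K" using K'[of "x + \<tau> j *\<^sub>R v" "\<tau> j"] \<tau>[of j] by auto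
        then show ?thesis using False by (simp add: \<phi>(3))
      qed
    qed measurable
    have "(LINT x|lborel. U x * dq j x) = (LINT x|lborel. (U x * \<phi> (x + \<tau> j *\<^sub>R v) - U x * \<phi> x) / \<tau> j)"
      by (intro Bochner_Integration.integral_cong) (auto simp: dq_def algebra_simps)
    also have "\<dots> = ((LINT x|lborel. U x * \<phi> (x + \<tau> j *\<^sub>R v)) - (LINT x|lborel. U x * \<phi> x)) / \<tau> j"
      using i2 i3 by (simp add: Bochner_Integration.integral_diff)
    also have "(LINT x|lborel. U x * \<phi> (x + \<tau> j *\<^sub>R v)) = (LINT x|lborel. U (x - \<tau> j *\<^sub>R v) * \<phi> x)"
      using integral_lborel_translate[of "\<lambda>x. U (x - \<tau> j *\<^sub>R v) * \<phi> x" "\<tau> j *\<^sub>R v"]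
      by (simp add: add.commute)
    also have "((LINT x|lborel. U (x - \<tau> j *\<^sub>R v) * \<phi> x) - (LINT x|lborel. U x * \<phi> x)) / \<tau> j
        = (LINT x|lborel. (U (x - \<tau> j *\<^sub>R v) * \<phi> x - U x * \<phi> x) / \<tau> j)"
      using i1 i2 by (simp add: Bochner_Integration.integral_diff)
    also have "\<dots> = (LINT x|lborel. (U (x - \<tau> j *\<^sub>R v) - U x) / \<tau> j * \<phi> x)"
      by (intro Bochner_Integration.integral_cong) (auto simp: algebra_simps diff_divide_distrib)
    finally show ?thesis .
  qed
  have lim2: "(\<lambda>j. LINT x|lborel. (U (x - \<tau> j *\<^sub>R v) - U x) / \<tau> j * \<phi> x) \<longlonglongrightarrow> (LINT x|lborel. - g x * \<phi> x)"
  proof (rule integral_dominated_convergence[where w = "\<lambda>x. \<bar>L\<bar> * M * indicator K x"])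
    show "integrable lborel (\<lambda>x. \<bar>L\<bar> * M * indicat_real K x)"
      using fmeasurable_compact[OF \<phi>(2)]
      by (intro integrable_mult_right) (auto simp: integrable_indicator_iff fmeasurable_def)
    show "AE x in lborel. (\<lambda>j. (U (x - \<tau> j *\<^sub>R v) - U x) / \<tau> j * \<phi> x) \<longlonglongrightarrow> - g x * \<phi> x"
      using lim
    proof eventually_elim
      case (elim x)
      show ?case
      proof (cases "x \<in> K")
        case True
        then show ?thesis using elim
          by (intro tendsto_mult tendsto_const filterlim_compose[OF _ \<tau>r]) auto
      qed (simp add: \<phi>(3))
    qed
    fix j
    have "\<bar>(U (x - \<tau> j *\<^sub>R v) - U x) / \<tau> j * \<phi> x\<bar> \<le> \<bar>L\<bar> * M * indicator K x" for x
    proof (cases "x \<in> K")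
      case True
      have "\<bar>U (x - \<tau> j *\<^sub>R v) - U x\<bar> \<le> \<bar>L\<bar> * \<tau> j"
        using L[OF True \<tau>(1)[of j] \<tau>(2)[of j]] mult_right_mono[OF abs_ge_self[of L], of "\<tau> j"] \<tau>(1)[of j]
        by linarith
      then have "\<bar>(U (x - \<tau> j *\<^sub>R v) - U x) / \<tau> j\<bar> \<le> \<bar>L\<bar>"
        using \<tau>(1)[of j] by (simp add: abs_divide divide_le_eq)
      then have "\<bar>(U (x - \<tau> j *\<^sub>R v) - U x) / \<tau> j\<bar> * \<bar>\<phi> x\<bar> \<le> \<bar>L\<bar> * M"
        using M(1,2) by (intro mult_mono) auto
      then show ?thesis using True by (simp add: abs_mult)
    qed (simp add: \<phi>(3))
    then show "AE x in lborel. norm ((U (x - \<tau> j *\<^sub>R v) - U x) / \<tau> j * \<phi> x) \<le> \<bar>L\<bar> * M * indicat_real K x" by simp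
  qed simp_all
  have "(LINT x|lborel. U x * dderiv \<phi> v x) = (LINT x|lborel. - g x * \<phi> x)"
    using lim1 unfolding eq by (rule LIMSEQ_unique[OF _ lim2])
  also have "\<dots> = - (LINT x|lborel. g x * \<phi> x)" by simp
  finally show ?thesis .
qed

lemma dderiv_minus: "dderiv f (- v) x = - dderiv f v x"
  by (simp add: dderiv_def sum_negf)

text \<open>The indicator of a set invariant along \<open>v\<close> is constant on lines parallel to
  \<open>v\<close>, so the boundary of the set contributes nothing. Applied to half spaces with
  tangential \<open>v\<close>, and to the whole space.\<close>

lemma ibp_invariant:
  fixes \<phi> q :: "real^'n \<Rightarrow> real"
  assumes \<phi>: "smooth \<phi>" "compact K" "\<And>x. x \<notin> K \<Longrightarrow> \<phi> x = 0" and q: "smooth q"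
    and A [measurable]: "A \<in> sets borel" and inv: "\<And>x t. x - t *\<^sub>R v \<in> A \<longleftrightarrow> x \<in> A"
  shows "(LINT x|lborel. indicator A x * q x * dderiv \<phi> v x) = - (LINT x|lborel. indicator A x * dderiv q v x * \<phi> x)"
proof -
  define K' where "K' = (\<lambda>(x, t). x - t *\<^sub>R v) ` (K \<times> {0..1})"
  have K'c: "compact K'" unfolding K'_def
    by (intro compact_continuous_image compact_Times compact_Icc \<phi>(2))
      (auto simp: case_prod_unfold intro!: continuous_intros)
  have K': "x - t *\<^sub>R v \<in> K'" if "x \<in> K" "0 \<le> t" "t \<le> 1" for x t
    unfolding K'_def using that by (intro image_eqI[of _ _ "(x, t)"]) auto
  have bd: "\<exists>B. \<forall>x\<in>K'. \<bar>f x\<bar> \<le> B" if "smooth f" for f :: "real^'n \<Rightarrow> real"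
  proof -
    have "bounded (f ` K')"
      by (intro compact_imp_bounded compact_continuous_image K'c smooth_continuous_on that)
    then show ?thesis unfolding bounded_iff by auto
  qed
  obtain B where B: "\<forall>x\<in>K'. \<bar>q x\<bar> \<le> B" using bd[OF q] ..
  obtain L where L: "\<forall>x\<in>K'. \<bar>dderiv q v x\<bar> \<le> L" using bd[OF smooth_dderiv[OF q]] ..
  have [measurable]: "q \<in> borel_measurable borel" "dderiv q v \<in> borel_measurable borel"
    using q smooth_dderiv smooth_borel_measurable by blast+
  have indA: "indicat_real A (x - t *\<^sub>R v) = indicator A x" for x t
    using inv by (simp add: indicator_def)
  show ?thesis
  proof (rule ibp_difference[OF \<phi> zero_less_one, where B = B and L = L])
    fix x t assume x: "x \<in> K" and t: "0 \<le> t" "t \<le> (1::real)"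
    have "\<bar>q (x - t *\<^sub>R v)\<bar> \<le> B" using B K'[OF x t] by blast
    then show "\<bar>indicat_real A (x - t *\<^sub>R v) * q (x - t *\<^sub>R v)\<bar> \<le> B"
      by (auto simp: indicator_def)
  next
    fix x t assume x: "x \<in> K" and t: "0 < t" "t \<le> (1::real)"
    obtain s where s: "0 < s" "s < t" "q (x + t *\<^sub>R (- v)) - q x = t * dderiv q (- v) (x + s *\<^sub>R (- v))"
      using mvt_line[OF q t(1)] by metis
    have "\<bar>dderiv q v (x - s *\<^sub>R v)\<bar> \<le> L" using L K'[OF x, of s] s t by auto
    then have "\<bar>q (x - t *\<^sub>R v) - q x\<bar> \<le> L * t"
      using s t by (simp add: dderiv_minus abs_mult mult.commute)
    moreover have "0 \<le> L * t" using calculation by linarith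
    ultimately show "\<bar>indicat_real A (x - t *\<^sub>R v) * q (x - t *\<^sub>R v) - indicat_real A x * q x\<bar> \<le> L * t"
      unfolding indA by (auto simp: indicator_def)
  next
    have "((\<lambda>t. (q (x - t *\<^sub>R v) - q x) / t) \<longlongrightarrow> - dderiv q v x) (at_right 0)" for x
      using difference_quotient_tendsto[OF q, of x "- v"] by (simp add: dderiv_minus)
    then have "((\<lambda>t. indicat_real A x * ((q (x - t *\<^sub>R v) - q x) / t)) \<longlongrightarrow> indicator A x * - dderiv q v x) (at_right 0)" for x
      by (intro tendsto_mult tendsto_const)
    then have "((\<lambda>t. (indicat_real A (x - t *\<^sub>R v) * q (x - t *\<^sub>R v) - indicat_real A x * q x) / t) \<longlongrightarrow>
        - (indicat_real A x * dderiv q v x)) (at_right 0)" for x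
      unfolding indA by (simp add: algebra_simps diff_divide_distrib)
    then show "AE x in lborel. x \<in> K \<longrightarrow>
       ((\<lambda>t. (indicat_real A (x - t *\<^sub>R v) * q (x - t *\<^sub>R v) - indicat_real A x * q x) / t) \<longlongrightarrow>
        - (indicat_real A x * dderiv q v x)) (at_right 0)" by simp
  qed measurable
qed

section \<open>Uniqueness of weak gradients\<close>

lemma test_functionsD:
  assumes "\<phi> \<in> test_functions \<Omega>"
  shows "smooth \<phi>" "\<exists>K. compact K \<and> K \<subseteq> \<Omega> \<and> (\<forall>x. x \<notin> K \<longrightarrow> \<phi> x = 0)"
  using assms by (auto simp: test_functions_def smooth_def)

lemma test_functionsI:
  assumes "smooth \<phi>" "compact K" "K \<subseteq> \<Omega>" "\<And>x. x \<notin> K \<Longrightarrow> \<phi> x = 0"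
  shows "\<phi> \<in> test_functions \<Omega>"
  using assms by (auto simp: test_functions_def smooth_def)

lemma test_function_sq_integrable:
  assumes "\<phi> \<in> test_functions \<Omega>" "open \<Omega>" "bounded \<Omega>"
  shows "sq_integrable_on \<Omega> \<phi>"
proof -
  obtain K where K: "compact K" "\<And>x. x \<notin> K \<Longrightarrow> \<phi> x = 0" using test_functionsD(2)[OF assms(1)] by blast
  obtain B where "\<And>x. \<bar>\<phi> x\<bar> \<le> B" using smooth_compact_support_bounded[OF test_functionsD(1)[OF assms(1)] K] by metis
  then show ?thesis using assms test_functionsD(1)[OF assms(1)]
    by (intro sq_integrable_bounded[of _ \<phi> _ B]) (auto intro: smooth_borel_measurable)
qed

lemma scaled_bump_smooth: "smooth (\<lambda>x :: real^'n. bump ((1 / \<delta>) *\<^sub>R (x - c)))"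
proof -
  have "smooth (\<lambda>x :: real^'n. bump ((1 / \<delta>) *\<^sub>R x + (- (1 / \<delta>) *\<^sub>R c)))"
    by (rule smooth_affine[OF linear_compose_scale_right[OF linear_ident] smooth_bump])
  then show ?thesis by (simp add: algebra_simps)
qed

text \<open>A finite sum of bumps centred in \<open>K\<close>, taken from a finite subcover. What
  counts later is the set where \<eta> is positive, so positivity on \<open>K\<close> replaces the
  usual cut-off equal to one there.\<close>

lemma smooth_neighbourhood:
  fixes K \<Omega> :: "(real^'n) set"
  assumes "compact K" "K \<subseteq> \<Omega>" "open \<Omega>" "\<delta> > 0"
  obtains \<eta> where "\<eta> \<in> test_functions \<Omega>" "\<And>x. \<eta> x \<ge> 0" "\<And>x. x \<in> K \<Longrightarrow> \<eta> x > 0"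
    "\<And>x. \<eta> x > 0 \<Longrightarrow> \<exists>c\<in>K. dist c x < \<delta>"
proof -
  obtain e where e: "e > 0" "(\<Union>x\<in>K. ball x e) \<subseteq> \<Omega>"
    using compact_subset_open_imp_ball_epsilon_subset[OF assms(1,3,2)] by blast
  define d where "d = min (e / 2) \<delta>"
  have d: "d > 0" "d < e" "d \<le> \<delta>" using e assms(4) by (auto simp: d_def min_def)
  obtain F where F: "F \<subseteq> K" "finite F" "K \<subseteq> (\<Union>c\<in>F. ball c d)"
    using compactE_image[OF assms(1), of K "\<lambda>c. ball c d"] d by (metis UN_I centre_in_ball open_ball subsetI)
  define \<eta> where "\<eta> x = (\<Sum>c\<in>F. bump ((1 / d) *\<^sub>R (x - c)))" for x
  have bp: "0 < bump ((1 / d) *\<^sub>R (x - c)) \<longleftrightarrow> dist c x < d" for x c :: "real^'n"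
    using d by (simp add: bump_pos_iff dist_norm norm_minus_commute)
  have pos: "\<eta> x > 0 \<longleftrightarrow> (\<exists>c\<in>F. dist c x < d)" for x
  proof
    assume "\<eta> x > 0"
    then have "\<exists>c\<in>F. 0 < bump ((1 / d) *\<^sub>R (x - c))"
      unfolding \<eta>_def by (meson linorder_not_less sum_nonpos)
    then show "\<exists>c\<in>F. dist c x < d" using bp by blast
  next
    assume "\<exists>c\<in>F. dist c x < d"
    then obtain c where "c \<in> F" "0 < bump ((1 / d) *\<^sub>R (x - c))" using bp by blast
    then show "\<eta> x > 0" unfolding \<eta>_def using F(2) by (intro sum_pos2[of _ c]) (auto intro: bump_nonneg)
  qed
  show ?thesis
  proof
    show nn: "\<eta> x \<ge> 0" for x unfolding \<eta>_def by (intro sum_nonneg bump_nonneg)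
    show "\<eta> \<in> test_functions \<Omega>"
    proof (rule test_functionsI)
      show "smooth \<eta>" unfolding \<eta>_def[abs_def] by (intro smooth_sum scaled_bump_smooth)
      show "compact (\<Union>c\<in>F. cball c d)" using F(2) by (intro compact_UN) auto
      show "(\<Union>c\<in>F. cball c d) \<subseteq> \<Omega>"
      proof
        fix x assume "x \<in> (\<Union>c\<in>F. cball c d)"
        then obtain c where "c \<in> K" "dist c x < e" using F(1) d by force
        then show "x \<in> \<Omega>" using e(2) by (meson UN_I mem_ball subsetD)
      qed
      fix x assume "x \<notin> (\<Union>c\<in>F. cball c d)"
      then have "\<not> \<eta> x > 0" unfolding pos by force
      then show "\<eta> x = 0" using nn[of x] by simp
    qed
    show "\<eta> x > 0" if "x \<in> K" for x using F(3) that unfolding pos by (meson UN_E mem_ball subsetD)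
    show "\<exists>c\<in>K. dist c x < \<delta>" if "\<eta> x > 0" for x using that F(1) d unfolding pos by force
  qed
qed

text \<open>The indicator of a compact set is reached from test functions by two limits, both with
  majorant |g|: flat (k \<eta>) tends to the indicator of {\<eta> > 0}, and these open sets shrink
  to \<open>K\<close> as the tolerance in \<open>smooth_neighbourhood\<close> goes to zero.\<close>

lemma integral_compact_eq_0:
  fixes g :: "real^'n \<Rightarrow> real"
  assumes \<Omega>: "open \<Omega>" "bounded \<Omega>" and g: "sq_integrable_on \<Omega> g"
    and z: "\<And>\<phi>. \<phi> \<in> test_functions \<Omega> \<Longrightarrow> L2_inner \<Omega> g \<phi> = 0" and K: "compact K" "K \<subseteq> \<Omega>"
  shows "(LINT x|lebesgue_on \<Omega>. g x * indicator K x) = 0"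
proof -
  have one: "sq_integrable_on \<Omega> (\<lambda>x. 1 :: real)"
    using \<Omega> by (intro sq_integrable_bounded[of _ "\<lambda>x. 1" _ 1]) auto
  have gm [measurable]: "g \<in> borel_measurable (lebesgue_on \<Omega>)" using g by (simp add: sq_integrable_on_def)
  have gi: "integrable (lebesgue_on \<Omega>) (\<lambda>x. \<bar>g x\<bar>)"
    using sq_integrable_inner[OF g one] by simp
  have bm: "f \<in> borel_measurable (lebesgue_on \<Omega>)" if "f \<in> borel_measurable borel" for f :: "real^'n \<Rightarrow> real"
    using that by (intro measurable_restrict_space1 measurable_completion) simp
  have dct: "(\<lambda>k. LINT x|lebesgue_on \<Omega>. g x * s k x) \<longlonglongrightarrow> (LINT x|lebesgue_on \<Omega>. g x * f x)"
    if "\<And>k. s k \<in> borel_measurable borel" "f \<in> borel_measurable borel" "\<And>k x. \<bar>s k x\<bar> \<le> 1" "\<And>x. (\<lambda>k. s k x) \<longlonglongrightarrow> f x"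
    for s :: "nat \<Rightarrow> real^'n \<Rightarrow> real" and f
  proof (rule integral_dominated_convergence[where w = "\<lambda>x. \<bar>g x\<bar>"])
    show "(\<lambda>x. g x * f x) \<in> borel_measurable (lebesgue_on \<Omega>)" using bm[OF that(2)] by measurable
    show "(\<lambda>x. g x * s k x) \<in> borel_measurable (lebesgue_on \<Omega>)" for k using bm[OF that(1)] by measurable
    show "AE x in lebesgue_on \<Omega>. (\<lambda>k. g x * s k x) \<longlonglongrightarrow> g x * f x"
      using that(4) by (intro always_eventually allI tendsto_mult tendsto_const)
    show "AE x in lebesgue_on \<Omega>. norm (g x * s k x) \<le> \<bar>g x\<bar>" for k
      using that(3) by (intro always_eventually allI) (auto simp: abs_mult mult_left_le)
  qed (rule gi)
  have pos0: "(LINT x|lebesgue_on \<Omega>. g x * indicator {x. \<eta> x > 0} x) = 0"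
    if \<eta>: "\<eta> \<in> test_functions \<Omega>" "\<And>x. \<eta> x \<ge> 0" for \<eta>
  proof -
    obtain K' where K': "compact K'" "K' \<subseteq> \<Omega>" "\<And>x. x \<notin> K' \<Longrightarrow> \<eta> x = 0"
      using test_functionsD(2)[OF \<eta>(1)] by blast
    have sm: "smooth (\<lambda>x. flat (real k * \<eta> x))" for k
      by (intro smooth_flat smooth_mult smooth_const test_functionsD(1)[OF \<eta>(1)])
    \<comment> \<open>\<open>flat\<close> vanishes at 0, so the support of \<eta> is kept; and flat
      (k t) = exp (-1/(k t)) tends to 1 for every t > 0.\<close>
    have "(\<lambda>x. flat (real k * \<eta> x)) \<in> test_functions \<Omega>" for k
      by (rule test_functionsI[OF sm K'(1,2)]) (simp add: K'(3) flat_eq)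
    then have z0: "(LINT x|lebesgue_on \<Omega>. g x * flat (real k * \<eta> x)) = 0" for k
      using z unfolding L2_inner_def by fastforce
    have [measurable]: "\<eta> \<in> borel_measurable borel"
      by (rule smooth_borel_measurable[OF test_functionsD(1)[OF \<eta>(1)]])
    have "(\<lambda>k. LINT x|lebesgue_on \<Omega>. g x * flat (real k * \<eta> x)) \<longlonglongrightarrow> (LINT x|lebesgue_on \<Omega>. g x * indicator {x. \<eta> x > 0} x)"
    proof (rule dct)
      show "(\<lambda>x. flat (real k * \<eta> x)) \<in> borel_measurable borel" for k by (rule smooth_borel_measurable[OF sm])
      show "indicat_real {x. 0 < \<eta> x} \<in> borel_measurable borel" by measurable
      show "\<bar>flat (real k * \<eta> x)\<bar> \<le> 1" for k x using flat_nonneg flat_le_1 by (simp add: abs_of_nonneg)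
      show "(\<lambda>k. flat (real k * \<eta> x)) \<longlonglongrightarrow> indicator {x. \<eta> x > 0} x" for x
      proof (cases "\<eta> x > 0")
        case True
        have "(\<lambda>k. (1 / \<eta> x) / real k) \<longlonglongrightarrow> 0" by (rule lim_const_over_n)
        then have "(\<lambda>k. exp (- ((1 / \<eta> x) / real k))) \<longlonglongrightarrow> exp (- 0)" by (intro tendsto_intros)
        moreover have "\<forall>\<^sub>F k in sequentially. exp (- ((1 / \<eta> x) / real k)) = flat (real k * \<eta> x)"
          using eventually_gt_at_top[of 0] by eventually_elim (use True in \<open>simp add: flat_eq field_simps\<close>)
        ultimately show ?thesis using True by (simp add: tendsto_cong)
      next
        case False
        then have "\<eta> x = 0" using \<eta>(2)[of x] by simp
        then show ?thesis by (simp add: flat_eq)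
      qed
    qed
    then show ?thesis unfolding z0 using LIMSEQ_unique tendsto_const by blast
  qed
  have "\<exists>\<eta>. \<eta> \<in> test_functions \<Omega> \<and> (\<forall>x. \<eta> x \<ge> 0) \<and> (\<forall>x\<in>K. \<eta> x > 0) \<and>
      (\<forall>x. \<eta> x > 0 \<longrightarrow> (\<exists>c\<in>K. dist c x < 1 / real (Suc j)))" for j
    by (rule smooth_neighbourhood[OF K \<Omega>(1), of "1 / real (Suc j)"]) auto
  then obtain \<eta> where \<eta>: "\<And>j. \<eta> j \<in> test_functions \<Omega>" "\<And>j x. \<eta> j x \<ge> 0" "\<And>j x. x \<in> K \<Longrightarrow> \<eta> j x > 0"
      "\<And>j x. \<eta> j x > 0 \<Longrightarrow> \<exists>c\<in>K. dist c x < 1 / real (Suc j)" by metis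
  have [measurable]: "\<eta> j \<in> borel_measurable borel" for j
    by (rule smooth_borel_measurable[OF test_functionsD(1)[OF \<eta>(1)]])
  have "(\<lambda>j. LINT x|lebesgue_on \<Omega>. g x * indicator {x. \<eta> j x > 0} x) \<longlonglongrightarrow> (LINT x|lebesgue_on \<Omega>. g x * indicator K x)"
  proof (rule dct)
    show "indicat_real {x. 0 < \<eta> j x} \<in> borel_measurable borel" for j by measurable
    show "indicat_real K \<in> borel_measurable borel" by (rule borel_measurable_indicator[OF borel_compact[OF K(1)]])
    show "\<bar>indicat_real {x. 0 < \<eta> j x} x\<bar> \<le> 1" for j x by (simp add: indicator_def)
    show "(\<lambda>j. indicat_real {x. 0 < \<eta> j x} x) \<longlonglongrightarrow> indicat_real K x" for x
    proof (cases "x \<in> K")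
      case True
      then show ?thesis using \<eta>(3) by simp
    next
      case False
      have "open (- K)" using K(1) compact_imp_closed by blast
      then obtain e where e: "e > 0" "ball x e \<subseteq> - K" using False by (meson ComplI openE)
      obtain n where n: "1 / real (Suc n) < e" using e(1) nat_approx_posE by (metis inverse_eq_divide)
      have "indicat_real {x. 0 < \<eta> j x} x = 0" if "j \<ge> n" for j
      proof -
        have "\<not> \<eta> j x > 0"
        proof
          assume "\<eta> j x > 0"
          then obtain c where c: "c \<in> K" "dist c x < 1 / real (Suc j)" using \<eta>(4) by blast
          have "1 / real (Suc j) \<le> 1 / real (Suc n)" using that by (intro divide_left_mono) auto
          then have "c \<in> ball x e" using c n by (simp add: dist_commute)
          then show False using e c by blast
        qed
        then show ?thesis by simp
      qed
      then have "\<forall>\<^sub>F j in sequentially. indicat_real {x. 0 < \<eta> j x} x = indicat_real K x"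
        using False eventually_sequentially by auto
      then show ?thesis by (rule tendsto_eventually)
    qed
  qed
  then show ?thesis using pos0[OF \<eta>(1,2)] LIMSEQ_unique[OF _ tendsto_const] by simp
qed

text \<open>A closed subset of {g > 0} is bounded, hence compact; the integral of g over it vanishes
  while g is positive there, so it is a null set. By inner regularity {g > 0} is null as well, and
  the same applies to -g.\<close>

lemma fundamental_lemma:
  fixes g :: "real^'n \<Rightarrow> real"
  assumes \<Omega>: "open \<Omega>" "bounded \<Omega>" and g: "sq_integrable_on \<Omega> g"
    and z: "\<And>\<phi>. \<phi> \<in> test_functions \<Omega> \<Longrightarrow> L2_inner \<Omega> g \<phi> = 0"
  shows "AE x in lebesgue_on \<Omega>. g x = 0"
proof -
  have pos: "emeasure lebesgue {x\<in>\<Omega>. g x > 0} = 0" if g: "sq_integrable_on \<Omega> g"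
    and z: "\<And>\<phi>. \<phi> \<in> test_functions \<Omega> \<Longrightarrow> L2_inner \<Omega> g \<phi> = 0" for g
  proof -
    let ?P = "{x\<in>\<Omega>. g x > 0}"
    have gm [measurable]: "g \<in> borel_measurable (lebesgue_on \<Omega>)" using g by (simp add: sq_integrable_on_def)
    have "{x \<in> space (lebesgue_on \<Omega>). g x > 0} \<in> sets (lebesgue_on \<Omega>)" by measurable
    then have P: "?P \<in> sets lebesgue" using \<Omega>(1) by (simp add: sets_restrict_space_iff)
    have bnd: "emeasure lebesgue ?P \<le> 0 + ennreal e" if e: "e > 0" for e
    proof -
      obtain T where T: "closed T" "T \<subseteq> ?P" "?P - T \<in> lmeasurable" "emeasure lebesgue (?P - T) < ennreal e"
        using sets_lebesgue_inner_closed[OF P e] by blast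
      have T\<Omega>: "T \<subseteq> \<Omega>" using T(2) by auto
      have Tc: "compact T" using T(1) bounded_subset[OF \<Omega>(2) T\<Omega>] by (simp add: compact_eq_bounded_closed)
      have one: "sq_integrable_on \<Omega> (indicat_real T)"
        using \<Omega> Tc borel_measurable_indicator[OF borel_compact[OF Tc]]
        by (intro sq_integrable_bounded[of _ "indicat_real T" _ 1]) auto
      have i: "integrable (lebesgue_on \<Omega>) (\<lambda>x. g x * indicator T x)"
        using sq_integrable_inner[OF g one] by simp
      have "AE x in lebesgue_on \<Omega>. g x * indicator T x = 0"
      proof (rule iffD1[OF integral_nonneg_eq_0_iff_AE[OF i]])
        show "AE x in lebesgue_on \<Omega>. 0 \<le> g x * indicator T x"
          using T(2) by (intro always_eventually allI) (force simp: indicator_def)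
        show "(LINT x|lebesgue_on \<Omega>. g x * indicator T x) = 0"
          by (rule integral_compact_eq_0[OF \<Omega> g z Tc T\<Omega>])
      qed
      then have "AE x in lebesgue. x \<in> \<Omega> \<longrightarrow> g x * indicator T x = 0"
        using \<Omega>(1) by (simp add: AE_restrict_space_iff)
      then have "AE x in lebesgue. x \<notin> T"
      proof eventually_elim
        case (elim x)
        then show ?case using T(2) by (force simp: indicator_def)
      qed
      moreover have "T \<in> sets lebesgue" using T(1) by simp
      ultimately have T0: "emeasure lebesgue T = 0"
        using AE_iff_null_sets[of T lebesgue] by (auto simp: null_sets_def)
      have "?P = T \<union> (?P - T)" using T(2) by auto
      then have "emeasure lebesgue ?P \<le> emeasure lebesgue T + emeasure lebesgue (?P - T)"
        using emeasure_subadditive[of T lebesgue "?P - T"] P \<open>T \<in> sets lebesgue\<close> by auto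
      also have "\<dots> \<le> 0 + ennreal e" using T(4) T0 by simp
      finally show ?thesis .
    qed
    have "emeasure lebesgue ?P \<le> 0" by (rule ennreal_le_epsilon) (rule bnd)
    then show ?thesis by simp
  qed
  have m: "f \<in> borel_measurable (lebesgue_on \<Omega>)" "{x\<in>\<Omega>. f x > 0} \<in> sets lebesgue" if "sq_integrable_on \<Omega> f" for f :: "real^'n \<Rightarrow> real"
  proof -
    show [measurable]: "f \<in> borel_measurable (lebesgue_on \<Omega>)" using that by (simp add: sq_integrable_on_def)
    have "{x \<in> space (lebesgue_on \<Omega>). f x > 0} \<in> sets (lebesgue_on \<Omega>)" by measurable
    then show "{x\<in>\<Omega>. f x > 0} \<in> sets lebesgue" using \<Omega>(1) by (simp add: sets_restrict_space_iff)
  qed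
  have ng: "sq_integrable_on \<Omega> (\<lambda>x. - g x)" using sq_integrable_lincomb[OF g g, of "-1" 0] by simp
  have zn: "L2_inner \<Omega> (\<lambda>x. - g x) \<phi> = 0" if "\<phi> \<in> test_functions \<Omega>" for \<phi>
    using z[OF that] by (simp add: L2_inner_def)
  have "{x\<in>\<Omega>. g x > 0} \<in> null_sets lebesgue" "{x\<in>\<Omega>. - g x > 0} \<in> null_sets lebesgue"
    using pos[OF g z] pos[OF ng zn] m(2)[OF g] m(2)[OF ng] by (auto simp: null_sets_def)
  then have "AE x in lebesgue. x \<notin> {x\<in>\<Omega>. g x > 0} \<and> x \<notin> {x\<in>\<Omega>. - g x > 0}"
    by (intro AE_conjI AE_not_in)
  then have "AE x in lebesgue. x \<in> \<Omega> \<longrightarrow> g x = 0" by (rule AE_mp) (auto intro!: always_eventually)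
  then show ?thesis using \<Omega>(1) by (simp add: AE_restrict_space_iff)
qed

lemma L2_inner_cong_AE:
  fixes f f' g :: "real^'n \<Rightarrow> 'b::euclidean_space"
  assumes "AE x in lebesgue_on S. f x = f' x" "sq_integrable_on S f" "sq_integrable_on S f'" "sq_integrable_on S g"
  shows "L2_inner S f g = L2_inner S f' g"
  unfolding L2_inner_def
proof (rule integral_cong_AE)
  show "AE x in lebesgue_on S. f x \<bullet> g x = f' x \<bullet> g x" using assms(1) by eventually_elim simp
qed (use assms in \<open>auto simp: sq_integrable_on_def intro!: borel_measurable_inner\<close>)

text \<open>\<open>weak_grad\<close> is an arbitrary representative; this lemma allows its
  replacement by any gradient that is known explicitly.\<close>

lemma weak_gradient_unique:
  fixes G G' :: "real^'n \<Rightarrow> real^'n"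
  assumes \<Omega>: "open \<Omega>" "bounded \<Omega>" and "sq_integrable_on \<Omega> G" "sq_integrable_on \<Omega> G'"
    "has_weak_gradient \<Omega> u G" "has_weak_gradient \<Omega> u G'"
  shows "AE x in lebesgue_on \<Omega>. G x = G' x"
proof -
  have "AE x in lebesgue_on \<Omega>. G x $ i - G' x $ i = 0" for i
  proof (rule fundamental_lemma[OF \<Omega>])
    have s: "sq_integrable_on \<Omega> (\<lambda>x. G x $ i)" "sq_integrable_on \<Omega> (\<lambda>x. G' x $ i)"
      using assms by (auto intro: sq_integrable_component)
    then show "sq_integrable_on \<Omega> (\<lambda>x. G x $ i - G' x $ i)" by (rule sq_integrable_diff)
    fix \<phi> assume \<phi>: "\<phi> \<in> test_functions \<Omega>"
    have "L2_inner \<Omega> (\<lambda>x. G x $ i) \<phi> = L2_inner \<Omega> (\<lambda>x. G' x $ i) \<phi>"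
      using assms(5,6) \<phi> unfolding has_weak_gradient_def by fastforce
    then show "L2_inner \<Omega> (\<lambda>x. G x $ i - G' x $ i) \<phi> = 0"
      using L2_inner_diff[OF s test_function_sq_integrable[OF \<phi> \<Omega>]] by simp
  qed
  then have "AE x in lebesgue_on \<Omega>. \<forall>i. G x $ i - G' x $ i = 0" by (simp add: AE_all_countable)
  then show ?thesis by eventually_elim (simp add: vec_eq_iff)
qed

definition grad :: "(real^'n \<Rightarrow> real) \<Rightarrow> real^'n \<Rightarrow> real^'n" where
  "grad \<phi> x = (\<chi> i. partial i \<phi> x)"

lemma test_function_grad_sq_integrable:
  assumes "\<phi> \<in> test_functions \<Omega>" "open \<Omega>" "bounded \<Omega>"
  shows "sq_integrable_on \<Omega> (grad \<phi>)"
proof -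
  obtain K where K: "compact K" "\<And>x. x \<notin> K \<Longrightarrow> \<phi> x = 0" using test_functionsD(2)[OF assms(1)] by blast
  have sm: "smooth \<phi>" using test_functionsD(1)[OF assms(1)] .
  obtain B where B: "\<And>x i. \<bar>partial i \<phi> x\<bar> \<le> B" using smooth_compact_support_bounded[OF sm K] by metis
  have "continuous_on UNIV (grad \<phi>)" unfolding grad_def[abs_def]
    by (intro continuous_on_vec_lambda smooth_continuous_on smooth_partial sm)
  moreover have "norm (grad \<phi> x) \<le> (\<Sum>i\<in>(UNIV::'a set). B)" for x
    by (intro order_trans[OF norm_le_l1_cart] sum_mono) (simp add: grad_def B)
  ultimately show ?thesis using assms
    by (intro sq_integrable_bounded[of _ "grad \<phi>"]) (auto intro: borel_measurable_continuous_onI)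
qed

lemma test_function_weak_gradient:
  assumes \<phi>: "\<phi> \<in> test_functions \<Omega>" and \<Omega>: "open \<Omega>"
  shows "has_weak_gradient \<Omega> \<phi> (grad \<phi>)"
  unfolding has_weak_gradient_def
proof (intro ballI allI)
  fix \<theta> i assume \<theta>: "\<theta> \<in> test_functions \<Omega>"
  obtain K where K: "compact K" "K \<subseteq> \<Omega>" "\<And>x. x \<notin> K \<Longrightarrow> \<theta> x = 0" using test_functionsD(2)[OF \<theta>] by blast
  have sm: "smooth \<theta>" "smooth \<phi>" using test_functionsD(1) \<phi> \<theta> by auto
  have [measurable]: "\<theta> \<in> borel_measurable borel" "\<phi> \<in> borel_measurable borel"
    "partial i \<theta> \<in> borel_measurable borel" "partial i \<phi> \<in> borel_measurable borel"
    using sm smooth_partial smooth_borel_measurable by blast+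
  have "(LINT x|lborel. indicator UNIV x * \<phi> x * dderiv \<theta> (axis i 1) x)
      = - (LINT x|lborel. indicator UNIV x * dderiv \<phi> (axis i 1) x * \<theta> x)"
    by (rule ibp_invariant[OF sm(1) K(1,3) sm(2)]) auto
  then have e: "(LINT x|lborel. \<phi> x * partial i \<theta> x) = - (LINT x|lborel. partial i \<phi> x * \<theta> x)"
    by (simp add: dderiv_axis)
  have 0: "\<theta> x = 0" "partial i \<theta> x = 0" if "x \<notin> \<Omega>" for x
    using K that partial_eq_0_outside[of K \<theta> x i] compact_imp_closed by auto
  have "L2_inner \<Omega> \<phi> (partial i \<theta>) = (LINT x|lborel. \<phi> x * partial i \<theta> x)"
    unfolding L2_inner_def using \<Omega> 0 by (intro integral_lebesgue_on_lborel) auto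
  also note e
  also have "(LINT x|lborel. partial i \<phi> x * \<theta> x) = L2_inner \<Omega> (\<lambda>x. grad \<phi> x $ i) \<theta>"
    unfolding L2_inner_def using \<Omega> 0 by (intro integral_lebesgue_on_lborel[symmetric]) (auto simp: grad_def)
  finally show "L2_inner \<Omega> \<phi> (partial i \<theta>) = - L2_inner \<Omega> (\<lambda>x. grad \<phi> x $ i) \<theta>" .
qed

lemma weak_grad:
  assumes "u \<in> H1 \<Omega>"
  shows "sq_integrable_on \<Omega> (weak_grad \<Omega> u)" "has_weak_gradient \<Omega> u (weak_grad \<Omega> u)"
  using someI_ex[of "\<lambda>G. sq_integrable_on \<Omega> G \<and> has_weak_gradient \<Omega> u G"] assms
  unfolding H1_def weak_grad_def by auto

lemma H1_test_function:
  assumes "\<phi> \<in> test_functions \<Omega>" "open \<Omega>" "bounded \<Omega>"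
  shows "\<phi> \<in> H1 \<Omega>" "AE x in lebesgue_on \<Omega>. weak_grad \<Omega> \<phi> x = grad \<phi> x"
proof -
  show h: "\<phi> \<in> H1 \<Omega>" unfolding H1_def
    using test_function_sq_integrable test_function_grad_sq_integrable test_function_weak_gradient assms by blast
  show "AE x in lebesgue_on \<Omega>. weak_grad \<Omega> \<phi> x = grad \<phi> x"
    using weak_gradient_unique[OF assms(2,3) weak_grad(1)[OF h] _ weak_grad(2)[OF h]]
      test_function_grad_sq_integrable test_function_weak_gradient assms by blast
qed

lemma zero_test_function: "(\<lambda>x. 0) \<in> test_functions \<Omega>"
  by (rule test_functionsI[of _ "{}"]) auto

text \<open>The function approximates itself. But the seminorm of the difference 0 is that of the
  representative picked by \<open>weak_grad\<close>, which is known to vanish only almost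
  everywhere, so uniqueness enters even here.\<close>

lemma test_function_H1_0:
  assumes "\<phi> \<in> test_functions \<Omega>" "open \<Omega>" "bounded \<Omega>"
  shows "\<phi> \<in> H1_0 \<Omega>"
proof -
  have g0: "grad (\<lambda>x. 0 :: real) = (\<lambda>x :: real^'a. 0)" by (simp add: grad_def fun_eq_iff vec_eq_iff)
  have "AE x in lebesgue_on \<Omega>. weak_grad \<Omega> (\<lambda>x. 0) x = 0"
    using H1_test_function(2)[OF zero_test_function assms(2,3)] by (simp add: g0)
  then have "AE x in lebesgue_on \<Omega>. weak_grad \<Omega> (\<lambda>x. 0) x \<bullet> weak_grad \<Omega> (\<lambda>x. 0) x = 0"
    by eventually_elim simp
  then have "L2_inner \<Omega> (weak_grad \<Omega> (\<lambda>x. 0)) (weak_grad \<Omega> (\<lambda>x. 0)) = 0"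
    unfolding L2_inner_def by (rule integral_eq_zero_AE)
  then have "H1_seminorm \<Omega> (\<lambda>x. \<phi> x - \<phi> x) = 0" by (simp add: H1_seminorm_def L2_norm_def)
  moreover have "L2_norm \<Omega> (\<lambda>x. \<phi> x - \<phi> x) = 0" by (simp add: L2_norm_def L2_inner_def)
  ultimately show ?thesis using assms H1_test_function(1)[OF assms] unfolding H1_0_def by force
qed

section \<open>Piecewise polynomials as Sobolev functions\<close>

text \<open>The piecewise function set to zero on the boundaries of the elements, a null set. As a
  finite sum it is Borel on the whole space, and disjoint interiors leave at most one nonzero
  summand at each point.\<close>

definition pw :: "(real^'n) set set \<Rightarrow> ((real^'n) set \<Rightarrow> real^'n \<Rightarrow> real) \<Rightarrow> real^'n \<Rightarrow> real" where
  "pw \<T> q x = (\<Sum>T\<in>\<T>. indicator (interior T) x * q T x)"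

text \<open>The properties on which the Sobolev theory of piecewise functions rests; shape and size
  of the elements come in later.\<close>

definition convex_mesh :: "(real^'n) set \<Rightarrow> (real^'n) set set \<Rightarrow> bool" where
  "convex_mesh \<Omega> \<T> \<longleftrightarrow> finite \<T> \<and> (\<forall>T\<in>\<T>. convex T \<and> compact T) \<and> \<Union>\<T> = closure \<Omega> \<and>
     (\<forall>S\<in>\<T>. \<forall>T\<in>\<T>. S \<noteq> T \<longrightarrow> interior S \<inter> interior T = {})"

lemma convex_meshD:
  assumes "convex_mesh \<Omega> \<T>"
  shows "finite \<T>" "T \<in> \<T> \<Longrightarrow> convex T" "T \<in> \<T> \<Longrightarrow> compact T" "\<Union>\<T> = closure \<Omega>"
    "S \<in> \<T> \<Longrightarrow> T \<in> \<T> \<Longrightarrow> x \<in> interior S \<Longrightarrow> x \<in> interior T \<Longrightarrow> S = T"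
  using assms unfolding convex_mesh_def by (simp, simp, simp, simp, blast)

lemma pw_eq:
  assumes "convex_mesh \<Omega> \<T>" "T \<in> \<T>" "x \<in> interior T"
  shows "pw \<T> q x = q T x"
proof -
  have "pw \<T> q x = (\<Sum>S\<in>\<T>. if S = T then q T x else 0)"
    unfolding pw_def using assms convex_meshD(5)[OF assms(1)]
    by (intro sum.cong) (auto simp: indicator_def)
  then show ?thesis using assms(2) convex_meshD(1)[OF assms(1)] by simp
qed

lemma AE_interior:
  assumes "convex_mesh \<Omega> \<T>"
  shows "AE x in lborel. x \<in> \<Omega> \<longrightarrow> (\<exists>T\<in>\<T>. x \<in> interior T)"
proof -
  have "frontier T \<in> null_sets lborel" if "T \<in> \<T>" for T
  proof -
    have "frontier T \<in> null_sets lebesgue"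
      using negligible_convex_frontier convex_meshD(2)[OF assms that] by (simp add: negligible_iff_null_sets)
    moreover have "frontier T \<in> sets lborel" by simp
    ultimately show ?thesis by (simp add: null_sets_completion_iff)
  qed
  then have "AE x in lborel. \<forall>T\<in>\<T>. x \<notin> frontier T"
    using convex_meshD(1)[OF assms] by (intro AE_finite_allI AE_not_in)
  then show ?thesis
  proof eventually_elim
    case (elim x)
    show ?case
    proof
      assume "x \<in> \<Omega>"
      then obtain T where "T \<in> \<T>" "x \<in> T" using convex_meshD(4)[OF assms] closure_subset by blast
      then show "\<exists>T\<in>\<T>. x \<in> interior T"
        using elim convex_meshD(3)[OF assms] by (auto simp: frontier_def compact_imp_closed)
    qed
  qed
qed

lemma pw_borel_measurable [measurable]:
  assumes "\<And>T. T \<in> \<T> \<Longrightarrow> smooth (q T)"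
  shows "pw \<T> q \<in> borel_measurable borel"
  unfolding pw_def[abs_def]
  by (intro borel_measurable_sum borel_measurable_times borel_measurable_indicator smooth_borel_measurable assms) auto

lemma bounded_on_compact:
  fixes q :: "real^'n \<Rightarrow> real"
  assumes "smooth q" "compact T"
  shows "\<exists>B\<ge>0. \<forall>x\<in>T. \<bar>q x\<bar> \<le> B"
proof -
  have "bounded (q ` T)"
    by (intro compact_imp_bounded compact_continuous_image assms smooth_continuous_on)
  then obtain B where "\<forall>x\<in>T. \<bar>q x\<bar> \<le> B" unfolding bounded_iff by auto
  then have "\<forall>x\<in>T. \<bar>q x\<bar> \<le> max B 0" by (auto simp: le_max_iff_disj)
  then show ?thesis by (intro exI[of _ "max B 0"]) auto
qed

lemma bounded_on_elements:
  fixes q :: "(real^'n) set \<Rightarrow> real^'n \<Rightarrow> real"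
  assumes "finite \<T>" "\<And>T. T \<in> \<T> \<Longrightarrow> compact T" "\<And>T. T \<in> \<T> \<Longrightarrow> smooth (q T)"
  shows "\<exists>B\<ge>0. \<forall>T\<in>\<T>. \<forall>x\<in>T. \<bar>q T x\<bar> \<le> B"
proof -
  have "\<forall>T\<in>\<T>. \<exists>B. B \<ge> 0 \<and> (\<forall>x\<in>T. \<bar>q T x\<bar> \<le> B)" using bounded_on_compact assms by blast
  from bchoice[OF this] obtain B where B: "\<And>T. T \<in> \<T> \<Longrightarrow> B T \<ge> 0" "\<And>T x. T \<in> \<T> \<Longrightarrow> x \<in> T \<Longrightarrow> \<bar>q T x\<bar> \<le> B T"
    by blast
  have "\<bar>q T x\<bar> \<le> (\<Sum>T\<in>\<T>. B T)" if "T \<in> \<T>" "x \<in> T" for T x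
    using B(2)[OF that] member_le_sum[of T \<T> B] B(1) assms(1) that by auto
  then show ?thesis using B(1) by (intro exI[of _ "\<Sum>T\<in>\<T>. B T"]) (auto intro: sum_nonneg)
qed

lemma pw_bounded:
  assumes m: "convex_mesh \<Omega> \<T>" and "\<And>T. T \<in> \<T> \<Longrightarrow> smooth (q T)"
  shows "\<exists>B. \<forall>x. \<bar>pw \<T> q x\<bar> \<le> B"
proof -
  have "\<exists>B\<ge>0. \<forall>T\<in>\<T>. \<forall>x\<in>T. \<bar>q T x\<bar> \<le> B"
    by (rule bounded_on_elements) (auto intro: convex_meshD[OF m] assms(2))
  then obtain B where B: "B \<ge> 0" "\<forall>T\<in>\<T>. \<forall>x\<in>T. \<bar>q T x\<bar> \<le> B" by blast
  have "\<bar>pw \<T> q x\<bar> \<le> B" for x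
  proof (cases "\<exists>T\<in>\<T>. x \<in> interior T")
    case True
    then show ?thesis using pw_eq[OF m] B interior_subset by (metis subsetD)
  next
    case False
    then have "pw \<T> q x = 0" unfolding pw_def by (intro sum.neutral) auto
    then show ?thesis using B by simp
  qed
  then show ?thesis by blast
qed

lemma pw_sq_integrable:
  assumes m: "convex_mesh \<Omega> \<T>" and s: "\<And>T. T \<in> \<T> \<Longrightarrow> smooth (q T)" and \<Omega>: "open \<Omega>" "bounded \<Omega>"
  shows "sq_integrable_on \<Omega> (pw \<T> q)"
proof -
  obtain B where "\<forall>x. \<bar>pw \<T> q x\<bar> \<le> B" using pw_bounded[OF m s] ..
  then show ?thesis using \<Omega>
    by (intro sq_integrable_bounded[of _ "pw \<T> q" _ B] pw_borel_measurable s) auto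
qed

text \<open>A segment meets each element in a closed set, on which convexity and the mean value
  theorem for the smooth piece of that element give the bound. A function on an interval that is
  Lipschitz on finitely many closed pieces covering it is Lipschitz with the same constant, so the
  order in which the segment crosses the elements never has to be described.\<close>

lemma lipschitz_on_segment:
  fixes w :: "real^'n \<Rightarrow> real"
  assumes m: "convex_mesh \<Omega> \<T>" and p: "\<And>T. T \<in> \<T> \<Longrightarrow> smooth (p T)"
    and w: "\<And>T x. T \<in> \<T> \<Longrightarrow> x \<in> T \<Longrightarrow> w x = p T x"
    and L: "L \<ge> 0" "\<And>T x. T \<in> \<T> \<Longrightarrow> x \<in> T \<Longrightarrow> \<bar>dderiv (p T) v x\<bar> \<le> L"
    and t: "0 < t" "\<And>s. 0 \<le> s \<Longrightarrow> s \<le> t \<Longrightarrow> x + s *\<^sub>R v \<in> \<Omega>"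
  shows "\<bar>w (x + t *\<^sub>R v) - w x\<bar> \<le> L * t"
proof -
  define U where "U T = {0..t} \<inter> (\<lambda>s. x + s *\<^sub>R v) -` T" for T
  have "L-lipschitz_on {0..t} (\<lambda>s. w (x + s *\<^sub>R v))"
  proof (rule lipschitz_on_closed_Union[OF _ _ convex_meshD(1)[OF m] L(1)])
    fix T assume T: "T \<in> \<T>"
    show "closed (U T)" unfolding U_def
      by (intro continuous_closed_preimage closed_atLeastAtMost compact_imp_closed convex_meshD(3)[OF m T] continuous_intros)
    have le: "\<bar>w (x + s' *\<^sub>R v) - w (x + s *\<^sub>R v)\<bar> \<le> L * (s' - s)" if ss: "s \<in> U T" "s' \<in> U T" "s < s'" for s s'
    proof -
      obtain r where r: "0 < r" "r < s' - s"
        "p T ((x + s *\<^sub>R v) + (s' - s) *\<^sub>R v) - p T (x + s *\<^sub>R v) = (s' - s) * dderiv (p T) v ((x + s *\<^sub>R v) + r *\<^sub>R v)"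
        using mvt_line[OF p[OF T], of "s' - s" "x + s *\<^sub>R v" v] ss(3) by (metis diff_gt_0_iff_gt)
      have e1: "(x + s *\<^sub>R v) + (s' - s) *\<^sub>R v = x + s' *\<^sub>R v" by (simp add: algebra_simps)
      \<comment> \<open>The intermediate point of the mean value theorem as a convex combination of
        two points of \<open>T\<close>, hence a point of \<open>T\<close>.\<close>
      have e2: "(x + s *\<^sub>R v) + r *\<^sub>R v = (1 - r / (s' - s)) *\<^sub>R (x + s *\<^sub>R v) + (r / (s' - s)) *\<^sub>R (x + s' *\<^sub>R v)"
      proof -
        have "r / (s' - s) * (s' - s) = r" using ss(3) by simp
        then have "(1 - r / (s' - s)) * s + (r / (s' - s)) * s' = s + r" by (simp only: algebra_simps)
        then have "s + r = (1 - r / (s' - s)) * s + (r / (s' - s)) * s'" by simp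
        then have "(s + r) *\<^sub>R v = ((1 - r / (s' - s)) * s) *\<^sub>R v + ((r / (s' - s)) * s') *\<^sub>R v"
          by (metis scaleR_add_left)
        then show ?thesis by (simp add: algebra_simps)
      qed
      have "(x + s *\<^sub>R v) + r *\<^sub>R v \<in> T"
        unfolding e2 using r ss convex_meshD(2)[OF m T]
        by (intro convexD) (auto simp: U_def divide_simps)
      then have "\<bar>(s' - s) * dderiv (p T) v ((x + s *\<^sub>R v) + r *\<^sub>R v)\<bar> \<le> L * (s' - s)"
        using L(2)[OF T] ss(3) by (simp add: abs_mult mult.commute)
      then show ?thesis using r(3) ss w[OF T] unfolding e1 by (simp add: U_def)
    qed
    show "L-lipschitz_on (U T) (\<lambda>s. w (x + s *\<^sub>R v))"
    proof (rule lipschitz_onI[OF _ L(1)])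
      fix s s' assume "s \<in> U T" "s' \<in> U T"
      then show "dist (w (x + s *\<^sub>R v)) (w (x + s' *\<^sub>R v)) \<le> L * dist s s'"
        using le[of s s'] le[of s' s] by (cases s s' rule: linorder_cases) (auto simp: dist_real_def abs_minus_commute)
    qed
  next
    show "{0..t} \<subseteq> (\<Union>T\<in>\<T>. U T)"
    proof
      fix s assume s: "s \<in> {0..t}"
      then have "x + s *\<^sub>R v \<in> \<Union>\<T>" using t(2)[of s] convex_meshD(4)[OF m] closure_subset by auto
      then show "s \<in> (\<Union>T\<in>\<T>. U T)" using s by (auto simp: U_def)
    qed
  qed
  from lipschitz_onD[OF this, of t 0] show ?thesis using t(1) by (simp add: dist_real_def)
qed

text \<open>Continuity across sides enters through a single \<open>w\<close> that agrees with the
  pieces on the closed elements: it makes the difference quotients uniformly bounded. They converge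
  at interior points of elements, that is almost everywhere in the domain.\<close>

lemma pw_poly_weak_gradient:
  fixes w :: "real^'n \<Rightarrow> real"
  assumes m: "convex_mesh \<Omega> \<T>" and \<Omega>: "open \<Omega>" "bounded \<Omega>"
    and p: "\<And>T. T \<in> \<T> \<Longrightarrow> smooth (p T)"
    and w: "\<And>T x. T \<in> \<T> \<Longrightarrow> x \<in> T \<Longrightarrow> w x = p T x" and wc: "continuous_on (closure \<Omega>) w"
  shows "has_weak_gradient \<Omega> w (\<lambda>x. \<chi> i. pw \<T> (\<lambda>T. partial i (p T)) x)"
  unfolding has_weak_gradient_def
proof (intro ballI allI)
  fix \<phi> i assume \<phi>: "\<phi> \<in> test_functions \<Omega>"
  obtain K where K: "compact K" "K \<subseteq> \<Omega>" "\<And>x. x \<notin> K \<Longrightarrow> \<phi> x = 0" using test_functionsD(2)[OF \<phi>] by blast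
  have sm: "smooth \<phi>" using test_functionsD(1)[OF \<phi>] .
  obtain e where e: "e > 0" "(\<Union>x\<in>K. ball x e) \<subseteq> \<Omega>"
    using compact_subset_open_imp_ball_epsilon_subset[OF K(1) \<Omega>(1) K(2)] by blast
  define t0 where "t0 = e / 2"
  define v :: "real^'n" where "v = axis i 1"
  have nv: "norm v = 1" by (simp add: v_def)
  have t0: "t0 > 0" "t0 < e" using e by (auto simp: t0_def)
  have in\<Omega>: "x - t *\<^sub>R v \<in> \<Omega>" if "x \<in> K" "0 \<le> t" "t \<le> t0" for x t
  proof -
    have "x - t *\<^sub>R v \<in> ball x e" using that t0 nv by (simp add: dist_norm)
    then show ?thesis using e(2) that(1) by blast
  qed
  \<comment> \<open>A Borel extension to the whole space. What matters are its values at short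
    translates of the support of \<phi>, which stay inside the domain.\<close>
  define U where "U x = indicat_real (closure \<Omega>) x *\<^sub>R w x" for x
  have U: "U x = w x" if "x \<in> \<Omega>" for x using that closure_subset by (auto simp: U_def indicator_def)
  have Um [measurable]: "U \<in> borel_measurable borel"
    unfolding U_def[abs_def] by (rule borel_measurable_continuous_on_indicator[OF _ wc]) simp
  have "bounded (w ` closure \<Omega>)"
    using \<Omega>(2) by (intro compact_imp_bounded compact_continuous_image wc) (simp add: compact_closure)
  then obtain B where B: "\<And>x. x \<in> closure \<Omega> \<Longrightarrow> \<bar>w x\<bar> \<le> B" unfolding bounded_iff by auto
  have "\<exists>L\<ge>0. \<forall>T\<in>\<T>. \<forall>x\<in>T. \<bar>dderiv (p T) (- v) x\<bar> \<le> L"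
    by (rule bounded_on_elements) (auto intro: convex_meshD[OF m] smooth_dderiv p)
  then obtain L where L: "L \<ge> 0" "\<And>T x. T \<in> \<T> \<Longrightarrow> x \<in> T \<Longrightarrow> \<bar>dderiv (p T) (- v) x\<bar> \<le> L"
    by blast
  have gm: "pw \<T> (\<lambda>T. partial i (p T)) \<in> borel_measurable borel"
    by (intro pw_borel_measurable smooth_partial p)
  have eq: "(LINT x|lborel. U x * dderiv \<phi> v x) = - (LINT x|lborel. pw \<T> (\<lambda>T. partial i (p T)) x * \<phi> x)"
  proof (rule ibp_difference[OF sm K(1,3) t0(1) Um gm, where B = B and L = L])
    fix x t assume x: "x \<in> K" and t: "0 \<le> t" "t \<le> t0"
    show "\<bar>U (x - t *\<^sub>R v)\<bar> \<le> B" using in\<Omega>[OF x t] B closure_subset by (auto simp: U)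
  next
    fix x t assume x: "x \<in> K" and t: "0 < t" "t \<le> t0"
    have "\<bar>w (x + t *\<^sub>R (- v)) - w x\<bar> \<le> L * t"
      by (rule lipschitz_on_segment[OF m p w L t(1)]) (use in\<Omega>[OF x] t in auto)
    then show "\<bar>U (x - t *\<^sub>R v) - U x\<bar> \<le> L * t"
      using in\<Omega>[OF x, of t] in\<Omega>[OF x, of 0] t t0 by (simp add: U)
  next
    show "AE x in lborel. x \<in> K \<longrightarrow> ((\<lambda>t. (U (x - t *\<^sub>R v) - U x) / t) \<longlongrightarrow> - pw \<T> (\<lambda>T. partial i (p T)) x) (at_right 0)"
      using AE_interior[OF m]
    proof eventually_elim
      case (elim x)
      show ?case
      proof
        assume x: "x \<in> K"
        then obtain T where T: "T \<in> \<T>" "x \<in> interior T" using elim K(2) by blast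
        obtain d where d: "d > 0" "ball x d \<subseteq> interior T" using T(2) open_interior openE by blast
        have Tcl: "T \<subseteq> closure \<Omega>" using convex_meshD(4)[OF m] T(1) by blast
        have UT: "U y = p T y" if "y \<in> interior T" for y
        proof -
          have "y \<in> T" using that interior_subset by blast
          then show ?thesis using Tcl w[OF T(1)] by (auto simp: U_def)
        qed
        have "\<forall>\<^sub>F t in at_right 0. t < d" using d(1) by (intro eventually_at_rightI[of 0 d]) auto
        moreover have "\<forall>\<^sub>F t in at_right 0. (0::real) < t" by (rule eventually_at_right_less)
        ultimately have "\<forall>\<^sub>F t in at_right 0. (p T (x + t *\<^sub>R (- v)) - p T x) / t = (U (x - t *\<^sub>R v) - U x) / t"
        proof eventually_elim
          case (elim t)
          have "x - t *\<^sub>R v \<in> ball x d" using elim nv by (simp add: dist_norm)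
          then have "x - t *\<^sub>R v \<in> interior T" using d(2) by blast
          then show ?case using UT T(2) by simp
        qed
        moreover have "((\<lambda>t. (p T (x + t *\<^sub>R (- v)) - p T x) / t) \<longlongrightarrow> - pw \<T> (\<lambda>T. partial i (p T)) x) (at_right 0)"
          using difference_quotient_tendsto[OF p[OF T(1)], of x "- v"]
          by (simp add: dderiv_minus v_def dderiv_axis pw_eq[OF m T])
        ultimately show "((\<lambda>t. (U (x - t *\<^sub>R v) - U x) / t) \<longlongrightarrow> - pw \<T> (\<lambda>T. partial i (p T)) x) (at_right 0)"
          by (simp only: tendsto_cong)
      qed
    qed
  qed
  have 0: "\<phi> x = 0" "partial i \<phi> x = 0" if "x \<notin> \<Omega>" for x
    using K that partial_eq_0_outside[of K \<phi> x i] compact_imp_closed by auto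
  have m\<phi>: "\<phi> \<in> borel_measurable borel" "partial i \<phi> \<in> borel_measurable borel"
    using sm smooth_partial smooth_borel_measurable by blast+
  have "L2_inner \<Omega> w (partial i \<phi>) = (LINT x|lborel. U x * partial i \<phi> x)"
    unfolding L2_inner_def using \<Omega> 0 m\<phi> by (intro integral_lebesgue_on_lborel borel_measurable_times Um) (auto simp: U)
  also have "\<dots> = - (LINT x|lborel. pw \<T> (\<lambda>T. partial i (p T)) x * \<phi> x)"
    using eq by (simp add: v_def dderiv_axis)
  also have "(LINT x|lborel. pw \<T> (\<lambda>T. partial i (p T)) x * \<phi> x) = L2_inner \<Omega> (\<lambda>x. (\<chi> i. pw \<T> (\<lambda>T. partial i (p T)) x) $ i) \<phi>"
    unfolding L2_inner_def using \<Omega> 0 m\<phi> gm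
    by (intro integral_lebesgue_on_lborel[symmetric] borel_measurable_times) auto
  finally show "L2_inner \<Omega> w (partial i \<phi>) = - L2_inner \<Omega> (\<lambda>x. (\<chi> i. pw \<T> (\<lambda>T. partial i (p T)) x) $ i) \<phi>" .
qed

lemma pw_vector_sq_integrable:
  fixes q :: "'n::finite \<Rightarrow> (real^'n) set \<Rightarrow> real^'n \<Rightarrow> real"
  assumes m: "convex_mesh \<Omega> \<T>" and s: "\<And>i T. T \<in> \<T> \<Longrightarrow> smooth (q i T)" and \<Omega>: "open \<Omega>" "bounded \<Omega>"
  shows "sq_integrable_on \<Omega> (\<lambda>x. \<chi> i. pw \<T> (q i) x)"
proof -
  have "\<exists>B. \<forall>x. \<bar>pw \<T> (q i) x\<bar> \<le> B" for i by (rule pw_bounded[OF m s])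
  then obtain B where B: "\<And>i x. \<bar>pw \<T> (q i) x\<bar> \<le> B i" by metis
  have "(\<lambda>x. \<chi> i. pw \<T> (q i) x) \<in> borel_measurable borel"
    by (subst borel_measurable_euclidean_space)
      (auto simp: Basis_vec_def inner_axis intro!: pw_borel_measurable s)
  moreover have "norm (\<chi> i. pw \<T> (q i) x) \<le> (\<Sum>i\<in>UNIV. B i)" for x
    by (intro order_trans[OF norm_le_l1_cart] sum_mono) (simp add: B)
  ultimately show ?thesis using \<Omega>
    by (intro sq_integrable_bounded[of _ "\<lambda>x. \<chi> i. pw \<T> (q i) x"]) auto
qed

section \<open>Surface measure and integration by parts on half spaces\<close>

text \<open>The uniqueness of Haar measure in a special case. The image measure \<mu> is translation
  invariant, and Fubini for the product of both measures, applied to 1_A(x) 1_B(y - x) with the unit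
  ball B, yields \<mu>(A) |B| = |A| \<mu>(B). The preimage of B under \<open>f\<close> is B, so
  \<mu>(B) = |B|.\<close>

lemma distr_lborel_orthogonal:
  fixes f :: "real^'n \<Rightarrow> real^'n"
  assumes f: "orthogonal_transformation f"
  shows "distr lborel borel f = lborel"
proof (rule measure_eqI)
  have lf: "linear f" by (rule orthogonal_transformation_linear[OF f])
  have fm [measurable]: "f \<in> borel_measurable borel"
    using lf by (intro borel_measurable_continuous_onI linear_continuous_on) (simp add: linear_conv_bounded_linear)
  define \<mu> where "\<mu> = distr lborel borel f"
  have [measurable_cong]: "sets \<mu> = sets borel" by (simp add: \<mu>_def)
  have sp: "space \<mu> = UNIV" by (simp add: \<mu>_def)
  have bij: "bij f" by (rule orthogonal_transformation_bij[OF f])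
  have trans_mu: "(\<integral>\<^sup>+ x. g (y + x) \<partial>\<mu>) = (\<integral>\<^sup>+ x. g x \<partial>\<mu>)"
    if [measurable]: "g \<in> borel_measurable borel" for g :: "real^'n \<Rightarrow> ennreal" and y
  proof -
    obtain z where z: "y = f z" using bij by (metis bij_pointE)
    have "(\<integral>\<^sup>+ x. g (y + x) \<partial>\<mu>) = (\<integral>\<^sup>+ x. g (f (z + x)) \<partial>lborel)"
      unfolding \<mu>_def by (subst nn_integral_distr) (auto simp: z linear_add[OF lf])
    also have "\<dots> = (\<integral>\<^sup>+ x. g (f x) \<partial>distr lborel borel ((+) z))"
      by (subst nn_integral_distr) auto
    also have "\<dots> = (\<integral>\<^sup>+ x. g (f x) \<partial>lborel)" by (simp only: lborel_distr_plus)
    also have "\<dots> = (\<integral>\<^sup>+ x. g x \<partial>\<mu>)"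
      unfolding \<mu>_def by (subst nn_integral_distr) auto
    finally show ?thesis .
  qed
  have trans_lborel: "(\<integral>\<^sup>+ x. g (y + x) \<partial>lborel) = (\<integral>\<^sup>+ x. g x \<partial>lborel)"
    if [measurable]: "g \<in> borel_measurable borel" for g :: "real^'n \<Rightarrow> ennreal" and y
    by (subst lborel_distr_plus[symmetric, of y], subst nn_integral_distr) auto
  have vb: "f -` ball (0 :: real^'n) r = ball 0 r" for r
    by (auto simp: orthogonal_transformation_norm[OF f])
  have mub: "emeasure \<mu> (ball 0 r) = emeasure lborel (ball (0 :: real^'n) r)" for r
    unfolding \<mu>_def by (subst emeasure_distr) (auto simp: vb)
  have fin: "emeasure lborel (ball (0 :: real^'n) r) \<noteq> top" for r
    using emeasure_bounded_finite[of "ball (0 :: real^'n) r"] by (simp add: less_top)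
  let ?B = "ball (0 :: real^'n) 1"
  \<comment> \<open>Balls about the origin keep their measure under \<open>f\<close>, which gives
    the \<sigma>-finiteness that Fubini asks for.\<close>
  interpret \<mu>: sigma_finite_measure \<mu>
  proof
    show "\<exists>A. countable A \<and> A \<subseteq> sets \<mu> \<and> \<Union> A = space \<mu> \<and> (\<forall>a\<in>A. emeasure \<mu> a \<noteq> \<infinity>)"
    proof (intro exI[of _ "range (\<lambda>i. ball 0 (real i))"] conjI)
      have "\<exists>i. norm x < real i" for x :: "real^'n" by (rule reals_Archimedean2)
      then show "\<Union> (range (\<lambda>i. ball 0 (real i))) = space \<mu>" by (auto simp: sp)
      show "\<forall>a\<in>range (\<lambda>i. ball 0 (real i)). emeasure \<mu> a \<noteq> \<infinity>"
        by (auto simp: mub fin)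
    qed auto
  qed
  interpret P: pair_sigma_finite \<mu> "lborel :: (real^'n) measure" ..
  show "sets (distr lborel borel f) = sets lborel" by simp
  fix A assume "A \<in> sets (distr lborel borel f)"
  then have A [measurable]: "A \<in> sets borel" by simp
  define I J :: "real^'n \<Rightarrow> ennreal" where "I = indicator A" and "J = indicator ?B"
  have [measurable]: "I \<in> borel_measurable borel" "J \<in> borel_measurable borel"
    unfolding I_def J_def by (intro borel_measurable_indicator A borel_open open_ball)+
  have J: "J (- x) = J x" for x by (simp add: J_def indicator_def)
  have II: "(\<integral>\<^sup>+ x. I x \<partial>\<mu>) = emeasure \<mu> A" "(\<integral>\<^sup>+ x. I x \<partial>lborel) = emeasure lborel A"
    "(\<integral>\<^sup>+ x. J x \<partial>\<mu>) = emeasure lborel ?B" "(\<integral>\<^sup>+ x. J x \<partial>lborel) = emeasure lborel ?B"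
    by (simp_all add: I_def J_def mub)
  have "emeasure \<mu> A * emeasure lborel ?B = (\<integral>\<^sup>+ x. I x * emeasure lborel ?B \<partial>\<mu>)"
    by (simp add: nn_integral_multc II)
  also have "\<dots> = (\<integral>\<^sup>+ x. (\<integral>\<^sup>+ y. I x * J (y - x) \<partial>lborel) \<partial>\<mu>)"
  proof (rule nn_integral_cong)
    fix x
    have "(\<integral>\<^sup>+ y. I x * J (y - x) \<partial>lborel) = I x * (\<integral>\<^sup>+ y. J (- x + y) \<partial>lborel)"
      by (simp add: nn_integral_cmult)
    also have "(\<integral>\<^sup>+ y. J (- x + y) \<partial>lborel) = emeasure lborel ?B" by (subst trans_lborel) (auto simp: II)
    finally show "I x * emeasure lborel ?B = (\<integral>\<^sup>+ y. I x * J (y - x) \<partial>lborel)" ..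
  qed
  also have "\<dots> = (\<integral>\<^sup>+ y. (\<integral>\<^sup>+ x. I x * J (y - x) \<partial>\<mu>) \<partial>lborel)"
    by (rule P.Fubini'[symmetric]) measurable
  \<comment> \<open>A translation by y in the first measure turns the argument of \<open>J\<close>
    into -x, and \<open>J\<close> is even.\<close>
  also have "\<dots> = (\<integral>\<^sup>+ y. (\<integral>\<^sup>+ x. I (y + x) * J x \<partial>\<mu>) \<partial>lborel)"
  proof (rule nn_integral_cong)
    fix y
    have "(\<integral>\<^sup>+ x. I x * J (y - x) \<partial>\<mu>) = (\<integral>\<^sup>+ x. I (y + x) * J (y - (y + x)) \<partial>\<mu>)"
      by (rule trans_mu[symmetric]) measurable
    then show "(\<integral>\<^sup>+ x. I x * J (y - x) \<partial>\<mu>) = (\<integral>\<^sup>+ x. I (y + x) * J x \<partial>\<mu>)"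
      by (simp add: J)
  qed
  also have "\<dots> = (\<integral>\<^sup>+ x. (\<integral>\<^sup>+ y. I (y + x) * J x \<partial>lborel) \<partial>\<mu>)"
    by (rule P.Fubini') measurable
  also have "\<dots> = (\<integral>\<^sup>+ x. emeasure lborel A * J x \<partial>\<mu>)"
  proof (rule nn_integral_cong)
    fix x
    have "(\<integral>\<^sup>+ y. I (y + x) * J x \<partial>lborel) = (\<integral>\<^sup>+ y. I (x + y) \<partial>lborel) * J x"
      by (simp add: nn_integral_multc add.commute)
    also have "(\<integral>\<^sup>+ y. I (x + y) \<partial>lborel) = emeasure lborel A" by (subst trans_lborel) (auto simp: II)
    finally show "(\<integral>\<^sup>+ y. I (y + x) * J x \<partial>lborel) = emeasure lborel A * J x" .
  qed
  also have "\<dots> = emeasure lborel A * emeasure lborel ?B"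
    by (simp add: nn_integral_cmult II)
  finally have e: "emeasure \<mu> A * emeasure lborel ?B = emeasure lborel A * emeasure lborel ?B" .
  have "emeasure lborel ?B \<noteq> 0" "emeasure lborel ?B \<noteq> \<infinity>"
    using fin[of 1] open_not_negligible[of ?B]
    by (auto simp: negligible_iff_null_sets null_sets_def)
  then show "emeasure (distr lborel borel f) A = emeasure lborel A"
    using e unfolding \<mu>_def[symmetric]
    by (metis ennreal_mult_divide_eq infinity_ennreal_def)
qed

text \<open>Connects two descriptions of one product measure: \<open>lborel\<close> on vectors
  indexed by \<open>'n\<close>, and the product over an initial segment of the naturals from which
  \<open>surface_measure\<close> is made.\<close>

lemma lborel_eq_distr_PiM:
  fixes \<beta> :: "nat \<Rightarrow> 'n::finite"
  assumes \<beta>: "bij_betw \<beta> {..<m} UNIV"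
  shows "lborel = distr (PiM {..<m} (\<lambda>_. lborel)) borel (\<lambda>y. \<Sum>i<m. y i *\<^sub>R (axis (\<beta> i) 1 :: real^'n))"
    (is "_ = distr ?M borel ?F")
proof (rule lborel_eqI)
  interpret product_sigma_finite "\<lambda>_::nat. lborel :: real measure" ..
  show "sets (distr ?M borel ?F) = sets borel" by simp
  have Fm [measurable]: "?F \<in> ?M \<rightarrow>\<^sub>M borel" by measurable
  fix l u :: "real^'n" assume le: "\<And>b. b \<in> Basis \<Longrightarrow> l \<bullet> b \<le> u \<bullet> b"
  have Fi: "?F y $ \<beta> j = y j" if "j < m" for y j
  proof -
    have inj: "\<beta> j = \<beta> i \<longleftrightarrow> i = j" if "i < m" for i
      using \<beta> \<open>j < m\<close> that by (auto simp: bij_betw_def inj_on_def)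
    have "?F y $ \<beta> j = (\<Sum>i<m. y i * axis (\<beta> i) 1 $ \<beta> j)" by simp
    also have "\<dots> = (\<Sum>i<m. if i = j then y i else 0)"
      using inj by (intro sum.cong refl) (simp add: axis_def)
    finally show ?thesis using that by simp
  qed
  have surj: "\<exists>j<m. k = \<beta> j" for k
  proof -
    have "k \<in> \<beta> ` {..<m}" using \<beta> by (simp add: bij_betw_def)
    then show ?thesis by auto
  qed
  have vimg: "?F -` box l u \<inter> space ?M = PiE {..<m} (\<lambda>j. {l $ \<beta> j <..< u $ \<beta> j})"
  proof (intro set_eqI iffI)
    fix y assume y: "y \<in> ?F -` box l u \<inter> space ?M"
    then have box: "?F y \<in> box l u" and "y \<in> space ?M" by (simp_all only: vimage_eq Int_iff)
    then have ext: "y \<in> extensional {..<m}" by (simp add: space_PiM PiE_iff)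
    have mem: "\<forall>k. l $ k < ?F y $ k \<and> ?F y $ k < u $ k" using box unfolding mem_box_cart .
    have "l $ \<beta> j < y j \<and> y j < u $ \<beta> j" if "j < m" for j
      using mem[rule_format, of "\<beta> j"] unfolding Fi[OF that] .
    then show "y \<in> PiE {..<m} (\<lambda>j. {l $ \<beta> j <..< u $ \<beta> j})"
      using ext by (simp add: PiE_iff)
  next
    fix y assume y: "y \<in> PiE {..<m} (\<lambda>j. {l $ \<beta> j <..< u $ \<beta> j})"
    have "l $ k < ?F y $ k \<and> ?F y $ k < u $ k" for k
    proof -
      obtain j where "j < m" "k = \<beta> j" using surj by blast
      then show ?thesis using y by (simp only: Fi PiE_iff) auto
    qed
    then have "?F y \<in> box l u" by (simp only: mem_box_cart) blast
    then show "y \<in> ?F -` box l u \<inter> space ?M" using y by (simp only: vimage_eq Int_iff space_PiM PiE_iff) simp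
  qed
  have le': "l $ k \<le> u $ k" for k using le[of "axis k 1"] by (simp add: inner_axis axis_in_Basis_iff)
  have "emeasure (distr ?M borel ?F) (box l u) = emeasure ?M (?F -` box l u \<inter> space ?M)"
    by (subst emeasure_distr) auto
  also have "\<dots> = (\<Prod>j<m. emeasure lborel {l $ \<beta> j <..< u $ \<beta> j})"
    unfolding vimg by (subst emeasure_PiM) auto
  also have "\<dots> = (\<Prod>j<m. ennreal (u $ \<beta> j - l $ \<beta> j))" using le' by (intro prod.cong) auto
  also have "\<dots> = (\<Prod>k\<in>UNIV. ennreal (u $ k - l $ k))"
    by (rule prod.reindex_bij_betw[OF \<beta>, of "\<lambda>k. ennreal (u $ k - l $ k)"])
  also have "\<dots> = ennreal (\<Prod>k\<in>UNIV. u $ k - l $ k)" using le' by (subst prod_ennreal) auto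
  also have "(\<Prod>k\<in>UNIV. u $ k - l $ k) = (\<Prod>b\<in>Basis. (u - l) \<bullet> b)"
    by (simp add: Basis_vec_def cart_eq_inner_axis axis_eq_axis prod.UNION_disjoint inner_diff_left)
  finally show "emeasure (distr ?M borel ?F) (box l u) = (\<Prod>b\<in>Basis. (u - l) \<bullet> b)" .
qed

section \<open>Hyperplanes of sides, their charts and the coarea formula\<close>

text \<open>A predicate in contrast to \<open>unit_normal\<close>: a side has two unit normals, and
  later the one pointing into a given element is wanted. The dimension forces the affine hull of the
  side to be a whole hyperplane.\<close>

definition normal_to :: "(real^'n) set \<Rightarrow> real^'n \<Rightarrow> bool" where
  "normal_to E n \<longleftrightarrow> E \<noteq> {} \<and> aff_dim E = int CARD('n) - 1 \<and> norm n = 1 \<and> (\<forall>x\<in>E. \<forall>y\<in>E. n \<bullet> (x - y) = 0)"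

lemma affine_hull_normal:
  fixes E :: "(real^'n) set"
  assumes E: "normal_to E n" and c: "c \<in> E"
  shows "affine hull E = {x. n \<bullet> (x - c) = 0}"
proof -
  have "affine hull E = {x. n \<bullet> x = n \<bullet> c}"
  proof (rule affine_dim_equal)
    show "affine (affine hull E)" "affine {x. n \<bullet> x = n \<bullet> c}" by (simp_all add: affine_hyperplane)
    show "affine hull E \<noteq> {}" using c by auto
    have "n \<bullet> (x - c) = 0" if "x \<in> E" for x using E c that unfolding normal_to_def by blast
    then have "E \<subseteq> {x. n \<bullet> x = n \<bullet> c}" by (auto simp: inner_diff_right)
    then show "affine hull E \<subseteq> {x. n \<bullet> x = n \<bullet> c}" by (simp add: hull_minimal affine_hyperplane)
    have "n \<noteq> 0" using E by (auto simp: normal_to_def)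
    then show "aff_dim (affine hull E) = aff_dim {x. n \<bullet> x = n \<bullet> c}"
      using E by (simp add: normal_to_def)
  qed
  then show ?thesis by (simp add: inner_diff_right)
qed

text \<open>Makes the choice in \<open>surface_measure\<close> meaningful. The frame is an
  orthonormal basis of the complement of \<open>n\<close>, attached to a point of
  \<open>E\<close>.\<close>

lemma side_chart_exists:
  fixes E :: "(real^'n) set"
  assumes E: "normal_to E n"
  shows "\<exists>\<Phi>. side_chart E \<Phi>"
proof -
  obtain c where c: "c \<in> E" using E by (auto simp: normal_to_def)
  let ?V = "{x. n \<bullet> x = 0}"
  have n0: "n \<noteq> 0" using E by (auto simp: normal_to_def)
  obtain B where B: "B \<subseteq> ?V" "pairwise orthogonal B" "\<And>x. x \<in> B \<Longrightarrow> norm x = 1"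
      "independent B" "card B = dim ?V" "span B = ?V"
    using orthonormal_basis_subspace[OF subspace_hyperplane] by metis
  have cB: "card B = CARD('n) - 1" using B(5) n0 by (simp add: dim_hyperplane)
  have fB: "finite B" using B(4) independent_imp_finite by blast
  obtain e where e: "bij_betw e {..<CARD('n) - 1} B"
    using ex_bij_betw_nat_finite[OF fB] cB by (auto simp: atLeast0LessThan)
  define \<Phi> where "\<Phi> y = c + (\<Sum>i<CARD('n) - 1. y i *\<^sub>R e i)" for y :: "nat \<Rightarrow> real"
  have "e i \<bullet> e j = (if i = j then 1 else 0)" if "i < CARD('n) - 1" "j < CARD('n) - 1" for i j
  proof (cases "i = j")
    case True
    then show ?thesis using B(3)[of "e i"] e that by (auto simp: bij_betw_def norm_eq_1)
  next
    case False
    have "e i \<in> B" "e j \<in> B" using e that by (auto simp: bij_betw_def)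
    moreover have "e i \<noteq> e j" using e that False by (auto simp: bij_betw_def inj_on_def)
    ultimately show ?thesis using B(2) False by (auto simp: pairwise_def orthogonal_def)
  qed
  moreover have "range \<Phi> = affine hull E"
  proof -
    have "x \<in> range \<Phi>" if "n \<bullet> (x - c) = 0" for x
    proof -
      have "x - c \<in> span B" using B(6) that by simp
      then obtain u where "x - c = (\<Sum>b\<in>B. u b *\<^sub>R b)" using span_finite[OF fB] by auto
      also have "\<dots> = (\<Sum>i<CARD('n) - 1. u (e i) *\<^sub>R e i)"
        by (rule sum.reindex_bij_betw[OF e, symmetric])
      finally have "x = \<Phi> (\<lambda>i. u (e i))" by (simp add: \<Phi>_def algebra_simps)
      then show ?thesis by blast
    qed
    moreover have "n \<bullet> (\<Phi> y - c) = 0" for y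
    proof -
      have "n \<bullet> e i = 0" if "i < CARD('n) - 1" for i using B(1) e that by (auto simp: bij_betw_def)
      then show ?thesis by (simp add: \<Phi>_def inner_sum_right)
    qed
    ultimately show ?thesis unfolding affine_hull_normal[OF E c] by auto
  qed
  ultimately show ?thesis unfolding side_chart_def \<Phi>_def[abs_def] by blast
qed

text \<open>Unfolds the chart chosen in \<open>surface_measure\<close>. That its frame is orthogonal
  to \<open>n\<close> is read off from its range: the images of a unit vector and of the zero vector
  lie in the same hyperplane.\<close>

lemma surface_chart:
  fixes E :: "(real^'n) set"
  assumes E: "normal_to E n"
  shows "\<exists>a e. (\<forall>i<CARD('n) - 1. \<forall>j<CARD('n) - 1. e i \<bullet> e j = (if i = j then 1 else 0 :: real)) \<and>
    (\<forall>i<CARD('n) - 1. n \<bullet> e i = 0) \<and>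
    range (\<lambda>y. a + (\<Sum>i<CARD('n) - 1. y i *\<^sub>R e i)) = affine hull E \<and>
    surface_measure E = distr (PiM {..<CARD('n) - 1} (\<lambda>_. lborel)) borel (\<lambda>y. a + (\<Sum>i<CARD('n) - 1. y i *\<^sub>R e i))"
proof -
  have "side_chart E (SOME \<Phi>. side_chart E \<Phi>)" using someI_ex[OF side_chart_exists[OF E]] .
  then obtain a e where o: "\<forall>i<CARD('n) - 1. \<forall>j<CARD('n) - 1. e i \<bullet> e j = (if i = j then 1 else 0)"
    and \<Phi>: "(SOME \<Phi>. side_chart E \<Phi>) = (\<lambda>y. a + (\<Sum>i<CARD('n) - 1. y i *\<^sub>R e i))"
    and r: "range (SOME \<Phi>. side_chart E \<Phi>) = affine hull E"
    unfolding side_chart_def by blast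
  obtain c where c: "c \<in> E" using E by (auto simp: normal_to_def)
  have r': "range (\<lambda>y. a + (\<Sum>i<CARD('n) - 1. y i *\<^sub>R e i)) = {x. n \<bullet> (x - c) = 0}"
    using r unfolding \<Phi> affine_hull_normal[OF E c] .
  have "n \<bullet> e i = 0" if i: "i < CARD('n) - 1" for i
  proof -
    have z: "n \<bullet> ((a + (\<Sum>j<CARD('n) - 1. y j *\<^sub>R e j)) - c) = 0" for y
      using r' by blast
    have "(\<Sum>j<CARD('n) - 1. (if j = i then 1 else 0) *\<^sub>R e j) = e i"
      using i by (simp add: if_distrib[of "\<lambda>t. t *\<^sub>R _"] cong: if_cong)
    then show ?thesis using z[of "\<lambda>j. if j = i then 1 else 0"] z[of "\<lambda>j. 0"]
      by (simp add: inner_diff_right inner_add_right)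
  qed
  then show ?thesis using o r by (intro exI[of _ a] exI[of _ e]) (simp add: \<Phi> surface_measure_def)
qed

text \<open>The frame of the chart together with \<open>n\<close> is an orthonormal basis. A
  rotation carries the standard basis to it without changing Lebesgue measure, and Tonelli then
  splits off the last coordinate, the one along \<open>n\<close>.\<close>

lemma nn_integral_coarea:
  fixes E :: "(real^'n) set" and f :: "real^'n \<Rightarrow> ennreal"
  assumes E: "normal_to E n" and f [measurable]: "f \<in> borel_measurable borel"
  shows "(\<integral>\<^sup>+ x. f x \<partial>lborel) = (\<integral>\<^sup>+ z. (\<integral>\<^sup>+ s. f (z + s *\<^sub>R n) \<partial>lborel) \<partial>surface_measure E)"
proof -
  interpret product_sigma_finite "\<lambda>_::nat. lborel :: real measure" ..
  define k where "k = CARD('n) - 1"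
  have k: "CARD('n) = Suc k" by (simp add: k_def)
  from surface_chart[OF E] obtain a e where e0: "\<forall>i<CARD('n) - 1. \<forall>j<CARD('n) - 1. e i \<bullet> e j = (if i = j then 1 else 0 :: real)"
    "\<forall>i<CARD('n) - 1. n \<bullet> e i = 0"
    and "range (\<lambda>y. a + (\<Sum>i<CARD('n) - 1. y i *\<^sub>R e i)) = affine hull E"
    and S: "surface_measure E = distr (PiM {..<CARD('n) - 1} (\<lambda>_. lborel)) borel (\<lambda>y. a + (\<Sum>i<CARD('n) - 1. y i *\<^sub>R e i))"
    by (elim exE conjE)
  note e = e0[folded k_def, rule_format] and S = S[folded k_def]
  have nn: "n \<bullet> n = 1" using E by (simp add: normal_to_def norm_eq_1)
  define e' where "e' i = (if i < k then e i else n)" for i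
  have e': "e' i \<bullet> e' j = (if i = j then 1 else 0)" if "i < Suc k" "j < Suc k" for i j
    using that e nn by (auto simp: e'_def inner_commute less_Suc_eq)
  obtain \<beta> :: "nat \<Rightarrow> 'n" where \<beta>: "bij_betw \<beta> {..<Suc k} UNIV"
    using ex_bij_betw_nat_finite[of "UNIV :: 'n set"] k by (auto simp: atLeast0LessThan)
  define R where "R x = (\<Sum>i<Suc k. (x $ \<beta> i) *\<^sub>R e' i)" for x :: "real^'n"
  have lR: "linear R" unfolding R_def[abs_def]
    by (intro linearI) (auto simp: scaleR_left_distrib scaleR_right_distrib sum.distrib scaleR_sum_right)
  have "R x \<bullet> R y = x \<bullet> y" for x y
  proof -
    have "R x \<bullet> R y = (\<Sum>i<Suc k. \<Sum>j<Suc k. (x $ \<beta> i) * (y $ \<beta> j) * (e' i \<bullet> e' j))"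
      unfolding R_def inner_sum_left inner_sum_right by (subst sum.swap) (simp add: mult_ac)
    also have "\<dots> = (\<Sum>i<Suc k. \<Sum>j<Suc k. if i = j then (x $ \<beta> i) * (y $ \<beta> j) else 0)"
      using e' by (intro sum.cong refl) auto
    also have "\<dots> = (\<Sum>i<Suc k. (x $ \<beta> i) * (y $ \<beta> i))"
      by (intro sum.cong refl) (simp add: sum.delta)
    also have "\<dots> = (\<Sum>i\<in>UNIV. x $ i * y $ i)" by (rule sum.reindex_bij_betw[OF \<beta>])
    finally show ?thesis by (simp add: inner_vec_def)
  qed
  then have oR: "orthogonal_transformation R" using lR by (simp add: orthogonal_transformation_def)
  have Rm [measurable]: "R \<in> borel_measurable borel"
    using lR by (intro borel_measurable_continuous_onI linear_continuous_on) (simp add: linear_conv_bounded_linear)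
  have Rax: "R (\<Sum>i<Suc k. y i *\<^sub>R axis (\<beta> i) 1) = (\<Sum>i<Suc k. y i *\<^sub>R e' i)" for y
  proof -
    have "R (axis (\<beta> j) 1) = e' j" if "j < Suc k" for j
    proof -
      have "R (axis (\<beta> j) 1) = (\<Sum>i<Suc k. if i = j then e' i else 0)"
        unfolding R_def using \<beta> that by (intro sum.cong refl) (auto simp: axis_def bij_betw_def inj_on_def)
      then show ?thesis using that by simp
    qed
    then show ?thesis using lR by (simp add: linear_sum linear_scale linear_add)
  qed
  have "(\<integral>\<^sup>+ x. f x \<partial>lborel) = (\<integral>\<^sup>+ x. f (a + x) \<partial>lborel)"
    by (subst lborel_distr_plus[symmetric, of a], subst nn_integral_distr) auto
  also have "\<dots> = (\<integral>\<^sup>+ x. f (a + R x) \<partial>lborel)"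
    by (subst distr_lborel_orthogonal[OF oR, symmetric], subst nn_integral_distr) auto
  also have "\<dots> = (\<integral>\<^sup>+ y. f (a + R (\<Sum>i<Suc k. y i *\<^sub>R axis (\<beta> i) 1)) \<partial>PiM {..<Suc k} (\<lambda>_. lborel))"
    by (subst lborel_eq_distr_PiM[OF \<beta>], subst nn_integral_distr) auto
  also have "\<dots> = (\<integral>\<^sup>+ y. f (a + (\<Sum>i<Suc k. y i *\<^sub>R e' i)) \<partial>PiM (insert k {..<k}) (\<lambda>_. lborel))"
    unfolding Rax by (simp only: lessThan_Suc)
  also have "\<dots> = (\<integral>\<^sup>+ y. (\<integral>\<^sup>+ s. f (a + (\<Sum>i<Suc k. (y(k := s)) i *\<^sub>R e' i)) \<partial>lborel) \<partial>PiM {..<k} (\<lambda>_. lborel))"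
    by (subst product_nn_integral_insert) (auto simp: lessThan_Suc[symmetric])
  also have "\<dots> = (\<integral>\<^sup>+ y. (\<integral>\<^sup>+ s. f ((a + (\<Sum>i<k. y i *\<^sub>R e i)) + s *\<^sub>R n) \<partial>lborel) \<partial>PiM {..<k} (\<lambda>_. lborel))"
  proof -
    have "(\<Sum>i<Suc k. (y(k := s)) i *\<^sub>R e' i) = (\<Sum>i<k. y i *\<^sub>R e i) + s *\<^sub>R n" for y s
      by (auto simp: e'_def intro!: sum.cong)
    then show ?thesis by (simp add: add.assoc)
  qed
  also have "\<dots> = (\<integral>\<^sup>+ z. (\<integral>\<^sup>+ s. f (z + s *\<^sub>R n) \<partial>lborel) \<partial>surface_measure E)"
    unfolding S by (subst nn_integral_distr) auto
  finally show ?thesis .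
qed

lemma sets_surface_measure [simp, measurable_cong]: "sets (surface_measure E) = sets borel"
  by (simp add: surface_measure_def)

lemma space_surface_measure [simp]: "space (surface_measure E) = UNIV"
  by (simp add: surface_measure_def)

lemma AE_surface_measure:
  fixes E :: "(real^'n) set"
  assumes E: "normal_to E n"
  shows "AE z in surface_measure E. z \<in> affine hull E"
proof -
  from surface_chart[OF E] obtain a e where r: "range (\<lambda>y. a + (\<Sum>i<CARD('n) - 1. y i *\<^sub>R e i)) = affine hull E"
    and S: "surface_measure E = distr (PiM {..<CARD('n) - 1} (\<lambda>_. lborel)) borel (\<lambda>y. a + (\<Sum>i<CARD('n) - 1. y i *\<^sub>R e i))"
    by (elim exE conjE)
  have "{x \<in> space borel. x \<in> affine hull E} \<in> sets borel" by (simp add: borel_closed)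
  then show ?thesis unfolding S using r by (subst AE_distr_iff) auto
qed

text \<open>The nonnegative case, applied to indicators, says that Lebesgue measure is the image of
  the product of the chart parameters and the normal coordinate. Fubini for signed functions is
  applied on that product. The chart stays in the hyperplane, so \<open>g\<close> has to match the
  inner integrals only there.\<close>

lemma integral_coarea:
  fixes E :: "(real^'n) set" and f :: "real^'n \<Rightarrow> real"
  assumes E: "normal_to E n" and f: "integrable lborel f" "f \<in> borel_measurable borel"
    and g: "\<And>z. z \<in> affine hull E \<Longrightarrow> (LINT s|lborel. f (z + s *\<^sub>R n)) = g z" "g \<in> borel_measurable borel"
  shows "(LINT x|lborel. f x) = (LINT z|surface_measure E. g z)"
proof -
  note [measurable] = f(2) g(2)
  from surface_chart[OF E] obtain a e where r: "range (\<lambda>y. a + (\<Sum>i<CARD('n) - 1. y i *\<^sub>R e i)) = affine hull E"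
    and S: "surface_measure E = distr (PiM {..<CARD('n) - 1} (\<lambda>_. lborel)) borel (\<lambda>y. a + (\<Sum>i<CARD('n) - 1. y i *\<^sub>R e i))"
    by (elim exE conjE)
  let ?k = "CARD('n) - 1"
  interpret product_sigma_finite "\<lambda>_::nat. lborel :: real measure" ..
  define M where "M = PiM {..<?k} (\<lambda>_. lborel :: real measure)"
  interpret M: sigma_finite_measure M unfolding M_def by (rule sigma_finite) simp
  interpret P: pair_sigma_finite M "lborel :: real measure" ..
  define \<Phi> where "\<Phi> y = a + (\<Sum>i<?k. y i *\<^sub>R e i)" for y :: "nat \<Rightarrow> real"
  have [measurable]: "\<Phi> \<in> M \<rightarrow>\<^sub>M borel" unfolding \<Phi>_def M_def by measurable
  have SM: "surface_measure E = distr M borel \<Phi>" unfolding S M_def \<Phi>_def ..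
  define \<Psi> where "\<Psi> = (\<lambda>(y, s). \<Phi> y + s *\<^sub>R n)"
  have [measurable]: "\<Psi> \<in> (M \<Otimes>\<^sub>M lborel) \<rightarrow>\<^sub>M borel" unfolding \<Psi>_def by measurable
  have eq: "lborel = distr (M \<Otimes>\<^sub>M lborel) borel \<Psi>"
  proof (rule measure_eqI)
    fix A assume "A \<in> sets (lborel :: (real^'n) measure)"
    then have [measurable]: "A \<in> sets borel" by simp
    have "emeasure lborel A = (\<integral>\<^sup>+ x. indicator A x \<partial>lborel)" by simp
    also have "\<dots> = (\<integral>\<^sup>+ z. (\<integral>\<^sup>+ s. indicator A (z + s *\<^sub>R n) \<partial>lborel) \<partial>surface_measure E)"
      by (rule nn_integral_coarea[OF E]) measurable
    also have "\<dots> = (\<integral>\<^sup>+ y. (\<integral>\<^sup>+ s. indicator A (\<Psi> (y, s)) \<partial>lborel) \<partial>M)"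
      unfolding SM by (subst nn_integral_distr) (auto simp: \<Psi>_def)
    also have "\<dots> = (\<integral>\<^sup>+ p. indicator A (\<Psi> p) \<partial>(M \<Otimes>\<^sub>M lborel))"
      by (rule lborel.nn_integral_fst) measurable
    also have "\<dots> = (\<integral>\<^sup>+ x. indicator A x \<partial>distr (M \<Otimes>\<^sub>M lborel) borel \<Psi>)"
      by (subst nn_integral_distr) auto
    also have "\<dots> = emeasure (distr (M \<Otimes>\<^sub>M lborel) borel \<Psi>) A" by simp
    finally show "emeasure lborel A = emeasure (distr (M \<Otimes>\<^sub>M lborel) borel \<Psi>) A" .
  qed simp
  have "integrable (distr (M \<Otimes>\<^sub>M lborel) borel \<Psi>) f" using f(1) by (simp only: eq[symmetric])
  then have i: "integrable (M \<Otimes>\<^sub>M lborel) (\<lambda>p. f (\<Psi> p))" by (subst (asm) integrable_distr_eq) auto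
  have "(LINT x|lborel. f x) = (LINT x|distr (M \<Otimes>\<^sub>M lborel) borel \<Psi>. f x)" by (simp only: eq[symmetric])
  also have "\<dots> = (LINT p|(M \<Otimes>\<^sub>M lborel). f (\<Psi> p))" by (subst integral_distr) auto
  also have "\<dots> = (LINT y|M. LINT s|lborel. f (\<Psi> (y, s)))" using P.integral_fst'[OF i] by simp
  also have "\<dots> = (LINT y|M. g (\<Phi> y))"
  proof (rule Bochner_Integration.integral_cong[OF refl])
    fix y
    have "\<Phi> y \<in> affine hull E" using r by (auto simp: \<Phi>_def)
    then show "(LINT s|lborel. f (\<Psi> (y, s))) = g (\<Phi> y)" using g(1) by (simp add: \<Psi>_def)
  qed
  also have "\<dots> = (LINT z|surface_measure E. g z)" unfolding SM by (subst integral_distr) auto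
  finally show ?thesis .
qed

text \<open>The cylinder of height r erected on the part of the hyperplane in the ball lies in the
  ball of twice the radius. So volumes bound surface measures, and no surface measure is ever
  computed.\<close>

lemma surface_measure_cball:
  fixes E :: "(real^'n) set"
  assumes E: "normal_to E n" and r: "r > 0"
  shows "ennreal r * emeasure (surface_measure E) (cball c r) \<le> emeasure lborel (cball c (2 * r))"
proof -
  have "ennreal r * emeasure (surface_measure E) (cball c r)
      = (\<integral>\<^sup>+ z. ennreal r * indicator (cball c r) z \<partial>surface_measure E)"
    by (subst nn_integral_cmult) (auto intro!: borel_measurable_indicator)
  also have "\<dots> \<le> (\<integral>\<^sup>+ z. (\<integral>\<^sup>+ s. indicator (cball c (2 * r)) (z + s *\<^sub>R n) \<partial>lborel) \<partial>surface_measure E)"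
  proof (rule nn_integral_mono)
    fix z
    show "ennreal r * indicator (cball c r) z \<le> (\<integral>\<^sup>+ s. indicator (cball c (2 * r)) (z + s *\<^sub>R n) \<partial>lborel)"
    proof (cases "z \<in> cball c r")
      case True
      have "ennreal r = (\<integral>\<^sup>+ s. indicator {0..r} s \<partial>lborel)" using r by simp
      also have "\<dots> \<le> (\<integral>\<^sup>+ s. indicator (cball c (2 * r)) (z + s *\<^sub>R n) \<partial>lborel)"
      proof (rule nn_integral_mono)
        fix s :: real
        have "dist c (z + s *\<^sub>R n) \<le> 2 * r" if "0 \<le> s" "s \<le> r"
        proof -
          have "dist c (z + s *\<^sub>R n) \<le> dist c z + dist z (z + s *\<^sub>R n)" by (rule dist_triangle)
          also have "dist z (z + s *\<^sub>R n) = s" using that E by (simp add: dist_norm normal_to_def)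
          finally show ?thesis using True that by simp
        qed
        then show "indicator {0..r} s \<le> (indicator (cball c (2 * r)) (z + s *\<^sub>R n) :: ennreal)"
          by (auto simp: indicator_def)
      qed
      finally show ?thesis using True by simp
    qed simp
  qed
  also have "\<dots> = (\<integral>\<^sup>+ x. indicator (cball c (2 * r)) x \<partial>lborel)"
    by (rule nn_integral_coarea[OF E, symmetric]) (auto intro!: borel_measurable_indicator)
  also have "\<dots> = emeasure lborel (cball c (2 * r))" by simp
  finally show ?thesis .
qed

lemma surface_measure_cball_finite:
  fixes E :: "(real^'n) set"
  assumes E: "normal_to E n"
  shows "emeasure (surface_measure E) (cball c r) < \<infinity>"
proof -
  define R where "R = max r 1"
  have R: "R > 0" by (simp add: R_def)
  have "ennreal R * emeasure (surface_measure E) (cball c R) < \<infinity>"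
    using surface_measure_cball[OF E R, of c] emeasure_compact_finite[of "cball c (2 * R)"] by (simp add: order_le_less_trans)
  then have "emeasure (surface_measure E) (cball c R) < \<infinity>"
    using R by (auto simp: ennreal_mult_less_top)
  moreover have "emeasure (surface_measure E) (cball c r) \<le> emeasure (surface_measure E) (cball c R)"
    by (intro emeasure_mono) (auto simp: R_def)
  ultimately show ?thesis by (rule order_le_less_trans[rotated])
qed

lemma integrable_surface_bounded:
  fixes E :: "(real^'n) set" and f :: "real^'n \<Rightarrow> real"
  assumes E: "normal_to E n" and [measurable]: "f \<in> borel_measurable borel" and f: "\<And>x. \<bar>f x\<bar> \<le> C * indicator (cball c r) x"
  shows "integrable (surface_measure E) f"
proof (rule Bochner_Integration.integrable_bound)
  show "integrable (surface_measure E) (\<lambda>x. C * indicat_real (cball c r) x)"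
    using surface_measure_cball_finite[OF E, of c r]
    by (intro integrable_mult_right) (auto simp: integrable_indicator_iff)
  show "AE x in surface_measure E. norm (f x) \<le> norm (C * indicator (cball c r) x)"
    using f by (intro always_eventually allI) (metis abs_ge_self order_trans real_norm_def)
qed simp

section \<open>Green's formula on a half space\<close>

lemma integral_half_line:
  fixes H :: "real^'n \<Rightarrow> real"
  assumes H: "smooth H" "\<And>s. \<bar>s\<bar> > R \<Longrightarrow> H (z + s *\<^sub>R n) = 0"
    "\<And>s. \<bar>s\<bar> > R \<Longrightarrow> dderiv H n (z + s *\<^sub>R n) = 0"
  shows "(LINT s|lborel. indicator {0<..} s * dderiv H n (z + s *\<^sub>R n)) = - H z"
proof -
  define b where "b = \<bar>R\<bar> + 1"
  have b: "b > 0" "b > R" by (simp_all add: b_def)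
  have [measurable]: "dderiv H n \<in> borel_measurable borel"
    by (rule smooth_borel_measurable[OF smooth_dderiv[OF H(1)]])
  have "(LINT s|lborel. indicator {0<..} s * dderiv H n (z + s *\<^sub>R n))
      = (LINT s|lborel. indicator {0..b} s *\<^sub>R dderiv H n (z + s *\<^sub>R n))"
  proof (rule integral_cong_AE)
    show "AE s in lborel. indicator {0<..} s * dderiv H n (z + s *\<^sub>R n) = indicator {0..b} s *\<^sub>R dderiv H n (z + s *\<^sub>R n)"
      using AE_lborel_singleton[of 0]
    proof eventually_elim
      case (elim s)
      have "dderiv H n (z + s *\<^sub>R n) = 0" if "s > b" using that b by (intro H(3)) auto
      then show ?case using elim by (auto simp: indicator_def)
    qed
  qed measurable
  also have "\<dots> = H (z + b *\<^sub>R n) - H (z + 0 *\<^sub>R n)"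
  proof (rule integral_FTC_atLeastAtMost)
    show "((\<lambda>s. H (z + s *\<^sub>R n)) has_vector_derivative dderiv H n (z + s *\<^sub>R n)) (at s within {0..b})" for s
      using has_real_derivative_line[OF H(1), of z n s]
      by (simp add: has_real_derivative_iff_has_vector_derivative has_vector_derivative_at_within)
    show "continuous_on {0..b} (\<lambda>s. dderiv H n (z + s *\<^sub>R n))"
      by (rule continuous_on_compose2[OF smooth_continuous_on[OF smooth_dderiv[OF H(1)], of UNIV]])
        (auto intro!: continuous_intros)
  qed (use b in auto)
  also have "H (z + b *\<^sub>R n) = 0" using b by (intro H(2)) auto
  finally show ?thesis by simp
qed

lemma dderiv_eq_0_outside:
  assumes "closed K" "\<And>x. x \<notin> K \<Longrightarrow> f x = 0" "x \<notin> K"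
  shows "dderiv f v x = 0"
  using partial_eq_0_outside[OF assms] by (simp add: dderiv_def)

text \<open>The fundamental theorem on every half line in direction \<open>n\<close>. The minus sign
  is there because \<open>n\<close> points into the half space.\<close>

lemma integral_halfspace_normal:
  fixes E :: "(real^'n) set" and H :: "real^'n \<Rightarrow> real"
  assumes E: "normal_to E n" and c: "c \<in> E" and H: "smooth H" "compact K" "\<And>x. x \<notin> K \<Longrightarrow> H x = 0"
  shows "(LINT x|lborel. indicator {x. n \<bullet> (x - c) > 0} x * dderiv H n x) = - (LINT z|surface_measure E. H z)"
proof -
  have [measurable]: "H \<in> borel_measurable borel" "dderiv H n \<in> borel_measurable borel"
    using smooth_borel_measurable H(1) smooth_dderiv by blast+
  have A [measurable]: "{x. n \<bullet> (x - c) > 0} \<in> sets borel" by measurable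
  have clK: "closed K" using H(2) compact_imp_closed by blast
  have dd0: "dderiv H n x = 0" if "x \<notin> K" for x by (rule dderiv_eq_0_outside[OF clK H(3) that])
  obtain B where B: "B \<ge> 0" "\<forall>x\<in>K. \<bar>dderiv H n x\<bar> \<le> B"
    using bounded_on_compact[OF smooth_dderiv[OF H(1)] H(2)] by blast
  obtain R where R: "\<And>x. x \<in> K \<Longrightarrow> dist c x \<le> R"
    using compact_imp_bounded[OF H(2)] bounded_any_center[of K c] by blast
  have "(LINT x|lborel. indicator {x. n \<bullet> (x - c) > 0} x * dderiv H n x) = (LINT z|surface_measure E. - H z)"
  proof (rule integral_coarea[OF E])
    show "integrable lborel (\<lambda>x. indicat_real {x. n \<bullet> (x - c) > 0} x * dderiv H n x)"
      by (rule integrable_compact_bounded[OF _ H(2), of _ B]) (use B dd0 in \<open>auto simp: indicator_def\<close>)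
    fix z assume "z \<in> affine hull E"
    then have z: "n \<bullet> (z - c) = 0" using affine_hull_normal[OF E c] by auto
    have nn: "n \<bullet> n = 1" using E by (simp add: normal_to_def norm_eq_1)
    have zs: "n \<bullet> (z + s *\<^sub>R n - c) = s" for s
    proof -
      have "n \<bullet> (z + s *\<^sub>R n - c) = n \<bullet> (z - c) + s * (n \<bullet> n)" by (simp add: inner_diff_right inner_add_right)
      then show ?thesis using z nn by simp
    qed
    have out: "z + s *\<^sub>R n \<notin> K" if "\<bar>s\<bar> > R" for s
    proof
      assume "z + s *\<^sub>R n \<in> K"
      then have "dist c (z + s *\<^sub>R n) \<le> R" by (rule R)
      moreover have "\<bar>n \<bullet> (z + s *\<^sub>R n - c)\<bar> \<le> norm n * norm (z + s *\<^sub>R n - c)" by (rule Cauchy_Schwarz_ineq2)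
      ultimately show False using that zs[of s] E by (simp add: normal_to_def dist_norm norm_minus_commute)
    qed
    have "(LINT s|lborel. indicat_real {0<..} s * dderiv H n (z + s *\<^sub>R n)) = - H z"
      by (rule integral_half_line[OF H(1), of R]) (use out H(3) dd0 in auto)
    then show "(LINT s|lborel. indicat_real {x. n \<bullet> (x - c) > 0} (z + s *\<^sub>R n) * dderiv H n (z + s *\<^sub>R n)) = - H z"
      by (simp add: zs indicator_def)
  qed measurable
  then show ?thesis by simp
qed

lemma dderiv_mult:
  assumes "smooth f" "smooth g"
  shows "dderiv (\<lambda>x. f x * g x) v x = dderiv f v x * g x + f x * dderiv g v x"
proof -
  have "dderiv (\<lambda>x. f x * g x) v x = (\<Sum>i\<in>UNIV. (partial i f x * g x + f x * partial i g x) * v $ i)"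
    unfolding dderiv_def using assms by (intro sum.cong refl) (simp add: partial_mult smooth_differentiable)
  then show ?thesis by (simp add: dderiv_def sum_distrib_left sum_distrib_right sum.distrib[symmetric] algebra_simps)
qed

lemma dderiv_lincomb: "dderiv f (a *\<^sub>R v + w) x = a * dderiv f v x + dderiv f w x"
  by (simp add: dderiv_def sum_distrib_left sum.distrib[symmetric] algebra_simps)

lemma integrable_smooth_mult:
  fixes q \<phi> :: "real^'n \<Rightarrow> real"
  assumes "smooth q" "smooth \<phi>" "compact K" "\<And>x. x \<notin> K \<Longrightarrow> \<phi> x = 0" "A \<in> sets borel"
  shows "integrable lborel (\<lambda>x. indicator A x * q x * \<phi> x)"
proof -
  obtain B where B: "B \<ge> 0" "\<forall>x\<in>K. \<bar>q x * \<phi> x\<bar> \<le> B"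
    using bounded_on_compact[OF smooth_mult[OF assms(1,2)] assms(3)] by blast
  note [measurable] = assms(5) smooth_borel_measurable[OF assms(1)] smooth_borel_measurable[OF assms(2)]
  show ?thesis
    by (rule integrable_compact_bounded[OF _ assms(3), of _ B]) (use B assms(4) in \<open>auto simp: indicator_def\<close>)
qed

text \<open>The axis is split into a multiple of \<open>n\<close> and a vector w tangential to the
  hyperplane. Translations along w preserve the half space, so that part has no boundary term; the
  normal part comes from the product rule and the fundamental theorem.\<close>

lemma halfspace_ibp_axis:
  fixes E :: "(real^'n) set" and g \<phi> :: "real^'n \<Rightarrow> real"
  assumes E: "normal_to E n" and c: "c \<in> E" and \<phi>: "smooth \<phi>" "compact K" "\<And>x. x \<notin> K \<Longrightarrow> \<phi> x = 0" and g: "smooth g"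
  defines "A \<equiv> {x. n \<bullet> (x - c) > 0}"
  shows "(LINT x|lborel. indicator A x * g x * partial i \<phi> x)
    = - (LINT x|lborel. indicator A x * partial i g x * \<phi> x) - n $ i * (LINT z|surface_measure E. g z * \<phi> z)"
proof -
  have A [measurable]: "A \<in> sets borel" unfolding A_def by measurable
  define w where "w = axis i 1 - (n $ i) *\<^sub>R n"
  have ax: "axis i 1 = (n $ i) *\<^sub>R n + w" by (simp add: w_def)
  have nn: "n \<bullet> n = 1" using E by (simp add: normal_to_def norm_eq_1)
  have nw: "n \<bullet> w = 0" using nn by (simp add: w_def inner_diff_right inner_axis)
  have pd: "partial i f x = n $ i * dderiv f n x + dderiv f w x" for f x
    by (simp only: dderiv_axis[symmetric] ax dderiv_lincomb)
  have inv: "x - t *\<^sub>R w \<in> A \<longleftrightarrow> x \<in> A" for x t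
    using nw by (simp add: A_def inner_diff_right)
  have clK: "closed K" using \<phi>(2) compact_imp_closed by blast
  have int: "integrable lborel (\<lambda>x. indicator A x * q x * \<theta> x)" if "smooth q" "smooth \<theta>" "\<And>x. x \<notin> K \<Longrightarrow> \<theta> x = 0" for q \<theta>
    using integrable_smooth_mult[OF that(1,2) \<phi>(2) that(3) A] .
  have d0: "dderiv \<phi> v x = 0" if "x \<notin> K" for v x by (rule dderiv_eq_0_outside[OF clK \<phi>(3) that])
  have i1: "integrable lborel (\<lambda>x. indicator A x * g x * dderiv \<phi> v x)" for v
    by (rule int[OF g smooth_dderiv[OF \<phi>(1)] d0])
  have i2: "integrable lborel (\<lambda>x. indicator A x * dderiv g v x * \<phi> x)" for v
    by (rule int[OF smooth_dderiv[OF g] \<phi>(1,3)])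
  have tang: "(LINT x|lborel. indicator A x * g x * dderiv \<phi> w x) = - (LINT x|lborel. indicator A x * dderiv g w x * \<phi> x)"
    by (rule ibp_invariant[OF \<phi> g A inv])
  have "(LINT x|lborel. indicator A x * dderiv (\<lambda>x. g x * \<phi> x) n x) = - (LINT z|surface_measure E. g z * \<phi> z)"
    unfolding A_def using integral_halfspace_normal[OF E c smooth_mult[OF g \<phi>(1)] \<phi>(2)] \<phi>(3) by simp
  moreover have "(LINT x|lborel. indicator A x * dderiv (\<lambda>x. g x * \<phi> x) n x)
      = (LINT x|lborel. indicator A x * dderiv g n x * \<phi> x) + (LINT x|lborel. indicator A x * g x * dderiv \<phi> n x)"
    unfolding dderiv_mult[OF g \<phi>(1)]
    by (subst Bochner_Integration.integral_add[OF i2 i1, symmetric]) (simp add: algebra_simps)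
  ultimately have norm: "(LINT x|lborel. indicator A x * g x * dderiv \<phi> n x)
      = - (LINT x|lborel. indicator A x * dderiv g n x * \<phi> x) - (LINT z|surface_measure E. g z * \<phi> z)" by simp
  have "(LINT x|lborel. indicator A x * g x * partial i \<phi> x)
      = (LINT x|lborel. n $ i * (indicator A x * g x * dderiv \<phi> n x) + indicator A x * g x * dderiv \<phi> w x)"
    by (intro Bochner_Integration.integral_cong refl)
      (simp add: pd algebra_simps)
  also have "\<dots> = n $ i * (LINT x|lborel. indicator A x * g x * dderiv \<phi> n x) + (LINT x|lborel. indicator A x * g x * dderiv \<phi> w x)"
    using i1 by (subst Bochner_Integration.integral_add) auto
  also have "\<dots> = - (n $ i * (LINT x|lborel. indicator A x * dderiv g n x * \<phi> x) + (LINT x|lborel. indicator A x * dderiv g w x * \<phi> x))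
      - n $ i * (LINT z|surface_measure E. g z * \<phi> z)"
    unfolding tang norm by (simp add: algebra_simps)
  also have "n $ i * (LINT x|lborel. indicator A x * dderiv g n x * \<phi> x) + (LINT x|lborel. indicator A x * dderiv g w x * \<phi> x)
      = (LINT x|lborel. n $ i * (indicator A x * dderiv g n x * \<phi> x) + indicator A x * dderiv g w x * \<phi> x)"
    using i2 by (subst Bochner_Integration.integral_add) auto
  also have "\<dots> = (LINT x|lborel. indicator A x * partial i g x * \<phi> x)"
    by (intro Bochner_Integration.integral_cong refl)
      (simp add: pd algebra_simps)
  finally show ?thesis .
qed

lemma halfspace_green:
  fixes E :: "(real^'n) set" and q \<phi> :: "real^'n \<Rightarrow> real"
  assumes E: "normal_to E n" and c: "c \<in> E" and \<phi>: "smooth \<phi>" "compact K" "\<And>x. x \<notin> K \<Longrightarrow> \<phi> x = 0" and q: "smooth q"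
  defines "A \<equiv> {x. n \<bullet> (x - c) > 0}"
  shows "(LINT x|lborel. indicator A x * (grad q x \<bullet> grad \<phi> x))
    = - (LINT x|lborel. indicator A x * laplacian q x * \<phi> x) - (LINT z|surface_measure E. dderiv q n z * \<phi> z)"
proof -
  have A [measurable]: "A \<in> sets borel" unfolding A_def by measurable
  have clK: "closed K" using \<phi>(2) compact_imp_closed by blast
  have i1: "integrable lborel (\<lambda>x. indicator A x * partial i q x * partial i \<phi> x)" for i
    by (rule integrable_smooth_mult[OF smooth_partial[OF q] smooth_partial[OF \<phi>(1)] \<phi>(2) partial_eq_0_outside[OF clK \<phi>(3)] A])
  have i2: "integrable lborel (\<lambda>x. indicator A x * partial i (partial i q) x * \<phi> x)" for i
    by (rule integrable_smooth_mult[OF smooth_partial[OF smooth_partial[OF q]] \<phi> A])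
  have i3: "integrable (surface_measure E) (\<lambda>z. partial i q z * \<phi> z)" for i
  proof -
    obtain B where B: "B \<ge> 0" "\<forall>x\<in>K. \<bar>partial i q x * \<phi> x\<bar> \<le> B"
      using bounded_on_compact[OF smooth_mult[OF smooth_partial[OF q] \<phi>(1)] \<phi>(2)] by blast
    obtain R where R: "\<And>x. x \<in> K \<Longrightarrow> dist c x \<le> R"
      using compact_imp_bounded[OF \<phi>(2)] bounded_any_center[of K c] by blast
    show ?thesis
    proof (rule integrable_surface_bounded[OF E, of _ B c R])
      show "(\<lambda>z. partial i q z * \<phi> z) \<in> borel_measurable borel"
        by (rule smooth_borel_measurable[OF smooth_mult[OF smooth_partial[OF q] \<phi>(1)]])
      show "\<bar>partial i q x * \<phi> x\<bar> \<le> B * indicat_real (cball c R) x" for x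
        using B R[of x] \<phi>(3)[of x] by (cases "x \<in> K") (auto simp: indicator_def)
    qed
  qed
  have "(LINT x|lborel. indicator A x * (grad q x \<bullet> grad \<phi> x)) = (LINT x|lborel. (\<Sum>i\<in>UNIV. indicator A x * partial i q x * partial i \<phi> x))"
    by (simp add: grad_def inner_vec_def sum_distrib_left mult.assoc)
  also have "\<dots> = (\<Sum>i\<in>UNIV. LINT x|lborel. indicator A x * partial i q x * partial i \<phi> x)"
    by (rule Bochner_Integration.integral_sum) (rule i1)
  also have "\<dots> = (\<Sum>i\<in>UNIV. - (LINT x|lborel. indicator A x * partial i (partial i q) x * \<phi> x)
      - n $ i * (LINT z|surface_measure E. partial i q z * \<phi> z))"
    unfolding A_def by (intro sum.cong refl halfspace_ibp_axis[OF E c \<phi> smooth_partial[OF q]])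
  also have "\<dots> = - (\<Sum>i\<in>UNIV. LINT x|lborel. indicator A x * partial i (partial i q) x * \<phi> x)
      - (\<Sum>i\<in>UNIV. LINT z|surface_measure E. n $ i * (partial i q z * \<phi> z))"
    by (simp add: sum_subtractf sum_negf)
  also have "(\<Sum>i\<in>UNIV. LINT x|lborel. indicator A x * partial i (partial i q) x * \<phi> x)
      = (LINT x|lborel. indicator A x * laplacian q x * \<phi> x)"
    by (subst Bochner_Integration.integral_sum[symmetric, OF i2])
      (simp only: laplacian_def sum_distrib_left sum_distrib_right)
  also have "(\<Sum>i\<in>UNIV. LINT z|surface_measure E. n $ i * (partial i q z * \<phi> z)) = (LINT z|surface_measure E. dderiv q n z * \<phi> z)"
  proof -
    have "(\<Sum>i\<in>UNIV. LINT z|surface_measure E. n $ i * (partial i q z * \<phi> z))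
        = (LINT z|surface_measure E. (\<Sum>i\<in>UNIV. n $ i * (partial i q z * \<phi> z)))"
      by (rule Bochner_Integration.integral_sum[symmetric]) (intro integrable_mult_right i3)
    also have "(\<lambda>z. \<Sum>i\<in>UNIV. n $ i * (partial i q z * \<phi> z)) = (\<lambda>z. dderiv q n z * \<phi> z)"
      by (simp add: dderiv_def sum_distrib_right sum_distrib_left mult_ac)
    finally show ?thesis .
  qed
  finally show ?thesis .
qed

section \<open>Geometry of mesh elements\<close>

text \<open>After a rotation that takes a coordinate axis to \<open>n\<close>, the set lies in a box
  with one edge of length w and all others of length 2h.\<close>

lemma measure_slab:
  fixes T :: "(real^'n) set"
  assumes T: "compact T" "T \<subseteq> cball c h" and n: "norm n = 1" and b: "\<And>x. x \<in> T \<Longrightarrow> b \<le> n \<bullet> x \<and> n \<bullet> x \<le> b + w"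
    and h: "0 \<le> h" "0 \<le> w"
  shows "measure lebesgue T \<le> w * (2 * h) ^ (CARD('n) - 1)"
proof -
  define k :: 'n where "k = undefined"
  have "\<exists>f :: real^'n \<Rightarrow> real^'n. orthogonal_transformation f \<and> f (axis k 1) = n"
  proof (rule orthogonal_transformation_exists_1[of "axis k 1" n])
    show "norm (axis k 1 :: real^'n) = 1" by (simp add: norm_axis_1)
    show "norm n = 1" by (rule n)
    fix f :: "real^'n \<Rightarrow> real^'n"
    assume "orthogonal_transformation f" "f (axis k 1) = n"
    then show "\<exists>f :: real^'n \<Rightarrow> real^'n. orthogonal_transformation f \<and> f (axis k 1) = n" by auto
  qed
  then obtain f :: "real^'n \<Rightarrow> real^'n" where f: "orthogonal_transformation f" "f (axis k 1) = n" by blast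
  obtain c' where c': "f c' = c" using orthogonal_transformation_surj[OF f(1)] by (metis surjD)
  define lo hi where "lo = (\<chi> i. if i = k then b else c' $ i - h)" and "hi = (\<chi> i. if i = k then b + w else c' $ i + h)"
  have fm [measurable]: "f \<in> borel_measurable borel"
    using orthogonal_transformation_linear[OF f(1)]
    by (intro borel_measurable_continuous_onI linear_continuous_on) (simp add: linear_conv_bounded_linear)
  have sub: "f -` T \<subseteq> cbox lo hi"
  proof
    fix x assume "x \<in> f -` T"
    then have fx: "f x \<in> T" by simp
    have "x $ k = x \<bullet> axis k 1" by (simp add: inner_axis)
    also have "\<dots> = f x \<bullet> n" using f by (metis orthogonal_transformation_def)
    finally have k: "b \<le> x $ k" "x $ k \<le> b + w" using b[OF fx] by (simp_all add: inner_commute)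
    have "norm (x - c') = norm (f (x - c'))" using orthogonal_transformation_norm[OF f(1)] by simp
    also have "f (x - c') = f x - c" using c' orthogonal_transformation_linear[OF f(1)] by (simp add: linear_diff)
    finally have "norm (x - c') \<le> h" using fx T(2) by (auto simp: dist_norm norm_minus_commute)
    then have "\<bar>x $ i - c' $ i\<bar> \<le> h" for i using component_le_norm_cart[of "x - c'" i] by simp
    then have "c' $ i - h \<le> x $ i" "x $ i \<le> c' $ i + h" for i by (simp_all add: abs_le_iff algebra_simps)
    then show "x \<in> cbox lo hi" using k by (simp add: mem_box_cart lo_def hi_def)
  qed
  have Tb: "T \<in> sets borel" using T(1) by (rule borel_compact)
  have "emeasure lebesgue T = emeasure (distr lborel borel f) T" using Tb by (simp add: distr_lborel_orthogonal[OF f(1)])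
  also have "\<dots> = emeasure lborel (f -` T)" using Tb by (subst emeasure_distr) auto
  also have "\<dots> \<le> emeasure lborel (cbox lo hi)" by (rule emeasure_mono[OF sub]) simp
  also have "\<dots> = ennreal (measure lborel (cbox lo hi))" by (rule emeasure_eq_ennreal_measure) (simp add: emeasure_lborel_cbox_eq)
  finally have "emeasure lebesgue T \<le> ennreal (measure lborel (cbox lo hi))" .
  then have "measure lebesgue T \<le> measure lborel (cbox lo hi)"
    unfolding measure_def by (intro enn2real_leI) auto
  also have "\<dots> = (\<Prod>i\<in>UNIV. hi $ i - lo $ i)"
  proof -
    have "cbox lo hi \<noteq> {}" using h by (auto simp: interval_ne_empty_cart lo_def hi_def)
    then show ?thesis using content_cbox_cart[of lo hi] by simp
  qed
  also have "\<dots> = (\<Prod>i\<in>UNIV. if i = k then w else 2 * h)" by (intro prod.cong refl) (simp add: lo_def hi_def)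
  also have "\<dots> = w * (\<Prod>i\<in>UNIV - {k}. 2 * h)"
    by (subst prod.remove[of _ k]) (auto intro!: prod.cong)
  also have "\<dots> = w * (2 * h) ^ (CARD('n) - 1)" by (simp add: card_Diff_singleton)
  finally show ?thesis .
qed

text \<open>The inequalities are normalised so that each affine function ranges over \<open>[0, 1]\<close> on \<open>T\<close>.\<close>

definition halfspace_rep :: "(real^'n) set \<Rightarrow> ((real^'n) \<times> real) set \<Rightarrow> real^'n \<Rightarrow> bool" where
  "halfspace_rep T H c \<longleftrightarrow> finite H \<and> T = {x. \<forall>(a, b)\<in>H. b \<le> a \<bullet> x} \<and>
     (\<forall>(a, b)\<in>H. a \<noteq> 0 \<and> (\<forall>x\<in>T. a \<bullet> x \<le> b + 1) \<and> b + 1 / (real CARD('n) + 1) \<le> a \<bullet> c)"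

section \<open>Simplices and parallelotopes as intersections of half spaces, and their inscribed
  balls\<close>

lemma linear_real_inner:
  fixes g :: "real^'n \<Rightarrow> real"
  assumes "linear g"
  shows "\<exists>a. \<forall>x. g x = a \<bullet> x"
  using adjoint_works[OF assms, of _ 1] by (intro exI[of _ "adjoint g 1"]) (simp add: inner_commute)

text \<open>\<open>a u \<bullet> x - b u\<close> is the barycentric coordinate of x belonging to the
  vertex u. These coordinates are defined on the whole space because d + 1 affinely independent
  points span it, and the simplex is where all of them are nonnegative.\<close>

lemma barycentric:
  fixes C :: "(real^'n) set"
  assumes C: "\<not> affine_dependent C" "card C = CARD('n) + 1"
  obtains a b where "\<And>u v. u \<in> C \<Longrightarrow> v \<in> C \<Longrightarrow> a u \<bullet> v - b u = (if v = u then 1 else 0)"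
    "\<And>x. x = (\<Sum>u\<in>C. (a u \<bullet> x - b u) *\<^sub>R u)" "\<And>x. (\<Sum>u\<in>C. a u \<bullet> x - b u) = 1"
    "\<And>x. x \<in> convex hull C \<longleftrightarrow> (\<forall>u\<in>C. 0 \<le> a u \<bullet> x - b u)"
    "\<And>u t. u \<in> C \<Longrightarrow> sum t C = 1 \<Longrightarrow> a u \<bullet> (\<Sum>v\<in>C. t v *\<^sub>R v) - b u = t u"
proof -
  have fC: "finite C" using C(2) card.infinite by fastforce
  have "\<exists>a b. \<forall>v\<in>C. a \<bullet> v - b = (if v = u then 1 else 0)" if u: "u \<in> C" for u
  proof -
    have "card (C - {u}) > 0" using C(2) u fC by simp
    \<comment> \<open>Another vertex serves as origin: the differences to it are independent, so
      there is a linear form that is 1 at u - v0 and 0 at the other differences.\<close>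
    then obtain v0 where v0: "v0 \<in> C" "v0 \<noteq> u" by (metis Diff_iff card_gt_0_iff ex_in_conv insertCI)
    have "independent ((\<lambda>x. - v0 + x) ` (C - {v0}))"
      using affine_dependent_iff_dependent2[OF v0(1)] C(1) by simp
    then have "\<exists>g. linear g \<and> (\<forall>x\<in>(\<lambda>x. - v0 + x) ` (C - {v0}). g x = (if x = - v0 + u then 1 else 0 :: real))"
      by (rule linear_independent_extend)
    then obtain g :: "real^'n \<Rightarrow> real" where g: "linear g"
      "\<forall>x\<in>(\<lambda>x. - v0 + x) ` (C - {v0}). g x = (if x = - v0 + u then 1 else 0 :: real)" by (elim exE conjE)
    obtain a where a: "\<And>x. g x = a \<bullet> x" using linear_real_inner[OF g(1)] by blast
    have "a \<bullet> v - a \<bullet> v0 = (if v = u then 1 else 0)" if "v \<in> C" for v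
    proof (cases "v = v0")
      case False
      then have "g (- v0 + v) = (if v = u then 1 else 0)" using g(2) that by auto
      then show ?thesis unfolding a by (simp add: inner_diff_right inner_add_right)
    qed (use v0 in simp)
    then show ?thesis by blast
  qed
  then obtain a b where ab: "\<And>u v. u \<in> C \<Longrightarrow> v \<in> C \<Longrightarrow> a u \<bullet> v - b u = (if v = u then 1 else 0)" by metis
  have "aff_dim C = int (CARD('n))" using C aff_dim_affine_independent[OF C(1)] by simp
  then have full: "affine hull C = UNIV" using aff_dim_eq_full[of C] by simp
  have comb: "a u \<bullet> (\<Sum>v\<in>C. t v *\<^sub>R v) - b u = t u" if u: "u \<in> C" and "sum t C = 1" for t u
  proof -
    have "a u \<bullet> (\<Sum>v\<in>C. t v *\<^sub>R v) - b u = (\<Sum>v\<in>C. t v * (a u \<bullet> v)) - (\<Sum>v\<in>C. t v) * b u"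
      using that by (simp add: inner_sum_right)
    also have "\<dots> = (\<Sum>v\<in>C. t v * (a u \<bullet> v - b u))"
      by (simp only: right_diff_distrib sum_subtractf sum_distrib_right)
    also have "\<dots> = (\<Sum>v\<in>C. if v = u then t v else 0)" using ab[OF u] by (intro sum.cong) auto
    finally show ?thesis using u fC by simp
  qed
  have x: "x = (\<Sum>u\<in>C. (a u \<bullet> x - b u) *\<^sub>R u) \<and> (\<Sum>u\<in>C. a u \<bullet> x - b u) = 1" for x
  proof -
    have "x \<in> affine hull C" using full by simp
    then obtain t where t: "sum t C = 1" "(\<Sum>v\<in>C. t v *\<^sub>R v) = x"
      unfolding affine_hull_finite[OF fC] by blast
    have l: "a u \<bullet> x - b u = t u" if u: "u \<in> C" for u using comb[OF u t(1)] t(2) by simp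
    have "(\<Sum>u\<in>C. (a u \<bullet> x - b u) *\<^sub>R u) = (\<Sum>u\<in>C. t u *\<^sub>R u)" using l by (intro sum.cong) auto
    moreover have "(\<Sum>u\<in>C. a u \<bullet> x - b u) = sum t C" using l by (intro sum.cong) auto
    ultimately show ?thesis using t by simp
  qed
  have hull: "x \<in> convex hull C \<longleftrightarrow> (\<forall>u\<in>C. 0 \<le> a u \<bullet> x - b u)" for x
  proof
    assume "x \<in> convex hull C"
    then obtain t where t: "\<forall>u\<in>C. 0 \<le> t u" "sum t C = 1" "(\<Sum>v\<in>C. t v *\<^sub>R v) = x"
      unfolding convex_hull_finite[OF fC] by blast
    show "\<forall>u\<in>C. 0 \<le> a u \<bullet> x - b u"
    proof
      fix u assume u: "u \<in> C"
      show "0 \<le> a u \<bullet> x - b u" using comb[OF u t(2)] t(1) u unfolding t(3) by simp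
    qed
  next
    assume "\<forall>u\<in>C. 0 \<le> a u \<bullet> x - b u"
    moreover have "sum (\<lambda>u. a u \<bullet> x - b u) C = 1" "(\<Sum>u\<in>C. (a u \<bullet> x - b u) *\<^sub>R u) = x"
      using x[of x] by simp_all
    ultimately show "x \<in> convex hull C" unfolding convex_hull_finite[OF fC]
      by (intro CollectI exI[of _ "\<lambda>u. a u \<bullet> x - b u"] conjI)
  qed
  show ?thesis
  proof (rule that[of a b])
    show "x = (\<Sum>u\<in>C. (a u \<bullet> x - b u) *\<^sub>R u)" "(\<Sum>u\<in>C. a u \<bullet> x - b u) = 1" for x
      using x[of x] by simp_all
    show "a u \<bullet> v - b u = (if v = u then 1 else 0)" if "u \<in> C" "v \<in> C" for u v using ab that .
    show "x \<in> convex hull C \<longleftrightarrow> (\<forall>u\<in>C. 0 \<le> a u \<bullet> x - b u)" for x by (rule hull)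
    show "a u \<bullet> (\<Sum>v\<in>C. t v *\<^sub>R v) - b u = t u" if "u \<in> C" "sum t C = 1" for u t using comb that .
  qed
qed

text \<open>\<open>c\<close> is the centroid, whose barycentric coordinates all equal 1/(d + 1). On
  the simplex no coordinate exceeds 1, since they are nonnegative with sum 1.\<close>

lemma simplex_rep:
  fixes C :: "(real^'n) set"
  assumes C: "\<not> affine_dependent C" "card C = CARD('n) + 1"
  shows "\<exists>H c. halfspace_rep (convex hull C) H c"
proof (rule barycentric[OF C])
  fix a b
  assume ab: "\<And>u v. u \<in> C \<Longrightarrow> v \<in> C \<Longrightarrow> a u \<bullet> v - b u = (if v = u then 1 else 0)"
    and s1: "\<And>x. (\<Sum>u\<in>C. a u \<bullet> x - b u) = 1"
    and hull: "\<And>x. x \<in> convex hull C \<longleftrightarrow> (\<forall>u\<in>C. 0 \<le> a u \<bullet> x - b u)"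
    and comb: "\<And>u t. u \<in> C \<Longrightarrow> sum t C = 1 \<Longrightarrow> a u \<bullet> (\<Sum>v\<in>C. t v *\<^sub>R v) - b u = t u"
  have fC: "finite C" using C(2) card.infinite by fastforce
  define c where "c = (\<Sum>v\<in>C. (1 / (real CARD('n) + 1)) *\<^sub>R v)"
  have c: "b u + 1 / (real CARD('n) + 1) \<le> a u \<bullet> c" if "u \<in> C" for u
  proof -
    have "a u \<bullet> c - b u = 1 / (real CARD('n) + 1)"
      unfolding c_def using C(2) by (intro comb[OF that]) (simp add: add_nonneg_eq_0_iff add.commute)
    then show ?thesis by linarith
  qed
  have one: "a u \<bullet> x \<le> b u + 1" if u: "u \<in> C" and x: "x \<in> convex hull C" for u x
  proof -
    have "a u \<bullet> x - b u \<le> (\<Sum>v\<in>C. a v \<bullet> x - b v)"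
      using x u fC unfolding hull by (intro member_le_sum) auto
    then show ?thesis using s1[of x] by simp
  qed
  have a0: "a u \<noteq> 0" if u: "u \<in> C" for u
  proof
    assume z: "a u = 0"
    have "card (C - {u}) > 0" using C(2) u fC by simp
    then obtain v where v: "v \<in> C" "v \<noteq> u" by (metis Diff_iff card_gt_0_iff ex_in_conv insertCI)
    show False using ab[OF u u] ab[OF u v(1)] v(2) z by simp
  qed
  have T: "convex hull C = {x. \<forall>u\<in>C. b u \<le> a u \<bullet> x}" by (auto simp: hull)
  have "halfspace_rep (convex hull C) ((\<lambda>u. (a u, b u)) ` C) c"
    unfolding halfspace_rep_def
  proof (intro conjI)
    show "finite ((\<lambda>u. (a u, b u)) ` C)" using fC by simp
    show "convex hull C = {x. \<forall>(a, b)\<in>(\<lambda>u. (a u, b u)) ` C. b \<le> a \<bullet> x}" unfolding T by auto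
    show "\<forall>(a, b)\<in>(\<lambda>u. (a u, b u)) ` C. a \<noteq> 0 \<and> (\<forall>x\<in>convex hull C. a \<bullet> x \<le> b + 1) \<and>
        b + 1 / (real CARD('n) + 1) \<le> a \<bullet> c"
      using a0 one c by auto
  qed
  then show ?thesis by blast
qed

text \<open>\<open>f\<close> is the basis dual to the edge vectors.\<close>

lemma parallelotope_coords:
  fixes v :: "'n::finite \<Rightarrow> real^'n"
  assumes v: "inj v" "independent (range v)"
  obtains f where "\<And>i j. f i \<bullet> v j = (if j = i then 1 else 0)" "\<And>x. x = (\<Sum>i\<in>UNIV. (f i \<bullet> x) *\<^sub>R v i)"
proof -
  have "\<exists>f. \<forall>j. f \<bullet> v j = (if j = i then 1 else 0)" for i
  proof -
    obtain g :: "real^'n \<Rightarrow> real" where g: "linear g" "\<And>x. x \<in> range v \<Longrightarrow> g x = (if x = v i then 1 else 0)"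
      using linear_independent_extend[OF v(2), of "\<lambda>x. if x = v i then 1 else 0"] by auto
    obtain a where a: "\<And>x. g x = a \<bullet> x" using linear_real_inner[OF g(1)] by blast
    have "a \<bullet> v j = (if j = i then 1 else 0)" for j using g(2)[of "v j"] v(1) by (simp add: a inj_eq)
    then show ?thesis by blast
  qed
  then obtain f where f: "\<And>i j. f i \<bullet> v j = (if j = i then 1 else 0)" by metis
  have "card (range v) = CARD('n)" using v(1) by (simp add: card_image)
  then have "dim (range v) = CARD('n)" using v(2) by (simp add: dim_eq_card_independent)
  then have "span (range v) = UNIV" using dim_eq_full[of "range v"] by simp
  have "x = (\<Sum>i\<in>UNIV. (f i \<bullet> x) *\<^sub>R v i)" for x
  proof -
    have "x \<in> span (range v)" using \<open>span (range v) = UNIV\<close> by simp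
    then obtain t where "x = (\<Sum>y\<in>range v. t y *\<^sub>R y)" using span_finite[of "range v"] by auto
    then have t: "x = (\<Sum>i\<in>UNIV. t (v i) *\<^sub>R v i)" using v(1) by (simp add: sum.reindex)
    have "f i \<bullet> x = t (v i)" for i
    proof -
      have "f i \<bullet> x = (\<Sum>j\<in>UNIV. t (v j) * (f i \<bullet> v j))" by (subst t) (simp add: inner_sum_right)
      also have "\<dots> = (\<Sum>j\<in>UNIV. if j = i then t (v j) else 0)" using f by (intro sum.cong) auto
      finally show ?thesis by simp
    qed
    then show ?thesis using t by simp
  qed
  then show ?thesis using that f by blast
qed

lemma parallelotope_eq:
  fixes v :: "'n::finite \<Rightarrow> real^'n"
  assumes f: "\<And>i j. f i \<bullet> v j = (if j = i then 1 else 0)" "\<And>x. x = (\<Sum>i\<in>UNIV. (f i \<bullet> x) *\<^sub>R v i)"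
  shows "{p + (\<Sum>i\<in>UNIV. t i *\<^sub>R v i) | t. \<forall>i. 0 \<le> t i \<and> t i \<le> 1} = {x. \<forall>i. 0 \<le> f i \<bullet> (x - p) \<and> f i \<bullet> (x - p) \<le> (1::real)}"
proof (intro set_eqI iffI)
  fix x assume "x \<in> {p + (\<Sum>i\<in>UNIV. t i *\<^sub>R v i) | t. \<forall>i. 0 \<le> t i \<and> t i \<le> 1}"
  then obtain t where t: "x = p + (\<Sum>i\<in>UNIV. t i *\<^sub>R v i)" "\<forall>i. 0 \<le> t i \<and> t i \<le> 1" by auto
  have "f i \<bullet> (x - p) = t i" for i
  proof -
    have "f i \<bullet> (x - p) = (\<Sum>j\<in>UNIV. t j * (f i \<bullet> v j))" by (simp add: t(1) inner_sum_right)
    also have "\<dots> = (\<Sum>j\<in>UNIV. if j = i then t j else 0)" using f(1) by (intro sum.cong) auto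
    finally show ?thesis by simp
  qed
  then show "x \<in> {x. \<forall>i. 0 \<le> f i \<bullet> (x - p) \<and> f i \<bullet> (x - p) \<le> (1::real)}" using t(2) by simp
next
  fix x assume x: "x \<in> {x. \<forall>i. 0 \<le> f i \<bullet> (x - p) \<and> f i \<bullet> (x - p) \<le> (1::real)}"
  have "x = p + (\<Sum>i\<in>UNIV. (f i \<bullet> (x - p)) *\<^sub>R v i)" using f(2)[of "x - p"] by (simp add: algebra_simps)
  then show "x \<in> {p + (\<Sum>i\<in>UNIV. t i *\<^sub>R v i) | t. \<forall>i. 0 \<le> t i \<and> t i \<le> 1}" using x
    by (intro CollectI exI[of _ "\<lambda>i. f i \<bullet> (x - p)"]) auto
qed

text \<open>Each dual vector gives two inequalities. At the centre both hold with slack 1/2, which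
  is weakened to 1/(d + 1) to share one constant with simplices.\<close>

lemma parallelotope_rep:
  fixes v :: "'n::finite \<Rightarrow> real^'n"
  assumes v: "inj v" "independent (range v)"
  shows "\<exists>H c. halfspace_rep {p + (\<Sum>i\<in>UNIV. t i *\<^sub>R v i) | t. \<forall>i. 0 \<le> t i \<and> t i \<le> 1} H c"
proof -
  obtain f where f: "\<And>i j. f i \<bullet> v j = (if j = i then 1 else 0)" "\<And>x. x = (\<Sum>i\<in>UNIV. (f i \<bullet> x) *\<^sub>R v i)"
    using parallelotope_coords[OF v] by metis
  define H where "H = range (\<lambda>i. (f i, f i \<bullet> p)) \<union> range (\<lambda>i. (- f i, - (f i \<bullet> p) - 1))"
  define c where "c = p + (\<Sum>i\<in>UNIV. (1/2) *\<^sub>R v i)"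
  have fc: "f i \<bullet> c = f i \<bullet> p + 1 / 2" for i
  proof -
    have "f i \<bullet> c = f i \<bullet> p + (\<Sum>j\<in>UNIV. (1/2) * (f i \<bullet> v j))" by (simp add: c_def inner_add_right inner_sum_right)
    also have "(\<Sum>j\<in>UNIV. (1/2) * (f i \<bullet> v j)) = (\<Sum>j\<in>UNIV. if j = i then 1 / 2 else 0)" using f(1) by (intro sum.cong) auto
    finally show ?thesis by simp
  qed
  have f0: "f i \<noteq> 0" for i using f(1)[of i i] by auto
  have d: "1 / (real CARD('n) + 1) \<le> 1 / 2"
    using zero_less_card_finite[where 'a = 'n] by (intro divide_left_mono) auto
  have d2: "1 / (real CARD('n) + 1) - 1 \<le> - (1 / 2)" using d by linarith
  have "halfspace_rep {x. \<forall>i. 0 \<le> f i \<bullet> (x - p) \<and> f i \<bullet> (x - p) \<le> (1::real)} H c"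
    unfolding halfspace_rep_def
  proof (intro conjI)
    show "finite H" by (simp add: H_def)
    show "{x. \<forall>i. 0 \<le> f i \<bullet> (x - p) \<and> f i \<bullet> (x - p) \<le> 1} = {x. \<forall>(a, b)\<in>H. b \<le> a \<bullet> x}"
      unfolding H_def ball_Un by (auto simp: inner_diff_right algebra_simps)
    have "f i \<bullet> x \<le> f i \<bullet> p + 1 \<and> f i \<bullet> p \<le> f i \<bullet> x"
      if "\<forall>i. 0 \<le> f i \<bullet> (x - p) \<and> f i \<bullet> (x - p) \<le> 1" for x i
      using that[rule_format, of i] by (simp add: inner_diff_right)
    then show "\<forall>(a, b)\<in>H. a \<noteq> 0 \<and> (\<forall>x\<in>{x. \<forall>i. 0 \<le> f i \<bullet> (x - p) \<and> f i \<bullet> (x - p) \<le> 1}. a \<bullet> x \<le> b + 1) \<and>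
        b + 1 / (real CARD('n) + 1) \<le> a \<bullet> c"
      unfolding H_def ball_Un using f0 by (auto simp: fc d d2)
  qed
  then show ?thesis unfolding parallelotope_eq[OF f, symmetric] by blast
qed

lemma shape_rep:
  fixes T :: "(real^'n) set"
  assumes "is_simplex T \<or> is_parallelotope T"
  shows "\<exists>H c. halfspace_rep T H c"
proof -
  have "\<exists>H c. halfspace_rep T H c" if T: "is_simplex T"
  proof -
    obtain C where "\<not> affine_dependent C" "int (card C) = int CARD('n) + 1" "T = convex hull C"
      using T unfolding is_simplex_def simplex_def by blast
    then show ?thesis using simplex_rep[of C] by simp
  qed
  moreover have "\<exists>H c. halfspace_rep T H c" if T: "is_parallelotope T"
    using T parallelotope_rep unfolding is_parallelotope_def by blast
  ultimately show ?thesis using assms by blast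
qed

lemma halfspace_rep_polyhedron:
  assumes "halfspace_rep T H c"
  shows "polyhedron T"
proof -
  have "T = \<Inter> ((\<lambda>(a, b). {x. b \<le> a \<bullet> x}) ` H)" using assms by (auto simp: halfspace_rep_def)
  also have "polyhedron \<dots>" using assms
    by (intro polyhedron_Inter) (auto simp: halfspace_rep_def polyhedron_halfspace_ge)
  finally show ?thesis .
qed

lemma shape_compact:
  fixes T :: "(real^'n) set"
  assumes "is_simplex T \<or> is_parallelotope T"
  shows "compact T"
proof -
  have "compact T" if T: "is_simplex T"
  proof -
    obtain C where "\<not> affine_dependent C" "T = convex hull C"
      using T unfolding is_simplex_def simplex_def by blast
    then show ?thesis using finite_imp_compact_convex_hull[OF aff_independent_finite] by blast
  qed
  moreover have "compact T" if T: "is_parallelotope T"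
  proof -
    obtain p and v :: "'n \<Rightarrow> real^'n" where v: "inj v" "independent (range v)" and
      T: "T = {p + (\<Sum>i\<in>UNIV. t i *\<^sub>R v i) | t. \<forall>i. 0 \<le> t i \<and> t i \<le> 1}"
      using T unfolding is_parallelotope_def by blast
    have "T = (\<lambda>t :: real^'n. p + (\<Sum>i\<in>UNIV. (t $ i) *\<^sub>R v i)) ` cbox 0 1" (is "_ = ?F ` _")
    proof (intro set_eqI iffI)
      fix x assume "x \<in> T"
      then obtain t where t: "x = p + (\<Sum>i\<in>UNIV. t i *\<^sub>R v i)" "\<forall>i. 0 \<le> t i \<and> t i \<le> 1" unfolding T by auto
      then show "x \<in> ?F ` cbox 0 1" by (intro image_eqI[of _ _ "\<chi> i. t i"]) (auto simp: mem_box_cart)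
    qed (auto simp: T mem_box_cart)
    then show ?thesis by (simp add: compact_continuous_image continuous_intros)
  qed
  ultimately show ?thesis using assms by blast
qed

lemma subset_cball_diameter:
  assumes "compact T" "x \<in> T"
  shows "T \<subseteq> cball x (diameter T)"
  using diameter_bounded_bound[OF compact_imp_bounded[OF assms(1)] assms(2)] by auto

text \<open>Since the affine function of an inequality ranges in [0, 1] on \<open>T\<close>, the
  element lies in a slab of width 1/|a| and in a ball of radius h. The volume bound therefore gives
  h |a| \<le> C0 2^(d-1). Hence within distance \<rho> h of \<open>c\<close> the function falls by
  at most 1/(d + 1), which does not exceed its value at \<open>c\<close>.\<close>

lemma inscribed_ball:
  fixes T :: "(real^'n) set" and C0 \<rho> :: real
  assumes T: "is_simplex T \<or> is_parallelotope T" and C0: "C0 > 0"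
    and m: "diameter T ^ CARD('n) / C0 \<le> measure lebesgue T"
    and \<rho>: "\<rho> = 1 / ((CARD('n) + 1) * (C0 * 2 ^ (CARD('n) - 1)))"
  shows "\<exists>c. cball c (\<rho> * diameter T) \<subseteq> T" "diameter T > 0"
proof -
  obtain H c where H: "halfspace_rep T H c" using shape_rep[OF T] by blast
  have cT: "compact T" by (rule shape_compact[OF T])
  have TH: "T = {x. \<forall>(a, b)\<in>H. b \<le> a \<bullet> x}" and fH: "finite H"
    using H by (simp_all only: halfspace_rep_def)
  have ab: "a \<noteq> 0 \<and> (\<forall>x\<in>T. a \<bullet> x \<le> b + 1) \<and> b + 1 / (real CARD('n) + 1) \<le> a \<bullet> c" if "(a, b) \<in> H" for a b
    using H that unfolding halfspace_rep_def by blast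
  have strict: "b < a \<bullet> c" if "(a, b) \<in> H" for a b
  proof -
    have "0 < 1 / (real CARD('n) + 1)" by simp
    then show ?thesis using ab[OF that] by linarith
  qed
  then have cin: "c \<in> T" unfolding TH using less_imp_le by blast
  define h where "h = diameter T"
  have h0: "h \<ge> 0" unfolding h_def by (rule diameter_ge_0[OF compact_imp_bounded[OF cT]])
  have Tc: "T \<subseteq> cball c h" unfolding h_def by (rule subset_cball_diameter[OF cT cin])
  define k where "k = CARD('n) - 1"
  have k: "CARD('n) = Suc k" by (simp add: k_def)
  have d1: "0 < real CARD('n) + 1" by simp
  \<comment> \<open>A ball of unspecified radius, from which it is seen that the diameter is
    positive.\<close>
  have bound: "\<exists>e>0. cball c e \<subseteq> T"
  proof -
    have "c \<in> {x. \<forall>(a, b)\<in>H. b < a \<bullet> x}" using strict by blast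
    moreover have "open {x. \<forall>(a, b)\<in>H. b < a \<bullet> x}"
    proof -
      have "{x. \<forall>(a, b)\<in>H. b < a \<bullet> x} = (\<Inter>(a, b)\<in>H. {x. a \<bullet> x > b})" by auto
      then show ?thesis using fH by (auto intro!: open_INT open_halfspace_gt)
    qed
    ultimately obtain e where "e > 0" "cball c e \<subseteq> {x. \<forall>(a, b)\<in>H. b < a \<bullet> x}"
      using open_contains_cball by blast
    moreover have "{x. \<forall>(a, b)\<in>H. b < a \<bullet> x} \<subseteq> T" unfolding TH by (auto intro: less_imp_le)
    ultimately show ?thesis by blast
  qed
  then obtain e where e: "e > 0" "cball c e \<subseteq> T" by blast
  have h: "h > 0"
  proof (rule ccontr)
    assume "\<not> h > 0"
    then have "cball c e \<subseteq> {c}" using Tc h0 e by auto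
    moreover have "c + e *\<^sub>R axis undefined 1 \<in> cball c e" using e(1) by (simp add: dist_norm norm_axis_1)
    ultimately have "e *\<^sub>R (axis undefined 1 :: real^'n) = 0" by auto
    then show False using e(1) by (simp add: axis_eq_0_iff)
  qed
  then show "diameter T > 0" by (simp add: h_def)
  have "cball c (\<rho> * h) \<subseteq> T"
  proof
    fix x assume "x \<in> cball c (\<rho> * h)"
    then have x: "norm (x - c) \<le> \<rho> * h" by (simp add: dist_norm norm_minus_commute)
    have "b \<le> a \<bullet> x" if abH: "(a, b) \<in> H" for a b
    proof -
      have a0: "norm a > 0" and ac: "b + 1 / (real CARD('n) + 1) \<le> a \<bullet> c" using ab[OF abH] by simp_all
      have aT: "b \<le> a \<bullet> x \<and> a \<bullet> x \<le> b + 1" if "x \<in> T" for x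
        using ab[OF abH] that abH unfolding TH by blast
      have "h ^ CARD('n) / C0 \<le> measure lebesgue T" using m by (simp add: h_def)
      also have "\<dots> \<le> 1 / norm a * (2 * h) ^ (CARD('n) - 1)"
      proof (rule measure_slab[OF cT Tc])
        show "norm (a /\<^sub>R norm a) = 1" using a0 by simp
        fix x assume "x \<in> T"
        from aT[OF this] show "b / norm a \<le> (a /\<^sub>R norm a) \<bullet> x \<and> (a /\<^sub>R norm a) \<bullet> x \<le> b / norm a + 1 / norm a"
          using a0 by (simp add: divide_simps)
      qed (use h0 in auto)
      finally have "h * h ^ k * norm a \<le> C0 * 2 ^ k * h ^ k"
        using a0 C0 by (simp add: k power_mult_distrib field_simps)
      then have "(h * norm a) * h ^ k \<le> (C0 * 2 ^ k) * h ^ k" by (simp add: mult_ac)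
      then have "h * norm a \<le> C0 * 2 ^ k" using h by (simp add: mult_le_cancel_right)
      moreover have "\<rho> \<ge> 0" using C0 by (simp add: \<rho>)
      ultimately have "\<rho> * (h * norm a) \<le> \<rho> * (C0 * 2 ^ k)" by (rule mult_left_mono)
      then have "norm a * (\<rho> * h) \<le> \<rho> * (C0 * 2 ^ k)" by (simp only: mult_ac)
      also have "\<rho> * (C0 * 2 ^ k) = 1 / (real CARD('n) + 1)" using C0 by (simp add: \<rho> k_def)
      finally have "norm a * norm (x - c) \<le> 1 / (real CARD('n) + 1)"
        using mult_left_mono[OF x, of "norm a"] by simp
      moreover have "\<bar>a \<bullet> (x - c)\<bar> \<le> norm a * norm (x - c)" by (rule Cauchy_Schwarz_ineq2)
      ultimately show ?thesis using ac by (simp add: inner_diff_right abs_le_iff)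
    qed
    then show "x \<in> T" unfolding TH by blast
  qed
  then show "\<exists>c. cball c (\<rho> * diameter T) \<subseteq> T" by (auto simp: h_def)
qed

section \<open>Facets, their normals and the discs they contain\<close>

lemma normal_unique:
  fixes E :: "(real^'n) set"
  assumes n: "normal_to E n" and m: "normal_to E m"
  shows "m = n \<or> m = - n"
proof -
  obtain c where c: "c \<in> E" using n by (auto simp: normal_to_def)
  have nn: "n \<bullet> n = 1" and mm: "m \<bullet> m = 1" using n m by (simp_all add: normal_to_def norm_eq_1)
  define z where "z = m - (m \<bullet> n) *\<^sub>R n"
  have nz: "n \<bullet> z = 0" using nn by (simp add: z_def inner_diff_right inner_commute)
  then have "c + z \<in> affine hull E" using affine_hull_normal[OF n c] by simp
  then have mz: "m \<bullet> z = 0" using affine_hull_normal[OF m c] by simp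
  have "z \<bullet> z = m \<bullet> z - (m \<bullet> n) * (n \<bullet> z)" by (subst (1) z_def) (simp add: inner_diff_left)
  then have "z = 0" using nz mz by simp
  then have e: "m = (m \<bullet> n) *\<^sub>R n" by (simp add: z_def)
  then have "m \<bullet> m = (m \<bullet> n) * (m \<bullet> n)" by (metis inner_scaleR_right)
  then have "(m \<bullet> n)\<^sup>2 = 1" using mm by (simp add: power2_eq_square)
  then have "m \<bullet> n = 1 \<or> m \<bullet> n = - 1" by (simp add: power2_eq_1_iff)
  then show ?thesis using e by auto
qed

lemma normal_scaled:
  fixes E :: "(real^'n) set"
  assumes E: "E \<noteq> {}" "aff_dim E = int CARD('n) - 1" and a: "a \<noteq> 0" "\<And>x. x \<in> E \<Longrightarrow> a \<bullet> x = b"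
  shows "normal_to E (a /\<^sub>R norm a)"
  unfolding normal_to_def using assms by (auto simp: inner_diff_right)

lemma normal_minus: "normal_to E n \<Longrightarrow> normal_to E (- n)"
  by (auto simp: normal_to_def)

lemma facet_aff_dim:
  fixes T :: "(real^'n) set"
  assumes "interior T \<noteq> {}" "E facet_of T"
  shows "aff_dim E = int CARD('n) - 1" "E \<noteq> {}" "E \<noteq> T" "E \<subseteq> T" "E face_of T"
  using assms aff_dim_nonempty_interior[OF assms(1)] by (auto simp: facet_of_def dest: face_of_imp_subset)

lemma unit_normal:
  fixes E :: "(real^'n) set"
  assumes E: "E \<noteq> {}" "aff_dim E = int CARD('n) - 1"
  shows "normal_to E (unit_normal E)"
proof -
  obtain a b where ab: "a \<noteq> 0" "affine hull E = {x. a \<bullet> x = b}"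
    using aff_dim_eq_hyperplane[of E] E by auto
  then have "normal_to E (a /\<^sub>R norm a)"
    using hull_subset[of E affine] by (intro normal_scaled[OF E ab(1), of b]) auto
  then have "\<exists>n. norm n = 1 \<and> (\<forall>x\<in>E. \<forall>y\<in>E. n \<bullet> (x - y) = 0)" unfolding normal_to_def by blast
  from someI_ex[OF this] show ?thesis using E unfolding unit_normal_def normal_to_def by blast
qed

text \<open>The section through \<open>c\<close> parallel to the facet opposite \<open>u\<close> is
  mapped into the facet by the homothety with centre \<open>u\<close> and ratio \<alpha> = 1/(1 -
  l), where l is the barycentric coordinate of \<open>c\<close> at \<open>u\<close>. As \<alpha> is
  at least 1, a disc in the section becomes a disc of no smaller radius in the facet.\<close>

lemma simplex_section:
  fixes C :: "(real^'n) set"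
  assumes C: "\<not> affine_dependent C" "card C = CARD('n) + 1" and u: "u \<in> C" and E: "E = convex hull (C - {u})"
    and n: "normal_to E n" and c: "cball c r \<subseteq> convex hull C" "r > 0"
  shows "\<exists>\<alpha>\<ge>1. \<exists>w. \<forall>x\<in>convex hull C. n \<bullet> x = n \<bullet> c \<longrightarrow> \<alpha> *\<^sub>R x + w \<in> E"
proof (rule barycentric[OF C])
  fix a b
  assume ab: "\<And>u v. u \<in> C \<Longrightarrow> v \<in> C \<Longrightarrow> a u \<bullet> v - b u = (if v = u then 1 else 0)"
    and x: "\<And>x. x = (\<Sum>u\<in>C. (a u \<bullet> x - b u) *\<^sub>R u)"
    and s1: "\<And>x. (\<Sum>u\<in>C. a u \<bullet> x - b u) = 1"
    and hull: "\<And>x. x \<in> convex hull C \<longleftrightarrow> (\<forall>u\<in>C. 0 \<le> a u \<bullet> x - b u)"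
  define l where "l v x = a v \<bullet> x - b v" for v x
  have fC: "finite C" using C(2) card.infinite by fastforce
  have "card (C - {u}) > 0" using C(2) u fC by simp
  then obtain p where p: "p \<in> C" "p \<noteq> u" by (metis Diff_iff card_gt_0_iff ex_in_conv insertCI)
  have pE: "p \<in> E" using p by (auto simp: E intro: hull_inc)
  have nv: "n \<bullet> v = n \<bullet> p" if "v \<in> C" "v \<noteq> u" for v
  proof -
    have "v \<in> E" using that by (auto simp: E intro: hull_inc)
    then have "n \<bullet> (v - p) = 0" using n pE unfolding normal_to_def by blast
    then show ?thesis by (simp add: inner_diff_right)
  qed
  have nx: "n \<bullet> y = n \<bullet> p + l u y * (n \<bullet> u - n \<bullet> p)" for y
  proof -
    have "n \<bullet> y = n \<bullet> (\<Sum>v\<in>C. l v y *\<^sub>R v)" using x[of y] by (simp add: l_def)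
    also have "\<dots> = (\<Sum>v\<in>C. l v y * (n \<bullet> v))" by (simp add: inner_sum_right)
    also have "\<dots> = (\<Sum>v\<in>C. l v y * (n \<bullet> p) + (if v = u then l u y * (n \<bullet> u - n \<bullet> p) else 0))"
      using nv by (intro sum.cong refl) (auto simp: algebra_simps)
    also have "\<dots> = (\<Sum>v\<in>C. l v y) * (n \<bullet> p) + l u y * (n \<bullet> u - n \<bullet> p)"
      using u fC by (simp add: sum.distrib sum_distrib_right)
    finally show ?thesis using s1[of y] by (simp add: l_def)
  qed
  have nu: "n \<bullet> u - n \<bullet> p \<noteq> 0"
  proof
    assume z: "n \<bullet> u - n \<bullet> p = 0"
    then have "n \<bullet> n = n \<bullet> 0" using nx[of n] nx[of 0] by simp
    then show False using n by (simp add: normal_to_def)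
  qed
  have ap: "a u \<bullet> (u - p) = 1" using ab[OF u u] ab[OF u p(1)] p(2) by (simp add: inner_diff_right)
  then have up: "norm (u - p) > 0" by auto
  \<comment> \<open>A point on the boundary of the ball in the direction u - p, along which the
    coordinate of u strictly grows. It is at most 1 there, hence below 1 at
    \<open>c\<close>.\<close>
  define y where "y = c + (r / norm (u - p)) *\<^sub>R (u - p)"
  have "dist c y = r" using up c(2) by (simp add: y_def dist_norm)
  then have "y \<in> convex hull C" using c(1) by auto
  then have "l u y \<le> (\<Sum>v\<in>C. l v y)"
    using u fC unfolding hull l_def by (intro member_le_sum) auto
  then have "l u y \<le> 1" using s1[of y] by (simp add: l_def)
  moreover have "l u y = l u c + r / norm (u - p)" using ap by (simp add: y_def l_def inner_add_right)
  ultimately have lc1: "l u c < 1" using up c(2) by (smt (verit) divide_pos_pos)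
  have "c \<in> convex hull C" using c by auto
  then have lc0: "0 \<le> l u c" using u by (simp add: hull l_def)
  define \<alpha> where "\<alpha> = 1 / (1 - l u c)"
  have \<alpha>: "\<alpha> \<ge> 1" using lc0 lc1 by (simp add: \<alpha>_def)
  have "\<alpha> *\<^sub>R z + (- (\<alpha> * l u c)) *\<^sub>R u \<in> E" if z: "z \<in> convex hull C" and nz: "n \<bullet> z = n \<bullet> c" for z
  proof -
    have lz: "l u z = l u c" using nz nu unfolding nx[of z] nx[of c] by simp
    have "z = (\<Sum>v\<in>C. l v z *\<^sub>R v)" using x[of z] by (simp add: l_def)
    also have "\<dots> = l u z *\<^sub>R u + (\<Sum>v\<in>C - {u}. l v z *\<^sub>R v)" by (rule sum.remove[OF fC u])
    finally have zz: "z = l u z *\<^sub>R u + (\<Sum>v\<in>C - {u}. l v z *\<^sub>R v)" .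
    have z': "z - l u c *\<^sub>R u = (\<Sum>v\<in>C - {u}. l v z *\<^sub>R v)"
      unfolding lz[symmetric] diff_eq_eq by (subst add.commute) (rule zz)
    have "\<alpha> *\<^sub>R z + (- (\<alpha> * l u c)) *\<^sub>R u = \<alpha> *\<^sub>R (z - l u c *\<^sub>R u)" by (simp add: algebra_simps)
    also have "\<dots> = (\<Sum>v\<in>C - {u}. (\<alpha> * l v z) *\<^sub>R v)" unfolding z' by (simp add: scaleR_sum_right)
    finally have eq: "(\<Sum>v\<in>C - {u}. (\<alpha> * l v z) *\<^sub>R v) = \<alpha> *\<^sub>R z + (- (\<alpha> * l u c)) *\<^sub>R u" ..
    have "(\<Sum>v\<in>C. l v z) = l u z + (\<Sum>v\<in>C - {u}. l v z)" by (rule sum.remove[OF fC u])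
    then have "(\<Sum>v\<in>C - {u}. l v z) = 1 - l u c" using s1[of z] lz by (simp add: l_def)
    moreover have "(\<Sum>v\<in>C - {u}. \<alpha> * l v z) = \<alpha> * (\<Sum>v\<in>C - {u}. l v z)" by (simp only: sum_distrib_left)
    ultimately have sum: "(\<Sum>v\<in>C - {u}. \<alpha> * l v z) = 1" using lc1 by (simp add: \<alpha>_def)
    have nn: "\<forall>v\<in>C - {u}. 0 \<le> \<alpha> * l v z" using z \<alpha> by (auto simp: hull l_def)
    have "finite (C - {u})" using fC by simp
    show ?thesis unfolding E convex_hull_finite[OF \<open>finite (C - {u})\<close>]
      using eq sum nn by (intro CollectI exI[of _ "\<lambda>v. \<alpha> * l v z"] conjI)
  qed
  then show ?thesis using \<alpha> by blast
qed

text \<open>A point in the relative interior of the facet is not interior to \<open>T\<close>, so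
  one of the inequalities is an equality there. The face cut out by that equality contains the facet
  and lies in a hyperplane, so it has the same dimension and both agree.\<close>

lemma parallelotope_facet:
  fixes v :: "'n::finite \<Rightarrow> real^'n"
  assumes f: "\<And>i j. f i \<bullet> v j = (if j = i then 1 else 0 :: real)"
    and T: "T = {x. \<forall>i. 0 \<le> f i \<bullet> (x - p) \<and> f i \<bullet> (x - p) \<le> 1}" and E: "E facet_of T" and i: "interior T \<noteq> {}"
  shows "\<exists>i \<kappa>. (\<kappa> = 0 \<or> \<kappa> = 1) \<and> E = T \<inter> {x. f i \<bullet> x = f i \<bullet> p + \<kappa>}"
proof -
  have f0: "f i \<noteq> 0" for i using f[of i i] by auto
  have cT: "convex T"
  proof -
    have "T = (\<Inter>i. {x. f i \<bullet> x \<ge> f i \<bullet> p}) \<inter> (\<Inter>i. {x. f i \<bullet> x \<le> f i \<bullet> p + 1})"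
      by (auto simp: T inner_diff_right algebra_simps)
    then show ?thesis by (auto intro!: convex_Int convex_INT convex_halfspace_ge convex_halfspace_le)
  qed
  note Ef = facet_aff_dim[OF i E]
  have cE: "convex E" using face_of_imp_convex[OF Ef(5)] .
  obtain x0 where x0: "x0 \<in> rel_interior E" using rel_interior_eq_empty[OF cE] Ef(2) by blast
  have x0E: "x0 \<in> E" using x0 rel_interior_subset by blast
  have x0T: "x0 \<in> T" using x0E Ef(4) by blast
  have "\<exists>i. f i \<bullet> (x0 - p) = 0 \<or> f i \<bullet> (x0 - p) = 1"
  proof (rule ccontr)
    assume n: "\<nexists>i. f i \<bullet> (x0 - p) = 0 \<or> f i \<bullet> (x0 - p) = 1"
    let ?O = "(\<Inter>i. {x. f i \<bullet> x > f i \<bullet> p}) \<inter> (\<Inter>i. {x. f i \<bullet> x < f i \<bullet> p + 1})"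
    have "open ?O" by (intro open_Int open_INT ballI open_halfspace_gt open_halfspace_lt) auto
    moreover have "x0 \<in> ?O"
    proof -
      have "0 < f i \<bullet> (x0 - p) \<and> f i \<bullet> (x0 - p) < 1" for i
        using n x0T by (auto simp: T order_less_le)
      then show ?thesis by (auto simp: inner_diff_right algebra_simps)
    qed
    moreover have "?O \<subseteq> T"
    proof
      fix x assume "x \<in> ?O"
      then have "f i \<bullet> p < f i \<bullet> x \<and> f i \<bullet> x < f i \<bullet> p + 1" for i by auto
      then have "0 \<le> f i \<bullet> (x - p) \<and> f i \<bullet> (x - p) \<le> 1" for i
        by (smt (verit) inner_diff_right)
      then show "x \<in> T" unfolding T by blast
    qed
    ultimately have "x0 \<in> interior T" using interiorI by blast
    then show False using face_of_disjoint_interior[OF Ef(5) Ef(3)] x0E by blast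
  qed
  then obtain i where i: "f i \<bullet> (x0 - p) = 0 \<or> f i \<bullet> (x0 - p) = 1" by blast
  define \<kappa> where "\<kappa> = f i \<bullet> (x0 - p)"
  have \<kappa>: "\<kappa> = 0 \<or> \<kappa> = 1" using i by (simp add: \<kappa>_def)
  define F where "F = T \<inter> {x. f i \<bullet> x = f i \<bullet> p + \<kappa>}"
  have FT: "F face_of T"
    using \<kappa>
  proof
    assume k: "\<kappa> = 0"
    show ?thesis unfolding F_def
      by (rule face_of_Int_supporting_hyperplane_ge[OF cT]) (auto simp: T inner_diff_right k)
  next
    assume k: "\<kappa> = 1"
    show ?thesis unfolding F_def
    proof (rule face_of_Int_supporting_hyperplane_le[OF cT])
      fix x assume "x \<in> T"
      then have "f i \<bullet> (x - p) \<le> 1" by (simp add: T)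
      then show "f i \<bullet> x \<le> f i \<bullet> p + \<kappa>" by (simp add: inner_diff_right k)
    qed
  qed
  have "x0 \<in> F" using x0T by (simp add: F_def \<kappa>_def inner_diff_right)
  then have EF: "E \<subseteq> F" using subset_of_face_of[OF FT Ef(4)] x0 by blast
  have EfF: "E face_of F" using face_of_subset[OF Ef(5) EF face_of_imp_subset[OF FT]] .
  have "E = F"
  proof (rule ccontr)
    assume "E \<noteq> F"
    then have "aff_dim E < aff_dim F"
      using face_of_aff_dim_lt[OF face_of_imp_convex[OF FT] EfF] by blast
    also have "\<dots> \<le> aff_dim {x. f i \<bullet> x = f i \<bullet> p + \<kappa>}" by (rule aff_dim_subset) (auto simp: F_def)
    also have "\<dots> = int CARD('n) - 1" using f0 by simp
    finally show False using Ef(1) by simp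
  qed
  then show ?thesis using \<kappa> unfolding F_def by blast
qed

text \<open>Translation along the edge \<open>v i\<close> carries a section parallel to the facet
  into the facet, so the ratio \<alpha> is 1.\<close>

lemma parallelotope_section:
  fixes v :: "'n::finite \<Rightarrow> real^'n"
  assumes f: "\<And>i j. f i \<bullet> v j = (if j = i then 1 else 0 :: real)"
    and T: "T = {x. \<forall>i. 0 \<le> f i \<bullet> (x - p) \<and> f i \<bullet> (x - p) \<le> 1}" and E: "E facet_of T" and i: "interior T \<noteq> {}"
    and n: "normal_to E n"
  shows "\<exists>\<alpha>\<ge>1. \<exists>w. \<forall>x\<in>T. n \<bullet> x = n \<bullet> c \<longrightarrow> \<alpha> *\<^sub>R x + w \<in> E"
proof -
  obtain i \<kappa> where k: "\<kappa> = 0 \<or> \<kappa> = 1" and EF: "E = T \<inter> {x. f i \<bullet> x = f i \<bullet> p + \<kappa>}"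
    using parallelotope_facet[OF f T E i] by blast
  have f0: "f i \<noteq> 0" using f[of i i] by auto
  note Ef = facet_aff_dim[OF \<open>interior T \<noteq> {}\<close> E]
  have "normal_to E (f i /\<^sub>R norm (f i))"
    by (rule normal_scaled[OF Ef(2,1) f0, of "f i \<bullet> p + \<kappa>"]) (auto simp: EF)
  then have nf: "n = f i /\<^sub>R norm (f i) \<or> n = - (f i /\<^sub>R norm (f i))" using normal_unique n by blast
  define s where "s = \<kappa> - f i \<bullet> (c - p)"
  have "1 *\<^sub>R x + s *\<^sub>R v i \<in> E" if x: "x \<in> T" "n \<bullet> x = n \<bullet> c" for x
  proof -
    have fx: "f i \<bullet> x = f i \<bullet> c" using nf x(2) f0 by auto
    have j: "f j \<bullet> (x + s *\<^sub>R v i - p) = f j \<bullet> (x - p) + (if i = j then s else 0)" for j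
      using f by (simp add: inner_diff_right inner_add_right)
    have "f i \<bullet> (x + s *\<^sub>R v i - p) = \<kappa>" using j[of i] fx by (simp add: s_def inner_diff_right)
    moreover have "0 \<le> f j \<bullet> (x + s *\<^sub>R v i - p) \<and> f j \<bullet> (x + s *\<^sub>R v i - p) \<le> 1" if "j \<noteq> i" for j
      using j[of j] x(1) that by (simp add: T)
    ultimately have "0 \<le> f j \<bullet> (x + s *\<^sub>R v i - p) \<and> f j \<bullet> (x + s *\<^sub>R v i - p) \<le> 1" for j
      using k by (cases "j = i") auto
    then have "x + s *\<^sub>R v i \<in> T" unfolding T by blast
    moreover have "f i \<bullet> (x + s *\<^sub>R v i) = f i \<bullet> p + \<kappa>"
      using \<open>f i \<bullet> (x + s *\<^sub>R v i - p) = \<kappa>\<close> by (simp add: inner_diff_right)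
    ultimately show ?thesis by (simp add: EF)
  qed
  then show ?thesis by (intro exI[of _ 1] conjI exI[of _ "s *\<^sub>R v i"]) auto
qed

text \<open>The central disc of the inscribed ball parallel to the facet is carried into the facet
  by the maps of the two section lemmas; since \<alpha> is at least 1, the radius r
  survives.\<close>

lemma facet_disc:
  fixes T :: "(real^'n) set"
  assumes T: "is_simplex T \<or> is_parallelotope T" and E: "E facet_of T" and n: "normal_to E n"
    and c: "cball c r \<subseteq> T" "r > 0"
  obtains c' where "c' \<in> E" "\<And>z. n \<bullet> z = 0 \<Longrightarrow> norm z \<le> r \<Longrightarrow> c' + z \<in> E"
proof -
  have i: "interior T \<noteq> {}" using c by (metis ball_subset_cball centre_in_ball empty_iff interiorI open_ball subset_trans)
  have "\<exists>\<alpha>\<ge>1. \<exists>w. \<forall>x\<in>T. n \<bullet> x = n \<bullet> c \<longrightarrow> \<alpha> *\<^sub>R x + w \<in> E"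
    using T
  proof
    assume "is_simplex T"
    then obtain C where C: "\<not> affine_dependent C" "int (card C) = int CARD('n) + 1" "T = convex hull C"
      unfolding is_simplex_def simplex_def by blast
    then obtain u where "u \<in> C" "E = convex hull (C - {u})"
      using E facet_of_convex_hull_affine_independent[OF C(1)] by blast
    then show ?thesis using simplex_section[of C u E n c r] C n c by simp
  next
    assume "is_parallelotope T"
    then obtain p and v :: "'n \<Rightarrow> real^'n" where v: "inj v" "independent (range v)" and
      T: "T = {p + (\<Sum>i\<in>UNIV. t i *\<^sub>R v i) | t. \<forall>i. 0 \<le> t i \<and> t i \<le> 1}"
      unfolding is_parallelotope_def by blast
    show ?thesis
    proof (rule parallelotope_coords[OF v])
      fix f assume f: "\<And>i j. f i \<bullet> v j = (if j = i then 1 else 0 :: real)" "\<And>x. x = (\<Sum>i\<in>UNIV. (f i \<bullet> x) *\<^sub>R v i)"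
      show ?thesis by (rule parallelotope_section[OF f(1) _ E i n]) (use T parallelotope_eq[OF f] in simp)
    qed
  qed
  then obtain \<alpha> w where \<alpha>: "\<alpha> \<ge> 1" "\<And>x. x \<in> T \<Longrightarrow> n \<bullet> x = n \<bullet> c \<Longrightarrow> \<alpha> *\<^sub>R x + w \<in> E" by blast
  have z: "\<alpha> *\<^sub>R c + w + z \<in> E" if z: "n \<bullet> z = 0" "norm z \<le> r" for z
  proof -
    have "norm (z /\<^sub>R \<alpha>) \<le> r"
    proof -
      have "norm (z /\<^sub>R \<alpha>) = norm z / \<alpha>" using \<alpha>(1) by (simp add: divide_inverse mult.commute)
      also have "\<dots> \<le> norm z / 1" using \<alpha>(1) by (intro divide_left_mono) auto
      finally show ?thesis using z(2) by simp
    qed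
    then have "c + z /\<^sub>R \<alpha> \<in> T" using c(1) by (auto simp: dist_norm)
    then have "\<alpha> *\<^sub>R (c + z /\<^sub>R \<alpha>) + w \<in> E" using z(1) by (intro \<alpha>(2)) (auto simp: inner_add_right)
    then show ?thesis using \<alpha>(1) by (simp add: algebra_simps)
  qed
  have "\<alpha> *\<^sub>R c + w \<in> E" using z[of 0] c(2) by simp
  then show ?thesis using that z by blast
qed

text \<open>Facets of a polyhedron are exposed, so some hyperplane supporting \<open>T\<close> meets
  it exactly in \<open>E\<close>; by uniqueness up to sign, \<open>n\<close> is a normal of that
  hyperplane.\<close>

lemma facet_side:
  fixes T :: "(real^'n) set"
  assumes T: "is_simplex T \<or> is_parallelotope T" and E: "E facet_of T" and n: "normal_to E n"
    and i: "interior T \<noteq> {}" and p: "p \<in> E"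
  shows "(\<forall>x\<in>T. 0 \<le> n \<bullet> (x - p)) \<or> (\<forall>x\<in>T. n \<bullet> (x - p) \<le> 0)"
proof -
  obtain H c where "halfspace_rep T H c" using shape_rep[OF T] by blast
  then have "polyhedron T" by (rule halfspace_rep_polyhedron)
  note Ef = facet_aff_dim[OF i E]
  then have "E exposed_face_of T" using exposed_face_of_polyhedron[OF \<open>polyhedron T\<close>] by blast
  then obtain a b where ab: "T \<subseteq> {x. a \<bullet> x \<le> b}" "E = T \<inter> {x. a \<bullet> x = b}"
    unfolding exposed_face_of_def by blast
  have a0: "a \<noteq> 0"
  proof
    assume "a = 0"
    then have "E = T" using ab p by auto
    then show False using Ef(3) by blast
  qed
  have "normal_to E (a /\<^sub>R norm a)" by (rule normal_scaled[OF Ef(2,1) a0, of b]) (simp add: ab)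
  then have na: "n = a /\<^sub>R norm a \<or> n = - (a /\<^sub>R norm a)" using normal_unique n by blast
  have "a \<bullet> (x - p) \<le> 0" if "x \<in> T" for x using ab that p by (auto simp: inner_diff_right)
  then have "(a /\<^sub>R norm a) \<bullet> (x - p) \<le> 0" if "x \<in> T" for x using that a0
    by (simp add: mult_nonneg_nonpos)
  then show ?thesis using na by auto
qed

text \<open>x is a convex combination of \<open>c'\<close> and of a point \<open>c + z\<close> of
  the disc in \<open>E\<close>. The weight l of \<open>c'\<close> is the ratio of the heights of x
  and \<open>c'\<close> above the hyperplane, which makes z orthogonal to \<open>n\<close>. The
  height of \<open>c'\<close> is at least r because the ball around it stays on one side.\<close>

lemma half_ball:
  fixes T :: "(real^'n) set"
  assumes cT: "convex T" "E \<subseteq> T" and c: "c \<in> E" and disc: "\<And>z. n \<bullet> z = 0 \<Longrightarrow> norm z \<le> r \<Longrightarrow> c + z \<in> E"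
    and n: "norm n = 1" and side: "\<And>x. x \<in> T \<Longrightarrow> 0 \<le> n \<bullet> (x - c)"
    and ball: "cball c' r \<subseteq> T" and h: "T \<subseteq> cball c h" "0 < r" "r \<le> h"
    and x: "dist c x < r\<^sup>2 / (4 * h)" "0 \<le> n \<bullet> (x - c)"
  shows "x \<in> T"
proof -
  define H where "H = n \<bullet> (c' - c)"
  have nn: "n \<bullet> n = 1" using n by (simp add: norm_eq_1)
  have "c' - r *\<^sub>R n \<in> cball c' r" using n h(2) by (simp add: dist_norm)
  then have "0 \<le> n \<bullet> (c' - r *\<^sub>R n - c)" using ball side by blast
  then have H: "r \<le> H" using nn by (simp add: H_def inner_diff_right)
  have c'T: "c' \<in> T" using ball h(2) by auto
  have nc': "norm (c' - c) \<le> h" using c'T h(1) by (auto simp: dist_norm norm_minus_commute)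
  define s where "s = n \<bullet> (x - c)"
  define l where "l = s / H"
  have nx: "norm (x - c) \<le> r\<^sup>2 / (4 * h)" using x(1) by (simp add: dist_norm norm_minus_commute)
  have "\<bar>s\<bar> \<le> norm n * norm (x - c)" unfolding s_def by (rule Cauchy_Schwarz_ineq2)
  then have sle: "s \<le> r\<^sup>2 / (4 * h)" using nx n by simp
  have hp: "h > 0" using h by linarith
  have l0: "l \<ge> 0" using x(2) H h by (simp add: l_def s_def)
  \<comment> \<open>The radius r^2/(4h) is chosen for this bound on l. Both |x - c| and l |c' - c|
    are then at most r/4, and since 1 - l is at least 1/2, the vector z has length at most
    r.\<close>
  have "l \<le> (r\<^sup>2 / (4 * h)) / r" unfolding l_def using sle H h x(2) by (intro frac_le) (auto simp: s_def)
  also have "\<dots> = r / (4 * h)" using h by (simp add: power2_eq_square)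
  finally have l: "l \<le> r / (4 * h)" .
  have "r / (4 * h) \<le> 1 / 4" using h hp by (simp add: divide_simps)
  then have l4: "l \<le> 1 / 4" using l by linarith
  define z where "z = (1 / (1 - l)) *\<^sub>R (x - c - l *\<^sub>R (c' - c))"
  have nz: "n \<bullet> z = 0" using H h by (simp add: z_def inner_diff_right l_def s_def H_def)
  have "norm (x - c - l *\<^sub>R (c' - c)) \<le> norm (x - c) + norm (l *\<^sub>R (c' - c))" by (rule norm_triangle_ineq4)
  also have "norm (l *\<^sub>R (c' - c)) = l * norm (c' - c)" using l0 by simp
  also have "l * norm (c' - c) \<le> r / (4 * h) * h" using l nc' l0 h hp by (intro mult_mono) auto
  also have "r / (4 * h) * h = r / 4" using hp by simp
  finally have "norm (x - c - l *\<^sub>R (c' - c)) \<le> r\<^sup>2 / (4 * h) + r / 4" using nx by linarith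
  also have "r\<^sup>2 / (4 * h) \<le> r / 4"
    using h hp by (simp add: power2_eq_square divide_simps)
  finally have a: "norm (x - c - l *\<^sub>R (c' - c)) \<le> r / 2" by simp
  have "norm z = norm (x - c - l *\<^sub>R (c' - c)) / (1 - l)" using l4 by (simp add: z_def)
  also have "\<dots> \<le> (r / 2) / (1 / 2)" using a l4 h by (intro frac_le) auto
  finally have "norm z \<le> r" by simp
  then have "c + z \<in> T" using disc[OF nz] cT by blast
  then have "(1 - l) *\<^sub>R (c + z) + l *\<^sub>R c' \<in> T" using c'T l0 l4 by (intro convexD[OF cT(1)]) auto
  moreover have "(1 - l) *\<^sub>R (c + z) + l *\<^sub>R c' = x"
  proof -
    have "(1 - l) *\<^sub>R z = x - c - l *\<^sub>R (c' - c)" using l4 by (simp add: z_def)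
    then show ?thesis by (simp add: algebra_simps)
  qed
  ultimately show ?thesis by simp
qed

text \<open>At most one facet per vertex of a simplex, and at most one per dual vector and end value
  0 or 1 of a parallelotope; the common bound uses d + 1 \<le> 2d.\<close>

lemma card_sides:
  fixes T :: "(real^'n) set"
  assumes T: "is_simplex T \<or> is_parallelotope T" and i: "interior T \<noteq> {}"
  shows "finite (sides T)" "card (sides T) \<le> 2 * CARD('n)"
proof -
  have d: "CARD('n) \<ge> 1" using zero_less_card_finite[where 'a = 'n] by simp
  have "finite (sides T) \<and> card (sides T) \<le> 2 * CARD('n)"
    using T
  proof
    assume "is_simplex T"
    then obtain C where C: "\<not> affine_dependent C" "int (card C) = int CARD('n) + 1" "T = convex hull C"
      unfolding is_simplex_def simplex_def by blast
    have fC: "finite C" using C(1) aff_independent_finite by blast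
    have sub: "sides T \<subseteq> (\<lambda>u. convex hull (C - {u})) ` C"
      unfolding sides_def using facet_of_convex_hull_affine_independent[OF C(1)] C(3) by auto
    then have "card (sides T) \<le> card C" using fC card_image_le card_mono finite_imageI order_trans by meson
    then show ?thesis using sub fC C(2) d finite_subset finite_imageI by (metis (no_types, lifting) add_mono le_trans mult_2 of_nat_1 of_nat_add of_nat_eq_iff order_refl)
  next
    assume "is_parallelotope T"
    then obtain p and v :: "'n \<Rightarrow> real^'n" where v: "inj v" "independent (range v)" and
      T: "T = {p + (\<Sum>i\<in>UNIV. t i *\<^sub>R v i) | t. \<forall>i. 0 \<le> t i \<and> t i \<le> 1}"
      unfolding is_parallelotope_def by blast
    show ?thesis
    proof (rule parallelotope_coords[OF v])
      fix f assume f: "\<And>i j. f i \<bullet> v j = (if j = i then 1 else 0 :: real)" "\<And>x. x = (\<Sum>i\<in>UNIV. (f i \<bullet> x) *\<^sub>R v i)"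
      have T': "T = {x. \<forall>i. 0 \<le> f i \<bullet> (x - p) \<and> f i \<bullet> (x - p) \<le> 1}" using T parallelotope_eq[OF f] by simp
      have "sides T \<subseteq> (\<lambda>(i, b). T \<inter> {x. f i \<bullet> x = f i \<bullet> p + (if b then 1 else 0)}) ` (UNIV \<times> UNIV)"
      proof
        fix E assume "E \<in> sides T"
        then obtain i \<kappa> where k: "\<kappa> = 0 \<or> \<kappa> = 1" "E = T \<inter> {x. f i \<bullet> x = f i \<bullet> p + \<kappa>}"
          using parallelotope_facet[OF f(1) T' _ i] unfolding sides_def by blast
        then have "E = (\<lambda>(i, b). T \<inter> {x. f i \<bullet> x = f i \<bullet> p + (if b then 1 else 0)}) (i, \<kappa> = 1)" by auto
        then show "E \<in> (\<lambda>(i, b). T \<inter> {x. f i \<bullet> x = f i \<bullet> p + (if b then 1 else 0)}) ` (UNIV \<times> UNIV)" by blast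
      qed
      then have sub: "sides T \<subseteq> (\<lambda>(i, b). T \<inter> {x. f i \<bullet> x = f i \<bullet> p + (if b then 1 else 0)}) ` (UNIV \<times> UNIV)" .
      have fin: "finite (UNIV \<times> UNIV :: ('n \<times> bool) set)" by simp
      have "card (sides T) \<le> card (UNIV \<times> UNIV :: ('n \<times> bool) set)"
        by (rule order_trans[OF card_mono[OF finite_imageI[OF fin] sub] card_image_le[OF fin]])
      also have "\<dots> = 2 * CARD('n)" by (simp add: card_cartesian_product)
      finally show ?thesis using finite_subset[OF sub finite_imageI[OF fin]] by blast
    qed
  qed
  then show "finite (sides T)" "card (sides T) \<le> 2 * CARD('n)" by auto
qed

text \<open>Rules out slits. Points just below the Lipschitz graph have a neighbourhood that misses
  the domain, so they cannot belong to its closure, yet every neighbourhood of a boundary point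
  contains some. Consequently a ball filled by two adjacent elements lies in the domain and can
  carry a test function.\<close>

lemma interior_closure_lipschitz:
  fixes \<Omega> :: "(real^'n) set"
  assumes \<Omega>: "open \<Omega>" and lip: "lipschitz_boundary \<Omega>"
  shows "interior (closure \<Omega>) \<subseteq> \<Omega>"
proof
  fix x assume x: "x \<in> interior (closure \<Omega>)"
  show "x \<in> \<Omega>"
  proof (rule ccontr)
    assume nx: "x \<notin> \<Omega>"
    then have "x \<in> frontier \<Omega>" using x interior_subset interior_open[OF \<Omega>] by (auto simp: frontier_def)
    with lip obtain r \<nu> \<gamma> L where r: "r > 0" "norm \<nu> = 1" "L-lipschitz_on {z. \<nu> \<bullet> z = 0} \<gamma>"
      and eq: "\<Omega> \<inter> ball x r = {y \<in> ball x r. \<gamma> (y - (\<nu> \<bullet> y) *\<^sub>R \<nu>) < \<nu> \<bullet> y}"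
      unfolding lipschitz_boundary_def by blast
    define P where "P y = y - (\<nu> \<bullet> y) *\<^sub>R \<nu>" for y
    have nn: "\<nu> \<bullet> \<nu> = 1" using r(2) by (simp add: norm_eq_1)
    have "continuous_on UNIV (\<lambda>y. \<gamma> (P y))"
      by (rule continuous_on_compose2[OF lipschitz_on_continuous_on[OF r(3)]])
        (auto simp: P_def inner_diff_right nn intro!: continuous_intros)
    then have "open {y. \<nu> \<bullet> y < \<gamma> (P y)}" by (intro open_Collect_less continuous_intros) auto
    then have D: "open ({y. \<nu> \<bullet> y < \<gamma> (P y)} \<inter> ball x r)" by (intro open_Int) auto
    have False if "\<nu> \<bullet> y < \<gamma> (P y)" "y \<in> ball x r" "y \<in> \<Omega>" for y
    proof -
      have "y \<in> \<Omega> \<inter> ball x r" using that by blast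
      then have "\<gamma> (y - (\<nu> \<bullet> y) *\<^sub>R \<nu>) < \<nu> \<bullet> y" unfolding eq by blast
      then show False using that(1) by (simp add: P_def)
    qed
    then have "({y. \<nu> \<bullet> y < \<gamma> (P y)} \<inter> ball x r) \<inter> \<Omega> = {}" by blast
    then have cl: "({y. \<nu> \<bullet> y < \<gamma> (P y)} \<inter> ball x r) \<inter> closure \<Omega> = {}"
      using open_Int_closure_eq_empty[OF D] by blast
    have gx: "\<nu> \<bullet> x \<le> \<gamma> (P x)"
    proof (rule ccontr)
      assume "\<not> ?thesis"
      then have "x \<in> {y \<in> ball x r. \<gamma> (y - (\<nu> \<bullet> y) *\<^sub>R \<nu>) < \<nu> \<bullet> y}" using r(1) by (simp add: P_def)
      then show False using nx unfolding eq[symmetric] by blast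
    qed
    obtain e where e: "e > 0" "ball x e \<subseteq> closure \<Omega>" using x by (meson mem_interior)
    \<comment> \<open>A step against \<nu>, short enough to stay in both balls, leads from x to a
      point strictly below the graph.\<close>
    define t where "t = min e r / 2"
    have t: "0 < t" "t < e" "t < r" using e r by (auto simp: t_def)
    define y where "y = x - t *\<^sub>R \<nu>"
    have d: "dist x y = t" using t r(2) by (simp add: y_def dist_norm)
    have "P y = P x" by (simp add: P_def y_def inner_diff_right nn algebra_simps)
    moreover have "\<nu> \<bullet> y = \<nu> \<bullet> x - t" by (simp add: y_def inner_diff_right nn)
    ultimately have "\<nu> \<bullet> y < \<gamma> (P y)" using gx t by simp
    moreover have "y \<in> closure \<Omega>" using e(2) d t by auto
    ultimately show False using cl d t by auto
  qed
qed

text \<open>The volume bound forces the width of an element in any direction to be at least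
  \<open>h / (C0 2\<^sup>d\<^sup>-\<^sup>1)\<close>, and the barycentre lies at relative depth at least \<open>1 / (d + 1)\<close> behind each
  facet.\<close>

definition ball_ratio :: "nat \<Rightarrow> real \<Rightarrow> real" where
  "ball_ratio d C0 = 1 / ((real d + 1) * (C0 * 2 ^ (d - 1)))"

section \<open>Shape-regular meshes: inscribed balls and neighbourhoods of sides\<close>

lemma shape_regular_meshD:
  fixes \<T> :: "(real^'n) set set"
  assumes "shape_regular_mesh C0 \<Omega> \<T>"
  shows "finite \<T>" "\<Union>\<T> = closure \<Omega>" "T \<in> \<T> \<Longrightarrow> is_simplex T \<or> is_parallelotope T"
    "S \<in> \<T> \<Longrightarrow> T \<in> \<T> \<Longrightarrow> S \<noteq> T \<Longrightarrow> interior S \<inter> interior T = {}"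
    "S \<in> \<T> \<Longrightarrow> T \<in> \<T> \<Longrightarrow> S \<noteq> T \<Longrightarrow> (S \<inter> T) face_of S"
    "S \<in> \<T> \<Longrightarrow> T \<in> \<T> \<Longrightarrow> S \<noteq> T \<Longrightarrow> (S \<inter> T) face_of T"
    "T \<in> \<T> \<Longrightarrow> diameter T ^ CARD('n) / C0 \<le> measure lebesgue T"
  using assms unfolding shape_regular_mesh_def by (simp, simp, blast, blast, blast, blast, blast)

lemma shape_convex:
  fixes T :: "(real^'n) set"
  assumes "is_simplex T \<or> is_parallelotope T"
  shows "convex T"
  using shape_rep[OF assms] halfspace_rep_polyhedron polyhedron_imp_convex by blast

lemma shape_regular_convex_mesh:
  fixes \<T> :: "(real^'n) set set"
  assumes "shape_regular_mesh C0 \<Omega> \<T>"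
  shows "convex_mesh \<Omega> \<T>"
  unfolding convex_mesh_def
proof (intro conjI ballI impI)
  note D = shape_regular_meshD[OF assms]
  show "finite \<T>" by (rule D(1))
  show "\<Union>\<T> = closure \<Omega>" by (rule D(2))
  show "convex T" "compact T" if "T \<in> \<T>" for T
    using shape_convex[OF D(3)[OF that]] shape_compact[OF D(3)[OF that]] .
  show "interior S \<inter> interior T = {}" if "S \<in> \<T>" "T \<in> \<T>" "S \<noteq> T" for S T by (rule D(4)[OF that])
qed

lemma element_ball:
  fixes \<T> :: "(real^'n) set set"
  assumes m: "shape_regular_mesh C0 \<Omega> \<T>" and C0: "C0 > 0" and T: "T \<in> \<T>"
  defines "\<rho> \<equiv> ball_ratio CARD('n) C0"
  shows "\<exists>c. cball c (\<rho> * diameter T) \<subseteq> T" "diameter T > 0" "0 < \<rho>" "\<rho> \<le> 1" "interior T \<noteq> {}"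
proof -
  note D = shape_regular_meshD[OF m]
  show \<rho>0: "0 < \<rho>" using C0 by (simp add: \<rho>_def ball_ratio_def add_pos_nonneg)
  note ib = inscribed_ball[OF D(3)[OF T] C0 D(7)[OF T], of \<rho>]
  show 1: "\<exists>c. cball c (\<rho> * diameter T) \<subseteq> T" and h: "diameter T > 0"
    using ib by (simp_all add: \<rho>_def ball_ratio_def)
  then obtain c where c: "cball c (\<rho> * diameter T) \<subseteq> T" by blast
  have bT: "bounded T" using shape_compact[OF D(3)[OF T]] compact_imp_bounded by blast
  define y where "y = c + (\<rho> * diameter T) *\<^sub>R axis undefined 1"
  have d: "dist c y = \<rho> * diameter T" using \<rho>0 h by (simp add: y_def dist_norm norm_axis_1)
  have "c \<in> T" "y \<in> T" using c d \<rho>0 h by auto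
  then have "\<rho> * diameter T \<le> diameter T" using diameter_bounded_bound[OF bT, of c y] d by simp
  then show "\<rho> \<le> 1" using h by (simp add: mult_le_cancel_right1)
  have "ball c (\<rho> * diameter T) \<subseteq> interior T" using c by (meson ball_subset_cball interior_maximal open_ball subset_trans)
  then show "interior T \<noteq> {}" using \<rho>0 h by (metis centre_in_ball empty_iff mult_pos_pos subsetD)
qed

lemma sides_subset: "E \<in> sides T \<Longrightarrow> E \<subseteq> T"
  unfolding sides_def facet_of_def using face_of_imp_subset by blast

text \<open>A side contains a disc of the radius of the inscribed ball, and for d \<ge> 2 such a
  disc has nonzero vectors to measure. As diam E is at most the diameter of either element at E, the
  sizes of the two are comparable.\<close>

lemma side_diameter:
  fixes \<T> :: "(real^'n) set set"
  assumes m: "shape_regular_mesh C0 \<Omega> \<T>" and C0: "C0 > 0" and T: "T \<in> \<T>" and E: "E \<in> sides T" and d: "CARD('n) \<ge> 2"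
  shows "ball_ratio CARD('n) C0 * diameter T \<le> diameter E"
proof -
  define \<rho> where "\<rho> = ball_ratio CARD('n) C0"
  note D = shape_regular_meshD[OF m]
  note eb = element_ball[OF m C0 T, folded \<rho>_def]
  obtain c where c: "cball c (\<rho> * diameter T) \<subseteq> T" using eb(1) by blast
  have Ef: "E facet_of T" using E by (simp add: sides_def)
  note fa = facet_aff_dim[OF eb(5) Ef]
  have n: "normal_to E (unit_normal E)" by (rule unit_normal[OF fa(2,1)])
  have "dim {x. unit_normal E \<bullet> x = 0} = CARD('n) - 1"
    using n by (subst dim_hyperplane) (auto simp: normal_to_def)
  then have "dim {x. unit_normal E \<bullet> x = 0} \<noteq> 0" using d by simp
  then obtain z where z: "unit_normal E \<bullet> z = 0" "z \<noteq> 0" by (auto simp: dim_eq_0)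
  define z' where "z' = (\<rho> * diameter T / norm z) *\<^sub>R z"
  have r: "\<rho> * diameter T > 0" using eb by simp
  have z': "unit_normal E \<bullet> z' = 0" "norm z' = \<rho> * diameter T" using z r by (simp_all add: z'_def)
  show ?thesis unfolding \<rho>_def[symmetric]
  proof (rule facet_disc[OF D(3)[OF T] Ef n c r])
    fix c' assume c': "c' \<in> E" "\<And>z. unit_normal E \<bullet> z = 0 \<Longrightarrow> norm z \<le> \<rho> * diameter T \<Longrightarrow> c' + z \<in> E"
    have "c' + z' \<in> E" using c'(2) z' by simp
    moreover have "bounded E" using fa(4) shape_compact[OF D(3)[OF T]] compact_imp_bounded bounded_subset by blast
    ultimately have "dist c' (c' + z') \<le> diameter E" using diameter_bounded_bound c'(1) by blast
    then show "\<rho> * diameter T \<le> diameter E" using z' by (simp add: dist_norm)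
  qed
qed

text \<open>This is \<open>r\<^sup>2 / (4 D)\<close> for \<open>h = 1\<close>, the radius of the half ball below, where \<open>r = \<rho>\<^sup>2\<close> is the
  radius of a ball inside either neighbour and \<open>D = 1 / \<rho>\<close> bounds their diameters.\<close>

definition patch_ratio :: "nat \<Rightarrow> real \<Rightarrow> real" where
  "patch_ratio d C0 = (ball_ratio d C0) ^ 5 / 4"

text \<open>Names the choice made inside \<open>jump\<close>, so that the estimates can speak of the
  same two elements.\<close>

definition jump_pair :: "(real^'n) set set \<Rightarrow> (real^'n) set \<Rightarrow> (real^'n) set \<times> (real^'n) set" where
  "jump_pair \<T> E = (SOME (Tp, Tm). Tp \<in> \<T> \<and> Tm \<in> \<T> \<and> Tp \<noteq> Tm \<and> E = Tp \<inter> Tm)"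

lemma jump_eq: "jump \<T> E w x = w (fst (jump_pair \<T> E)) x - w (snd (jump_pair \<T> E)) x"
  unfolding jump_def jump_pair_def[symmetric] by (simp add: case_prod_unfold Let_def)

text \<open>The choice asks only that \<open>E\<close> be the intersection of the two elements. That
  it is a facet of both follows from conformity and from its dimension d - 1, which it has as a
  facet of some element.\<close>

lemma jump_pairD:
  fixes \<T> :: "(real^'n) set set"
  assumes m: "shape_regular_mesh C0 \<Omega> \<T>" and C0: "C0 > 0" and E: "E \<in> interior_sides \<T>"
  shows "fst (jump_pair \<T> E) \<in> \<T>" "snd (jump_pair \<T> E) \<in> \<T>" "fst (jump_pair \<T> E) \<noteq> snd (jump_pair \<T> E)"
    "E = fst (jump_pair \<T> E) \<inter> snd (jump_pair \<T> E)" "E \<in> sides (fst (jump_pair \<T> E))" "E \<in> sides (snd (jump_pair \<T> E))"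
proof -
  note D = shape_regular_meshD[OF m]
  from E obtain S S' where S: "S \<in> \<T>" "S' \<in> \<T>" "S \<noteq> S'" "E = S \<inter> S'" "E \<in> sides S" unfolding interior_sides_def by blast
  then have "\<exists>p. case p of (Tp, Tm) \<Rightarrow> Tp \<in> \<T> \<and> Tm \<in> \<T> \<and> Tp \<noteq> Tm \<and> E = Tp \<inter> Tm" by blast
  from someI_ex[OF this] have *: "case jump_pair \<T> E of (Tp, Tm) \<Rightarrow> Tp \<in> \<T> \<and> Tm \<in> \<T> \<and> Tp \<noteq> Tm \<and> E = Tp \<inter> Tm"
    unfolding jump_pair_def .
  show 1: "fst (jump_pair \<T> E) \<in> \<T>" and 2: "snd (jump_pair \<T> E) \<in> \<T>" and 3: "fst (jump_pair \<T> E) \<noteq> snd (jump_pair \<T> E)"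
    and 4: "E = fst (jump_pair \<T> E) \<inter> snd (jump_pair \<T> E)"
    using * by (auto simp: case_prod_unfold)
  have Ef: "E facet_of S" using S(5) by (simp add: sides_def)
  note fa = facet_aff_dim[OF element_ball(5)[OF m C0 S(1)] Ef]
  have "E \<in> sides T" if "T \<in> \<T>" "E face_of T" for T
    unfolding sides_def facet_of_def using that fa(1,2) aff_dim_nonempty_interior[OF element_ball(5)[OF m C0 that(1)]] by simp
  then show "E \<in> sides (fst (jump_pair \<T> E))" "E \<in> sides (snd (jump_pair \<T> E))"
    using D(5)[OF 1 2 3] D(6)[OF 1 2 3] 1 2 4 by metis+
qed

text \<open>h is the size of the element whose indicator is estimated, whereas \<open>S\<close> is
  either neighbour of \<open>E\<close> and has that size only up to the factor \<rho>. Its inscribed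
  ball therefore has radius at least \<rho>^2 h.\<close>

lemma half_ball_in_element:
  fixes \<T> :: "(real^'n) set set"
  assumes m: "shape_regular_mesh C0 \<Omega> \<T>" and C0: "C0 > 0" and S: "S \<in> \<T>" "E \<in> sides S"
    and n: "normal_to E n" and side: "\<And>x. x \<in> S \<Longrightarrow> 0 \<le> n \<bullet> (x - c)" and c: "c \<in> E"
  defines "\<rho> \<equiv> ball_ratio CARD('n) C0"
  assumes disc: "\<And>z. n \<bullet> z = 0 \<Longrightarrow> norm z \<le> \<rho> * h \<Longrightarrow> c + z \<in> E"
    and h: "0 < h" "\<rho> * h \<le> diameter S" "diameter S \<le> h / \<rho>"
    and x: "dist c x < patch_ratio CARD('n) C0 * h" "0 \<le> n \<bullet> (x - c)"
  shows "x \<in> S"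
proof -
  note D = shape_regular_meshD[OF m]
  note eb = element_ball[OF m C0 S(1), folded \<rho>_def]
  obtain c' where c': "cball c' (\<rho> * diameter S) \<subseteq> S" using eb(1) by blast
  have ES: "E \<subseteq> S" by (rule sides_subset[OF S(2)])
  define r where "r = \<rho>\<^sup>2 * h"
  have r0: "0 < r" using eb h by (simp add: r_def)
  have r1: "r \<le> \<rho> * diameter S"
    using mult_left_mono[OF h(2), of \<rho>] eb(3) by (simp add: r_def power2_eq_square mult.assoc)
  have "\<rho> * (\<rho> * h) \<le> 1 * (\<rho> * h)" using eb h by (intro mult_right_mono) auto
  then have r2: "r \<le> \<rho> * h" by (simp add: r_def power2_eq_square)
  have "\<rho> * h \<le> 1 * h" using eb h by (intro mult_right_mono) auto
  also have "1 * h \<le> h / \<rho>" using eb h by (simp add: pos_le_divide_eq mult_left_le)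
  finally have r3: "r \<le> h / \<rho>" using r2 by simp
  have ratio: "patch_ratio CARD('n) C0 * h = r\<^sup>2 / (4 * (h / \<rho>))"
    using eb h by (simp add: patch_ratio_def \<rho>_def[symmetric] r_def power_mult_distrib field_simps eval_nat_numeral)
  show ?thesis
  proof (rule half_ball[of S E c n r c' "h / \<rho>" x])
    show "convex S" by (rule shape_convex[OF D(3)[OF S(1)]])
    show "c + z \<in> E" if "n \<bullet> z = 0" "norm z \<le> r" for z using disc that r2 by simp
    show "norm n = 1" using n by (simp add: normal_to_def)
    show "cball c' r \<subseteq> S" using c' subset_cball[OF r1] by blast
    have "S \<subseteq> cball c (diameter S)" using subset_cball_diameter[OF shape_compact[OF D(3)[OF S(1)]], of c] c ES by blast
    then show "S \<subseteq> cball c (h / \<rho>)" using h(3) subset_cball by blast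
    show "dist c x < r\<^sup>2 / (4 * (h / \<rho>))" using x(1) unfolding ratio .
  qed (use ES c side r0 r3 x in auto)
qed

text \<open>Each element with facet \<open>E\<close> lies on one side of its hyperplane and contains
  the half ball there. Two different ones on the same side would share an open set. So
  \<open>Tp\<close> and \<open>Tm\<close> lie on opposite sides, and there is no third element:
  \<open>T\<close> is one of them.\<close>

lemma side_patch:
  fixes \<T> :: "(real^'n) set set"
  assumes m: "shape_regular_mesh C0 \<Omega> \<T>" and C0: "C0 > 0" and d: "CARD('n) \<ge> 2"
    and T: "T \<in> \<T>" "E \<in> sides T" and E: "E \<in> interior_sides \<T>"
  defines "\<rho> \<equiv> ball_ratio CARD('n) C0" and "Tp \<equiv> fst (jump_pair \<T> E)" and "Tm \<equiv> snd (jump_pair \<T> E)" and "h \<equiv> diameter T"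
  shows "T = Tp \<or> T = Tm" "\<rho> * h \<le> diameter Tp" "\<rho> * h \<le> diameter Tm"
    "\<exists>n c. (n = unit_normal E \<or> n = - unit_normal E) \<and> normal_to E n \<and> c \<in> E \<and>
      (\<forall>x. dist c x < patch_ratio CARD('n) C0 * h \<longrightarrow> (0 \<le> n \<bullet> (x - c) \<longrightarrow> x \<in> Tp) \<and> (n \<bullet> (x - c) \<le> 0 \<longrightarrow> x \<in> Tm))"
proof -
  note D = shape_regular_meshD[OF m]
  note jp = jump_pairD[OF m C0 E, folded Tp_def Tm_def]
  note eb = element_ball[OF m C0 T(1), folded \<rho>_def h_def]
  have hE: "diameter E \<le> diameter S" if "S \<in> \<T>" "E \<in> sides S" for S
    using diameter_subset[OF sides_subset[OF that(2)]] shape_compact[OF D(3)[OF that(1)]] compact_imp_bounded by blast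
  have rE: "\<rho> * diameter S \<le> diameter E" if "S \<in> \<T>" "E \<in> sides S" for S
    unfolding \<rho>_def by (rule side_diameter[OF m C0 that d])
  have lo: "\<rho> * h \<le> diameter S" if "S \<in> \<T>" "E \<in> sides S" for S using rE[OF T] hE[OF that] by (simp add: h_def)
  have hi: "diameter S \<le> h / \<rho>" if "S \<in> \<T>" "E \<in> sides S" for S
    using rE[OF that] hE[OF T] eb(3) by (simp add: h_def pos_le_divide_eq mult.commute)
  show "\<rho> * h \<le> diameter Tp" "\<rho> * h \<le> diameter Tm" using lo jp by auto
  have Ef: "E facet_of T" using T(2) by (simp add: sides_def)
  note fa = facet_aff_dim[OF eb(5) Ef]
  define n0 where "n0 = unit_normal E"
  have n0: "normal_to E n0" unfolding n0_def by (rule unit_normal[OF fa(2,1)])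
  obtain b where b: "cball b (\<rho> * h) \<subseteq> T" using eb(1) by blast
  have rh: "\<rho> * h > 0" using eb by simp
  obtain c where c: "c \<in> E" and disc: "\<And>z. n0 \<bullet> z = 0 \<Longrightarrow> norm z \<le> \<rho> * h \<Longrightarrow> c + z \<in> E"
    by (rule facet_disc[OF D(3)[OF T(1)] Ef n0 b rh]) blast
  define R where "R = patch_ratio CARD('n) C0 * h"
  have R: "R > 0" using eb by (simp add: R_def patch_ratio_def \<rho>_def[symmetric])
  have hb: "x \<in> S" if "S \<in> \<T>" "E \<in> sides S" "n = n0 \<or> n = - n0" "\<And>x. x \<in> S \<Longrightarrow> 0 \<le> n \<bullet> (x - c)" "dist c x < R" "0 \<le> n \<bullet> (x - c)" for S n x
  proof (rule half_ball_in_element[OF m C0 that(1,2) _ that(4) c, where h = h, folded \<rho>_def])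
    show "normal_to E n" using that(3) n0 normal_minus by blast
    show "c + z \<in> E" if "n \<bullet> z = 0" "norm z \<le> \<rho> * h" for z using disc that \<open>n = n0 \<or> n = - n0\<close> by auto
  qed (use that lo hi eb R_def in auto)
  have side: "(\<forall>x\<in>S. 0 \<le> n \<bullet> (x - c)) \<or> (\<forall>x\<in>S. 0 \<le> (- n) \<bullet> (x - c))" if "S \<in> \<T>" "E \<in> sides S" "n = n0 \<or> n = - n0" for S n
    using facet_side[OF D(3)[OF that(1)] _ _ element_ball(5)[OF m C0 that(1)] c, of n] that n0 normal_minus[OF n0] unfolding sides_def by auto
  have same: "S = S'" if S: "S \<in> \<T>" "E \<in> sides S" "S' \<in> \<T>" "E \<in> sides S'" and n: "n = n0 \<or> n = - n0"
    and s: "\<And>x. x \<in> S \<Longrightarrow> 0 \<le> n \<bullet> (x - c)" "\<And>x. x \<in> S' \<Longrightarrow> 0 \<le> n \<bullet> (x - c)" for S S' n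
  proof (rule ccontr)
    assume ne: "S \<noteq> S'"
    let ?U = "ball c R \<inter> {x. n \<bullet> (x - c) > 0}"
    have "open ?U" by (intro open_Int open_ball open_Collect_less continuous_intros)
    moreover have "?U \<subseteq> S" "?U \<subseteq> S'" using hb[OF S(1,2) n s(1)] hb[OF S(3,4) n s(2)] by auto
    ultimately have "?U \<subseteq> interior S \<inter> interior S'" using interior_maximal by blast
    moreover have "c + (R / 2) *\<^sub>R n \<in> ?U"
    proof -
      have "norm n = 1" "n \<bullet> n = 1" using n n0 by (auto simp: normal_to_def norm_eq_1)
      then show ?thesis using R by (simp add: dist_norm)
    qed
    ultimately show False using D(4)[OF S(1,3) ne] by blast
  qed
  \<comment> \<open>The sign of the normal is fixed so that it points into
    \<open>Tp\<close>.\<close>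
  obtain n where n: "n = n0 \<or> n = - n0" and np: "\<And>x. x \<in> Tp \<Longrightarrow> 0 \<le> n \<bullet> (x - c)"
    using side[OF jp(1,5), of n0] by blast
  have n': "- n = n0 \<or> - n = - n0" using n by auto
  have nm: "\<And>x. x \<in> Tm \<Longrightarrow> 0 \<le> (- n) \<bullet> (x - c)"
    using side[OF jp(2,6) n] same[OF jp(1,5) jp(2,6) n np] jp(3) by blast
  show "T = Tp \<or> T = Tm"
    using side[OF T n]
  proof
    assume "\<forall>x\<in>T. 0 \<le> n \<bullet> (x - c)"
    then show ?thesis using same[OF T jp(1,5) n _ np] by blast
  next
    assume "\<forall>x\<in>T. 0 \<le> (- n) \<bullet> (x - c)"
    then show ?thesis using same[OF T jp(2,6) n' _ nm] by blast
  qed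
  have "(0 \<le> n \<bullet> (x - c) \<longrightarrow> x \<in> Tp) \<and> (n \<bullet> (x - c) \<le> 0 \<longrightarrow> x \<in> Tm)" if "dist c x < R" for x
    using hb[OF jp(1,5) n np that] hb[OF jp(2,6) n' nm that] by auto
  moreover have "normal_to E n" using n n0 normal_minus by blast
  ultimately show "\<exists>n c. (n = unit_normal E \<or> n = - unit_normal E) \<and> normal_to E n \<and> c \<in> E \<and>
      (\<forall>x. dist c x < patch_ratio CARD('n) C0 * h \<longrightarrow> (0 \<le> n \<bullet> (x - c) \<longrightarrow> x \<in> Tp) \<and> (n \<bullet> (x - c) \<le> 0 \<longrightarrow> x \<in> Tm))"
    using n c unfolding n0_def R_def by blast
qed

section \<open>The residual functional\<close>

lemma smooth_laplacian: "smooth q \<Longrightarrow> smooth (laplacian q)"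
  unfolding laplacian_def[abs_def] by (intro smooth_sum smooth_partial)

lemma whole_space_green:
  fixes q \<phi> :: "real^'n \<Rightarrow> real"
  assumes \<phi>: "smooth \<phi>" "compact K" "\<And>x. x \<notin> K \<Longrightarrow> \<phi> x = 0" and q: "smooth q"
  shows "(LINT x|lborel. grad q x \<bullet> grad \<phi> x) = - (LINT x|lborel. laplacian q x * \<phi> x)"
proof -
  have clK: "closed K" using \<phi>(2) compact_imp_closed by blast
  have i1: "integrable lborel (\<lambda>x. partial i q x * partial i \<phi> x)" for i
    using integrable_smooth_mult[OF smooth_partial[OF q] smooth_partial[OF \<phi>(1)] \<phi>(2) partial_eq_0_outside[OF clK \<phi>(3)], of UNIV]
    by simp
  have i2: "integrable lborel (\<lambda>x. partial i (partial i q) x * \<phi> x)" for i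
    using integrable_smooth_mult[OF smooth_partial[OF smooth_partial[OF q]] \<phi>, of UNIV] by simp
  have e: "(LINT x|lborel. partial i q x * partial i \<phi> x) = - (LINT x|lborel. partial i (partial i q) x * \<phi> x)" for i
    using ibp_invariant[OF \<phi> smooth_partial[OF q], of UNIV "axis i 1"] by (simp add: dderiv_axis)
  have "(LINT x|lborel. grad q x \<bullet> grad \<phi> x) = (LINT x|lborel. (\<Sum>i\<in>UNIV. partial i q x * partial i \<phi> x))"
    by (simp add: grad_def inner_vec_def)
  also have "\<dots> = (\<Sum>i\<in>UNIV. LINT x|lborel. partial i q x * partial i \<phi> x)"
    by (rule Bochner_Integration.integral_sum) (rule i1)
  also have "\<dots> = - (\<Sum>i\<in>UNIV. LINT x|lborel. partial i (partial i q) x * \<phi> x)" unfolding e by (simp add: sum_negf)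
  also have "(\<Sum>i\<in>UNIV. LINT x|lborel. partial i (partial i q) x * \<phi> x) = (LINT x|lborel. (\<Sum>i\<in>UNIV. partial i (partial i q) x * \<phi> x))"
    by (rule Bochner_Integration.integral_sum[symmetric]) (rule i2)
  also have "\<dots> = (LINT x|lborel. laplacian q x * \<phi> x)" by (simp add: laplacian_def sum_distrib_right)
  finally show ?thesis .
qed

lemma L2_norm_bound:
  fixes f :: "real^'n \<Rightarrow> 'b::euclidean_space"
  assumes S: "S \<in> sets borel" and f: "sq_integrable_on S f" and K: "compact K" "\<And>x. x \<in> S \<Longrightarrow> x \<notin> K \<Longrightarrow> f x = 0"
    and M0: "0 \<le> M" and M: "\<And>x. x \<in> S \<Longrightarrow> norm (f x) \<le> M" and V: "measure lebesgue K \<le> V"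
  shows "L2_norm S f \<le> M * sqrt V"
proof -
  have Kb: "K \<in> sets borel" using K(1) by (rule borel_compact)
  have fin: "emeasure lebesgue K < \<infinity>" using Kb emeasure_compact_finite[OF K(1)] by simp
  have SK: "S \<inter> K \<in> sets lebesgue" using S Kb by auto
  have finSK: "emeasure lebesgue (S \<inter> K) < \<infinity>"
    using fin emeasure_mono[of "S \<inter> K" K lebesgue] Kb by (auto intro: order_le_less_trans)
  have ind: "integrable (lebesgue_on S) (indicat_real K)"
    using S SK finSK by (subst integrable_restrict_space)
      (auto simp: indicator_inter_arith[symmetric] integrable_indicator_iff Int_commute)
  have indv: "(LINT x|lebesgue_on S. indicat_real K x) = measure lebesgue (S \<inter> K)"
    using S SK by (subst integral_restrict_space) (auto simp: indicator_inter_arith[symmetric] Int_commute)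
  have "L2_inner S f f \<le> (LINT x|lebesgue_on S. M\<^sup>2 * indicat_real K x)"
    unfolding L2_inner_def
  proof (rule integral_mono)
    show "integrable (lebesgue_on S) (\<lambda>x. f x \<bullet> f x)" by (rule sq_integrable_inner[OF f f])
    show "integrable (lebesgue_on S) (\<lambda>x. M\<^sup>2 * indicat_real K x)" using ind by simp
    fix x assume "x \<in> space (lebesgue_on S)"
    then have x: "x \<in> S" by simp
    show "f x \<bullet> f x \<le> M\<^sup>2 * indicat_real K x"
      using K(2)[OF x] power_mono[OF M[OF x], of 2] by (cases "x \<in> K") (auto simp: power2_norm_eq_inner)
  qed
  also have "\<dots> = M\<^sup>2 * measure lebesgue (S \<inter> K)" by (subst integral_mult_right_zero) (simp only: indv)
  also have "\<dots> \<le> M\<^sup>2 * V"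
  proof (rule mult_left_mono)
    have "measure lebesgue (S \<inter> K) \<le> measure lebesgue K"
      using SK fin Kb by (intro measure_mono_fmeasurable) (auto simp: fmeasurable_def)
    then show "measure lebesgue (S \<inter> K) \<le> V" using V by linarith
  qed simp
  finally have "sqrt (L2_inner S f f) \<le> sqrt (M\<^sup>2 * V)" by (rule real_sqrt_le_mono)
  then show ?thesis using M0 by (simp add: L2_norm_def real_sqrt_mult)
qed

lemma sq_integrable_indicator:
  fixes f :: "real^'n \<Rightarrow> 'b::euclidean_space"
  assumes f: "sq_integrable_on S f" and A: "A \<in> sets borel"
  shows "sq_integrable_on S (\<lambda>x. indicat_real A x *\<^sub>R f x)"
proof -
  have [measurable]: "f \<in> borel_measurable (lebesgue_on S)" using f by (simp add: sq_integrable_on_def)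
  have [measurable]: "indicat_real A \<in> borel_measurable (lebesgue_on S)"
    by (intro measurable_restrict_space1 measurable_completion, rule borel_measurable_indicator) (simp add: A)
  show ?thesis unfolding sq_integrable_on_def
  proof
    show "(\<lambda>x. indicat_real A x *\<^sub>R f x) \<in> borel_measurable (lebesgue_on S)" by measurable
    show "integrable (lebesgue_on S) (\<lambda>x. (norm (indicat_real A x *\<^sub>R f x))\<^sup>2)"
    proof (rule Bochner_Integration.integrable_bound)
      show "integrable (lebesgue_on S) (\<lambda>x. (norm (f x))\<^sup>2)" using f by (simp add: sq_integrable_on_def)
      show "(\<lambda>x. (norm (indicat_real A x *\<^sub>R f x))\<^sup>2) \<in> borel_measurable (lebesgue_on S)" by measurable
      show "AE x in lebesgue_on S. norm ((norm (indicat_real A x *\<^sub>R f x))\<^sup>2) \<le> norm ((norm (f x))\<^sup>2)"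
        by (intro always_eventually allI) (auto simp: indicator_def)
    qed
  qed
qed

lemma norm_grad_le:
  fixes \<phi> :: "real^'n \<Rightarrow> real" and M :: real
  assumes "\<And>i. \<bar>partial i \<phi> x\<bar> \<le> M"
  shows "norm (grad \<phi> x) \<le> CARD('n) * M"
proof -
  have "norm (grad \<phi> x) \<le> (\<Sum>i\<in>UNIV. \<bar>grad \<phi> x $ i\<bar>)" by (rule norm_le_l1_cart)
  also have "\<dots> \<le> (\<Sum>i\<in>(UNIV::'n set). M)" by (intro sum_mono) (simp add: grad_def assms)
  finally show ?thesis by simp
qed

lemma grad_eq_0_outside:
  assumes "closed K" "\<And>x. x \<notin> K \<Longrightarrow> f x = 0" "x \<notin> K"
  shows "grad f x = 0"
  using partial_eq_0_outside[OF assms] by (simp add: grad_def vec_eq_iff)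

text \<open>The first equation is the case \<open>\<kappa> = \<epsilon>\<close>, \<open>g = f - \<psi>h\<close>, \<open>e = \<psi> - \<psi>h\<close>; the second one is
  \<open>\<kappa> = 1\<close>, \<open>g = \<psi>h\<close>, \<open>e = \<psi>h - \<psi>\<close>.  In both, \<open>G\<close> is the gradient of the error.\<close>

locale residual =
  fixes \<Omega> :: "(real^'n) set" and \<T> :: "(real^'n) set set" and p g :: "(real^'n) set \<Rightarrow> real^'n \<Rightarrow> real"
    and \<kappa> :: real and G :: "real^'n \<Rightarrow> real^'n" and e :: "real^'n \<Rightarrow> real"
  assumes mesh: "convex_mesh \<Omega> \<T>" and \<Omega>: "open \<Omega>" "bounded \<Omega>" "interior (closure \<Omega>) \<subseteq> \<Omega>"
    and p: "\<And>T. T \<in> \<T> \<Longrightarrow> smooth (p T)" and g: "\<And>T. T \<in> \<T> \<Longrightarrow> smooth (g T)"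
    and \<kappa>: "\<kappa> > 0" and G: "sq_integrable_on \<Omega> G" and e: "sq_integrable_on \<Omega> e"
    and residual_eq: "\<And>\<phi>. \<phi> \<in> test_functions \<Omega> \<Longrightarrow> \<kappa>\<^sup>2 * L2_inner \<Omega> G (grad \<phi>) + L2_inner \<Omega> e \<phi> =
      L2_inner \<Omega> (pw \<T> g) \<phi> - \<kappa>\<^sup>2 * L2_inner \<Omega> (\<lambda>x. \<chi> i. pw \<T> (\<lambda>T. partial i (p T)) x) (grad \<phi>)"
begin

text \<open>Evaluated in two ways: from above by Cauchy-Schwarz (\<open>res_bound\<close>), and
  exactly, by parts, as an integral of element residuals and jumps of the discrete solution
  (\<open>res_element\<close>, \<open>res_side\<close>).\<close>

definition res :: "(real^'n \<Rightarrow> real) \<Rightarrow> real" where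
  "res \<phi> = \<kappa>\<^sup>2 * L2_inner \<Omega> G (grad \<phi>) + L2_inner \<Omega> e \<phi>"

text \<open>The squared error on the part of the domain in \<open>A\<close>. Keeping the estimates
  local allows them to be summed at the end with a factor that counts only sides per
  element.\<close>

definition err :: "(real^'n) set \<Rightarrow> real" where
  "err A = (LINT x|lebesgue_on \<Omega>. indicat_real A x * (\<kappa>\<^sup>2 * (G x \<bullet> G x) + e x * e x))"

lemma err_integrable:
  assumes "A \<in> sets borel"
  shows "integrable (lebesgue_on \<Omega>) (\<lambda>x. indicat_real A x * (\<kappa>\<^sup>2 * (G x \<bullet> G x) + e x * e x))"
proof -
  have 1: "integrable (lebesgue_on \<Omega>) (\<lambda>x. (indicat_real A x *\<^sub>R G x) \<bullet> G x)"
    by (rule sq_integrable_inner[OF sq_integrable_indicator[OF G assms] G])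
  have 2: "integrable (lebesgue_on \<Omega>) (\<lambda>x. (indicat_real A x *\<^sub>R e x) \<bullet> e x)"
    by (rule sq_integrable_inner[OF sq_integrable_indicator[OF e assms] e])
  have "integrable (lebesgue_on \<Omega>) (\<lambda>x. \<kappa>\<^sup>2 * ((indicat_real A x *\<^sub>R G x) \<bullet> G x) + (indicat_real A x *\<^sub>R e x) \<bullet> e x)"
    by (intro Bochner_Integration.integrable_add integrable_mult_right 1 2)
  then show ?thesis by (simp add: algebra_simps)
qed

lemma err_nonneg: "0 \<le> err A"
  unfolding err_def by (intro integral_nonneg_AE always_eventually allI) (auto simp: indicator_def)

lemma res_bound:
  fixes M0 M1 V :: real
  assumes \<phi>: "smooth \<phi>" "compact K" "\<And>x. x \<notin> K \<Longrightarrow> \<phi> x = 0" and K: "K \<subseteq> \<Omega>" "K \<subseteq> A" and A: "A \<in> sets borel"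
    and M0: "\<And>x. \<bar>\<phi> x\<bar> \<le> M0" and M1: "\<And>x i. \<bar>partial i \<phi> x\<bar> \<le> M1" and V: "measure lebesgue K \<le> V"
  shows "\<bar>res \<phi>\<bar> \<le> sqrt (err A) * ((\<kappa> * (CARD('n) * M1) + M0) * sqrt V)"
proof -
  have t: "\<phi> \<in> test_functions \<Omega>" by (rule test_functionsI[OF \<phi>(1,2) K(1) \<phi>(3)])
  have clK: "closed K" using \<phi>(2) compact_imp_closed by blast
  have s\<phi>: "sq_integrable_on \<Omega> \<phi>" and sg: "sq_integrable_on \<Omega> (grad \<phi>)"
    using test_function_sq_integrable[OF t \<Omega>(1,2)] test_function_grad_sq_integrable[OF t \<Omega>(1,2)] .
  have g0: "grad \<phi> x = 0" if "x \<notin> K" for x by (rule grad_eq_0_outside[OF clK \<phi>(3) that])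
  have \<Omega>b: "\<Omega> \<in> sets borel" using \<Omega>(1) by simp
  have ng: "L2_norm \<Omega> (grad \<phi>) \<le> (CARD('n) * M1) * sqrt V"
  proof (rule L2_norm_bound[OF \<Omega>b sg \<phi>(2) _ _ _ V])
    show "0 \<le> real CARD('n) * M1" using M1[of undefined 0] by (intro mult_nonneg_nonneg) (auto intro: order_trans[OF abs_ge_zero])
    show "grad \<phi> x = 0" if "x \<notin> K" for x by (rule g0[OF that])
    show "norm (grad \<phi> x) \<le> real CARD('n) * M1" for x by (rule norm_grad_le[OF M1])
  qed
  have n\<phi>: "L2_norm \<Omega> \<phi> \<le> M0 * sqrt V"
  proof (rule L2_norm_bound[OF \<Omega>b s\<phi> \<phi>(2) _ _ _ V])
    show "0 \<le> M0" using M0[of 0] by (rule order_trans[OF abs_ge_zero])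
    show "\<phi> x = 0" if "x \<notin> K" for x by (rule \<phi>(3)[OF that])
    show "norm (\<phi> x) \<le> M0" for x using M0[of x] by simp
  qed
  define GA where "GA x = indicat_real A x *\<^sub>R G x" for x
  define eA where "eA x = indicat_real A x *\<^sub>R e x" for x
  have sGA: "sq_integrable_on \<Omega> GA" and seA: "sq_integrable_on \<Omega> eA"
    unfolding GA_def[abs_def] eA_def[abs_def] using sq_integrable_indicator G e A by blast+
  have "L2_inner \<Omega> G (grad \<phi>) = L2_inner \<Omega> GA (grad \<phi>)"
    unfolding L2_inner_def by (intro Bochner_Integration.integral_cong refl) (use g0 K(2) in \<open>force simp: GA_def indicator_def\<close>)
  moreover have "L2_inner \<Omega> e \<phi> = L2_inner \<Omega> eA \<phi>"
    unfolding L2_inner_def by (intro Bochner_Integration.integral_cong refl) (use \<phi>(3) K(2) in \<open>force simp: eA_def indicator_def\<close>)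
  ultimately have "\<bar>res \<phi>\<bar> = \<bar>\<kappa>\<^sup>2 * L2_inner \<Omega> GA (grad \<phi>) + L2_inner \<Omega> eA \<phi>\<bar>" by (simp add: res_def)
  also have "\<dots> \<le> \<kappa>\<^sup>2 * \<bar>L2_inner \<Omega> GA (grad \<phi>)\<bar> + \<bar>L2_inner \<Omega> eA \<phi>\<bar>"
    by (intro order_trans[OF abs_triangle_ineq]) (simp add: abs_mult)
  also have "\<dots> \<le> \<kappa>\<^sup>2 * (L2_norm \<Omega> GA * L2_norm \<Omega> (grad \<phi>)) + L2_norm \<Omega> eA * L2_norm \<Omega> \<phi>"
    by (intro add_mono mult_left_mono L2_Cauchy_Schwarz sGA sg seA s\<phi>) simp
  also have "\<dots> = (\<kappa> * L2_norm \<Omega> GA) * (\<kappa> * L2_norm \<Omega> (grad \<phi>)) + L2_norm \<Omega> eA * L2_norm \<Omega> \<phi>"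
    by (simp add: power2_eq_square)
  also have "\<dots> \<le> sqrt (err A) * (\<kappa> * ((CARD('n) * M1) * sqrt V)) + sqrt (err A) * (M0 * sqrt V)"
  proof -
    have eq: "err A = \<kappa>\<^sup>2 * L2_inner \<Omega> GA GA + L2_inner \<Omega> eA eA"
    proof -
      have "\<kappa>\<^sup>2 * L2_inner \<Omega> GA GA + L2_inner \<Omega> eA eA = (LINT x|lebesgue_on \<Omega>. \<kappa>\<^sup>2 * (GA x \<bullet> GA x) + eA x \<bullet> eA x)"
        unfolding L2_inner_def
        using sq_integrable_inner[OF sGA sGA] sq_integrable_inner[OF seA seA] by simp
      also have "\<dots> = err A" unfolding err_def
        by (intro Bochner_Integration.integral_cong refl) (auto simp: GA_def eA_def indicator_def)
      finally show ?thesis by simp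
    qed
    have "\<kappa>\<^sup>2 * L2_inner \<Omega> GA GA \<le> err A" unfolding eq using L2_inner_self_nonneg[of \<Omega> eA] by simp
    then have "sqrt (\<kappa>\<^sup>2 * L2_inner \<Omega> GA GA) \<le> sqrt (err A)" by (rule real_sqrt_le_mono)
    then have 1: "\<kappa> * L2_norm \<Omega> GA \<le> sqrt (err A)" using \<kappa> by (simp add: L2_norm_def real_sqrt_mult)
    have "L2_inner \<Omega> eA eA \<le> err A" unfolding eq using L2_inner_self_nonneg[of \<Omega> GA] by simp
    then have 2: "L2_norm \<Omega> eA \<le> sqrt (err A)" unfolding L2_norm_def by (rule real_sqrt_le_mono)
    show ?thesis
      using 1 2 ng n\<phi> \<kappa> err_nonneg by (intro add_mono mult_mono mult_nonneg_nonneg) (auto simp: L2_norm_nonneg)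
  qed
  also have "\<dots> = sqrt (err A) * ((\<kappa> * (CARD('n) * M1) + M0) * sqrt V)" by (simp add: algebra_simps)
  finally show ?thesis .
qed

lemma res_eq_lborel:
  assumes \<phi>: "smooth \<phi>" "compact K" "\<And>x. x \<notin> K \<Longrightarrow> \<phi> x = 0" and K: "K \<subseteq> \<Omega>"
  shows "res \<phi> = (LINT x|lborel. pw \<T> g x * \<phi> x)
    - \<kappa>\<^sup>2 * (LINT x|lborel. (\<chi> i. pw \<T> (\<lambda>T. partial i (p T)) x) \<bullet> grad \<phi> x)"
proof -
  have t: "\<phi> \<in> test_functions \<Omega>" by (rule test_functionsI[OF \<phi>(1,2) K \<phi>(3)])
  have clK: "closed K" using \<phi>(2) compact_imp_closed by blast
  have g0: "grad \<phi> x = 0" if "x \<notin> \<Omega>" for x using K that by (intro grad_eq_0_outside[OF clK \<phi>(3)]) auto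
  have p0: "\<phi> x = 0" if "x \<notin> \<Omega>" for x using K that \<phi>(3) by auto
  have pm: "pw \<T> (\<lambda>T. partial i (p T)) \<in> borel_measurable borel" for i by (intro pw_borel_measurable smooth_partial p)
  have dm: "partial i \<phi> \<in> borel_measurable borel" for i by (intro smooth_borel_measurable smooth_partial \<phi>(1))
  have "L2_inner \<Omega> (pw \<T> g) \<phi> = (LINT x|lborel. pw \<T> g x * \<phi> x)"
    unfolding L2_inner_def using \<Omega>(1) p0
    by (intro integral_lebesgue_on_lborel borel_measurable_times pw_borel_measurable smooth_borel_measurable[OF \<phi>(1)] g) auto
  moreover have "L2_inner \<Omega> (\<lambda>x. \<chi> i. pw \<T> (\<lambda>T. partial i (p T)) x) (grad \<phi>)
      = (LINT x|lborel. (\<chi> i. pw \<T> (\<lambda>T. partial i (p T)) x) \<bullet> grad \<phi> x)"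
    unfolding L2_inner_def
  proof (rule integral_lebesgue_on_lborel)
    show "(\<lambda>x. (\<chi> i. pw \<T> (\<lambda>T. partial i (p T)) x) \<bullet> grad \<phi> x) \<in> borel_measurable borel"
      by (simp add: inner_vec_def grad_def) (intro borel_measurable_sum borel_measurable_times pm dm)
  qed (use \<Omega>(1) g0 in auto)
  ultimately show ?thesis unfolding res_def using residual_eq[OF t] by simp
qed

definition elem_res :: "(real^'n) set \<Rightarrow> real^'n \<Rightarrow> real" where
  "elem_res T x = g T x + \<kappa>\<^sup>2 * laplacian (p T) x"

lemma elem_res_smooth: "T \<in> \<T> \<Longrightarrow> smooth (elem_res T)"
  unfolding elem_res_def[abs_def] by (intro smooth_add smooth_mult smooth_const smooth_laplacian g p)

lemma pw_grad_eq:
  assumes "T \<in> \<T>" "x \<in> interior T"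
  shows "(\<chi> i. pw \<T> (\<lambda>T. partial i (p T)) x) = grad (p T) x"
  by (simp add: grad_def vec_eq_iff pw_eq[OF mesh assms])

lemma interior_subset_domain: "T \<in> \<T> \<Longrightarrow> interior T \<subseteq> \<Omega>"
  using convex_meshD(4)[OF mesh] \<Omega>(3) interior_mono[of T "closure \<Omega>"] by blast

lemma res_element:
  assumes T: "T \<in> \<T>" and \<phi>: "smooth \<phi>" "compact K" "\<And>x. x \<notin> K \<Longrightarrow> \<phi> x = 0" and K: "K \<subseteq> interior T"
  shows "res \<phi> = (LINT x|lborel. elem_res T x * \<phi> x)"
proof -
  have clK: "closed K" using \<phi>(2) compact_imp_closed by blast
  have g0: "grad \<phi> x = 0" if "x \<notin> K" for x by (rule grad_eq_0_outside[OF clK \<phi>(3) that])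
  have i1: "integrable lborel (\<lambda>x. g T x * \<phi> x)" using integrable_smooth_mult[OF g[OF T] \<phi>, of UNIV] by simp
  have i2: "integrable lborel (\<lambda>x. laplacian (p T) x * \<phi> x)"
    using integrable_smooth_mult[OF smooth_laplacian[OF p[OF T]] \<phi>, of UNIV] by simp
  have "(LINT x|lborel. pw \<T> g x * \<phi> x) = (LINT x|lborel. g T x * \<phi> x)"
  proof (intro Bochner_Integration.integral_cong refl)
    fix x show "pw \<T> g x * \<phi> x = g T x * \<phi> x" using pw_eq[OF mesh T] \<phi>(3) K by (cases "x \<in> K") auto
  qed
  moreover have "(LINT x|lborel. (\<chi> i. pw \<T> (\<lambda>T. partial i (p T)) x) \<bullet> grad \<phi> x) = (LINT x|lborel. grad (p T) x \<bullet> grad \<phi> x)"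
  proof (intro Bochner_Integration.integral_cong refl)
    fix x show "(\<chi> i. pw \<T> (\<lambda>T. partial i (p T)) x) \<bullet> grad \<phi> x = grad (p T) x \<bullet> grad \<phi> x"
      using pw_grad_eq[OF T] g0 K by (cases "x \<in> K") auto
  qed
  ultimately have "res \<phi> = (LINT x|lborel. g T x * \<phi> x) + \<kappa>\<^sup>2 * (LINT x|lborel. laplacian (p T) x * \<phi> x)"
    unfolding whole_space_green[OF \<phi> p[OF T]]
    using res_eq_lborel[OF \<phi>] K interior_subset_domain[OF T] whole_space_green[OF \<phi> p[OF T]] by auto
  also have "\<dots> = (LINT x|lborel. g T x * \<phi> x + \<kappa>\<^sup>2 * (laplacian (p T) x * \<phi> x))"
    using i1 i2 by simp
  also have "\<dots> = (LINT x|lborel. elem_res T x * \<phi> x)"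
    by (intro Bochner_Integration.integral_cong refl) (simp add: elem_res_def algebra_simps)
  finally show ?thesis .
qed

text \<open>Each open half of the ball lies in the interior of one element, and \<phi> vanishes
  outside the ball, so the integrals over the elements become integrals over half spaces. With the
  normals n and -n the two boundary terms combine to the jump.\<close>

lemma res_side:
  assumes T: "Tp \<in> \<T>" "Tm \<in> \<T>" and E: "normal_to E n" and c: "c \<in> E"
    and patch: "\<And>x. dist c x < r \<Longrightarrow> 0 \<le> n \<bullet> (x - c) \<Longrightarrow> x \<in> Tp" "\<And>x. dist c x < r \<Longrightarrow> n \<bullet> (x - c) \<le> 0 \<Longrightarrow> x \<in> Tm"
    and \<phi>: "smooth \<phi>" "compact K" "\<And>x. x \<notin> K \<Longrightarrow> \<phi> x = 0" and K: "K \<subseteq> ball c r"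
  shows "ball c r \<subseteq> \<Omega>"
    "res \<phi> = (LINT x|lborel. indicator {x. n \<bullet> (x - c) > 0} x * elem_res Tp x * \<phi> x)
      + (LINT x|lborel. indicator {x. (- n) \<bullet> (x - c) > 0} x * elem_res Tm x * \<phi> x)
      + \<kappa>\<^sup>2 * ((LINT z|surface_measure E. dderiv (p Tp) n z * \<phi> z) - (LINT z|surface_measure E. dderiv (p Tm) n z * \<phi> z))"
proof -
  let ?P = "{x. n \<bullet> (x - c) > 0}" and ?M = "{x. (- n) \<bullet> (x - c) > 0}"
  have "ball c r \<subseteq> Tp \<union> Tm" using patch by force
  also have "\<dots> \<subseteq> closure \<Omega>" using convex_meshD(4)[OF mesh] T by blast
  finally have "ball c r \<subseteq> interior (closure \<Omega>)" by (simp add: interior_maximal)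
  then show b\<Omega>: "ball c r \<subseteq> \<Omega>" using \<Omega>(3) by blast
  have clK: "closed K" using \<phi>(2) compact_imp_closed by blast
  have g0: "grad \<phi> x = 0" if "x \<notin> K" for x by (rule grad_eq_0_outside[OF clK \<phi>(3) that])
  have oP: "open ?P" and oM: "open ?M" by (intro open_Collect_less continuous_intros)+
  have Pb [measurable]: "?P \<in> sets borel" and Mb [measurable]: "?M \<in> sets borel" using oP oM by auto
  have sub: "ball c r \<inter> ?P \<subseteq> Tp" "ball c r \<inter> ?M \<subseteq> Tm" using patch by auto
  have iP: "ball c r \<inter> ?P \<subseteq> interior Tp" by (rule interior_maximal[OF sub(1) open_Int[OF open_ball oP]])
  have iM: "ball c r \<inter> ?M \<subseteq> interior Tm" by (rule interior_maximal[OF sub(2) open_Int[OF open_ball oM]])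
  have E': "normal_to E (- n)" by (rule normal_minus[OF E])
  have n0: "n \<noteq> 0" using E by (auto simp: normal_to_def)
  have AE0: "AE x in lborel. n \<bullet> (x - c) \<noteq> 0"
  proof -
    have "{x. n \<bullet> x = n \<bullet> c} \<in> null_sets lebesgue"
      using negligible_hyperplane[of n "n \<bullet> c"] n0 by (simp add: negligible_iff_null_sets)
    moreover have "{x. n \<bullet> x = n \<bullet> c} \<in> sets lborel" by (simp add: closed_hyperplane borel_closed)
    ultimately have "{x. n \<bullet> x = n \<bullet> c} \<in> null_sets lborel" by (simp add: null_sets_completion_iff)
    then show ?thesis by (rule AE_I') (auto simp: inner_diff_right)
  qed
  \<comment> \<open>Splits a product at points off the hyperplane, which is a null set: where the
    second factor is nonzero the point lies in the ball, hence in the interior of \<open>Tp\<close>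
    or \<open>Tm\<close>.\<close>
  have pt: "F x * \<psi> x = indicator ?P x * Fp x * \<psi> x + indicator ?M x * Fm x * \<psi> x"
    if "n \<bullet> (x - c) \<noteq> 0" "x \<notin> K \<Longrightarrow> \<psi> x = 0" "x \<in> interior Tp \<Longrightarrow> F x = Fp x" "x \<in> interior Tm \<Longrightarrow> F x = Fm x"
    for F Fp Fm \<psi> :: "real^'n \<Rightarrow> real" and x
  proof (cases "x \<in> K")
    case True
    then have xb: "x \<in> ball c r" using K by blast
    show ?thesis
    proof (cases "n \<bullet> (x - c) > 0")
      case True
      then have "x \<in> interior Tp" using iP xb by blast
      then show ?thesis using that(3) True by (simp add: indicator_def)
    next
      case False
      then have m: "(- n) \<bullet> (x - c) > 0" using that(1) by simp
      then have "x \<in> interior Tm" using iM xb by blast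
      then show ?thesis using that(4) False m by (simp add: indicator_def)
    qed
  qed (use that in simp)
  have int: "integrable lborel (\<lambda>x. indicator A x * q x * \<phi> x)" if "smooth q" "A \<in> sets borel" for q A
    by (rule integrable_smooth_mult[OF that(1) \<phi> that(2)])
  have [measurable]: "\<phi> \<in> borel_measurable borel" by (rule smooth_borel_measurable[OF \<phi>(1)])
  have [measurable]: "pw \<T> g \<in> borel_measurable borel" by (intro pw_borel_measurable g)
  have [measurable]: "g Tp \<in> borel_measurable borel" "g Tm \<in> borel_measurable borel"
    by (intro smooth_borel_measurable g T)+
  have pm [measurable]: "pw \<T> (\<lambda>T. partial i (p T)) \<in> borel_measurable borel" "partial i \<phi> \<in> borel_measurable borel"
    "partial i (p Tp) \<in> borel_measurable borel" "partial i (p Tm) \<in> borel_measurable borel" for i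
    by (intro pw_borel_measurable smooth_borel_measurable smooth_partial p \<phi>(1) T, assumption?)+
  have 1: "(LINT x|lborel. pw \<T> g x * \<phi> x) = (LINT x|lborel. indicator ?P x * g Tp x * \<phi> x) + (LINT x|lborel. indicator ?M x * g Tm x * \<phi> x)"
  proof -
    have "(LINT x|lborel. pw \<T> g x * \<phi> x) = (LINT x|lborel. indicator ?P x * g Tp x * \<phi> x + indicator ?M x * g Tm x * \<phi> x)"
    proof (rule integral_cong_AE)
      show "AE x in lborel. pw \<T> g x * \<phi> x = indicator ?P x * g Tp x * \<phi> x + indicator ?M x * g Tm x * \<phi> x"
        using AE0 by eventually_elim (intro pt; simp add: \<phi>(3) pw_eq[OF mesh] T)
    qed measurable
    then show ?thesis using int[OF g[OF T(1)] Pb] int[OF g[OF T(2)] Mb] by simp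
  qed
  have intg: "integrable lborel (\<lambda>x. indicator A x * (grad q x \<bullet> grad \<phi> x))" if "smooth q" "A \<in> sets borel" for q A
  proof -
    have "integrable lborel (\<lambda>x. \<Sum>i\<in>UNIV. indicator A x * partial i q x * partial i \<phi> x)"
      by (intro Bochner_Integration.integrable_sum integrable_smooth_mult[OF smooth_partial[OF that(1)] smooth_partial[OF \<phi>(1)] \<phi>(2) partial_eq_0_outside[OF clK \<phi>(3)] that(2)])
    then show ?thesis by (simp add: grad_def inner_vec_def sum_distrib_left mult.assoc)
  qed
  have 2: "(LINT x|lborel. (\<chi> i. pw \<T> (\<lambda>T. partial i (p T)) x) \<bullet> grad \<phi> x)
      = (LINT x|lborel. indicator ?P x * (grad (p Tp) x \<bullet> grad \<phi> x)) + (LINT x|lborel. indicator ?M x * (grad (p Tm) x \<bullet> grad \<phi> x))"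
  proof -
    have "(LINT x|lborel. (\<chi> i. pw \<T> (\<lambda>T. partial i (p T)) x) \<bullet> grad \<phi> x)
      = (LINT x|lborel. indicator ?P x * (grad (p Tp) x \<bullet> grad \<phi> x) + indicator ?M x * (grad (p Tm) x \<bullet> grad \<phi> x))"
    proof (rule integral_cong_AE)
      show "AE x in lborel. (\<chi> i. pw \<T> (\<lambda>T. partial i (p T)) x) \<bullet> grad \<phi> x
          = indicator ?P x * (grad (p Tp) x \<bullet> grad \<phi> x) + indicator ?M x * (grad (p Tm) x \<bullet> grad \<phi> x)"
        using AE0
      proof eventually_elim
        case (elim x)
        have "((\<chi> i. pw \<T> (\<lambda>T. partial i (p T)) x) \<bullet> grad \<phi> x) * 1
          = indicator ?P x * (grad (p Tp) x \<bullet> grad \<phi> x) * 1 + indicator ?M x * (grad (p Tm) x \<bullet> grad \<phi> x) * 1"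
        proof (cases "x \<in> K")
          case True
          show ?thesis using elim True
            by (intro pt[where \<psi> = "\<lambda>_. 1" and F = "\<lambda>x. (\<chi> i. pw \<T> (\<lambda>T. partial i (p T)) x) \<bullet> grad \<phi> x"
                and Fp = "\<lambda>x. grad (p Tp) x \<bullet> grad \<phi> x" and Fm = "\<lambda>x. grad (p Tm) x \<bullet> grad \<phi> x"])
              (auto simp: pw_grad_eq[OF T(1)] pw_grad_eq[OF T(2)])
        qed (simp add: g0)
        then show ?case by simp
      qed
      show "(\<lambda>x. (\<chi> i. pw \<T> (\<lambda>T. partial i (p T)) x) \<bullet> grad \<phi> x) \<in> borel_measurable lborel"
        by (simp add: inner_vec_def grad_def)
      show "(\<lambda>x. indicator ?P x * (grad (p Tp) x \<bullet> grad \<phi> x) + indicator ?M x * (grad (p Tm) x \<bullet> grad \<phi> x)) \<in> borel_measurable lborel"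
        using intg[OF p[OF T(1)] Pb] intg[OF p[OF T(2)] Mb] by (intro borel_measurable_add) auto
    qed
    then show ?thesis using intg[OF p[OF T(1)] Pb] intg[OF p[OF T(2)] Mb] by simp
  qed
  have elem: "(LINT x|lborel. indicator A x * elem_res S x * \<phi> x)
      = (LINT x|lborel. indicator A x * g S x * \<phi> x) + \<kappa>\<^sup>2 * (LINT x|lborel. indicator A x * laplacian (p S) x * \<phi> x)"
    if S: "S \<in> \<T>" and A: "A \<in> sets borel" for S A
  proof -
    have "(LINT x|lborel. indicator A x * elem_res S x * \<phi> x)
      = (LINT x|lborel. indicator A x * g S x * \<phi> x + \<kappa>\<^sup>2 * (indicator A x * laplacian (p S) x * \<phi> x))"
      by (intro Bochner_Integration.integral_cong refl) (simp add: elem_res_def algebra_simps)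
    then show ?thesis using int[OF g[OF S] A] int[OF smooth_laplacian[OF p[OF S]] A] by simp
  qed
  have gp: "(LINT x|lborel. indicator ?P x * (grad (p Tp) x \<bullet> grad \<phi> x))
      = - (LINT x|lborel. indicator ?P x * laplacian (p Tp) x * \<phi> x) - (LINT z|surface_measure E. dderiv (p Tp) n z * \<phi> z)"
    by (rule halfspace_green[OF E c \<phi> p[OF T(1)]])
  have gm: "(LINT x|lborel. indicator ?M x * (grad (p Tm) x \<bullet> grad \<phi> x))
      = - (LINT x|lborel. indicator ?M x * laplacian (p Tm) x * \<phi> x) + (LINT z|surface_measure E. dderiv (p Tm) n z * \<phi> z)"
    using halfspace_green[OF E' c \<phi> p[OF T(2)]] by (simp add: dderiv_minus)
  show "res \<phi> = (LINT x|lborel. indicator ?P x * elem_res Tp x * \<phi> x)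
      + (LINT x|lborel. indicator ?M x * elem_res Tm x * \<phi> x)
      + \<kappa>\<^sup>2 * ((LINT z|surface_measure E. dderiv (p Tp) n z * \<phi> z) - (LINT z|surface_measure E. dderiv (p Tm) n z * \<phi> z))"
    unfolding elem[OF T(1) Pb] elem[OF T(2) Mb]
    using res_eq_lborel[OF \<phi> order_trans[OF K b\<Omega>]] unfolding 1 2 gp gm by (simp add: algebra_simps)
qed

end

section \<open>Squeezed bubble functions\<close>

text \<open>Stretching by \<open>h / \<tau>\<close> in the direction \<open>n\<close> confines the bump to a layer of
  thickness \<open>\<tau>\<close>, the width of the boundary layer; its trace on the hyperplane through \<open>c\<close> is
  unaffected.\<close>

definition stretch :: "real \<Rightarrow> real \<Rightarrow> real \<Rightarrow> real^'n \<Rightarrow> real^'n \<Rightarrow> real^'n" where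
  "stretch R h \<tau> n z = (1 / R) *\<^sub>R (z + ((h / \<tau> - 1) * (n \<bullet> z)) *\<^sub>R n)"

lemma linear_stretch: "linear (stretch R h \<tau> n)"
  unfolding stretch_def[abs_def]
  by (intro linearI) (simp_all add: inner_add_right algebra_simps)

text \<open>R times the map is symmetric, with eigenvalue h / \<tau> \<ge> 1 along \<open>n\<close>
  and 1 on the complement of \<open>n\<close>.\<close>

lemma stretch_bounds:
  assumes "norm n = 1" "0 < R" "0 < \<tau>" "\<tau> \<le> h"
  shows "norm z / R \<le> norm (stretch R h \<tau> n z)" "norm (stretch R h \<tau> n z) \<le> h / \<tau> / R * norm z"
    "\<bar>n \<bullet> z\<bar> * (h / \<tau> / R) \<le> norm (stretch R h \<tau> n z)"
proof -
  define \<mu> where "\<mu> = h / \<tau> - 1"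
  have nn: "n \<bullet> n = 1" using assms(1) by (simp add: norm_eq_1)
  have \<mu>: "\<mu> \<ge> 0" using assms by (simp add: \<mu>_def)
  define y where "y = z + (\<mu> * (n \<bullet> z)) *\<^sub>R n"
  have s: "norm (stretch R h \<tau> n z) = norm y / R" using assms by (simp add: stretch_def y_def \<mu>_def)
  have "y \<bullet> y = z \<bullet> z + (2 * \<mu> + \<mu>\<^sup>2) * (n \<bullet> z)\<^sup>2"
    using nn by (simp add: y_def inner_add_left inner_add_right inner_commute power2_eq_square algebra_simps)
  then have "z \<bullet> z \<le> y \<bullet> y" using \<mu> by simp
  then have "norm z \<le> norm y" by (simp add: norm_le)
  then show "norm z / R \<le> norm (stretch R h \<tau> n z)" unfolding s using assms by (intro divide_right_mono) auto
  have nz: "\<bar>n \<bullet> z\<bar> \<le> norm z" using Cauchy_Schwarz_ineq2[of n z] assms(1) by simp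
  have "norm y \<le> norm z + \<mu> * \<bar>n \<bullet> z\<bar>"
    using norm_triangle_ineq[of z "(\<mu> * (n \<bullet> z)) *\<^sub>R n"] assms(1) \<mu> by (simp add: y_def abs_mult)
  also have "\<dots> \<le> norm z + \<mu> * norm z" using nz \<mu> by (intro add_left_mono mult_left_mono)
  also have "\<dots> = h / \<tau> * norm z" by (simp add: \<mu>_def algebra_simps)
  finally show "norm (stretch R h \<tau> n z) \<le> h / \<tau> / R * norm z" unfolding s using assms(2)
    by (simp add: pos_divide_le_eq)
  have "n \<bullet> y = h / \<tau> * (n \<bullet> z)" using nn by (simp add: y_def \<mu>_def inner_add_right algebra_simps)
  moreover have "\<bar>n \<bullet> y\<bar> \<le> norm y" using Cauchy_Schwarz_ineq2[of n y] assms(1) by simp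
  ultimately have "\<bar>n \<bullet> z\<bar> * (h / \<tau>) \<le> norm y" using assms by (simp add: abs_mult mult.commute)
  then have "\<bar>n \<bullet> z\<bar> * (h / \<tau>) / R \<le> norm y / R" using assms by (intro divide_right_mono) auto
  then show "\<bar>n \<bullet> z\<bar> * (h / \<tau> / R) \<le> norm (stretch R h \<tau> n z)" unfolding s by simp
qed

definition abump :: "real \<Rightarrow> real \<Rightarrow> real \<Rightarrow> real^'n \<Rightarrow> real^'n \<Rightarrow> real^'n \<Rightarrow> real" where
  "abump R h \<tau> n c x = bump (stretch R h \<tau> n x + (- stretch R h \<tau> n c))"

definition abump_support :: "real \<Rightarrow> real \<Rightarrow> real \<Rightarrow> real^'n \<Rightarrow> real^'n \<Rightarrow> (real^'n) set" where
  "abump_support R h \<tau> n c = {x. norm (stretch R h \<tau> n (x - c)) \<le> 1}"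

lemma stretch_diff: "stretch R h \<tau> n x + (- stretch R h \<tau> n c) = stretch R h \<tau> n (x - c)"
  using linear_diff[OF linear_stretch, of R h \<tau> n x c] by simp

lemma smooth_abump: "smooth (abump R h \<tau> n c)"
  unfolding abump_def[abs_def] by (rule smooth_affine[OF linear_stretch smooth_bump])

lemma abump_eq_0: "x \<notin> abump_support R h \<tau> n c \<Longrightarrow> abump R h \<tau> n c x = 0"
  unfolding abump_def stretch_diff abump_support_def by (intro bump_eq_0) simp

text \<open>By the third of the \<open>stretch_bounds\<close> the support lies in a slab of half
  width R \<tau> / h; since R \<le> h, its volume is of order h^(d-1) \<tau>.\<close>

lemma abump_support:
  fixes n c :: "real^'n"
  assumes n: "norm n = 1" and R: "0 < R" "R \<le> h" and \<tau>: "0 < \<tau>" "\<tau> \<le> h"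
  shows "compact (abump_support R h \<tau> n c)" "abump_support R h \<tau> n c \<subseteq> cball c R"
    "measure lebesgue (abump_support R h \<tau> n c) \<le> 2 ^ CARD('n) * h ^ (CARD('n) - 1) * \<tau>"
proof -
  note sb = stretch_bounds[OF n R(1) \<tau>]
  show sub: "abump_support R h \<tau> n c \<subseteq> cball c R"
  proof
    fix x assume "x \<in> abump_support R h \<tau> n c"
    then have "norm (x - c) / R \<le> 1" using sb(1)[of "x - c"] by (simp add: abump_support_def)
    then show "x \<in> cball c R" using R by (simp add: dist_norm norm_minus_commute)
  qed
  have "continuous_on UNIV (\<lambda>x. norm (stretch R h \<tau> n (x - c)))"
    unfolding stretch_def by (intro continuous_intros)
  then have "closed (abump_support R h \<tau> n c)"
    unfolding abump_support_def by (intro closed_Collect_le continuous_on_const)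
  then show comp: "compact (abump_support R h \<tau> n c)"
    using sub bounded_subset bounded_cball by (auto simp: compact_eq_bounded_closed)
  have "measure lebesgue (abump_support R h \<tau> n c) \<le> (2 * (R * \<tau> / h)) * (2 * R) ^ (CARD('n) - 1)"
  proof (rule measure_slab[OF comp sub n])
    fix x assume "x \<in> abump_support R h \<tau> n c"
    then have "\<bar>n \<bullet> (x - c)\<bar> * (h / \<tau> / R) \<le> 1" using sb(3)[of "x - c"] by (simp add: abump_support_def)
    then have "\<bar>n \<bullet> (x - c)\<bar> \<le> R * \<tau> / h" using R \<tau> by (simp add: field_simps)
    then show "n \<bullet> c - R * \<tau> / h \<le> n \<bullet> x \<and> n \<bullet> x \<le> n \<bullet> c - R * \<tau> / h + 2 * (R * \<tau> / h)"
      by (simp add: inner_diff_right abs_le_iff)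
  qed (use R \<tau> in auto)
  also have "\<dots> \<le> (2 * \<tau>) * (2 * h) ^ (CARD('n) - 1)"
  proof (intro mult_mono power_mono)
    have "R * \<tau> / h \<le> h * \<tau> / h" using R \<tau> by (intro divide_right_mono mult_right_mono) auto
    then show "R * \<tau> / h \<le> \<tau>" using R by simp
  qed (use R \<tau> in auto)
  also have "\<dots> = 2 ^ CARD('n) * h ^ (CARD('n) - 1) * \<tau>"
  proof -
    have "CARD('n) = Suc (CARD('n) - 1)" by simp
    then have "2 ^ CARD('n) = 2 * (2::real) ^ (CARD('n) - 1)" by (metis power_Suc)
    then show ?thesis by (simp add: power_mult_distrib)
  qed
  finally show "measure lebesgue (abump_support R h \<tau> n c) \<le> 2 ^ CARD('n) * h ^ (CARD('n) - 1) * \<tau>" .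
qed

lemma abump_nonneg: "0 \<le> abump R h \<tau> n c x" and abump_le_1: "abump R h \<tau> n c x \<le> 1"
  by (simp_all add: abump_def bump_nonneg bump_le_1)

text \<open>Two situations without stretching: \<tau> = h, used for elements, and points of the
  hyperplane through \<open>c\<close>, used for sides.\<close>

lemma abump_ge:
  assumes "0 < R" "dist c x \<le> R / 2" "\<tau> = h \<and> 0 < h \<or> n \<bullet> (x - c) = 0"
  shows "flat (3 / 4) \<le> abump R h \<tau> n c x"
proof -
  have "stretch R h \<tau> n (x - c) = (1 / R) *\<^sub>R (x - c)" using assms(3) by (auto simp: stretch_def)
  then have "norm (stretch R h \<tau> n (x - c)) \<le> 1 / 2"
    using assms(1,2) by (simp add: dist_norm norm_minus_commute divide_simps)
  then show ?thesis unfolding abump_def stretch_diff by (rule bump_ge)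
qed

text \<open>With R proportional to h, the squeezing costs a gradient of order 1 / \<tau>.\<close>

lemma abump_partial:
  fixes n c :: "real^'n" and B :: real
  assumes n: "norm n = 1" and R: "0 < R" and \<tau>: "0 < \<tau>" "\<tau> \<le> h" and B: "\<And>x i. \<bar>partial i (bump :: real^'n \<Rightarrow> real) x\<bar> \<le> B"
  shows "\<bar>partial i (abump R h \<tau> n c) x\<bar> \<le> CARD('n) * B * (h / \<tau> / R)"
proof -
  have B0: "0 \<le> B" using B[of undefined 0] by (rule order_trans[OF abs_ge_zero])
  let ?y = "stretch R h \<tau> n x + (- stretch R h \<tau> n c)"
  have eq: "partial i (abump R h \<tau> n c) x = (\<Sum>j\<in>UNIV. partial j bump ?y * stretch R h \<tau> n (axis i 1) $ j)"
    unfolding abump_def[abs_def] by (rule partial_affine[OF linear_stretch smooth_differentiable[OF smooth_bump]])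
  have "\<bar>partial i (abump R h \<tau> n c) x\<bar> \<le> (\<Sum>j\<in>UNIV. \<bar>partial j bump ?y * stretch R h \<tau> n (axis i 1) $ j\<bar>)"
    unfolding eq by (rule sum_abs)
  also have "\<dots> \<le> (\<Sum>j\<in>(UNIV :: 'n set). B * (h / \<tau> / R))"
  proof (rule sum_mono)
    fix j
    have "\<bar>stretch R h \<tau> n (axis i 1) $ j\<bar> \<le> norm (stretch R h \<tau> n (axis i 1))" by (rule component_le_norm_cart)
    also have "\<dots> \<le> h / \<tau> / R * norm (axis i (1::real) :: real^'n)" by (rule stretch_bounds(2)[OF n R \<tau>])
    finally have "\<bar>stretch R h \<tau> n (axis i 1) $ j\<bar> \<le> h / \<tau> / R" by (simp add: norm_axis_1)
    then show "\<bar>partial j bump ?y * stretch R h \<tau> n (axis i 1) $ j\<bar> \<le> B * (h / \<tau> / R)"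
      unfolding abs_mult using B B0 by (intro mult_mono) auto
  qed
  finally show ?thesis by simp
qed

lemma product_bounds:
  fixes b \<sigma> :: "real^'n \<Rightarrow> real"
  assumes b: "smooth b" "closed K" "\<And>x. x \<notin> K \<Longrightarrow> b x = 0" "\<And>x. 0 \<le> b x" "\<And>x. b x \<le> 1" "\<And>x i. \<bar>partial i b x\<bar> \<le> B1"
    and \<sigma>: "smooth \<sigma>" "\<And>x. x \<in> K \<Longrightarrow> \<bar>\<sigma> x\<bar> \<le> M0" "\<And>x i. x \<in> K \<Longrightarrow> \<bar>partial i \<sigma> x\<bar> \<le> M1" and M: "0 \<le> M0" "0 \<le> M1"
  shows "\<bar>b x * \<sigma> x\<bar> \<le> M0" "\<bar>partial i (\<lambda>x. b x * \<sigma> x) x\<bar> \<le> B1 * M0 + M1"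
proof -
  have B1: "0 \<le> B1" using b(6)[of i x] by (rule order_trans[OF abs_ge_zero])
  show "\<bar>b x * \<sigma> x\<bar> \<le> M0"
  proof (cases "x \<in> K")
    case True
    have "\<bar>b x\<bar> * \<bar>\<sigma> x\<bar> \<le> 1 * M0" using b(4,5) \<sigma>(2)[OF True] by (intro mult_mono) auto
    then show ?thesis by (simp add: abs_mult)
  qed (use b(3) M in simp)
  show "\<bar>partial i (\<lambda>x. b x * \<sigma> x) x\<bar> \<le> B1 * M0 + M1"
  proof (cases "x \<in> K")
    case True
    have "partial i (\<lambda>x. b x * \<sigma> x) x = partial i b x * \<sigma> x + b x * partial i \<sigma> x"
      by (rule partial_mult) (intro smooth_differentiable b(1) \<sigma>(1))+
    also have "\<bar>\<dots>\<bar> \<le> \<bar>partial i b x\<bar> * \<bar>\<sigma> x\<bar> + \<bar>b x\<bar> * \<bar>partial i \<sigma> x\<bar>"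
      by (intro order_trans[OF abs_triangle_ineq]) (simp add: abs_mult)
    also have "\<dots> \<le> B1 * M0 + 1 * M1"
      using b(4,5,6) \<sigma>(2,3)[OF True] B1 by (intro add_mono mult_mono) auto
    finally show ?thesis by simp
  next
    case False
    then have "partial i (\<lambda>x. b x * \<sigma> x) x = 0" using b(3) by (intro partial_eq_0_outside[OF b(2)]) auto
    then show ?thesis using B1 M by simp
  qed
qed

text \<open>The conclusion of \<open>polys_norm_equiv\<close> as a property of the constant, so that
  \<open>C\<close> can be fixed before mesh and solution. The type argument carries the
  dimension.\<close>

definition norm_equiv_const :: "'n::finite itself \<Rightarrow> real \<Rightarrow> nat \<Rightarrow> real \<Rightarrow> bool" where
  "norm_equiv_const _ r N C \<longleftrightarrow> C > 0 \<and> (\<forall>p \<in> (polys_total N :: (real^'n \<Rightarrow> real) set). \<forall>c h. h > 0 \<longrightarrow> (\<forall>x\<in>cball c h.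
    (p x)\<^sup>2 \<le> C / h ^ CARD('n) * ball_ip c (r * h) p p \<and>
    (\<forall>j. h\<^sup>2 * (partial j p x)\<^sup>2 \<le> C / h ^ CARD('n) * ball_ip c (r * h) p p)))"

lemma norm_equiv_constD:
  fixes p :: "real^'n \<Rightarrow> real"
  assumes "norm_equiv_const TYPE('n) r N C" "p \<in> polys_total N" "h > 0" "x \<in> cball c h" and I: "ball_ip c (r * h) p p \<le> I"
  shows "\<bar>p x\<bar> \<le> sqrt (C / h ^ CARD('n) * I)" "\<bar>partial j p x\<bar> \<le> sqrt (C / h ^ CARD('n) * I) / h"
proof -
  have C: "C > 0" using assms(1) by (simp add: norm_equiv_const_def)
  have le: "C / h ^ CARD('n) * ball_ip c (r * h) p p \<le> C / h ^ CARD('n) * I"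
    using C assms(3) I by (intro mult_left_mono) auto
  have "(p x)\<^sup>2 \<le> C / h ^ CARD('n) * ball_ip c (r * h) p p" "h\<^sup>2 * (partial j p x)\<^sup>2 \<le> C / h ^ CARD('n) * ball_ip c (r * h) p p"
    using assms(1-4) unfolding norm_equiv_const_def by blast+
  then have 1: "(p x)\<^sup>2 \<le> C / h ^ CARD('n) * I" and 2: "(h * partial j p x)\<^sup>2 \<le> C / h ^ CARD('n) * I"
    using le by (simp_all add: power_mult_distrib)
  show "\<bar>p x\<bar> \<le> sqrt (C / h ^ CARD('n) * I)" using real_sqrt_le_mono[OF 1] by simp
  have "\<bar>h * partial j p x\<bar> \<le> sqrt (C / h ^ CARD('n) * I)" using real_sqrt_le_mono[OF 2] by simp
  then show "\<bar>partial j p x\<bar> \<le> sqrt (C / h ^ CARD('n) * I) / h"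
    using assms(3) by (simp add: abs_mult pos_le_divide_eq mult.commute)
qed

text \<open>Cancels a factor sqrt I in a form that includes a vanishing residual, I = 0.\<close>

lemma absorb_sqrt:
  fixes \<beta> I X :: real
  assumes "\<beta> > 0" "0 \<le> I" "0 \<le> X" "\<beta> * I \<le> X * sqrt I"
  shows "\<beta> * sqrt I \<le> X"
proof (cases "I = 0")
  case False
  then have "sqrt I > 0" using assms by simp
  moreover have "(\<beta> * sqrt I) * sqrt I \<le> X * sqrt I" using assms(2,4) by (simp add: mult.assoc)
  ultimately show ?thesis by (simp add: mult_le_cancel_right)
qed (use assms in simp)

context residual
begin

text \<open>The bump is at least \<open>flat (3 / 4)\<close> on a concentric ball, so testing yields
  at least that multiple of I, the integral of the squared residual there. On the other side, values
  of the residual and h times its derivatives are bounded through the norm equivalence by a multiple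
  of sqrt (I / h^d), and one factor sqrt I cancels. What remains is 1 + \<kappa> / h, which the
  weight min(h / \<kappa>, 1) makes bounded.\<close>

lemma element_estimate:
  fixes B :: real
  assumes T: "T \<in> \<T>" and q: "elem_res T \<in> polys_total N" and cT: "cball c (\<rho> * h) \<subseteq> T" "T \<subseteq> cball c h"
    and \<rho>: "0 < \<rho>" "\<rho> \<le> 1" and h: "h > 0" and C: "norm_equiv_const TYPE('n) (\<rho> / 4) N C"
    and B: "\<And>x i. \<bar>partial i (bump :: real^'n \<Rightarrow> real) x\<bar> \<le> B"
  defines "D \<equiv> CARD('n) * (2 * CARD('n) * B / \<rho> + 1) + 1"
  shows "min (h / \<kappa>) 1 * L2_norm T (elem_res T) \<le> 2 * D * (C * 2 ^ CARD('n)) / flat (3 / 4) * sqrt (err (interior T))"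
proof -
  \<comment> \<open>Half the inscribed radius keeps the support in the interior of \<open>T\<close>.
    The lower bound for the bump holds on the ball of radius R / 2 = \<rho> h / 4, whence the ratio
    \<rho> / 4 in \<open>norm_equiv_const\<close>.\<close>
  define R where "R = \<rho> * h / 2"
  have R: "0 < R" "R \<le> h" "R < \<rho> * h"
  proof -
    have "0 < \<rho> * h" "\<rho> * h \<le> 1 * h" using \<rho> h by (simp, intro mult_right_mono) auto
    then show "0 < R" "R \<le> h" "R < \<rho> * h" unfolding R_def by linarith+
  qed
  \<comment> \<open>Any unit vector does, as there is no stretching for \<tau> = h.\<close>
  define n :: "real^'n" where "n = axis undefined 1"
  have n: "norm n = 1" by (simp add: n_def norm_axis_1)
  define b where "b = abump R h h n c"
  define K where "K = abump_support R h h n c"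
  note K = abump_support[OF n R(1,2) h order_refl, of c, folded K_def]
  have clK: "closed K" using K(1) compact_imp_closed by blast
  have b0: "b x = 0" if "x \<notin> K" for x using abump_eq_0 that unfolding b_def K_def by blast
  have sb: "smooth b" unfolding b_def by (rule smooth_abump)
  let ?q = "elem_res T"
  have sq: "smooth ?q" by (rule elem_res_smooth[OF T])
  have C0: "C > 0" using C by (simp add: norm_equiv_const_def)
  have B0: "0 \<le> B" using B[of undefined 0] by (rule order_trans[OF abs_ge_zero])
  define I where "I = ball_ip c (\<rho> / 4 * h) ?q ?q"
  have I0: "0 \<le> I" unfolding I_def by (rule ball_ip_nonneg)
  define M0 where "M0 = sqrt (C / h ^ CARD('n) * I)"
  have M0: "0 \<le> M0" using C0 h I0 by (simp add: M0_def)
  have qb: "\<bar>?q x\<bar> \<le> M0" "\<bar>partial j ?q x\<bar> \<le> M0 / h" if "x \<in> cball c h" for x j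
    using norm_equiv_constD[OF C q h that order_refl] unfolding M0_def I_def by blast+
  define B1 where "B1 = CARD('n) * B * (h / h / R)"
  have B1: "\<bar>partial i b x\<bar> \<le> B1" for x i unfolding b_def B1_def by (rule abump_partial[OF n R(1) h order_refl B])
  have Kh: "K \<subseteq> cball c h" using K(2) R(2) subset_cball by blast
  define \<phi> where "\<phi> x = b x * ?q x" for x
  have pb: "\<bar>\<phi> x\<bar> \<le> M0" "\<bar>partial i \<phi> x\<bar> \<le> B1 * M0 + M0 / h" for x i
    unfolding \<phi>_def
    by (rule product_bounds[OF sb clK b0 _ _ B1 sq, where ?M1.0 = "M0 / h"];
        use qb Kh M0 h in \<open>auto simp: b_def abump_nonneg abump_le_1\<close>)+
  have s\<phi>: "smooth \<phi>" unfolding \<phi>_def[abs_def] by (intro smooth_mult sb sq)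
  have \<phi>0: "\<phi> x = 0" if "x \<notin> K" for x using b0[OF that] by (simp add: \<phi>_def)
  have "cball c R \<subseteq> ball c (\<rho> * h)" using R(3) by auto
  moreover have "ball c (\<rho> * h) \<subseteq> interior T" using cT(1) by (meson ball_subset_cball interior_maximal open_ball subset_trans)
  ultimately have KT: "K \<subseteq> interior T" using K(2) by blast
  define V where "V = 2 ^ CARD('n) * h ^ (CARD('n) - 1) * h"
  have V: "V = 2 ^ CARD('n) * h ^ CARD('n)"
  proof -
    have "CARD('n) = Suc (CARD('n) - 1)" by simp
    then have "h ^ CARD('n) = h ^ (CARD('n) - 1) * h" by (metis power_Suc2)
    then show ?thesis by (simp add: V_def)
  qed
  have rb: "\<bar>res \<phi>\<bar> \<le> sqrt (err (interior T)) * ((\<kappa> * (CARD('n) * (B1 * M0 + M0 / h)) + M0) * sqrt V)"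
    using res_bound[OF s\<phi> K(1) \<phi>0 _ KT _ pb K(3)] KT interior_subset_domain[OF T] unfolding V_def by auto
  have rT: "res \<phi> = (LINT x|lborel. ?q x * \<phi> x)" by (rule res_element[OF T s\<phi> K(1) \<phi>0 KT])
  have int1: "integrable lborel (\<lambda>x. ?q x * \<phi> x)" using integrable_smooth_mult[OF sq s\<phi> K(1) \<phi>0, of UNIV] by simp
  have "flat (3 / 4) * I \<le> (LINT x|lborel. ?q x * \<phi> x)"
  proof -
    have i: "integrable lborel (\<lambda>x. flat (3/4) * (indicator (cball c (\<rho> / 4 * h)) x *\<^sub>R (?q x * ?q x)))"
      using set_integrable_cball[of "\<lambda>x. ?q x * ?q x" c "\<rho> / 4 * h"] smooth_continuous_on[OF smooth_mult[OF sq sq]]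
      unfolding set_integrable_def by (intro integrable_mult_right) auto
    have "flat (3 / 4) * I = (LINT x|lborel. flat (3/4) * (indicator (cball c (\<rho> / 4 * h)) x *\<^sub>R (?q x * ?q x)))"
      by (simp add: I_def set_lebesgue_integral_def)
    also have "\<dots> \<le> (LINT x|lborel. ?q x * \<phi> x)"
    proof (rule integral_mono[OF i int1])
      fix x
      show "flat (3/4) * (indicator (cball c (\<rho> / 4 * h)) x *\<^sub>R (?q x * ?q x)) \<le> ?q x * \<phi> x"
      proof (cases "x \<in> cball c (\<rho> / 4 * h)")
        case True
        then have "flat (3/4) \<le> b x" unfolding b_def using R h by (intro abump_ge) (auto simp: R_def)
        then have "flat (3/4) * (?q x * ?q x) \<le> b x * (?q x * ?q x)" by (intro mult_right_mono) auto
        then show ?thesis using True by (simp add: \<phi>_def mult_ac)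
      next
        case False
        have "0 \<le> b x * (?q x * ?q x)" by (rule mult_nonneg_nonneg) (auto simp: b_def abump_nonneg)
        then show ?thesis using False by (simp add: \<phi>_def mult_ac)
      qed
    qed
    finally show ?thesis .
  qed
  also have "\<dots> \<le> sqrt (err (interior T)) * ((\<kappa> * (CARD('n) * (B1 * M0 + M0 / h)) + M0) * sqrt V)"
    using rb rT by simp
  also have "\<dots> \<le> sqrt (err (interior T)) * (M0 * (D * (\<kappa> / h + 1)) * sqrt V)"
  proof (intro mult_left_mono mult_right_mono)
    have e: "\<kappa> * (CARD('n) * (B1 * M0 + M0 / h)) + M0 = M0 * ((CARD('n) * (2 * CARD('n) * B / \<rho> + 1)) * (\<kappa> / h) + 1)"
      using h \<rho> by (simp add: B1_def R_def field_simps)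
    have D1: "CARD('n) * (2 * CARD('n) * B / \<rho> + 1) \<le> D" "1 \<le> D" using B0 \<rho> by (auto simp: D_def)
    have "(CARD('n) * (2 * CARD('n) * B / \<rho> + 1)) * (\<kappa> / h) + 1 \<le> D * (\<kappa> / h) + D"
      using D1 \<kappa> h by (intro add_mono mult_right_mono) auto
    also have "\<dots> = D * (\<kappa> / h + 1)" by (simp add: algebra_simps)
    finally show "\<kappa> * (CARD('n) * (B1 * M0 + M0 / h)) + M0 \<le> M0 * (D * (\<kappa> / h + 1))"
      unfolding e using M0 by (intro mult_left_mono)
  qed (use h V err_nonneg in auto)
  also have "\<dots> = (sqrt (err (interior T)) * (D * (\<kappa> / h + 1)) * sqrt (C * 2 ^ CARD('n))) * sqrt I"
  proof -
    have "M0 * sqrt V = sqrt (C / h ^ CARD('n) * I * (2 ^ CARD('n) * h ^ CARD('n)))" unfolding M0_def V by (rule real_sqrt_mult[symmetric])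
    also have "\<dots> = sqrt (C * 2 ^ CARD('n) * I)" using h by simp
    finally have "M0 * sqrt V = sqrt (C * 2 ^ CARD('n)) * sqrt I" by (simp add: real_sqrt_mult)
    then show ?thesis by (simp add: mult_ac)
  qed
  finally have "flat (3 / 4) * I \<le> (sqrt (err (interior T)) * (D * (\<kappa> / h + 1)) * sqrt (C * 2 ^ CARD('n))) * sqrt I" .
  moreover have fl: "flat (3/4) > 0" by (simp add: flat_pos_iff)
  moreover have D0: "D \<ge> 0" using B0 \<rho> by (auto simp: D_def)
  ultimately have S: "flat (3 / 4) * sqrt I \<le> sqrt (err (interior T)) * (D * (\<kappa> / h + 1)) * sqrt (C * 2 ^ CARD('n))"
    using \<kappa> h C0 I0 err_nonneg by (intro absorb_sqrt) auto
  define \<alpha> where "\<alpha> = min (h / \<kappa>) 1"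
  have \<alpha>0: "\<alpha> > 0" using h \<kappa> by (simp add: \<alpha>_def)
  \<comment> \<open>Each entry of the minimum takes care of one of the two terms.\<close>
  have \<alpha>2: "\<alpha> * (\<kappa> / h + 1) \<le> 2"
  proof -
    have "\<alpha> * (\<kappa> / h) \<le> (h / \<kappa>) * (\<kappa> / h)" using h \<kappa> by (intro mult_right_mono) (auto simp: \<alpha>_def)
    also have "\<dots> = 1" using h \<kappa> by simp
    finally show ?thesis by (simp add: \<alpha>_def distrib_left)
  qed
  have "flat (3 / 4) * (\<alpha> * sqrt I) = \<alpha> * (flat (3 / 4) * sqrt I)" by simp
  also have "\<dots> \<le> \<alpha> * (sqrt (err (interior T)) * (D * (\<kappa> / h + 1)) * sqrt (C * 2 ^ CARD('n)))"
    using S \<alpha>0 by (intro mult_left_mono) auto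
  also have "\<dots> = (\<alpha> * (\<kappa> / h + 1)) * (sqrt (err (interior T)) * D * sqrt (C * 2 ^ CARD('n)))" by (simp add: mult_ac)
  also have "\<dots> \<le> 2 * (sqrt (err (interior T)) * D * sqrt (C * 2 ^ CARD('n)))"
    using \<alpha>2 D0 C0 err_nonneg by (intro mult_right_mono) auto
  finally have SI: "\<alpha> * sqrt I \<le> 2 * (sqrt (err (interior T)) * D * sqrt (C * 2 ^ CARD('n))) / flat (3 / 4)"
    using fl by (simp add: pos_le_divide_eq mult.commute)
  have Tc: "compact T" by (rule convex_meshD(3)[OF mesh T])
  \<comment> \<open>From the small ball back to the whole element: \<open>T\<close> lies in the ball
    of radius h, on which the residual is at most M0, and V bounds the volume of \<open>T\<close> as
    well.\<close>
  have "L2_norm T ?q \<le> M0 * sqrt V"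
  proof (rule L2_norm_bound[OF borel_compact[OF Tc] _ Tc _ M0])
    show "sq_integrable_on T ?q"
      using qb cT(2) by (intro sq_integrable_bounded[OF borel_compact[OF Tc] compact_imp_bounded[OF Tc] smooth_borel_measurable[OF sq] refl, of M0]) auto
    have "measure lebesgue T \<le> (2 * h) * (2 * h) ^ (CARD('n) - 1)"
    proof (rule measure_slab[OF Tc cT(2) n, of "n \<bullet> c - h"])
      fix x assume "x \<in> T"
      then have "norm (x - c) \<le> h" using cT(2) by (auto simp: dist_norm norm_minus_commute)
      then have "\<bar>n \<bullet> (x - c)\<bar> \<le> h" using Cauchy_Schwarz_ineq2[of n "x - c"] n by simp
      then show "n \<bullet> c - h \<le> n \<bullet> x \<and> n \<bullet> x \<le> n \<bullet> c - h + 2 * h" by (simp add: inner_diff_right abs_le_iff)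
    qed (use h in auto)
    also have "\<dots> = (2 * h) ^ CARD('n)"
    proof -
      have "CARD('n) = Suc (CARD('n) - 1)" by simp
      then show ?thesis by (metis power_Suc)
    qed
    finally show "measure lebesgue T \<le> V" by (simp add: V power_mult_distrib)
  qed (use qb cT(2) in auto)
  also have "M0 * sqrt V = sqrt (C * 2 ^ CARD('n)) * sqrt I"
  proof -
    have "M0 * sqrt V = sqrt (C / h ^ CARD('n) * I * (2 ^ CARD('n) * h ^ CARD('n)))" unfolding M0_def V by (rule real_sqrt_mult[symmetric])
    also have "\<dots> = sqrt (C * 2 ^ CARD('n) * I)" using h by simp
    finally show ?thesis by (simp add: real_sqrt_mult)
  qed
  finally have "\<alpha> * L2_norm T ?q \<le> \<alpha> * (sqrt (C * 2 ^ CARD('n)) * sqrt I)" using \<alpha>0 by (intro mult_left_mono) auto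
  also have "\<dots> = sqrt (C * 2 ^ CARD('n)) * (\<alpha> * sqrt I)" by simp
  also have "\<dots> \<le> sqrt (C * 2 ^ CARD('n)) * (2 * (sqrt (err (interior T)) * D * sqrt (C * 2 ^ CARD('n))) / flat (3 / 4))"
    using SI C0 by (intro mult_left_mono) auto
  also have "\<dots> = 2 * D * (sqrt (C * 2 ^ CARD('n)) * sqrt (C * 2 ^ CARD('n))) / flat (3 / 4) * sqrt (err (interior T))"
    by (simp add: mult_ac)
  also have "sqrt (C * 2 ^ CARD('n)) * sqrt (C * 2 ^ CARD('n)) = C * 2 ^ CARD('n)" using C0 by simp
  finally show ?thesis by (simp add: \<alpha>_def)
qed

end

section \<open>The side estimate\<close>

lemma measure_cball_le:
  fixes c :: "real^'n"
  assumes "0 \<le> h"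
  shows "measure lborel (cball c h) \<le> (2 * h) ^ CARD('n)"
proof -
  define n :: "real^'n" where "n = axis undefined 1"
  have n: "norm n = 1" by (simp add: n_def norm_axis_1)
  have "measure lebesgue (cball c h) \<le> (2 * h) * (2 * h) ^ (CARD('n) - 1)"
  proof (rule measure_slab[OF compact_cball order_refl n, of _ _ "n \<bullet> c - h"])
    fix x assume "x \<in> cball c h"
    then have "norm (x - c) \<le> h" by (auto simp: dist_norm norm_minus_commute)
    then have "\<bar>n \<bullet> (x - c)\<bar> \<le> h" using Cauchy_Schwarz_ineq2[of n "x - c"] n by simp
    then show "n \<bullet> c - h \<le> n \<bullet> x \<and> n \<bullet> x \<le> n \<bullet> c - h + 2 * h" by (simp add: inner_diff_right abs_le_iff)
  qed (use assms in auto)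
  also have "\<dots> = (2 * h) ^ CARD('n)"
  proof -
    have "CARD('n) = Suc (CARD('n) - 1)" by simp
    then show ?thesis by (metis power_Suc)
  qed
  finally show ?thesis by simp
qed

text \<open>The ball lies in the cylinder of height 2r over its disc in the hyperplane, and \<sigma>
  is constant along the cylinder. This trades the volume norm of the norm equivalence for a norm on
  the side.\<close>

lemma ball_ip_le_surface:
  fixes \<sigma> :: "real^'n \<Rightarrow> real"
  assumes E: "normal_to E n" and c: "c \<in> E" and \<sigma>: "continuous_on UNIV \<sigma>" and inv: "\<And>z t. \<sigma> (z + t *\<^sub>R n) = \<sigma> z" and r: "r > 0"
  shows "ball_ip c r \<sigma> \<sigma> \<le> 2 * r * (LINT z|surface_measure E. indicat_real (cball c r) z * (\<sigma> z)\<^sup>2)"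
proof -
  define F where "F z = indicat_real (cball c r) z * (\<sigma> z)\<^sup>2" for z
  have [measurable]: "\<sigma> \<in> borel_measurable borel" using \<sigma> by (rule borel_measurable_continuous_onI)
  have [measurable]: "indicat_real (cball c r) \<in> borel_measurable borel" by (rule borel_measurable_indicator) simp
  have Fm [measurable]: "F \<in> borel_measurable borel" unfolding F_def by measurable
  have F0: "0 \<le> F z" for z by (simp add: F_def)
  have Fi: "integrable lborel F"
    using set_integrable_cball[of "\<lambda>x. (\<sigma> x)\<^sup>2" c r] \<sigma> by (simp add: set_integrable_def F_def[abs_def] continuous_on_power)
  have Fs: "integrable (surface_measure E) F"
  proof -
    have "continuous_on (cball c r) (\<lambda>x. (\<sigma> x)\<^sup>2)" using \<sigma> by (intro continuous_on_power) (auto intro: continuous_on_subset)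
    then have "bounded ((\<lambda>x. (\<sigma> x)\<^sup>2) ` cball c r)" by (intro compact_imp_bounded compact_continuous_image) auto
    then obtain B where B: "\<And>x. x \<in> cball c r \<Longrightarrow> \<bar>(\<sigma> x)\<^sup>2\<bar> \<le> B" unfolding bounded_iff by fastforce
    show ?thesis by (rule integrable_surface_bounded[OF E Fm, of B c r]) (use B in \<open>auto simp: F_def indicator_def\<close>)
  qed
  have "ennreal (LINT x|lborel. F x) = (\<integral>\<^sup>+ x. ennreal (F x) \<partial>lborel)"
    by (rule nn_integral_eq_integral[symmetric]) (auto simp: Fi F0)
  also have "\<dots> = (\<integral>\<^sup>+ z. (\<integral>\<^sup>+ s. ennreal (F (z + s *\<^sub>R n)) \<partial>lborel) \<partial>surface_measure E)"
    by (rule nn_integral_coarea[OF E]) measurable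
  also have "\<dots> \<le> (\<integral>\<^sup>+ z. ennreal (2 * r) * ennreal (F z) \<partial>surface_measure E)"
  proof (rule nn_integral_mono_AE)
    show "AE z in surface_measure E. (\<integral>\<^sup>+ s. ennreal (F (z + s *\<^sub>R n)) \<partial>lborel) \<le> ennreal (2 * r) * ennreal (F z)"
      using AE_surface_measure[OF E]
    proof eventually_elim
      case (elim z)
      then have nz: "n \<bullet> (z - c) = 0" using affine_hull_normal[OF E c] by simp
      have nn: "n \<bullet> n = 1" using E by (simp add: normal_to_def norm_eq_1)
      have "F (z + s *\<^sub>R n) \<le> indicator {-r..r} s * F z" for s
      proof (cases "z + s *\<^sub>R n \<in> cball c r")
        case True
        have eq: "(norm (z + s *\<^sub>R n - c))\<^sup>2 = (norm (z - c))\<^sup>2 + s\<^sup>2"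
        proof -
          have "z + s *\<^sub>R n - c = (z - c) + s *\<^sub>R n" by simp
          then have "(z + s *\<^sub>R n - c) \<bullet> (z + s *\<^sub>R n - c) = ((z - c) + s *\<^sub>R n) \<bullet> ((z - c) + s *\<^sub>R n)" by (simp only:)
          also have "\<dots> = (z - c) \<bullet> (z - c) + 2 * s * (n \<bullet> (z - c)) + s * s * (n \<bullet> n)"
            unfolding inner_add_left[of "z - c" "s *\<^sub>R n"] inner_add_right[of _ "z - c" "s *\<^sub>R n"]
            by (simp only: inner_scaleR_left inner_scaleR_right inner_commute[of "z - c" n])
          finally show ?thesis unfolding power2_norm_eq_inner using nz nn by (simp add: power2_eq_square)
        qed
        have le: "(norm (z + s *\<^sub>R n - c))\<^sup>2 \<le> r\<^sup>2" using True r by (intro power_mono) (auto simp: dist_norm norm_minus_commute)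
        have "(norm (z - c))\<^sup>2 \<le> r\<^sup>2" "s\<^sup>2 \<le> r\<^sup>2" using eq le zero_le_power2[of s] zero_le_power2[of "norm (z - c)"] by linarith+
        then have "norm (z - c) \<le> r" "\<bar>s\<bar> \<le> r" using r abs_le_square_iff[of "norm (z - c)" r] abs_le_square_iff[of s r] by auto
        then have "z \<in> cball c r" "s \<in> {-r..r}" by (auto simp: dist_norm norm_minus_commute)
        then show ?thesis by (auto simp: F_def inv indicator_def)
      qed (simp add: F_def[of "z + s *\<^sub>R n"] F0)
      then have le: "ennreal (F (z + s *\<^sub>R n)) \<le> ennreal (F z) * indicator {-r..r} s" for s
        using ennreal_leI[of "F (z + s *\<^sub>R n)" "indicator {-r..r} s * F z"]
        by (cases "s \<in> {-r..r}") auto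
      have "(\<integral>\<^sup>+ s. ennreal (F (z + s *\<^sub>R n)) \<partial>lborel) \<le> (\<integral>\<^sup>+ s. ennreal (F z) * indicator {-r..r} s \<partial>lborel)"
        by (rule nn_integral_mono) (rule le)
      also have "\<dots> = ennreal (F z) * ennreal (2 * r)" using r by (subst nn_integral_cmult_indicator) auto
      finally show ?case by (simp add: mult.commute)
    qed
  qed
  also have "\<dots> = ennreal (2 * r) * ennreal (LINT z|surface_measure E. F z)"
    by (subst nn_integral_cmult) (auto simp: nn_integral_eq_integral Fs F0)
  also have "\<dots> = ennreal (2 * r * (LINT z|surface_measure E. F z))" using r F0 by (simp add: ennreal_mult)
  finally have "(LINT x|lborel. F x) \<le> 2 * r * (LINT z|surface_measure E. F z)"
    using r F0 by (subst (asm) ennreal_le_iff) auto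
  then show ?thesis by (simp add: set_lebesgue_integral_def F_def[abs_def] power2_eq_square)
qed

text \<open>The factor (4h)^d / h bounds the surface measure of the ball of radius h: by
  \<open>surface_measure_cball\<close> it is at most the volume of a ball of radius 2h divided by
  h.\<close>

lemma surface_integral_le:
  fixes s :: "real^'n \<Rightarrow> real"
  assumes E: "normal_to E n" and Ec: "compact E" "E \<subseteq> cball c h" and h: "h > 0" and s: "continuous_on UNIV s"
    and M: "\<And>z. z \<in> E \<Longrightarrow> (s z)\<^sup>2 \<le> M" and M0: "0 \<le> M"
  shows "(LINT z:E|surface_measure E. (s z)\<^sup>2) \<le> M * ((4 * h) ^ CARD('n) / h)"
proof -
  let ?S = "surface_measure E"
  have [measurable]: "s \<in> borel_measurable borel" using s by (rule borel_measurable_continuous_onI)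
  have [measurable]: "indicat_real E \<in> borel_measurable borel" by (rule borel_measurable_indicator) (rule borel_compact[OF Ec(1)])
  have b: "indicat_real E z *\<^sub>R (s z)\<^sup>2 \<le> M * indicat_real (cball c h) z" for z
    using M[of z] Ec(2) M0 by (auto simp: indicator_def)
  have fin: "emeasure ?S (cball c h) < \<infinity>" by (rule surface_measure_cball_finite[OF E])
  have "(LINT z:E|?S. (s z)\<^sup>2) \<le> (LINT z|?S. M * indicat_real (cball c h) z)"
    unfolding set_lebesgue_integral_def
  proof (rule integral_mono)
    have "(\<lambda>z. indicat_real E z *\<^sub>R (s z)\<^sup>2) \<in> borel_measurable borel" by measurable
    then show "integrable ?S (\<lambda>z. indicat_real E z *\<^sub>R (s z)\<^sup>2)"
      by (rule integrable_surface_bounded[OF E, of _ M c h]) (use b in \<open>simp add: abs_mult\<close>)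
    show "integrable ?S (\<lambda>z. M * indicat_real (cball c h) z)"
      using fin by (intro integrable_mult_right) (auto simp: integrable_indicator_iff)
  qed (rule b)
  also have "\<dots> = M * measure ?S (cball c h)" by simp
  also have "\<dots> \<le> M * ((4 * h) ^ CARD('n) / h)"
  proof (rule mult_left_mono[OF _ M0])
    have "ennreal (h * measure ?S (cball c h)) = ennreal h * emeasure ?S (cball c h)"
      using fin h by (simp add: ennreal_mult emeasure_eq_ennreal_measure)
    also have "\<dots> \<le> emeasure lborel (cball c (2 * h))" by (rule surface_measure_cball[OF E h])
    also have "\<dots> = ennreal (measure lborel (cball c (2 * h)))"
      using emeasure_compact_finite[of "cball c (2 * h)"] by (intro emeasure_eq_ennreal_measure) auto
    finally have "h * measure ?S (cball c h) \<le> measure lborel (cball c (2 * h))" by simp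
    also have "\<dots> \<le> (4 * h) ^ CARD('n)" using measure_cball_le[of "2 * h" c] h by simp
    finally show "measure ?S (cball c h) \<le> (4 * h) ^ CARD('n) / h" using h by (simp add: pos_le_divide_eq mult.commute)
  qed
  finally show ?thesis .
qed

context residual
begin

text \<open>A side bubble also sees the residuals of the two elements next to the side. They are
  kept as norms here and estimated by \<open>element_indicator\<close> afterwards.\<close>

lemma half_element_bound:
  assumes T: "T \<in> \<T>" and A: "A \<in> sets borel" and \<phi>: "smooth \<phi>" "compact K" "\<And>x. x \<notin> K \<Longrightarrow> \<phi> x = 0"
    and b: "\<And>x. \<bar>\<phi> x\<bar> \<le> M0" and AK: "A \<inter> K \<subseteq> T" and V: "measure lebesgue K \<le> V"
  shows "\<bar>LINT x|lborel. indicator A x * elem_res T x * \<phi> x\<bar> \<le> L2_norm T (elem_res T) * (M0 * sqrt V)"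
proof -
  have Tc: "compact T" by (rule convex_meshD(3)[OF mesh T])
  note Tb = borel_compact[OF Tc] compact_imp_bounded[OF Tc]
  have sq: "smooth (elem_res T)" by (rule elem_res_smooth[OF T])
  have [measurable]: "elem_res T \<in> borel_measurable borel" "\<phi> \<in> borel_measurable borel"
    using smooth_borel_measurable sq \<phi>(1) by auto
  have [measurable]: "indicat_real A \<in> borel_measurable borel" by (rule borel_measurable_indicator[OF A])
  have M0: "0 \<le> M0" using b[of 0] by (rule order_trans[OF abs_ge_zero])
  define \<psi> where "\<psi> x = indicat_real A x * \<phi> x" for x
  have \<psi>b: "\<bar>\<psi> x\<bar> \<le> M0" for x using b[of x] M0 by (simp add: \<psi>_def indicator_def)
  have \<psi>m: "\<psi> \<in> borel_measurable borel" unfolding \<psi>_def by measurable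
  have s\<psi>: "sq_integrable_on T \<psi>" by (rule sq_integrable_bounded[OF Tb \<psi>m refl, of M0]) (simp add: \<psi>b)
  obtain B where B: "\<forall>x\<in>T. \<bar>elem_res T x\<bar> \<le> B" using bounded_on_compact[OF sq Tc] by blast
  have sr: "sq_integrable_on T (elem_res T)"
    by (rule sq_integrable_bounded[OF Tb smooth_borel_measurable[OF sq] refl, of B]) (use B in simp)
  have "L2_inner T (elem_res T) \<psi> = (LINT x|lborel. indicator A x * elem_res T x * \<phi> x)"
    unfolding L2_inner_def
  proof (rule integral_lebesgue_on_lborel[OF Tb(1)])
    show "indicator A x * elem_res T x * \<phi> x = 0" if "x \<notin> T" for x
      using that AK \<phi>(3)[of x] by (cases "x \<in> K") (auto simp: indicator_def)
    show "(\<lambda>x. indicator A x * elem_res T x * \<phi> x) \<in> borel_measurable borel" by measurable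
  qed (simp add: \<psi>_def)
  then have "\<bar>LINT x|lborel. indicator A x * elem_res T x * \<phi> x\<bar> \<le> L2_norm T (elem_res T) * L2_norm T \<psi>"
    using L2_Cauchy_Schwarz[OF sr s\<psi>] by simp
  also have "\<dots> \<le> L2_norm T (elem_res T) * (M0 * sqrt V)"
    by (intro mult_left_mono L2_norm_bound[OF Tb(1) s\<psi> \<phi>(2) _ M0 _ V] L2_norm_nonneg)
      (use \<psi>b \<phi>(3) in \<open>auto simp: \<psi>_def\<close>)
  finally show ?thesis .
qed

text \<open>The thickness is \<tau> = \<kappa> \<alpha> = min(h, \<kappa>). Up to constants the test
  function has size sqrt (\<tau> J) in L2, with J the integral of the squared jump over a disc, and
  its gradient weighted by \<kappa> is larger by the factor \<kappa> / \<tau> \<ge> 1. After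
  multiplication by sqrt (\<alpha> / \<kappa>) = sqrt \<tau> / \<kappa> the error term is free of h
  and \<kappa>, because \<alpha> \<kappa> / \<tau> = 1, and the element residuals receive the weight
  \<alpha>.\<close>

lemma side_estimate:
  fixes B :: real
  assumes T: "Tp \<in> \<T>" "Tm \<in> \<T>" and E: "normal_to E n" "compact E" "c \<in> E" "E \<subseteq> cball c h"
    and patch: "\<And>x. dist c x < \<rho> * h \<Longrightarrow> 0 \<le> n \<bullet> (x - c) \<Longrightarrow> x \<in> Tp" "\<And>x. dist c x < \<rho> * h \<Longrightarrow> n \<bullet> (x - c) \<le> 0 \<Longrightarrow> x \<in> Tm"
    and \<rho>: "0 < \<rho>" "\<rho> \<le> 1" and h: "h > 0" and C: "norm_equiv_const TYPE('n) (\<rho> / 4) N C"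
    and B: "\<And>x i. \<bar>partial i (bump :: real^'n \<Rightarrow> real) x\<bar> \<le> B"
    and pp: "p Tp \<in> polys_total N" "p Tm \<in> polys_total N"
  defines "D \<equiv> CARD('n) * (2 * CARD('n) * B / \<rho> + 1) + 1"
    and "s \<equiv> \<lambda>x. \<kappa>\<^sup>2 * (dderiv (p Tp) n x - dderiv (p Tm) n x)" and "\<alpha> \<equiv> min (h / \<kappa>) 1"
  shows "sqrt (\<alpha> / \<kappa> * (LINT z:E|surface_measure E. (s z)\<^sup>2)) \<le>
    sqrt (C * 4 ^ CARD('n)) * sqrt (C * 2 ^ CARD('n)) / flat (3 / 4) *
      (D * sqrt (err (ball c (\<rho> * h))) + \<alpha> * L2_norm Tp (elem_res Tp) + \<alpha> * L2_norm Tm (elem_res Tm))"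
proof -
  let ?S = "surface_measure E"
  define Qp where "Qp = L2_norm Tp (elem_res Tp)"
  define Qm where "Qm = L2_norm Tm (elem_res Tm)"
  have Q0: "0 \<le> Qp" "0 \<le> Qm" by (simp_all add: Qp_def Qm_def L2_norm_nonneg)
  define \<tau> where "\<tau> = \<kappa> * \<alpha>"
  have \<alpha>: "\<alpha> > 0" "\<alpha> \<le> 1" "\<alpha> \<le> h / \<kappa>" using h \<kappa> by (auto simp: \<alpha>_def)
  have \<tau>: "0 < \<tau>" "\<tau> \<le> h" "\<tau> \<le> \<kappa>"
    using \<alpha> \<kappa> by (auto simp: \<tau>_def pos_le_divide_eq mult.commute mult_left_le)
  define R where "R = \<rho> * h / 2"
  have R: "0 < R" "R \<le> h" "R < \<rho> * h"
  proof -
    have "0 < \<rho> * h" "\<rho> * h \<le> 1 * h" using \<rho> h by (simp, intro mult_right_mono) auto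
    then show "0 < R" "R \<le> h" "R < \<rho> * h" unfolding R_def by linarith+
  qed
  have n: "norm n = 1" using E(1) by (simp add: normal_to_def)
  have nn: "n \<bullet> n = 1" using n by (simp add: norm_eq_1)
  define b where "b = abump R h \<tau> n c"
  define K where "K = abump_support R h \<tau> n c"
  note K = abump_support[OF n R(1,2) \<tau>(1,2), of c, folded K_def]
  have clK: "closed K" using K(1) compact_imp_closed by blast
  have b0: "b x = 0" if "x \<notin> K" for x using abump_eq_0 that unfolding b_def K_def by blast
  have sb: "smooth b" unfolding b_def by (rule smooth_abump)
  have C0: "C > 0" using C by (simp add: norm_equiv_const_def)
  have B0: "0 \<le> B" using B[of undefined 0] by (rule order_trans[OF abs_ge_zero])
  have D0: "D \<ge> 0" "CARD('n) * (2 * CARD('n) * B / \<rho> + 1) + 1 \<le> D" using B0 \<rho> by (auto simp: D_def)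
  have ps: "s \<in> polys_total N"
    unfolding s_def dderiv_def by (intro polys_total_cmul polys_total_diff polys_total_sum, unfold mult.commute[of _ "_ $ _"])
      (intro polys_total_cmul polys_total_partial pp)+
  \<comment> \<open>The projection along \<open>n\<close>; together with a translation it maps into
    the hyperplane through \<open>c\<close>. The extension \<sigma> is again a polynomial of degree
    at most \<open>N\<close>, and it meets the invariance demanded by
    \<open>ball_ip_le_surface\<close>.\<close>
  define A where "A x = x + (- (n \<bullet> x)) *\<^sub>R n" for x
  have linA: "linear A" unfolding A_def[abs_def] by (intro linearI) (simp_all add: inner_add_right algebra_simps)
  define \<sigma> where "\<sigma> x = s (A x + (n \<bullet> c) *\<^sub>R n)" for x
  have \<sigma>p: "\<sigma> \<in> polys_total N" unfolding \<sigma>_def[abs_def] by (rule polys_total_affine[OF linA ps])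
  have inv: "\<sigma> (z + t *\<^sub>R n) = \<sigma> z" for z t
    using nn by (simp add: \<sigma>_def A_def inner_add_right algebra_simps)
  have \<sigma>s: "\<sigma> z = s z" if "n \<bullet> (z - c) = 0" for z
  proof -
    have "n \<bullet> z = n \<bullet> c" using that by (simp add: inner_diff_right)
    then show ?thesis by (simp add: \<sigma>_def A_def)
  qed
  have s\<sigma>: "smooth \<sigma>" and ss: "smooth s" using \<sigma>p ps by (simp_all add: polys_total_smooth)
  \<comment> \<open>The bump is bounded below on this disc, and its radius R / 2 = \<rho> h / 4 is
    at the same time that of the ball in the norm equivalence.\<close>
  define J where "J = (LINT z|?S. indicat_real (cball c (R / 2)) z * (\<sigma> z)\<^sup>2)"
  have J0: "0 \<le> J" unfolding J_def by (intro integral_nonneg_AE always_eventually allI) simp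
  have ip: "ball_ip c (\<rho> / 4 * h) \<sigma> \<sigma> \<le> R * J"
    using ball_ip_le_surface[OF E(1,3) smooth_continuous_on[OF s\<sigma>] inv, of "R / 2"] R by (simp add: J_def R_def)
  define M0 where "M0 = sqrt (C / h ^ CARD('n) * (R * J))"
  have M0: "0 \<le> M0" using C0 h J0 R by (simp add: M0_def)
  have \<sigma>b: "\<bar>\<sigma> x\<bar> \<le> M0" "\<bar>partial j \<sigma> x\<bar> \<le> M0 / h" if "x \<in> cball c h" for x j
    using norm_equiv_constD[OF C \<sigma>p h that ip] unfolding M0_def by blast+
  define B1 where "B1 = CARD('n) * B * (h / \<tau> / R)"
  have B1: "\<bar>partial i b x\<bar> \<le> B1" for x i unfolding b_def B1_def by (rule abump_partial[OF n R(1) \<tau>(1,2) B])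
  have Kh: "K \<subseteq> cball c h" using K(2) R(2) subset_cball by blast
  define \<phi> where "\<phi> x = b x * \<sigma> x" for x
  have pb: "\<bar>\<phi> x\<bar> \<le> M0" "\<bar>partial i \<phi> x\<bar> \<le> B1 * M0 + M0 / h" for x i
    unfolding \<phi>_def
    by (rule product_bounds[OF sb clK b0 _ _ B1 s\<sigma>, where ?M1.0 = "M0 / h"];
        use \<sigma>b Kh M0 h in \<open>auto simp: b_def abump_nonneg abump_le_1\<close>)+
  have s\<phi>: "smooth \<phi>" unfolding \<phi>_def[abs_def] by (intro smooth_mult sb s\<sigma>)
  have \<phi>0: "\<phi> x = 0" if "x \<notin> K" for x using b0[OF that] by (simp add: \<phi>_def)
  have Kr: "K \<subseteq> ball c (\<rho> * h)" using K(2) R(3) by (auto simp: subset_eq)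
  define V where "V = 2 ^ CARD('n) * h ^ (CARD('n) - 1) * \<tau>"
  have V0: "0 \<le> V" using h \<tau> by (simp add: V_def)
  note rs = res_side[OF T E(1,3) patch s\<phi> K(1) \<phi>0 Kr]
  have rb: "\<bar>res \<phi>\<bar> \<le> sqrt (err (ball c (\<rho> * h))) * ((\<kappa> * (CARD('n) * (B1 * M0 + M0 / h)) + M0) * sqrt V)"
    using res_bound[OF s\<phi> K(1) \<phi>0 order_trans[OF Kr rs(1)] Kr _ pb K(3)] unfolding V_def by auto
  have op: "{x. n \<bullet> (x - c) > 0} \<in> sets borel" "{x. (- n) \<bullet> (x - c) > 0} \<in> sets borel"
    by (intro borel_open open_Collect_less continuous_intros)+
  define Ip where "Ip = (LINT x|lborel. indicator {x. n \<bullet> (x - c) > 0} x * elem_res Tp x * \<phi> x)"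
  define Im where "Im = (LINT x|lborel. indicator {x. (- n) \<bullet> (x - c) > 0} x * elem_res Tm x * \<phi> x)"
  have Ip: "\<bar>Ip\<bar> \<le> Qp * (M0 * sqrt V)" unfolding Ip_def Qp_def V_def
    by (rule half_element_bound[OF T(1) op(1) s\<phi> K(1) \<phi>0 pb(1) _ K(3)]) (use patch(1) Kr in auto)
  have Im: "\<bar>Im\<bar> \<le> Qm * (M0 * sqrt V)" unfolding Im_def Qm_def V_def
    by (rule half_element_bound[OF T(2) op(2) s\<phi> K(1) \<phi>0 pb(1) _ K(3)]) (use patch(2) Kr in auto)
  have si: "integrable ?S (\<lambda>z. q z * \<phi> z)" if q: "smooth q" for q
  proof -
    have sm: "smooth (\<lambda>z. q z * \<phi> z)" by (intro smooth_mult q s\<phi>)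
    have v: "q z * \<phi> z = 0" if "z \<notin> K" for z using \<phi>0[OF that] by simp
    obtain M where M: "\<forall>z\<in>K. \<bar>q z * \<phi> z\<bar> \<le> M" using bounded_on_compact[OF sm K(1)] by blast
    show ?thesis
    proof (rule integrable_surface_bounded[OF E(1) smooth_borel_measurable[OF sm], of "max M 0" c R])
      fix z show "\<bar>q z * \<phi> z\<bar> \<le> max M 0 * indicator (cball c R) z"
      proof (cases "z \<in> K")
        case True
        then have "\<bar>q z * \<phi> z\<bar> \<le> M" "z \<in> cball c R" using M K(2) by blast+
        then show ?thesis by simp
      next
        case False
        show ?thesis unfolding v[OF False] by simp
      qed
    qed
  qed
  have sI: "(LINT z|?S. s z * \<phi> z) = res \<phi> - Ip - Im"
  proof -
    have "(LINT z|?S. s z * \<phi> z) = (LINT z|?S. \<kappa>\<^sup>2 * (dderiv (p Tp) n z * \<phi> z - dderiv (p Tm) n z * \<phi> z))"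
      by (simp add: s_def algebra_simps)
    also have "\<dots> = \<kappa>\<^sup>2 * ((LINT z|?S. dderiv (p Tp) n z * \<phi> z) - (LINT z|?S. dderiv (p Tm) n z * \<phi> z))"
      using si[OF smooth_dderiv[OF p[OF T(1)]]] si[OF smooth_dderiv[OF p[OF T(2)]]] by simp
    finally show ?thesis using rs(2) by (simp add: Ip_def Im_def)
  qed
  have "flat (3 / 4) * J \<le> (LINT z|?S. s z * \<phi> z)"
  proof -
    have bi: "integrable ?S (\<lambda>z. indicat_real (cball c (R / 2)) z * (\<sigma> z)\<^sup>2)"
    proof -
      obtain M where M: "\<forall>z\<in>cball c (R / 2). \<bar>\<sigma> z * \<sigma> z\<bar> \<le> M"
        using bounded_on_compact[OF smooth_mult[OF s\<sigma> s\<sigma>] compact_cball] by blast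
      have [measurable]: "\<sigma> \<in> borel_measurable borel" by (rule smooth_borel_measurable[OF s\<sigma>])
      have [measurable]: "indicat_real (cball c (R / 2)) \<in> borel_measurable borel" by (rule borel_measurable_indicator) simp
      have "(\<lambda>z. indicat_real (cball c (R / 2)) z * (\<sigma> z)\<^sup>2) \<in> borel_measurable borel" by measurable
      then show ?thesis
        by (rule integrable_surface_bounded[OF E(1), of _ M c "R / 2"]) (use M in \<open>auto simp: indicator_def power2_eq_square\<close>)
    qed
    have "flat (3 / 4) * J = (LINT z|?S. flat (3 / 4) * (indicat_real (cball c (R / 2)) z * (\<sigma> z)\<^sup>2))" by (simp add: J_def)
    also have "\<dots> \<le> (LINT z|?S. s z * \<phi> z)"
    proof (rule integral_mono_AE)
      show "integrable ?S (\<lambda>z. flat (3 / 4) * (indicat_real (cball c (R / 2)) z * (\<sigma> z)\<^sup>2))" by (intro integrable_mult_right bi)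
      show "integrable ?S (\<lambda>z. s z * \<phi> z)" by (rule si[OF ss])
      show "AE z in ?S. flat (3 / 4) * (indicat_real (cball c (R / 2)) z * (\<sigma> z)\<^sup>2) \<le> s z * \<phi> z"
        using AE_surface_measure[OF E(1)]
      proof eventually_elim
        case (elim z)
        then have nz: "n \<bullet> (z - c) = 0" using affine_hull_normal[OF E(1,3)] by simp
        have e: "s z * \<phi> z = b z * (\<sigma> z)\<^sup>2" by (simp add: \<phi>_def \<sigma>s[OF nz] power2_eq_square)
        show ?case
        proof (cases "z \<in> cball c (R / 2)")
          case True
          then have "flat (3 / 4) \<le> b z" unfolding b_def using nz R by (intro abump_ge) auto
          then show ?thesis unfolding e using True by (simp add: mult_right_mono)
        next
          case False
          have "0 \<le> b z * (\<sigma> z)\<^sup>2" by (rule mult_nonneg_nonneg) (auto simp: b_def abump_nonneg)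
          then show ?thesis unfolding e using False by simp
        qed
      qed
    qed
    finally show ?thesis .
  qed
  also have "\<dots> \<le> \<bar>res \<phi>\<bar> + \<bar>Ip\<bar> + \<bar>Im\<bar>" unfolding sI by linarith
  also have "\<dots> \<le> sqrt (err (ball c (\<rho> * h))) * ((M0 * (D * (\<kappa> / \<tau>))) * sqrt V) + Qp * (M0 * sqrt V) + Qm * (M0 * sqrt V)"
  proof (intro add_mono order_trans[OF rb] Ip Im mult_left_mono mult_right_mono)
    have e: "\<kappa> * (CARD('n) * (B1 * M0 + M0 / h)) + M0 = M0 * (CARD('n) * (2 * CARD('n) * B / \<rho> * (\<kappa> / \<tau>) + \<kappa> / h) + 1)"
      using h \<rho> \<tau> by (simp add: B1_def R_def field_simps)
    have 1: "1 \<le> \<kappa> / \<tau>" using \<tau> by (simp add: pos_le_divide_eq)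
    have 2: "\<kappa> / h \<le> \<kappa> / \<tau>" using \<tau> \<kappa> by (intro divide_left_mono) auto
    have "CARD('n) * (2 * CARD('n) * B / \<rho> * (\<kappa> / \<tau>) + \<kappa> / h) + 1
      \<le> CARD('n) * (2 * CARD('n) * B / \<rho> * (\<kappa> / \<tau>) + \<kappa> / \<tau>) + \<kappa> / \<tau>"
      using 1 2 by (intro add_mono mult_left_mono order_refl) auto
    also have "\<dots> = D * (\<kappa> / \<tau>)" by (simp add: D_def algebra_simps)
    finally show "\<kappa> * (CARD('n) * (B1 * M0 + M0 / h)) + M0 \<le> M0 * (D * (\<kappa> / \<tau>))"
      unfolding e using M0 by (intro mult_left_mono)
  qed (use V0 err_nonneg in auto)
  also have "\<dots> = (sqrt (err (ball c (\<rho> * h))) * (D * (\<kappa> / \<tau>)) + Qp + Qm) * (M0 * sqrt V)" by (simp add: algebra_simps)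
  also have "\<dots> \<le> (sqrt (err (ball c (\<rho> * h))) * (D * (\<kappa> / \<tau>)) + Qp + Qm) * (sqrt (C * 2 ^ CARD('n)) * sqrt \<tau> * sqrt J)"
  proof (rule mult_left_mono)
    have hd: "h ^ CARD('n) = h ^ (CARD('n) - 1) * h"
    proof -
      have "CARD('n) = Suc (CARD('n) - 1)" by simp
      then show ?thesis by (metis power_Suc2)
    qed
    \<comment> \<open>In M0^2 V the powers of h cancel up to R / h \<le> 1, and the thickness \<tau>
      is left.\<close>
    have "C / h ^ CARD('n) * (R * J) * V = C * 2 ^ CARD('n) * \<tau> * J * (R / h)"
      unfolding V_def hd using h by (simp add: field_simps)
    also have "\<dots> \<le> C * 2 ^ CARD('n) * \<tau> * J * 1" using R h C0 \<tau> J0 by (intro mult_left_mono) auto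
    finally have "sqrt (C / h ^ CARD('n) * (R * J) * V) \<le> sqrt (C * 2 ^ CARD('n) * \<tau> * J * 1)" by (rule real_sqrt_le_mono)
    then show "M0 * sqrt V \<le> sqrt (C * 2 ^ CARD('n)) * sqrt \<tau> * sqrt J" unfolding M0_def real_sqrt_mult by simp
    show "0 \<le> sqrt (err (ball c (\<rho> * h))) * (D * (\<kappa> / \<tau>)) + Qp + Qm" using err_nonneg D0 \<kappa> \<tau> Q0 by simp
  qed
  finally have "flat (3 / 4) * J \<le> ((sqrt (err (ball c (\<rho> * h))) * (D * (\<kappa> / \<tau>)) + Qp + Qm) * (sqrt (C * 2 ^ CARD('n)) * sqrt \<tau>)) * sqrt J"
    by (simp add: mult.assoc)
  moreover have fl: "flat (3/4) > 0" by (simp add: flat_pos_iff)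
  ultimately have SJ: "flat (3 / 4) * sqrt J \<le> (sqrt (err (ball c (\<rho> * h))) * (D * (\<kappa> / \<tau>)) + Qp + Qm) * (sqrt (C * 2 ^ CARD('n)) * sqrt \<tau>)"
    using err_nonneg D0 \<kappa> \<tau> Q0 C0 J0 by (intro absorb_sqrt) auto
  have w: "sqrt \<tau> / \<kappa> * sqrt \<tau> = \<alpha>" "sqrt (\<alpha> / \<kappa>) = sqrt \<tau> / \<kappa>"
  proof -
    show "sqrt \<tau> / \<kappa> * sqrt \<tau> = \<alpha>" using \<tau>(1) \<kappa> by (simp add: \<tau>_def)
    have "\<alpha> / \<kappa> = \<tau> / \<kappa>\<^sup>2" using \<kappa> by (simp add: \<tau>_def power2_eq_square)
    then show "sqrt (\<alpha> / \<kappa>) = sqrt \<tau> / \<kappa>" using \<kappa> by (simp add: real_sqrt_divide)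
  qed
  have "flat (3 / 4) * (sqrt (\<alpha> / \<kappa>) * sqrt J) = sqrt \<tau> / \<kappa> * (flat (3 / 4) * sqrt J)" unfolding w by simp
  also have "\<dots> \<le> sqrt \<tau> / \<kappa> * ((sqrt (err (ball c (\<rho> * h))) * (D * (\<kappa> / \<tau>)) + Qp + Qm) * (sqrt (C * 2 ^ CARD('n)) * sqrt \<tau>))"
    using SJ \<tau> \<kappa> by (intro mult_left_mono) auto
  also have "\<dots> = sqrt (C * 2 ^ CARD('n)) * ((sqrt \<tau> / \<kappa> * sqrt \<tau>) * (sqrt (err (ball c (\<rho> * h))) * (D * (\<kappa> / \<tau>)) + Qp + Qm))"
    by (simp only: mult_ac)
  also have "\<dots> = sqrt (C * 2 ^ CARD('n)) * (D * sqrt (err (ball c (\<rho> * h))) + \<alpha> * Qp + \<alpha> * Qm)"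
  proof -
    have k: "\<alpha> * (\<kappa> / \<tau>) = 1" using \<alpha> \<kappa> by (simp add: \<tau>_def)
    have "\<alpha> * (sqrt (err (ball c (\<rho> * h))) * (D * (\<kappa> / \<tau>)) + Qp + Qm)
      = (\<alpha> * (\<kappa> / \<tau>)) * (D * sqrt (err (ball c (\<rho> * h)))) + \<alpha> * Qp + \<alpha> * Qm" by (simp only: distrib_left mult_ac)
    then show ?thesis unfolding w(1) k by simp
  qed
  finally have SJ': "sqrt (\<alpha> / \<kappa>) * sqrt J \<le> sqrt (C * 2 ^ CARD('n)) * (D * sqrt (err (ball c (\<rho> * h))) + \<alpha> * Qp + \<alpha> * Qm) / flat (3 / 4)"
    using fl by (simp add: pos_le_divide_eq mult.commute)
  \<comment> \<open>From the disc back to all of \<open>E\<close>, which lies in the ball of radius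
    h: on \<open>E\<close> the jump agrees with \<sigma>, so M0 bounds it there.\<close>
  have "(LINT z:E|?S. (s z)\<^sup>2) \<le> (C / h ^ CARD('n) * (R * J)) * ((4 * h) ^ CARD('n) / h)"
  proof (rule surface_integral_le[OF E(1,2,4) h smooth_continuous_on[OF ss]])
    fix z assume z: "z \<in> E"
    have "n \<bullet> (z - c) = 0" using E(1,3) z unfolding normal_to_def by blast
    then have "\<bar>s z\<bar> \<le> M0" using \<sigma>b(1)[of z] \<sigma>s[of z] z E(4) by auto
    then have "(s z)\<^sup>2 \<le> M0\<^sup>2" using power_mono[of "\<bar>s z\<bar>" M0 2] by simp
    then show "(s z)\<^sup>2 \<le> C / h ^ CARD('n) * (R * J)" using C0 h J0 R by (simp add: M0_def)
  qed (use C0 h J0 R in simp)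
  also have "\<dots> = C * 4 ^ CARD('n) * J * (R / h)" using h by (simp add: field_simps power_mult_distrib)
  also have "\<dots> \<le> C * 4 ^ CARD('n) * J * 1" using R h C0 J0 by (intro mult_left_mono) auto
  finally have "\<alpha> / \<kappa> * (LINT z:E|?S. (s z)\<^sup>2) \<le> \<alpha> / \<kappa> * (C * 4 ^ CARD('n) * J)"
    using \<alpha> \<kappa> by (intro mult_left_mono) auto
  then have "sqrt (\<alpha> / \<kappa> * (LINT z:E|?S. (s z)\<^sup>2)) \<le> sqrt (\<alpha> / \<kappa> * (C * 4 ^ CARD('n) * J))" by (rule real_sqrt_le_mono)
  also have "\<dots> = sqrt (C * 4 ^ CARD('n)) * (sqrt (\<alpha> / \<kappa>) * sqrt J)" unfolding real_sqrt_mult by (simp only: mult_ac)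
  also have "\<dots> \<le> sqrt (C * 4 ^ CARD('n)) * (sqrt (C * 2 ^ CARD('n)) * (D * sqrt (err (ball c (\<rho> * h))) + \<alpha> * Qp + \<alpha> * Qm) / flat (3 / 4))"
    using SJ' C0 by (intro mult_left_mono) auto
  finally show ?thesis unfolding Qp_def Qm_def by (simp add: mult_ac)
qed

text \<open>Boundaries of elements are null sets, so what two closed elements cover is covered by
  their interiors up to measure zero.\<close>

lemma err_mono_AE:
  assumes A: "A \<in> sets borel" and Tp: "Tp \<in> \<T>" and Tm: "Tm \<in> \<T>" and sub: "A \<subseteq> Tp \<union> Tm"
  shows "err A \<le> err (interior Tp) + err (interior Tm)"
proof -
  let ?F = "\<lambda>x. \<kappa>\<^sup>2 * (G x \<bullet> G x) + e x * e x"
  have ae: "AE x in lebesgue_on \<Omega>. x \<notin> frontier T" if "T \<in> \<T>" for T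
  proof -
    have "frontier T \<in> null_sets lebesgue"
      using negligible_convex_frontier[OF convex_meshD(2)[OF mesh that]] by (simp add: negligible_iff_null_sets)
    then have "AE x in lebesgue. x \<notin> frontier T" by (rule AE_not_in)
    then show ?thesis using \<Omega>(1) by (subst AE_restrict_space_iff) auto
  qed
  have "err A \<le> (LINT x|lebesgue_on \<Omega>. indicat_real (interior Tp) x * ?F x + indicat_real (interior Tm) x * ?F x)"
    unfolding err_def
  proof (rule integral_mono_AE[OF err_integrable[OF A] Bochner_Integration.integrable_add[OF err_integrable err_integrable]])
    show "AE x in lebesgue_on \<Omega>. indicat_real A x * ?F x \<le> indicat_real (interior Tp) x * ?F x + indicat_real (interior Tm) x * ?F x"
      using ae[OF Tp] ae[OF Tm]
    proof eventually_elim
      case (elim x)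
      have F: "0 \<le> ?F x" by simp
      have "x \<in> A \<Longrightarrow> x \<in> interior Tp \<or> x \<in> interior Tm"
        using elim sub closure_subset by (auto simp: frontier_def)
      then show ?case using F by (auto simp: indicator_def)
    qed
  qed auto
  also have "\<dots> = err (interior Tp) + err (interior Tm)"
    unfolding err_def by (intro Bochner_Integration.integral_add err_integrable) auto
  finally show ?thesis .
qed

lemma sum_err_le: "(\<Sum>T\<in>\<T>. err (interior T)) \<le> err UNIV"
proof -
  let ?F = "\<lambda>x. \<kappa>\<^sup>2 * (G x \<bullet> G x) + e x * e x"
  have "(\<Sum>T\<in>\<T>. err (interior T)) = (LINT x|lebesgue_on \<Omega>. (\<Sum>T\<in>\<T>. indicat_real (interior T) x * ?F x))"
    unfolding err_def by (rule Bochner_Integration.integral_sum[symmetric]) (rule err_integrable, simp)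
  also have "\<dots> \<le> err UNIV" unfolding err_def
  proof (rule integral_mono)
    show "integrable (lebesgue_on \<Omega>) (\<lambda>x. \<Sum>T\<in>\<T>. indicat_real (interior T) x * ?F x)"
      by (intro Bochner_Integration.integrable_sum err_integrable) simp
    show "integrable (lebesgue_on \<Omega>) (\<lambda>x. indicat_real UNIV x * ?F x)" by (rule err_integrable) simp
    fix x
    have F: "0 \<le> ?F x" by simp
    have "(\<Sum>T\<in>\<T>. indicat_real (interior T) x) \<le> 1"
    proof (cases "\<exists>S\<in>\<T>. x \<in> interior S")
      case True
      then obtain S where S: "S \<in> \<T>" "x \<in> interior S" by blast
      have "(\<Sum>T\<in>\<T>. indicat_real (interior T) x) = (\<Sum>T\<in>{S}. indicat_real (interior T) x)"
        using S convex_meshD(5)[OF mesh] by (intro sum.mono_neutral_right convex_meshD(1)[OF mesh]) (auto simp: indicator_def)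
      then show ?thesis by simp
    next
      case False
      then have "(\<Sum>T\<in>\<T>. indicat_real (interior T) x) = 0" by (intro sum.neutral) (auto simp: indicator_def)
      then show ?thesis by simp
    qed
    then have "(\<Sum>T\<in>\<T>. indicat_real (interior T) x) * ?F x \<le> 1 * ?F x" by (rule mult_right_mono[OF _ F])
    then show "(\<Sum>T\<in>\<T>. indicat_real (interior T) x * ?F x) \<le> indicat_real UNIV x * ?F x" by (simp only: sum_distrib_right) simp
  qed
  finally show ?thesis .
qed

end

section \<open>Global efficiency\<close>

context residual
begin

lemma err_UNIV: "err UNIV = \<kappa>\<^sup>2 * L2_inner \<Omega> G G + L2_inner \<Omega> e e"
  unfolding err_def L2_inner_def using sq_integrable_inner[OF G G] sq_integrable_inner[OF e e] by simp

lemma element_indicator: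
  fixes B :: real
  assumes m: "shape_regular_mesh C0 \<Omega> \<T>" and C0: "C0 > 0" and T: "T \<in> \<T>"
    and C: "norm_equiv_const TYPE('n) (ball_ratio CARD('n) C0 / 4) N C"
    and B: "\<And>x i. \<bar>partial i (bump :: real^'n \<Rightarrow> real) x\<bar> \<le> B"
    and q: "elem_res T \<in> polys_total N"
  defines "D \<equiv> CARD('n) * (2 * CARD('n) * B / ball_ratio CARD('n) C0 + 1) + 1"
  shows "min (diameter T / \<kappa>) 1 * L2_norm T (elem_res T)
    \<le> 2 * D * (C * 2 ^ CARD('n)) / flat (3 / 4) * sqrt (err (interior T))"
proof -
  note eb = element_ball[OF m C0 T]
  obtain c where c: "cball c (ball_ratio CARD('n) C0 * diameter T) \<subseteq> T" using eb(1) by blast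
  have "c \<in> T" using c eb(2,3) by (auto simp: subset_eq)
  then have "T \<subseteq> cball c (diameter T)" by (intro subset_cball_diameter convex_meshD(3)[OF mesh T])
  then show ?thesis unfolding D_def by (rule element_estimate[OF T q c _ eb(3,4,2) C B])
qed

definition jump_res :: "(real^'n) set \<Rightarrow> real^'n \<Rightarrow> real" where
  "jump_res E x = \<kappa>\<^sup>2 * (dderiv (p (fst (jump_pair \<T> E))) (unit_normal E) x - dderiv (p (snd (jump_pair \<T> E))) (unit_normal E) x)"

text \<open>The weight on the left belongs to \<open>T\<close>, whereas the residuals of
  \<open>Tp\<close> and \<open>Tm\<close> are controlled with weights of their own sizes. These
  sizes are at least \<rho> h, which costs a factor 1 / \<rho>; hence Ce / \<rho> in
  \<open>Cs\<close>, twice for the two elements.\<close>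

lemma side_indicator:
  fixes B :: real
  assumes m: "shape_regular_mesh C0 \<Omega> \<T>" and C0: "C0 > 0" and d: "CARD('n) \<ge> 2" and T: "T \<in> \<T>"
    and C1: "norm_equiv_const TYPE('n) (ball_ratio CARD('n) C0 / 4) N C1"
    and C2: "norm_equiv_const TYPE('n) (patch_ratio CARD('n) C0 / 4) N C2"
    and B: "\<And>x i. \<bar>partial i (bump :: real^'n \<Rightarrow> real) x\<bar> \<le> B"
    and pp: "\<And>T. T \<in> \<T> \<Longrightarrow> p T \<in> polys_total N" and qq: "\<And>T. T \<in> \<T> \<Longrightarrow> elem_res T \<in> polys_total N"
    and E: "E \<in> sides T" "E \<in> interior_sides \<T>"
  defines "Tp \<equiv> fst (jump_pair \<T> E)" and "Tm \<equiv> snd (jump_pair \<T> E)"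
    and "Ce \<equiv> 2 * (CARD('n) * (2 * CARD('n) * B / ball_ratio CARD('n) C0 + 1) + 1) * (C1 * 2 ^ CARD('n)) / flat (3 / 4)"
  defines "Cs \<equiv> sqrt (C2 * 4 ^ CARD('n)) * sqrt (C2 * 2 ^ CARD('n)) / flat (3 / 4) *
    ((CARD('n) * (2 * CARD('n) * B / patch_ratio CARD('n) C0 + 1) + 1) + 2 * (Ce / ball_ratio CARD('n) C0))"
  shows "min (diameter T / \<kappa>) 1 / \<kappa> * (LINT x:E|surface_measure E. (jump_res E x)\<^sup>2)
    \<le> Cs\<^sup>2 * (err (interior Tp) + err (interior Tm))"
proof -
  define \<rho> where "\<rho> = ball_ratio CARD('n) C0"
  define \<rho>' where "\<rho>' = patch_ratio CARD('n) C0"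
  define h where "h = diameter T"
  define \<alpha> where "\<alpha> = min (h / \<kappa>) 1"
  note eb = element_ball[OF m C0 T, folded \<rho>_def h_def]
  note jp = jump_pairD[OF m C0 E(2), folded Tp_def Tm_def]
  note sp = side_patch[OF m C0 d T E, folded Tp_def Tm_def \<rho>_def h_def \<rho>'_def]
  have \<rho>': "0 < \<rho>'" "\<rho>' \<le> 1"
    using eb(3,4) power_le_one[of \<rho> 5] by (auto simp: \<rho>'_def patch_ratio_def \<rho>_def)
  have \<alpha>: "\<alpha> > 0" using eb(2) \<kappa> by (simp add: \<alpha>_def)
  obtain n c where n: "n = unit_normal E \<or> n = - unit_normal E" "normal_to E n" and c: "c \<in> E"
    and patch: "\<forall>x. dist c x < \<rho>' * h \<longrightarrow> (0 \<le> n \<bullet> (x - c) \<longrightarrow> x \<in> Tp) \<and> (n \<bullet> (x - c) \<le> 0 \<longrightarrow> x \<in> Tm)"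
    using sp(4) by blast
  have Tc: "compact T" "convex T" by (rule convex_meshD(3)[OF mesh T], rule convex_meshD(2)[OF mesh T])
  have Ec: "compact E" using E(1) Tc by (auto simp: sides_def intro: face_of_imp_compact facet_of_imp_face_of)
  have Eh: "E \<subseteq> cball c h"
    using sides_subset[OF E(1)] c subset_cball_diameter[OF Tc(1), of c] unfolding h_def by blast
  define D where "D = CARD('n) * (2 * CARD('n) * B / \<rho>' + 1) + 1"
  define L where "L = sqrt (C2 * 4 ^ CARD('n)) * sqrt (C2 * 2 ^ CARD('n)) / flat (3 / 4)"
  have fl: "flat (3/4) > 0" by (simp add: flat_pos_iff)
  have B0: "0 \<le> B" using B[of undefined 0] by (rule order_trans[OF abs_ge_zero])
  have C0': "C1 > 0" "C2 > 0" using C1 C2 by (simp_all add: norm_equiv_const_def)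
  have nn: "0 \<le> D" "0 \<le> L" "0 \<le> Ce" using fl B0 C0' \<rho>' eb(3) by (simp_all add: D_def L_def Ce_def \<rho>_def)
  define s where "s x = \<kappa>\<^sup>2 * (dderiv (p Tp) n x - dderiv (p Tm) n x)" for x
  \<comment> \<open>\<open>n\<close> may be opposite to \<open>unit_normal E\<close>, which changes
    only the sign of the jump.\<close>
  have s: "(s x)\<^sup>2 = (jump_res E x)\<^sup>2" for x
    using n(1) by (auto simp: s_def jump_res_def Tp_def Tm_def dderiv_minus power2_eq_square algebra_simps)
  let ?I = "LINT x:E|surface_measure E. (jump_res E x)\<^sup>2"
  let ?ep = "err (interior Tp)" and ?em = "err (interior Tm)"
  have Q: "\<alpha> * L2_norm S (elem_res S) \<le> Ce / \<rho> * sqrt (?ep + ?em)" if S: "S = Tp \<or> S = Tm" for S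
  proof -
    have S': "S \<in> \<T>" "\<rho> * h \<le> diameter S" using S jp sp(2,3) by auto
    have "\<rho> * \<alpha> \<le> min (diameter S / \<kappa>) 1"
    proof -
      have "\<rho> * \<alpha> \<le> \<rho> * (h / \<kappa>)" using eb(3) by (intro mult_left_mono) (auto simp: \<alpha>_def)
      also have "\<dots> \<le> diameter S / \<kappa>" using S'(2) \<kappa> by (simp add: divide_right_mono)
      finally have 1: "\<rho> * \<alpha> \<le> diameter S / \<kappa>" .
      have "\<rho> * \<alpha> \<le> 1 * 1" using eb(3,4) \<alpha> by (intro mult_mono) (auto simp: \<alpha>_def)
      then show ?thesis using 1 by simp
    qed
    then have "\<rho> * \<alpha> * L2_norm S (elem_res S) \<le> min (diameter S / \<kappa>) 1 * L2_norm S (elem_res S)"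
      by (intro mult_right_mono L2_norm_nonneg)
    also have "\<dots> \<le> Ce * sqrt (err (interior S))"
      unfolding Ce_def by (rule element_indicator[OF m C0 S'(1) C1 B qq[OF S'(1)]])
    also have "\<dots> \<le> Ce * sqrt (?ep + ?em)" using S nn(3) err_nonneg[of "interior Tp"] err_nonneg[of "interior Tm"]
      by (intro mult_left_mono real_sqrt_le_mono) auto
    finally show ?thesis using eb(3) by (simp add: pos_le_divide_eq mult_ac)
  qed
  have bb: "sqrt (err (ball c (\<rho>' * h))) \<le> sqrt (?ep + ?em)"
  proof (intro real_sqrt_le_mono err_mono_AE jp(1,2))
    show "ball c (\<rho>' * h) \<subseteq> Tp \<union> Tm" using patch by force
  qed simp
  have "sqrt (\<alpha> / \<kappa> * ?I) = sqrt (\<alpha> / \<kappa> * (LINT x:E|surface_measure E. (s x)\<^sup>2))" by (simp only: s)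
  also have "\<dots> \<le> L * (D * sqrt (err (ball c (\<rho>' * h))) + \<alpha> * L2_norm Tp (elem_res Tp) + \<alpha> * L2_norm Tm (elem_res Tm))"
    unfolding L_def D_def \<alpha>_def s_def
    by (rule side_estimate[OF jp(1,2) n(2) Ec c Eh _ _ \<rho>' eb(2) C2[folded \<rho>'_def] B pp[OF jp(1)] pp[OF jp(2)]]) (use patch in auto)
  also have "\<dots> \<le> L * (D * sqrt (?ep + ?em) + Ce / \<rho> * sqrt (?ep + ?em) + Ce / \<rho> * sqrt (?ep + ?em))"
    using nn by (intro mult_left_mono add_mono bb Q) auto
  also have "\<dots> = Cs * sqrt (?ep + ?em)" 
  proof -
    have "Cs = L * (D + 2 * (Ce / \<rho>))" by (simp only: Cs_def L_def D_def \<rho>_def \<rho>'_def)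
    then show ?thesis by (simp only: distrib_left distrib_right mult_2 mult_ac add_ac)
  qed
  finally have le: "sqrt (\<alpha> / \<kappa> * ?I) \<le> Cs * sqrt (?ep + ?em)" .
  have I0: "0 \<le> ?I" unfolding set_lebesgue_integral_def by (intro integral_nonneg_AE always_eventually allI) simp
  have "\<alpha> / \<kappa> * ?I = (sqrt (\<alpha> / \<kappa> * ?I))\<^sup>2" using I0 \<alpha> \<kappa> by simp
  also have "\<dots> \<le> (Cs * sqrt (?ep + ?em))\<^sup>2" using le I0 \<alpha> \<kappa> by (intro power_mono) auto
  also have "\<dots> = Cs\<^sup>2 * (?ep + ?em)" using err_nonneg[of "interior Tp"] err_nonneg[of "interior Tm"] by (simp add: power_mult_distrib)
  finally show ?thesis by (simp add: \<alpha>_def h_def)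
qed

end

text \<open>Double counting of pairs (T, E). The weight of S is charged only to pairs in which E is
  a side of S; there are at most 2d such sides, and by \<open>side_patch\<close> T is one of the two
  elements at E. This gives 4d.\<close>

lemma sum_over_sides_le:
  fixes \<T> :: "(real^'n) set set" and w :: "(real^'n) set \<Rightarrow> real"
  assumes m: "shape_regular_mesh C0 \<Omega> \<T>" and C0: "C0 > 0" and d: "CARD('n) \<ge> 2" and w: "\<And>T. 0 \<le> w T"
  shows "(\<Sum>T\<in>\<T>. \<Sum>E\<in>sides T \<inter> interior_sides \<T>. w (fst (jump_pair \<T> E)) + w (snd (jump_pair \<T> E)))
    \<le> 4 * CARD('n) * (\<Sum>T\<in>\<T>. w T)"
proof -
  let ?Tp = "\<lambda>E. fst (jump_pair \<T> E)" and ?Tm = "\<lambda>E. snd (jump_pair \<T> E)"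
  have fin: "finite \<T>" by (rule shape_regular_meshD(1)[OF m])
  have fs: "finite (sides T)" "card (sides T) \<le> 2 * CARD('n)" if "T \<in> \<T>" for T
    using card_sides[OF shape_regular_meshD(3)[OF m that] element_ball(5)[OF m C0 that]] .
  define P where "P = Sigma \<T> (\<lambda>T. sides T \<inter> interior_sides \<T>)"
  have fP: "finite P" unfolding P_def using fin fs(1) by (intro finite_SigmaI) auto
  have "(\<Sum>T\<in>\<T>. \<Sum>E\<in>sides T \<inter> interior_sides \<T>. w (?Tp E) + w (?Tm E)) = (\<Sum>(T, E)\<in>P. w (?Tp E) + w (?Tm E))"
    unfolding P_def using fin fs(1) by (subst sum.Sigma) auto
  also have "\<dots> \<le> (\<Sum>(T, E)\<in>P. \<Sum>S\<in>\<T>. if E \<in> sides S then w S else 0)"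
  proof (rule sum_mono, clarify)
    fix T E assume "(T, E) \<in> P"
    then have E: "E \<in> interior_sides \<T>" by (simp add: P_def)
    note jp = jump_pairD[OF m C0 E]
    have "w (?Tp E) + w (?Tm E) = (\<Sum>S\<in>{?Tp E, ?Tm E}. if E \<in> sides S then w S else 0)" using jp by simp
    also have "\<dots> \<le> (\<Sum>S\<in>\<T>. if E \<in> sides S then w S else 0)" using jp fin w by (intro sum_mono2) auto
    finally show "w (?Tp E) + w (?Tm E) \<le> (\<Sum>S\<in>\<T>. if E \<in> sides S then w S else 0)" .
  qed
  also have "\<dots> = (\<Sum>x\<in>P. \<Sum>S\<in>\<T>. if snd x \<in> sides S then w S else 0)" by (simp add: case_prod_unfold)
  also have "\<dots> = (\<Sum>S\<in>\<T>. \<Sum>x\<in>P. if snd x \<in> sides S then w S else 0)" by (rule sum.swap)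
  also have "\<dots> \<le> (\<Sum>S\<in>\<T>. 4 * CARD('n) * w S)"
  proof (rule sum_mono)
    fix S assume S: "S \<in> \<T>"
    have "(\<Sum>x\<in>P. if snd x \<in> sides S then w S else 0) = (\<Sum>x\<in>{x\<in>P. snd x \<in> sides S}. w S)"
      using fP by (intro sum.mono_neutral_cong_right) auto
    also have "\<dots> = card {x\<in>P. snd x \<in> sides S} * w S" by simp
    also have "\<dots> \<le> (4 * CARD('n)) * w S"
    proof (rule mult_right_mono[OF _ w])
      have sub: "{x\<in>P. snd x \<in> sides S} \<subseteq> (\<lambda>E. (?Tp E, E)) ` sides S \<union> (\<lambda>E. (?Tm E, E)) ` sides S"
      proof
        fix x assume x: "x \<in> {x\<in>P. snd x \<in> sides S}"
        then have x': "fst x \<in> \<T>" "snd x \<in> sides (fst x)" "snd x \<in> interior_sides \<T>" "snd x \<in> sides S"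
          by (auto simp: P_def)
        have "fst x = ?Tp (snd x) \<or> fst x = ?Tm (snd x)" by (rule side_patch(1)[OF m C0 d x'(1,2,3)])
        then have "x = (?Tp (snd x), snd x) \<or> x = (?Tm (snd x), snd x)" by (metis prod.collapse)
        then show "x \<in> (\<lambda>E. (?Tp E, E)) ` sides S \<union> (\<lambda>E. (?Tm E, E)) ` sides S" using x'(4) by blast
      qed
      have "card {x\<in>P. snd x \<in> sides S} \<le> card ((\<lambda>E. (?Tp E, E)) ` sides S \<union> (\<lambda>E. (?Tm E, E)) ` sides S)"
        by (rule card_mono[OF _ sub]) (simp add: fs(1)[OF S])
      also have "\<dots> \<le> card ((\<lambda>E. (?Tp E, E)) ` sides S) + card ((\<lambda>E. (?Tm E, E)) ` sides S)" by (rule card_Un_le)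
      also have "\<dots> \<le> card (sides S) + card (sides S)" by (intro add_mono card_image_le fs(1)[OF S])
      also have "\<dots> \<le> 4 * CARD('n)" using fs(2)[OF S] by simp
      finally show "real (card {x\<in>P. snd x \<in> sides S}) \<le> real (4 * CARD('n))" by (simp only: of_nat_le_iff)
    qed
    finally show "(\<Sum>x\<in>P. if snd x \<in> sides S then w S else 0) \<le> 4 * CARD('n) * w S" by simp
  qed
  also have "\<dots> = 4 * CARD('n) * (\<Sum>T\<in>\<T>. w T)" by (simp add: sum_distrib_left)
  finally show ?thesis .
qed

text \<open>The constant precedes the quantifiers over domain, mesh, \<kappa> and error. In its
  definition 2 d Cs^2 is one half of the factor 4d from \<open>sum_over_sides_le\<close>, and the
  summand 1 ensures positivity.\<close>

lemma residual_efficiency: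
  fixes C0 :: real
  assumes C0: "C0 > 0" and d: "CARD('n) \<ge> 2"
  shows "\<exists>K>0. \<forall>(\<Omega> :: (real^'n) set) \<T> p g \<kappa> G e. residual \<Omega> \<T> p g \<kappa> G e \<longrightarrow> shape_regular_mesh C0 \<Omega> \<T> \<longrightarrow>
    (\<forall>T\<in>\<T>. p T \<in> polys_total N \<and> g T \<in> polys_total N) \<longrightarrow>
    (\<Sum>T\<in>\<T>. (min (diameter T / \<kappa>) 1)\<^sup>2 * (L2_norm T (\<lambda>x. g T x + \<kappa>\<^sup>2 * laplacian (p T) x))\<^sup>2 +
      1/2 * (\<Sum>E\<in>sides T \<inter> interior_sides \<T>. min (diameter T / \<kappa>) 1 / \<kappa> *
        (LINT x:E|surface_measure E. (\<kappa>\<^sup>2 * (dderiv (p (fst (jump_pair \<T> E))) (unit_normal E) x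
          - dderiv (p (snd (jump_pair \<T> E))) (unit_normal E) x))\<^sup>2)))
    \<le> K * (\<kappa>\<^sup>2 * L2_inner \<Omega> G G + L2_inner \<Omega> e e)"
proof -
  define \<rho> where "\<rho> = ball_ratio CARD('n) C0"
  have \<rho>: "\<rho> > 0" using C0 by (simp add: \<rho>_def ball_ratio_def)
  then have \<rho>': "patch_ratio CARD('n) C0 > 0" by (simp add: \<rho>_def patch_ratio_def)
  have "\<exists>C. norm_equiv_const TYPE('n) r N C" if "r > 0" for r
    using polys_norm_equiv[OF that, of N] unfolding norm_equiv_const_def by blast
  \<comment> \<open>Two ratios occur: that of the inscribed ball, for element bubbles, and that of
    the half balls at a side, for side bubbles.\<close>
  then obtain C1 C2 where C1: "norm_equiv_const TYPE('n) (ball_ratio CARD('n) C0 / 4) N C1"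
    and C2: "norm_equiv_const TYPE('n) (patch_ratio CARD('n) C0 / 4) N C2"
    using \<rho> \<rho>' by (metis \<rho>_def divide_pos_pos zero_less_numeral)
  have "\<exists>B. \<forall>x i. \<bar>partial i (bump :: real^'n \<Rightarrow> real) x\<bar> \<le> B"
    using smooth_compact_support_bounded[OF smooth_bump compact_cball, of 0 1] bump_eq_0 by (metis mem_cball_0 not_le_imp_less less_imp_le)
  then obtain B where B: "\<And>x i. \<bar>partial i (bump :: real^'n \<Rightarrow> real) x\<bar> \<le> B" by blast
  define Ce where "Ce = 2 * (CARD('n) * (2 * CARD('n) * B / ball_ratio CARD('n) C0 + 1) + 1) * (C1 * 2 ^ CARD('n)) / flat (3 / 4)"
  define Cs where "Cs = sqrt (C2 * 4 ^ CARD('n)) * sqrt (C2 * 2 ^ CARD('n)) / flat (3 / 4) *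
    ((CARD('n) * (2 * CARD('n) * B / patch_ratio CARD('n) C0 + 1) + 1) + 2 * (Ce / ball_ratio CARD('n) C0))"
  define K where "K = Ce\<^sup>2 + 2 * CARD('n) * Cs\<^sup>2 + 1"
  show ?thesis
  proof (intro exI[of _ K] conjI allI impI)
    show "0 < K" unfolding K_def by (intro add_nonneg_pos add_nonneg_nonneg) auto
    fix \<Omega> :: "(real^'n) set" and \<T> p g \<kappa> G e
    assume r: "residual \<Omega> \<T> p g \<kappa> G e" and m: "shape_regular_mesh C0 \<Omega> \<T>"
      and pg: "\<forall>T\<in>\<T>. p T \<in> polys_total N \<and> g T \<in> polys_total N"
    interpret residual \<Omega> \<T> p g \<kappa> G e by (rule r)
    have pp: "p T \<in> polys_total N" if "T \<in> \<T>" for T using pg that by blast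
    have qq: "elem_res T \<in> polys_total N" if "T \<in> \<T>" for T
      unfolding elem_res_def[abs_def] laplacian_def
      by (intro polys_total_add polys_total_cmul polys_total_sum polys_total_partial) (use pg that in auto)
    have fin: "finite \<T>" by (rule shape_regular_meshD(1)[OF m])
    have 1: "(min (diameter T / \<kappa>) 1)\<^sup>2 * (L2_norm T (elem_res T))\<^sup>2 \<le> Ce\<^sup>2 * err (interior T)" if T: "T \<in> \<T>" for T
    proof -
      have "0 \<le> min (diameter T / \<kappa>) 1" using element_ball(2)[OF m C0 T] \<kappa> by simp
      then have "(min (diameter T / \<kappa>) 1 * L2_norm T (elem_res T))\<^sup>2 \<le> (Ce * sqrt (err (interior T)))\<^sup>2"
        unfolding Ce_def by (intro power_mono element_indicator[OF m C0 T C1 B qq[OF T]] mult_nonneg_nonneg L2_norm_nonneg)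
      then show ?thesis using err_nonneg[of "interior T"] by (simp add: power_mult_distrib)
    qed
    have 2: "min (diameter T / \<kappa>) 1 / \<kappa> * (LINT x:E|surface_measure E. (jump_res E x)\<^sup>2)
        \<le> Cs\<^sup>2 * (err (interior (fst (jump_pair \<T> E))) + err (interior (snd (jump_pair \<T> E))))"
      if "T \<in> \<T>" "E \<in> sides T \<inter> interior_sides \<T>" for T E
      unfolding Cs_def Ce_def by (rule side_indicator[OF m C0 d that(1) C1 C2 B pp qq]) (use that(2) in auto)
    have gen: "(\<Sum>T\<in>\<T>. Ce\<^sup>2 * err (interior T) + 1/2 * (\<Sum>E\<in>sides T \<inter> interior_sides \<T>. Cs\<^sup>2 * v E))
      = Ce\<^sup>2 * (\<Sum>T\<in>\<T>. err (interior T)) + (1/2 * Cs\<^sup>2) * (\<Sum>T\<in>\<T>. \<Sum>E\<in>sides T \<inter> interior_sides \<T>. v E)" for v :: "(real^'n) set \<Rightarrow> real"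
      by (simp only: sum.distrib sum_distrib_left mult.assoc)
    have "(\<Sum>T\<in>\<T>. (min (diameter T / \<kappa>) 1)\<^sup>2 * (L2_norm T (elem_res T))\<^sup>2 + 1/2 * (\<Sum>E\<in>sides T \<inter> interior_sides \<T>.
        min (diameter T / \<kappa>) 1 / \<kappa> * (LINT x:E|surface_measure E. (jump_res E x)\<^sup>2)))
      \<le> (\<Sum>T\<in>\<T>. Ce\<^sup>2 * err (interior T) + 1/2 * (\<Sum>E\<in>sides T \<inter> interior_sides \<T>.
        Cs\<^sup>2 * (err (interior (fst (jump_pair \<T> E))) + err (interior (snd (jump_pair \<T> E))))))"
      by (intro sum_mono add_mono mult_left_mono 1 2) auto
    also have "\<dots> = Ce\<^sup>2 * (\<Sum>T\<in>\<T>. err (interior T)) + (1/2 * Cs\<^sup>2) * (\<Sum>T\<in>\<T>. \<Sum>E\<in>sides T \<inter> interior_sides \<T>.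
        err (interior (fst (jump_pair \<T> E))) + err (interior (snd (jump_pair \<T> E))))"
      by (rule gen)
    also have "\<dots> \<le> Ce\<^sup>2 * (\<Sum>T\<in>\<T>. err (interior T)) + (1/2 * Cs\<^sup>2) * (4 * CARD('n) * (\<Sum>T\<in>\<T>. err (interior T)))"
      by (intro add_left_mono mult_left_mono sum_over_sides_le[OF m C0 d, of "\<lambda>T. err (interior T)"] err_nonneg) auto
    also have "\<dots> = (Ce\<^sup>2 + 2 * CARD('n) * Cs\<^sup>2) * (\<Sum>T\<in>\<T>. err (interior T))" by (simp add: algebra_simps)
    also have "\<dots> \<le> K * err UNIV"
      by (intro mult_mono sum_err_le) (auto simp: K_def intro!: sum_nonneg err_nonneg)
    finally show "(\<Sum>T\<in>\<T>. (min (diameter T / \<kappa>) 1)\<^sup>2 * (L2_norm T (\<lambda>x. g T x + \<kappa>\<^sup>2 * laplacian (p T) x))\<^sup>2 +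
      1/2 * (\<Sum>E\<in>sides T \<inter> interior_sides \<T>. min (diameter T / \<kappa>) 1 / \<kappa> *
        (LINT x:E|surface_measure E. (\<kappa>\<^sup>2 * (dderiv (p (fst (jump_pair \<T> E))) (unit_normal E) x
          - dderiv (p (snd (jump_pair \<T> E))) (unit_normal E) x))\<^sup>2)))
    \<le> K * (\<kappa>\<^sup>2 * L2_inner \<Omega> G G + L2_inner \<Omega> e e)"
      unfolding err_UNIV elem_res_def[abs_def] jump_res_def .
  qed
qed

section \<open>Piecewise polynomial functions and their traces\<close>

text \<open>Lebesgue measure is complete. On element boundaries \<open>f\<close> and the Laplacian
  of the discrete solution are uncontrolled, so measurability has to be inherited from the smooth
  pieces, with which they agree almost everywhere.\<close>

lemma borel_measurable_lebesgue_on_cong_AE: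
  fixes f g :: "real^'n \<Rightarrow> 'b::topological_space"
  assumes S: "S \<in> sets lebesgue" and ae: "AE x in lebesgue_on S. f x = g x" and g: "g \<in> borel_measurable (lebesgue_on S)"
  shows "f \<in> borel_measurable (lebesgue_on S)"
proof -
  have "AE x in lebesgue. x \<in> S \<longrightarrow> f x = g x" using ae S by (subst (asm) AE_restrict_space_iff) auto
  then obtain N where N: "N \<in> null_sets lebesgue" "\<And>x. x \<in> S \<Longrightarrow> x \<notin> N \<Longrightarrow> f x = g x" by (rule AE_E3) auto
  show ?thesis
  proof (rule measurableI)
    fix A :: "'b set" assume A: "A \<in> sets borel"
    have gA: "g -` A \<inter> S \<in> sets (lebesgue_on S)" using measurable_sets[OF g A] by simp
    then have 1: "g -` A \<inter> S \<in> sets lebesgue" using S by (simp add: sets_restrict_space_iff)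
    have "negligible (f -` A \<inter> S \<inter> N)" using N(1) by (rule negligible_subset[OF iffD2[OF negligible_iff_null_sets]]) auto
    then have 2: "f -` A \<inter> S \<inter> N \<in> sets lebesgue" by (simp add: negligible_imp_sets)
    have "f -` A \<inter> S = ((g -` A \<inter> S) - N) \<union> (f -` A \<inter> S \<inter> N)" using N(2) by force
    then have "f -` A \<inter> S \<in> sets lebesgue" using 1 2 N(1) by (metis null_setsD2 sets.Diff sets.Un)
    then show "f -` A \<inter> space (lebesgue_on S) \<in> sets (lebesgue_on S)" using S by (simp add: sets_restrict_space_iff)
  qed simp
qed

lemma sq_integrable_cong_AE:
  fixes f g :: "real^'n \<Rightarrow> 'b::euclidean_space"
  assumes S: "S \<in> sets lebesgue" and ae: "AE x in lebesgue_on S. f x = g x" and g: "sq_integrable_on S g"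
  shows "sq_integrable_on S f"
proof -
  have [measurable]: "f \<in> borel_measurable (lebesgue_on S)" "g \<in> borel_measurable (lebesgue_on S)"
    using borel_measurable_lebesgue_on_cong_AE[OF S ae] g by (auto simp: sq_integrable_on_def)
  have "integrable (lebesgue_on S) (\<lambda>x. (norm (f x))\<^sup>2) = integrable (lebesgue_on S) (\<lambda>x. (norm (g x))\<^sup>2)"
  proof (rule integrable_cong_AE)
    show "AE x in lebesgue_on S. (norm (f x))\<^sup>2 = (norm (g x))\<^sup>2" using ae by eventually_elim simp
  qed measurable
  then show ?thesis using g by (simp add: sq_integrable_on_def)
qed

lemma L2_norm_cong_AE:
  fixes f g :: "real^'n \<Rightarrow> 'b::euclidean_space"
  assumes S: "S \<in> sets lebesgue" and ae: "AE x in lebesgue_on S. f x = g x" and g: "sq_integrable_on S g"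
  shows "L2_norm S f = L2_norm S g"
proof -
  have f: "sq_integrable_on S f" by (rule sq_integrable_cong_AE[OF assms])
  show ?thesis unfolding L2_norm_def L2_inner_def
  proof (rule arg_cong[of _ _ sqrt], rule integral_cong_AE)
    show "AE x in lebesgue_on S. f x \<bullet> f x = g x \<bullet> g x" using ae by eventually_elim simp
    show "(\<lambda>x. f x \<bullet> f x) \<in> borel_measurable (lebesgue_on S)" "(\<lambda>x. g x \<bullet> g x) \<in> borel_measurable (lebesgue_on S)"
      using f g by (auto simp: sq_integrable_on_def intro!: borel_measurable_inner)
  qed
qed

lemma AE_interior_convex:
  fixes T :: "(real^'n) set"
  assumes "convex T" "compact T"
  shows "AE x in lebesgue_on T. x \<in> interior T"
proof -
  have "frontier T \<in> null_sets lebesgue"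
    using negligible_convex_frontier[OF assms(1)] by (simp add: negligible_iff_null_sets)
  then have "AE x in lebesgue. x \<notin> frontier T" by (rule AE_not_in)
  then have "AE x in lebesgue. x \<in> T \<longrightarrow> x \<in> interior T"
    by eventually_elim (use closure_subset in \<open>auto simp: frontier_def\<close>)
  then show ?thesis using borel_compact[OF assms(2)] by (subst AE_restrict_space_iff) auto
qed

lemma partial_cong_open:
  assumes "open U" "x \<in> U" "\<And>y. y \<in> U \<Longrightarrow> f y = g y" "g differentiable (at x)"
  shows "partial i f x = partial i g x"
proof -
  have "(g has_derivative (\<lambda>v. \<Sum>i\<in>UNIV. partial i g x * v $ i)) (at x)" by (rule has_derivative_partial[OF assms(4)])
  then have "(f has_derivative (\<lambda>v. \<Sum>i\<in>UNIV. partial i g x * v $ i)) (at x)"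
    by (rule has_derivative_transform_within_open[OF _ assms(1,2)]) (simp add: assms(3))
  then have "partial i f x = (\<Sum>j\<in>UNIV. partial j g x * axis i 1 $ j)" by (rule partial_eqI)
  also have "\<dots> = dderiv g (axis i 1) x" by (simp add: dderiv_def)
  finally show ?thesis by (simp add: dderiv_axis)
qed

lemma laplacian_cong_open:
  assumes "open U" "x \<in> U" "\<And>y. y \<in> U \<Longrightarrow> f y = g y" "smooth g"
  shows "laplacian f x = laplacian g x"
proof -
  have 1: "partial i f y = partial i g y" if "y \<in> U" for i y
    by (rule partial_cong_open[OF assms(1) that assms(3) smooth_differentiable[OF assms(4)]])
  have "partial i (partial i f) x = partial i (partial i g) x" for i
    by (rule partial_cong_open[OF assms(1,2) 1 smooth_differentiable[OF smooth_partial[OF assms(4)]]])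
  then show ?thesis by (simp add: laplacian_def)
qed

text \<open>Also at a boundary point the derivative within \<open>T\<close> is determined on the
  vectors y - x with y in \<open>T\<close>, by approaching x along segments. Differences of such
  vectors point in every direction, as \<open>T\<close> contains a ball.\<close>

lemma has_derivative_within_convex_unique:
  fixes v :: "real^'n \<Rightarrow> real"
  assumes T: "convex T" "interior T \<noteq> {}" and x: "x \<in> T"
    and f: "(v has_derivative f') (at x within T)" "(v has_derivative f'') (at x within T)"
  shows "f' = f''"
proof -
  have lin: "linear f'" "linear f''" using f has_derivative_linear by blast+
  have eq: "f' (y - x) = f'' (y - x)" if y: "y \<in> T" for y
  proof -
    let ?\<gamma> = "\<lambda>t. x + t *\<^sub>R (y - x)"
    have \<gamma>T: "?\<gamma> ` {0..1} \<subseteq> T"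
    proof
      fix z assume "z \<in> ?\<gamma> ` {0..1}"
      then obtain t where t: "0 \<le> t" "t \<le> 1" "z = (1 - t) *\<^sub>R x + t *\<^sub>R y" by (auto simp: algebra_simps)
      show "z \<in> T" unfolding t(3) using T(1) x y t(1,2) by (intro convexD) auto
    qed
    have d\<gamma>: "(?\<gamma> has_derivative (\<lambda>t. t *\<^sub>R (y - x))) (at 0 within {0..1})" by (auto intro!: derivative_eq_intros)
    \<comment> \<open>Either candidate yields the one-sided derivative at 0 of the restriction to
      the segment, which is unique.\<close>
    have dv: "((\<lambda>t. v (?\<gamma> t)) has_vector_derivative g (y - x)) (at 0 within {0..1})"
      if g: "(v has_derivative g) (at x within T)" for g
    proof -
      have "(v has_derivative g) (at (?\<gamma> 0) within ?\<gamma> ` {0..1})" using g \<gamma>T by (simp add: has_derivative_subset)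
      from has_derivative_in_compose[OF d\<gamma> this]
      have "((\<lambda>t. v (?\<gamma> t)) has_derivative (\<lambda>t. g (t *\<^sub>R (y - x)))) (at 0 within {0..1})" .
      then show ?thesis unfolding has_vector_derivative_def
        using linear_scale[OF has_derivative_linear[OF g]] by simp
    qed
    show ?thesis
      using vector_derivative_unique_within_closed_interval[of 0 1 0, OF _ _ dv[OF f(1), unfolded box_real(2)[symmetric]] dv[OF f(2), unfolded box_real(2)[symmetric]]] by auto
  qed
  obtain z r where r: "r > 0" "ball z r \<subseteq> T" using T(2) by (metis all_not_in_conv mem_interior)
  show ?thesis
  proof
    fix w :: "real^'n"
    define s where "s = r / (2 * (norm w + 1))"
    have s: "s > 0" using r by (simp add: s_def add_nonneg_pos)
    have "norm (s *\<^sub>R w) < r"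
    proof -
      have "norm (s *\<^sub>R w) = r * (norm w / (2 * (norm w + 1)))" using r by (simp add: s_def)
      also have "\<dots> < r * 1" 
      proof (rule mult_strict_left_mono[OF _ r(1)])
        have "0 < 2 * (norm w + 1)" "norm w < 2 * (norm w + 1)" using norm_ge_zero[of w] by (simp_all add: add_nonneg_pos)
        then show "norm w / (2 * (norm w + 1)) < 1" by (simp only: divide_less_eq_1_pos)
      qed
      finally show ?thesis by simp
    qed
    then have "z + s *\<^sub>R w \<in> T" "z \<in> T" using r by (auto simp: dist_norm subset_eq)
    then have "f' (z + s *\<^sub>R w - x) - f' (z - x) = f'' (z + s *\<^sub>R w - x) - f'' (z - x)" using eq by simp
    then have "f' (s *\<^sub>R w) = f'' (s *\<^sub>R w)"
      by (simp add: linear_diff[OF lin(1), symmetric] linear_diff[OF lin(2), symmetric])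
    then show "f' w = f'' w" using s by (simp add: linear_scale[OF lin(1)] linear_scale[OF lin(2)])
  qed
qed

text \<open>Gives access to the derivative within \<open>T\<close> that enters the jump: the smooth
  piece \<open>q\<close> is differentiable beyond \<open>T\<close>, and uniqueness identifies its
  derivative with the one from the definition.\<close>

lemma normal_deriv_eq:
  fixes v q :: "real^'n \<Rightarrow> real"
  assumes T: "convex T" "interior T \<noteq> {}" and x: "x \<in> T" and q: "smooth q" and vq: "\<And>y. y \<in> T \<Longrightarrow> v y = q y"
  shows "normal_deriv v E T x = dderiv q (unit_normal E) x"
proof -
  have dq: "(q has_derivative (\<lambda>w. dderiv q w x)) (at x within T)"
    unfolding dderiv_def by (rule has_derivative_at_withinI[OF has_derivative_partial[OF smooth_differentiable[OF q]]])
  have d: "(v has_derivative (\<lambda>w. dderiv q w x)) (at x within T)"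
  proof (rule has_derivative_transform[OF x _ dq])
    show "v y = q y" if "y \<in> T" for y by (rule vq[OF that])
  qed
  then have "(v has_derivative frechet_derivative v (at x within T)) (at x within T)"
    using differentiableI frechet_derivative_works by blast
  from has_derivative_within_convex_unique[OF T x this d]
  show ?thesis by (simp add: normal_deriv_def)
qed

lemma V_h_pieces:
  fixes v :: "real^'n \<Rightarrow> real"
  assumes "v \<in> V_h_0 k \<Omega> \<T>" "CARD('n) * k \<le> N"
  obtains p where "\<And>T. T \<in> \<T> \<Longrightarrow> p T \<in> polys_total N" "\<And>T x. T \<in> \<T> \<Longrightarrow> x \<in> T \<Longrightarrow> v x = p T x"
    "continuous_on (closure \<Omega>) v"
proof -
  have v: "continuous_on (closure \<Omega>) v" "\<forall>T\<in>\<T>. \<exists>p\<in>P_k k T. \<forall>x\<in>T. v x = p x"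
    using assms(1) by (auto simp: V_h_0_def V_h_def)
  obtain p where p: "\<forall>T\<in>\<T>. p T \<in> P_k k T \<and> (\<forall>x\<in>T. v x = p T x)" using bchoice[OF v(2)[unfolded Bex_def]] by blast
  have "1 * k \<le> CARD('n) * k" by (rule mult_le_mono1) (simp add: Suc_leI)
  then have "k \<le> N" using assms(2) by linarith
  show ?thesis
  proof (rule that[of p])
    show "p T \<in> polys_total N" if "T \<in> \<T>" for T using P_k_subset[OF \<open>k \<le> N\<close> assms(2)] p that by blast
  qed (use p v in auto)
qed

lemma piecewise_polys_pieces:
  fixes f :: "real^'n \<Rightarrow> real"
  assumes "f \<in> piecewise_polys m \<T>" "m \<le> N"
  obtains F where "\<And>T. T \<in> \<T> \<Longrightarrow> F T \<in> polys_total N" "\<And>T x. T \<in> \<T> \<Longrightarrow> x \<in> interior T \<Longrightarrow> f x = F T x"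
proof -
  have f: "\<forall>T\<in>\<T>. \<exists>p. p \<in> polys_total m \<and> (\<forall>x\<in>interior T. f x = p x)"
    using assms(1) by (auto simp: piecewise_polys_def Bex_def)
  obtain F where F: "\<forall>T\<in>\<T>. F T \<in> polys_total m \<and> (\<forall>x\<in>interior T. f x = F T x)" using bchoice[OF f] by blast
  show ?thesis by (rule that[of F]) (use F polys_total_mono[OF _ assms(2)] in auto)
qed

lemma pw_AE_eq:
  fixes w :: "real^'n \<Rightarrow> real"
  assumes m: "convex_mesh \<Omega> \<T>" and \<Omega>: "open \<Omega>" and w: "\<And>T x. T \<in> \<T> \<Longrightarrow> x \<in> interior T \<Longrightarrow> w x = q T x"
  shows "AE x in lebesgue_on \<Omega>. w x = pw \<T> q x"
proof -
  have "AE x in lebesgue. x \<in> \<Omega> \<longrightarrow> (\<exists>T\<in>\<T>. x \<in> interior T)" by (rule AE_completion[OF AE_interior[OF m]])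
  then have "AE x in lebesgue. x \<in> \<Omega> \<longrightarrow> w x = pw \<T> q x"
    by eventually_elim (use w pw_eq[OF m] in auto)
  then show ?thesis using \<Omega> by (subst AE_restrict_space_iff) auto
qed

lemma continuous_pieces_H1:
  fixes w :: "real^'n \<Rightarrow> real"
  assumes m: "convex_mesh \<Omega> \<T>" and \<Omega>: "open \<Omega>" "bounded \<Omega>"
    and p: "\<And>T. T \<in> \<T> \<Longrightarrow> smooth (p T)"
    and w: "\<And>T x. T \<in> \<T> \<Longrightarrow> x \<in> T \<Longrightarrow> w x = p T x" and wc: "continuous_on (closure \<Omega>) w"
  shows "sq_integrable_on \<Omega> w" "w \<in> H1 \<Omega>"
proof -
  have S: "\<Omega> \<in> sets lebesgue" using \<Omega>(1) by simp
  have "AE x in lebesgue_on \<Omega>. w x = pw \<T> p x" by (rule pw_AE_eq[OF m \<Omega>(1)]) (use w interior_subset in blast)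
  then show s: "sq_integrable_on \<Omega> w" by (rule sq_integrable_cong_AE[OF S _ pw_sq_integrable[OF m p \<Omega>]])
  have "sq_integrable_on \<Omega> (\<lambda>x. \<chi> i. pw \<T> (\<lambda>T. partial i (p T)) x)"
    by (rule pw_vector_sq_integrable[OF m smooth_partial[OF p] \<Omega>])
  then show "w \<in> H1 \<Omega>" unfolding H1_def 
    using s pw_poly_weak_gradient[where p = p and w = w, OF m \<Omega> p w wc] by blast
qed

lemma has_weak_gradient_diff:
  fixes u v :: "real^'n \<Rightarrow> real"
  assumes \<Omega>: "open \<Omega>" "bounded \<Omega>" and s: "sq_integrable_on \<Omega> u" "sq_integrable_on \<Omega> v" "sq_integrable_on \<Omega> G" "sq_integrable_on \<Omega> H"
    and g: "has_weak_gradient \<Omega> u G" "has_weak_gradient \<Omega> v H"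
  shows "has_weak_gradient \<Omega> (\<lambda>x. u x - v x) (\<lambda>x. G x - H x)"
  unfolding has_weak_gradient_def
proof (intro ballI allI)
  fix \<phi> i assume \<phi>: "\<phi> \<in> test_functions \<Omega>"
  have s\<phi>: "sq_integrable_on \<Omega> \<phi>" by (rule test_function_sq_integrable[OF \<phi> \<Omega>])
  have sg: "sq_integrable_on \<Omega> (partial i \<phi>)"
    using sq_integrable_component[OF test_function_grad_sq_integrable[OF \<phi> \<Omega>], of i] by (simp add: grad_def)
  have "L2_inner \<Omega> (\<lambda>x. u x - v x) (partial i \<phi>) = - (L2_inner \<Omega> (\<lambda>x. G x $ i) \<phi> - L2_inner \<Omega> (\<lambda>x. H x $ i) \<phi>)"
    using g \<phi> by (simp add: L2_inner_diff[OF s(1,2) sg] has_weak_gradient_def)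
  also have "\<dots> = - L2_inner \<Omega> (\<lambda>x. (G x - H x) $ i) \<phi>"
    using L2_inner_diff[OF sq_integrable_component[OF s(3)] sq_integrable_component[OF s(4)] s\<phi>, of i i] by simp
  finally show "L2_inner \<Omega> (\<lambda>x. u x - v x) (partial i \<phi>) = - L2_inner \<Omega> (\<lambda>x. (G x - H x) $ i) \<phi>" .
qed

text \<open>The locale speaks of classical gradients of test functions and of the gradients of the
  pieces, the problem of \<open>weak_grad\<close>. Uniqueness is invoked twice: for the test
  function, and to replace the weak gradient of the error by a difference of gradients.\<close>

lemma residualI:
  fixes w wh :: "real^'n \<Rightarrow> real"
  assumes m: "convex_mesh \<Omega> \<T>" and \<Omega>: "open \<Omega>" "bounded \<Omega>" "interior (closure \<Omega>) \<subseteq> \<Omega>"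
    and p: "\<And>T. T \<in> \<T> \<Longrightarrow> smooth (p T)" and g: "\<And>T. T \<in> \<T> \<Longrightarrow> smooth (g T)"
    and wh: "\<And>T x. T \<in> \<T> \<Longrightarrow> x \<in> T \<Longrightarrow> wh x = p T x" "continuous_on (closure \<Omega>) wh"
    and w: "w \<in> H1 \<Omega>" and \<kappa>: "\<kappa> > 0" and e: "sq_integrable_on \<Omega> e"
    and eq: "\<And>\<phi>. \<phi> \<in> test_functions \<Omega> \<Longrightarrow>
      \<kappa>\<^sup>2 * L2_inner \<Omega> (weak_grad \<Omega> w) (weak_grad \<Omega> \<phi>) + L2_inner \<Omega> e \<phi> = L2_inner \<Omega> (pw \<T> g) \<phi>"
  shows "residual \<Omega> \<T> p g \<kappa> (weak_grad \<Omega> (\<lambda>x. w x - wh x)) e"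
proof -
  let ?H = "\<lambda>x. \<chi> i. pw \<T> (\<lambda>T. partial i (p T)) x"
  have S: "\<Omega> \<in> sets lebesgue" using \<Omega>(1) by simp
  have swh: "sq_integrable_on \<Omega> wh" by (rule continuous_pieces_H1(1)[OF m \<Omega>(1,2) p wh])
  have sw: "sq_integrable_on \<Omega> w" using w by (simp add: H1_def)
  have sH: "sq_integrable_on \<Omega> ?H" by (rule pw_vector_sq_integrable[OF m smooth_partial[OF p] \<Omega>(1,2)])
  have sW: "sq_integrable_on \<Omega> (weak_grad \<Omega> w)" by (rule weak_grad(1)[OF w])
  have hd: "has_weak_gradient \<Omega> (\<lambda>x. w x - wh x) (\<lambda>x. weak_grad \<Omega> w x - ?H x)"
    by (rule has_weak_gradient_diff[OF \<Omega>(1,2) sw swh sW sH weak_grad(2)[OF w] pw_poly_weak_gradient[where p = p and w = wh, OF m \<Omega>(1,2) p wh]])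
  have sd: "sq_integrable_on \<Omega> (\<lambda>x. weak_grad \<Omega> w x - ?H x)" by (rule sq_integrable_diff[OF sW sH])
  have H1d: "(\<lambda>x. w x - wh x) \<in> H1 \<Omega>" unfolding H1_def using sq_integrable_diff[OF sw swh] hd sd by blast
  note wd = weak_grad[OF H1d]
  have ae: "AE x in lebesgue_on \<Omega>. weak_grad \<Omega> (\<lambda>x. w x - wh x) x = weak_grad \<Omega> w x - ?H x"
    by (rule weak_gradient_unique[OF \<Omega>(1,2) wd(1) sd wd(2) hd])
  show ?thesis
  proof
    fix \<phi> assume \<phi>: "\<phi> \<in> test_functions \<Omega>"
    have sg: "sq_integrable_on \<Omega> (grad \<phi>)" by (rule test_function_grad_sq_integrable[OF \<phi> \<Omega>(1,2)])
    note h = H1_test_function[OF \<phi> \<Omega>(1,2)]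
    have "L2_inner \<Omega> (weak_grad \<Omega> w) (weak_grad \<Omega> \<phi>) = L2_inner \<Omega> (weak_grad \<Omega> w) (grad \<phi>)"
      using L2_inner_cong_AE[OF h(2) weak_grad(1)[OF h(1)] sg sW] by (simp add: L2_inner_commute)
    moreover have "L2_inner \<Omega> (weak_grad \<Omega> (\<lambda>x. w x - wh x)) (grad \<phi>) = L2_inner \<Omega> (weak_grad \<Omega> w) (grad \<phi>) - L2_inner \<Omega> ?H (grad \<phi>)"
      using L2_inner_cong_AE[OF ae wd(1) sd sg] L2_inner_diff[OF sW sH sg] by simp
    ultimately show "\<kappa>\<^sup>2 * L2_inner \<Omega> (weak_grad \<Omega> (\<lambda>x. w x - wh x)) (grad \<phi>) + L2_inner \<Omega> e \<phi> =
      L2_inner \<Omega> (pw \<T> g) \<phi> - \<kappa>\<^sup>2 * L2_inner \<Omega> ?H (grad \<phi>)"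
      using eq[OF \<phi>] by (simp add: right_diff_distrib)
  qed (use m \<Omega> p g \<kappa> wd(1) e in auto)
qed

lemma side_norm_jump:
  fixes \<T> :: "(real^'n) set set" and v :: "real^'n \<Rightarrow> real"
  assumes m: "shape_regular_mesh C0 \<Omega> \<T>" and C0: "C0 > 0" and E: "E \<in> interior_sides \<T>"
    and p: "\<And>T. T \<in> \<T> \<Longrightarrow> smooth (p T)" and v: "\<And>T x. T \<in> \<T> \<Longrightarrow> x \<in> T \<Longrightarrow> v x = p T x"
  shows "(side_norm E (jump \<T> E (\<lambda>S x. a * normal_deriv v E S x)))\<^sup>2 = (LINT x:E|surface_measure E.
    (a * (dderiv (p (fst (jump_pair \<T> E))) (unit_normal E) x - dderiv (p (snd (jump_pair \<T> E))) (unit_normal E) x))\<^sup>2)"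
proof -
  note jp = jump_pairD[OF m C0 E]
  note cm = shape_regular_convex_mesh[OF m]
  have nd: "normal_deriv v E T x = dderiv (p T) (unit_normal E) x" if "T \<in> \<T>" "E \<in> sides T" "x \<in> E" for T x
    using that sides_subset
    by (intro normal_deriv_eq convex_meshD(2)[OF cm] element_ball(5)[OF m C0] p v) auto
  have "(side_norm E (jump \<T> E (\<lambda>S x. a * normal_deriv v E S x)))\<^sup>2
      = (LINT x:E|surface_measure E. (jump \<T> E (\<lambda>S x. a * normal_deriv v E S x) x)\<^sup>2)"
    unfolding side_norm_def set_lebesgue_integral_def
    by (rule real_sqrt_pow2) (intro integral_nonneg_AE always_eventually allI, simp)
  also have "\<dots> = (LINT x:E|surface_measure E.
    (a * (dderiv (p (fst (jump_pair \<T> E))) (unit_normal E) x - dderiv (p (snd (jump_pair \<T> E))) (unit_normal E) x))\<^sup>2)"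
    unfolding set_lebesgue_integral_def
    by (intro Bochner_Integration.integral_cong refl)
      (auto simp: indicator_def jump_eq nd[OF jp(1,5)] nd[OF jp(2,6)] right_diff_distrib)
  finally show ?thesis .
qed

text \<open>On the boundary of \<open>T\<close> the function \<open>v\<close> sees the neighbouring
  elements, so its Laplacian is known only inside. The boundary is a null set and the norm does not
  notice.\<close>

lemma element_norm_eq:
  fixes \<T> :: "(real^'n) set set" and v f p g :: "real^'n \<Rightarrow> real"
  assumes m: "convex_mesh \<Omega> \<T>" and T: "T \<in> \<T>" and p: "smooth p" and g: "smooth g"
    and v: "\<And>x. x \<in> T \<Longrightarrow> v x = p x" and f: "\<And>x. x \<in> interior T \<Longrightarrow> f x = g x + a * laplacian v x"
  shows "L2_norm T f = L2_norm T (\<lambda>x. g x + a * laplacian p x)"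
proof (rule L2_norm_cong_AE)
  have Tc: "compact T" by (rule convex_meshD(3)[OF m T])
  note Tb = borel_compact[OF Tc] compact_imp_bounded[OF Tc]
  show "T \<in> sets lebesgue" using Tb(1) by simp
  have sm: "smooth (\<lambda>x. g x + a * laplacian p x)" by (intro smooth_add smooth_mult smooth_const smooth_laplacian p g)
  obtain B where B: "\<forall>x\<in>T. \<bar>g x + a * laplacian p x\<bar> \<le> B" using bounded_on_compact[OF sm Tc] by blast
  show "sq_integrable_on T (\<lambda>x. g x + a * laplacian p x)"
    by (rule sq_integrable_bounded[OF Tb smooth_borel_measurable[OF sm] refl, of B]) (use B in simp)
  show "AE x in lebesgue_on T. f x = g x + a * laplacian p x"
    using AE_interior_convex[OF convex_meshD(2)[OF m T] Tc]
  proof eventually_elim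
    case (elim x)
    have "laplacian v x = laplacian p x"
      by (rule laplacian_cong_open[OF open_interior elim _ p]) (use v interior_subset in blast)
    then show ?case using f[OF elim] by simp
  qed
qed

section \<open>The indicators\<close>

lemma smooth_diff: "smooth f \<Longrightarrow> smooth g \<Longrightarrow> smooth (\<lambda>x. f x - g x)"
  using smooth_add[OF _ smooth_mult[OF smooth_const, of g "-1"]] by simp

lemma scaled_sqrt_le:
  fixes A K V :: real
  assumes "K > 0" "A \<le> K * V\<^sup>2" "0 \<le> V"
  shows "1 / sqrt K * sqrt A \<le> V"
proof -
  have "sqrt A \<le> sqrt (K * V\<^sup>2)" using assms(2) by (rule real_sqrt_le_mono)
  also have "\<dots> = sqrt K * V" using assms by (simp add: real_sqrt_mult)
  finally show ?thesis using assms(1) by (simp add: pos_divide_le_eq mult.commute)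
qed

lemma eta_psi_power2:
  fixes \<T> :: "(real^'n) set set" and f \<psi>h :: "real^'n \<Rightarrow> real"
  assumes m: "shape_regular_mesh C0 \<Omega> \<T>" and C0: "C0 > 0" and T: "T \<in> \<T>" and \<epsilon>: "\<epsilon> > 0"
    and p: "\<And>T. T \<in> \<T> \<Longrightarrow> smooth (p T)" and v: "\<And>T x. T \<in> \<T> \<Longrightarrow> x \<in> T \<Longrightarrow> \<psi>h x = p T x"
    and F: "\<And>T. T \<in> \<T> \<Longrightarrow> smooth (F T)" and f: "\<And>T x. T \<in> \<T> \<Longrightarrow> x \<in> interior T \<Longrightarrow> f x = F T x"
  shows "(eta_psi \<epsilon> \<T> f \<psi>h T)\<^sup>2 =
    (min (diameter T / \<epsilon>) 1)\<^sup>2 * (L2_norm T (\<lambda>x. (F T x - p T x) + \<epsilon>\<^sup>2 * laplacian (p T) x))\<^sup>2 +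
      1/2 * (\<Sum>E\<in>sides T \<inter> interior_sides \<T>. min (diameter T / \<epsilon>) 1 / \<epsilon> *
        (LINT x:E|surface_measure E. (\<epsilon>\<^sup>2 * (dderiv (p (fst (jump_pair \<T> E))) (unit_normal E) x
          - dderiv (p (snd (jump_pair \<T> E))) (unit_normal E) x))\<^sup>2))"
proof -
  note cm = shape_regular_convex_mesh[OF m]
  have "0 \<le> min (diameter T / \<epsilon>) 1" using element_ball(2)[OF m C0 T] \<epsilon> by simp
  \<comment> \<open>The squared side weight is the factor \<alpha> / \<kappa> of
    \<open>side_estimate\<close> for \<kappa> = \<epsilon>.\<close>
  then have a: "(alpha_E \<epsilon> T)\<^sup>2 = min (diameter T / \<epsilon>) 1 / \<epsilon>"
    using \<epsilon> by (simp add: alpha_E_def power_mult_distrib powr_minus powr_half_sqrt power_divide divide_simps)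
  have n: "L2_norm T (\<lambda>x. f x + \<epsilon>\<^sup>2 * laplacian \<psi>h x - \<psi>h x) = L2_norm T (\<lambda>x. (F T x - p T x) + \<epsilon>\<^sup>2 * laplacian (p T) x)"
    by (rule element_norm_eq[where g = "\<lambda>x. F T x - p T x" and v = \<psi>h and p = "p T", OF cm T p[OF T] smooth_diff[OF F[OF T] p[OF T]] v[OF T]])
      (use f[OF T] v[OF T] interior_subset[of T] in \<open>auto simp: subset_eq\<close>)
  show ?thesis unfolding eta_psi_def
  proof (subst real_sqrt_pow2)
    show "0 \<le> (alpha_T \<epsilon> T)\<^sup>2 * (L2_norm T (\<lambda>x. f x + \<epsilon>\<^sup>2 * laplacian \<psi>h x - \<psi>h x))\<^sup>2 +
     1/2 * (\<Sum>E\<in>sides T \<inter> interior_sides \<T>.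
       (alpha_E \<epsilon> T)\<^sup>2 * (side_norm E (jump \<T> E (\<lambda>S x. \<epsilon>\<^sup>2 * normal_deriv \<psi>h E S x)))\<^sup>2)"
      by (intro add_nonneg_nonneg mult_nonneg_nonneg sum_nonneg) auto
  qed (auto simp: alpha_T_def n a side_norm_jump[OF m C0 _ p v] intro!: sum.cong)
qed

text \<open>For \<kappa> = 1 the general estimate carries the weights min(h, 1)^2 and min(h, 1),
  while \<open>eta_u\<close> carries h^2 and diam E. From h \<le> M and 1 \<le> M follows h \<le> M
  min(h, 1), and the common factor M^2 covers both terms.\<close>

lemma eta_u_power2_le:
  fixes \<T> :: "(real^'n) set set" and uh \<psi>h :: "real^'n \<Rightarrow> real"
  assumes m: "shape_regular_mesh C0 \<Omega> \<T>" and C0: "C0 > 0" and T: "T \<in> \<T>"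
    and q: "\<And>T. T \<in> \<T> \<Longrightarrow> smooth (q T)" and v: "\<And>T x. T \<in> \<T> \<Longrightarrow> x \<in> T \<Longrightarrow> uh x = q T x"
    and p: "\<And>T. T \<in> \<T> \<Longrightarrow> smooth (p T)" and \<psi>: "\<And>T x. T \<in> \<T> \<Longrightarrow> x \<in> T \<Longrightarrow> \<psi>h x = p T x"
    and M: "diameter T \<le> M" "1 \<le> M"
  shows "(eta_u \<T> \<psi>h uh T)\<^sup>2 \<le> M\<^sup>2 *
    ((min (diameter T / 1) 1)\<^sup>2 * (L2_norm T (\<lambda>x. p T x + 1\<^sup>2 * laplacian (q T) x))\<^sup>2 +
      1/2 * (\<Sum>E\<in>sides T \<inter> interior_sides \<T>. min (diameter T / 1) 1 / 1 *
        (LINT x:E|surface_measure E. (1\<^sup>2 * (dderiv (q (fst (jump_pair \<T> E))) (unit_normal E) x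
          - dderiv (q (snd (jump_pair \<T> E))) (unit_normal E) x))\<^sup>2)))"
proof -
  note cm = shape_regular_convex_mesh[OF m]
  define h where "h = diameter T"
  have h: "h > 0" using element_ball(2)[OF m C0 T] by (simp add: h_def)
  have hM: "h \<le> M * min h 1"
  proof (cases "h \<le> 1")
    case True
    then have "1 * h \<le> M * h" using M(2) h by (intro mult_right_mono) auto
    then show ?thesis using True by (simp add: min_def)
  qed (use M in \<open>simp add: h_def min_def\<close>)
  have n: "L2_norm T (\<lambda>x. laplacian uh x + \<psi>h x) = L2_norm T (\<lambda>x. p T x + 1 * laplacian (q T) x)"
    by (rule element_norm_eq[where g = "p T" and v = uh and p = "q T", OF cm T q[OF T] p[OF T] v[OF T]])
      (use \<psi>[OF T] interior_subset[of T] in \<open>auto simp: subset_eq\<close>)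
  let ?J = "\<lambda>E. (LINT x:E|surface_measure E. (1 * (dderiv (q (fst (jump_pair \<T> E))) (unit_normal E) x
          - dderiv (q (snd (jump_pair \<T> E))) (unit_normal E) x))\<^sup>2)"
  have J: "(side_norm E (jump \<T> E (normal_deriv uh E)))\<^sup>2 = ?J E" if "E \<in> interior_sides \<T>" for E
    using side_norm_jump[OF m C0 that q v, where a = 1] by simp
  have bT: "bounded T" by (rule compact_imp_bounded[OF convex_meshD(3)[OF cm T]])
  have bE: "bounded E" if "E \<in> sides T" for E by (rule bounded_subset[OF bT sides_subset[OF that]])
  have "(eta_u \<T> \<psi>h uh T)\<^sup>2 = h\<^sup>2 * (L2_norm T (\<lambda>x. laplacian uh x + \<psi>h x))\<^sup>2 +
     1/2 * (\<Sum>E\<in>sides T \<inter> interior_sides \<T>. diameter E * (side_norm E (jump \<T> E (normal_deriv uh E)))\<^sup>2)"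
    unfolding eta_u_def h_def
    by (rule real_sqrt_pow2) (intro add_nonneg_nonneg mult_nonneg_nonneg sum_nonneg; simp add: diameter_ge_0 bE)
  also have "\<dots> \<le> (M * min h 1)\<^sup>2 * (L2_norm T (\<lambda>x. laplacian uh x + \<psi>h x))\<^sup>2 +
     1/2 * (\<Sum>E\<in>sides T \<inter> interior_sides \<T>. M\<^sup>2 * min h 1 * (side_norm E (jump \<T> E (normal_deriv uh E)))\<^sup>2)"
  proof (intro add_mono mult_right_mono mult_left_mono sum_mono power_mono hM)
    fix E assume E: "E \<in> sides T \<inter> interior_sides \<T>"
    have "diameter E \<le> h" unfolding h_def
      using E sides_subset by (intro diameter_subset bT) auto
    also have "\<dots> \<le> M * min h 1" by (rule hM)
    also have "\<dots> \<le> M\<^sup>2 * min h 1"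
      using M(2) h self_le_power[of M 2] by (intro mult_right_mono) auto
    finally show "diameter E \<le> M\<^sup>2 * min h 1" .
  qed (use h in auto)
  also have "\<dots> = (M * min h 1)\<^sup>2 * (L2_norm T (\<lambda>x. p T x + 1 * laplacian (q T) x))\<^sup>2 +
     1/2 * (\<Sum>E\<in>sides T \<inter> interior_sides \<T>. M\<^sup>2 * min h 1 * ?J E)"
    using J n by (auto intro!: sum.cong)
  also have "\<dots> = M\<^sup>2 * ((min h 1)\<^sup>2 * (L2_norm T (\<lambda>x. p T x + 1 * laplacian (q T) x))\<^sup>2 +
     1/2 * (\<Sum>E\<in>sides T \<inter> interior_sides \<T>. min h 1 * ?J E))"
    by (simp only: distrib_left sum_distrib_left power_mult_distrib mult_ac)
  finally show ?thesis by (simp add: h_def)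
qed

theorem theorem5p3:
  fixes \<Omega> :: "(real^'n) set" and k m :: nat and C0 :: real
  assumes "CARD('n) = 2 \<or> CARD('n) = 3"
    and "polyhedral_domain \<Omega>" and "lipschitz_boundary \<Omega>"
    and "k \<ge> 1" and "C0 > 0"
  shows "\<exists>C7>0. \<exists>C8>0. \<forall>\<epsilon> \<T> f \<psi> u \<psi>h uh.
      0 < \<epsilon> \<longrightarrow> \<epsilon> < 1 \<longrightarrow>
      shape_regular_mesh C0 \<Omega> \<T> \<longrightarrow>
      f \<in> piecewise_polys m \<T> \<longrightarrow>
      solves \<epsilon> \<Omega> f (H1_0 \<Omega>) \<psi> u \<longrightarrow>
      solves \<epsilon> \<Omega> f (V_h_0 k \<Omega> \<T>) \<psi>h uh \<longrightarrow>
        C7 * sqrt (\<Sum>T\<in>\<T>. (eta_psi \<epsilon> \<T> f \<psi>h T)\<^sup>2)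
          \<le> energy_norm \<epsilon> \<Omega> (\<lambda>x. \<psi> x - \<psi>h x) \<and>
        C8 * sqrt (\<Sum>T\<in>\<T>. ((eta_psi \<epsilon> \<T> f \<psi>h T)\<^sup>2 + (eta_u \<T> \<psi>h uh T)\<^sup>2))
          \<le> pair_norm \<epsilon> \<Omega> (\<lambda>x. \<psi> x - \<psi>h x) (\<lambda>x. u x - uh x)"
proof -
  have d: "CARD('n) \<ge> 2" using assms(1) by auto
  have \<Omega>: "open \<Omega>" "bounded \<Omega>" using assms(2) by (auto simp: polyhedral_domain_def)
  have \<Omega>i: "interior (closure \<Omega>) \<subseteq> \<Omega>" by (rule interior_closure_lipschitz[OF \<Omega>(1) assms(3)])
  \<comment> \<open>One degree for the data, both discrete functions and all residuals; d k accounts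
    for polynomials of degree k in each variable.\<close>
  define N where "N = m + CARD('n) * k"
  \<comment> \<open>Bounds every element diameter and is at least 1, as
    \<open>eta_u_power2_le\<close> requires.\<close>
  define M where "M = max 1 (diameter (closure \<Omega>))"
  obtain K where K: "K > 0" and est: "\<And>(\<Omega> :: (real^'n) set) \<T> p g \<kappa> G e. residual \<Omega> \<T> p g \<kappa> G e \<Longrightarrow> shape_regular_mesh C0 \<Omega> \<T> \<Longrightarrow>
    (\<forall>T\<in>\<T>. p T \<in> polys_total N \<and> g T \<in> polys_total N) \<Longrightarrow>
    (\<Sum>T\<in>\<T>. (min (diameter T / \<kappa>) 1)\<^sup>2 * (L2_norm T (\<lambda>x. g T x + \<kappa>\<^sup>2 * laplacian (p T) x))\<^sup>2 +
      1/2 * (\<Sum>E\<in>sides T \<inter> interior_sides \<T>. min (diameter T / \<kappa>) 1 / \<kappa> *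
        (LINT x:E|surface_measure E. (\<kappa>\<^sup>2 * (dderiv (p (fst (jump_pair \<T> E))) (unit_normal E) x
          - dderiv (p (snd (jump_pair \<T> E))) (unit_normal E) x))\<^sup>2)))
    \<le> K * (\<kappa>\<^sup>2 * L2_inner \<Omega> G G + L2_inner \<Omega> e e)"
    using residual_efficiency[OF assms(5) d, of N] by (elim exE conjE) (rule that, assumption, blast)
  have K': "K * (1 + M\<^sup>2) > 0" using K by (intro mult_pos_pos) (auto intro: add_pos_nonneg)
  show ?thesis
  proof (rule exI[of _ "1 / sqrt K"], rule conjI, simp add: K, rule exI[of _ "1 / sqrt (K * (1 + M\<^sup>2))"], intro conjI allI impI)
    show "0 < 1 / sqrt (K * (1 + M\<^sup>2))" using K' by simp
    fix \<epsilon> \<T> and f \<psi> u \<psi>h uh :: "real^'n \<Rightarrow> real"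
    assume \<epsilon>: "0 < \<epsilon>" "\<epsilon> < 1" and mesh: "shape_regular_mesh C0 \<Omega> \<T>" and f: "f \<in> piecewise_polys m \<T>"
      and cont: "solves \<epsilon> \<Omega> f (H1_0 \<Omega>) \<psi> u" and disc: "solves \<epsilon> \<Omega> f (V_h_0 k \<Omega> \<T>) \<psi>h uh"
    note cm = shape_regular_convex_mesh[OF mesh]
    have V: "\<psi>h \<in> V_h_0 k \<Omega> \<T>" "uh \<in> V_h_0 k \<Omega> \<T>" using disc by (auto simp: solves_def)
    have N: "m \<le> N" "CARD('n) * k \<le> N" by (auto simp: N_def)
    obtain p where p: "\<And>T. T \<in> \<T> \<Longrightarrow> p T \<in> polys_total N" "\<And>T x. T \<in> \<T> \<Longrightarrow> x \<in> T \<Longrightarrow> \<psi>h x = p T x"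
      "continuous_on (closure \<Omega>) \<psi>h" by (rule V_h_pieces[OF V(1) N(2)]) blast
    obtain q where q: "\<And>T. T \<in> \<T> \<Longrightarrow> q T \<in> polys_total N" "\<And>T x. T \<in> \<T> \<Longrightarrow> x \<in> T \<Longrightarrow> uh x = q T x"
      "continuous_on (closure \<Omega>) uh" by (rule V_h_pieces[OF V(2) N(2)]) blast
    obtain F where F: "\<And>T. T \<in> \<T> \<Longrightarrow> F T \<in> polys_total N" "\<And>T x. T \<in> \<T> \<Longrightarrow> x \<in> interior T \<Longrightarrow> f x = F T x"
      by (rule piecewise_polys_pieces[OF f N(1)]) blast
    have sp: "smooth (p T)" "smooth (q T)" "smooth (F T)" if "T \<in> \<T>" for T
      using polys_total_smooth p(1) q(1) F(1) that by blast+
    define g where "g T x = F T x - p T x" for T x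
    have gN: "g T \<in> polys_total N" if "T \<in> \<T>" for T
      unfolding g_def[abs_def] by (intro polys_total_diff F(1) p(1) that)
    then have sg: "smooth (g T)" if "T \<in> \<T>" for T using polys_total_smooth that by blast
    have hom: "\<psi> \<in> H1 \<Omega>" "u \<in> H1 \<Omega>" using cont by (auto simp: solves_def H1_0_def)
    then have s: "sq_integrable_on \<Omega> \<psi>" by (simp add: H1_def)
    have sh: "sq_integrable_on \<Omega> \<psi>h" by (rule continuous_pieces_H1(1)[OF cm \<Omega> sp(1) p(2,3)])
    have S: "\<Omega> \<in> sets lebesgue" using \<Omega>(1) by simp
    have aef: "AE x in lebesgue_on \<Omega>. f x = pw \<T> F x" by (rule pw_AE_eq[OF cm \<Omega>(1) F(2)])
    have spF: "sq_integrable_on \<Omega> (pw \<T> F)" by (rule pw_sq_integrable[OF cm sp(3) \<Omega>])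
    have sf: "sq_integrable_on \<Omega> f" by (rule sq_integrable_cong_AE[OF S aef spF])
    have aeh: "AE x in lebesgue_on \<Omega>. \<psi>h x = pw \<T> p x"
      by (rule pw_AE_eq[OF cm \<Omega>(1)]) (use p(2) interior_subset in blast)
    have sph: "sq_integrable_on \<Omega> (pw \<T> p)" by (rule pw_sq_integrable[OF cm sp(1) \<Omega>])
    have aeg: "AE x in lebesgue_on \<Omega>. f x - \<psi>h x = pw \<T> g x"
      by (rule pw_AE_eq[OF cm \<Omega>(1)]) (use p(2) F(2) interior_subset in \<open>fastforce simp: g_def\<close>)
    have spg: "sq_integrable_on \<Omega> (pw \<T> g)" by (rule pw_sq_integrable[OF cm sg \<Omega>])
    have R1: "residual \<Omega> \<T> p g \<epsilon> (weak_grad \<Omega> (\<lambda>x. \<psi> x - \<psi>h x)) (\<lambda>x. \<psi> x - \<psi>h x)"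
    proof (rule residualI[OF cm \<Omega> \<Omega>i sp(1) sg p(2,3) hom(1) \<epsilon>(1) sq_integrable_diff[OF s sh]])
      fix \<phi> assume \<phi>: "\<phi> \<in> test_functions \<Omega>"
      have s\<phi>: "sq_integrable_on \<Omega> \<phi>" by (rule test_function_sq_integrable[OF \<phi> \<Omega>])
      have "\<epsilon>\<^sup>2 * L2_inner \<Omega> (weak_grad \<Omega> \<psi>) (weak_grad \<Omega> \<phi>) + L2_inner \<Omega> \<psi> \<phi> = L2_inner \<Omega> f \<phi>"
        using cont test_function_H1_0[OF \<phi> \<Omega>] by (simp add: solves_def)
      moreover have "L2_inner \<Omega> (pw \<T> g) \<phi> = L2_inner \<Omega> f \<phi> - L2_inner \<Omega> \<psi>h \<phi>"
        using L2_inner_cong_AE[OF aeg sq_integrable_diff[OF sf sh] spg s\<phi>] L2_inner_diff[OF sf sh s\<phi>] by simp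
      ultimately show "\<epsilon>\<^sup>2 * L2_inner \<Omega> (weak_grad \<Omega> \<psi>) (weak_grad \<Omega> \<phi>) + L2_inner \<Omega> (\<lambda>x. \<psi> x - \<psi>h x) \<phi> = L2_inner \<Omega> (pw \<T> g) \<phi>"
        using L2_inner_diff[OF s sh s\<phi>] by simp
    qed
    have R2: "residual \<Omega> \<T> q p 1 (weak_grad \<Omega> (\<lambda>x. u x - uh x)) (\<lambda>x. \<psi>h x - \<psi> x)"
    proof (rule residualI[OF cm \<Omega> \<Omega>i sp(2) sp(1) q(2,3) hom(2) zero_less_one sq_integrable_diff[OF sh s]])
      fix \<phi> assume \<phi>: "\<phi> \<in> test_functions \<Omega>"
      have s\<phi>: "sq_integrable_on \<Omega> \<phi>" by (rule test_function_sq_integrable[OF \<phi> \<Omega>])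
      have "L2_inner \<Omega> (weak_grad \<Omega> u) (weak_grad \<Omega> \<phi>) = L2_inner \<Omega> \<psi> \<phi>"
        using cont test_function_H1_0[OF \<phi> \<Omega>] by (simp add: solves_def)
      moreover have "L2_inner \<Omega> (pw \<T> p) \<phi> = L2_inner \<Omega> \<psi>h \<phi>"
        using L2_inner_cong_AE[OF aeh sh sph s\<phi>] by simp
      ultimately show "1\<^sup>2 * L2_inner \<Omega> (weak_grad \<Omega> u) (weak_grad \<Omega> \<phi>) + L2_inner \<Omega> (\<lambda>x. \<psi>h x - \<psi> x) \<phi> = L2_inner \<Omega> (pw \<T> p) \<phi>"
        using L2_inner_diff[OF sh s s\<phi>] by simp
    qed
    define en where "en = energy_norm \<epsilon> \<Omega> (\<lambda>x. \<psi> x - \<psi>h x)"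
    define pn where "pn = pair_norm \<epsilon> \<Omega> (\<lambda>x. \<psi> x - \<psi>h x) (\<lambda>x. u x - uh x)"
    define Gu where "Gu = L2_inner \<Omega> (weak_grad \<Omega> (\<lambda>x. u x - uh x)) (weak_grad \<Omega> (\<lambda>x. u x - uh x))"
    define e2 where "e2 = L2_inner \<Omega> (\<lambda>x. \<psi> x - \<psi>h x) (\<lambda>x. \<psi> x - \<psi>h x)"
    have en2: "en\<^sup>2 = \<epsilon>\<^sup>2 * L2_inner \<Omega> (weak_grad \<Omega> (\<lambda>x. \<psi> x - \<psi>h x)) (weak_grad \<Omega> (\<lambda>x. \<psi> x - \<psi>h x)) + e2"
      by (simp add: en_def energy_norm_def e2_def H1_seminorm_def L2_norm_power2 L2_inner_self_nonneg)
    have pn2: "pn\<^sup>2 = en\<^sup>2 + Gu"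
      by (simp add: pn_def pair_norm_def en_def[symmetric] Gu_def H1_seminorm_def L2_norm_power2 L2_inner_self_nonneg)
    have nn: "0 \<le> en" "0 \<le> pn" "0 \<le> Gu" by (simp_all add: en_def energy_norm_def pn_def pair_norm_def Gu_def L2_inner_self_nonneg)
    have e2: "e2 \<le> en\<^sup>2" unfolding en2
      using mult_nonneg_nonneg[OF zero_le_power2 L2_inner_self_nonneg, of \<epsilon> \<Omega> "weak_grad \<Omega> (\<lambda>x. \<psi> x - \<psi>h x)"] by linarith
    have e2': "L2_inner \<Omega> (\<lambda>x. \<psi>h x - \<psi> x) (\<lambda>x. \<psi>h x - \<psi> x) = e2"
      unfolding e2_def L2_inner_def by (intro Bochner_Integration.integral_cong refl) (simp add: algebra_simps)
    have A: "(\<Sum>T\<in>\<T>. (eta_psi \<epsilon> \<T> f \<psi>h T)\<^sup>2) \<le> K * en\<^sup>2"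
    proof -
      have "(\<Sum>T\<in>\<T>. (eta_psi \<epsilon> \<T> f \<psi>h T)\<^sup>2) =
        (\<Sum>T\<in>\<T>. (min (diameter T / \<epsilon>) 1)\<^sup>2 * (L2_norm T (\<lambda>x. g T x + \<epsilon>\<^sup>2 * laplacian (p T) x))\<^sup>2 +
      1/2 * (\<Sum>E\<in>sides T \<inter> interior_sides \<T>. min (diameter T / \<epsilon>) 1 / \<epsilon> *
        (LINT x:E|surface_measure E. (\<epsilon>\<^sup>2 * (dderiv (p (fst (jump_pair \<T> E))) (unit_normal E) x
          - dderiv (p (snd (jump_pair \<T> E))) (unit_normal E) x))\<^sup>2)))"
        unfolding g_def by (rule sum.cong[OF refl]) (rule eta_psi_power2[OF mesh assms(5) _ \<epsilon>(1) sp(1) p(2) sp(3) F(2)])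
      also have "\<dots> \<le> K * en\<^sup>2" unfolding en2 e2_def by (rule est[OF R1 mesh]) (use p(1) gN in blast)
      finally show ?thesis .
    qed
    have B: "(\<Sum>T\<in>\<T>. (eta_u \<T> \<psi>h uh T)\<^sup>2) \<le> M\<^sup>2 * (K * (Gu + e2))"
    proof -
      have dM: "diameter T \<le> M" if "T \<in> \<T>" for T
      proof -
        have "diameter T \<le> diameter (closure \<Omega>)"
          using convex_meshD(4)[OF cm] that \<Omega>(2) by (intro diameter_subset) auto
        then show ?thesis by (simp add: M_def)
      qed
      have "(\<Sum>T\<in>\<T>. (eta_u \<T> \<psi>h uh T)\<^sup>2) \<le> (\<Sum>T\<in>\<T>. M\<^sup>2 *
        ((min (diameter T / 1) 1)\<^sup>2 * (L2_norm T (\<lambda>x. p T x + 1\<^sup>2 * laplacian (q T) x))\<^sup>2 +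
      1/2 * (\<Sum>E\<in>sides T \<inter> interior_sides \<T>. min (diameter T / 1) 1 / 1 *
        (LINT x:E|surface_measure E. (1\<^sup>2 * (dderiv (q (fst (jump_pair \<T> E))) (unit_normal E) x
          - dderiv (q (snd (jump_pair \<T> E))) (unit_normal E) x))\<^sup>2))))"
        by (rule sum_mono) (rule eta_u_power2_le[OF mesh assms(5) _ sp(2) q(2) sp(1) p(2) dM], auto simp: M_def)
      also have "\<dots> \<le> M\<^sup>2 * (K * (1\<^sup>2 * Gu + e2))"
        unfolding Gu_def e2'[symmetric] sum_distrib_left[of "M\<^sup>2", symmetric]
        by (intro mult_left_mono est[OF R2 mesh]) (use p(1) q(1) in auto)
      finally show ?thesis by simp
    qed
    show "1 / sqrt K * sqrt (\<Sum>T\<in>\<T>. (eta_psi \<epsilon> \<T> f \<psi>h T)\<^sup>2) \<le> energy_norm \<epsilon> \<Omega> (\<lambda>x. \<psi> x - \<psi>h x)"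
      using scaled_sqrt_le[OF K A nn(1)] by (simp add: en_def)
    have "(\<Sum>T\<in>\<T>. (eta_psi \<epsilon> \<T> f \<psi>h T)\<^sup>2 + (eta_u \<T> \<psi>h uh T)\<^sup>2) \<le> K * en\<^sup>2 + M\<^sup>2 * (K * (Gu + e2))"
      using A B by (simp add: sum.distrib)
    \<comment> \<open>The perturbation e2 of the right-hand side in the second equation is part of
      the energy error, so Gu + e2 is at most the squared pair norm.\<close>
    also have "\<dots> \<le> K * pn\<^sup>2 + M\<^sup>2 * (K * pn\<^sup>2)"
      using K nn(3) e2 by (intro add_mono mult_left_mono) (auto simp: pn2)
    also have "\<dots> = K * (1 + M\<^sup>2) * pn\<^sup>2" by (simp add: algebra_simps)
    finally show "1 / sqrt (K * (1 + M\<^sup>2)) * sqrt (\<Sum>T\<in>\<T>. (eta_psi \<epsilon> \<T> f \<psi>h T)\<^sup>2 + (eta_u \<T> \<psi>h uh T)\<^sup>2)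
      \<le> pair_norm \<epsilon> \<Omega> (\<lambda>x. \<psi> x - \<psi>h x) (\<lambda>x. u x - uh x)"
      using scaled_sqrt_le[OF K' _ nn(2)] unfolding pn_def by blast
  qed
qed

end
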